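(* Let $d\in\mathbb N$, $\mu\ge 0$, $1\le p\le\infty$ and $r>(d+2\mu)/p$. Then $$e_n^{\rm det}(BW_{p,\mu}^r)\asymp n^{-r/d},$$ that is, there are constants $c_1,c_2>0$ independent of $n$ such that $c_1n^{-r/d}\le e_n^{\rm det}(BW_{p,\mu}^r)\le c_2n^{-r/d}$ for all $n\in\mathbb N$. Here $e_n^{\rm det}(F)$ is the minimal deterministic error for the integration problem ${\rm INT}_d(f)=\int_{\mathbb B^d}f(x)w_\mu(x)\,dx$ on the class $F$.
   Context: $\mathbb B^d=\{x\in\mathbb R^d: |x|\le 1\}$ is the Euclidean unit ball, and $w_\mu(x)=b_d^\mu(1-|x|^2)^{\mu-1/2}$, $\mu\ge 0$, with $b_d^\mu$ chosen so that $\int_{\mathbb B^d}w_\mu(x)\,dx=1$. For $1\le p<\infty$, $L_{p,\mu}$ is the space of measurable $f$ on $\mathbb B^d$ with $\|f\|_{p,\mu}=(\int_{\mathbb B^d}|f|^pw_\mu\,dx)^{1/p}<\infty$; for $p=\infty$, $L_{\infty,\mu}$ means $C(\mathbb B^d)$ with the uniform norm. $\Pi_n^d$ is the space of polynomials in $d$ variables of total degree at most $n$. $\mathcal V_n^d(w_\mu)$ is the space of polynomials of degree $n$ orthogonal in $L_{2,\mu}$ to all polynomials of lower degree. ${\rm Proj}_n$ is the orthogonal projector of $L_{2,\mu}$ onto $\mathcal V_n^d(w_\mu)$; it is given by integration against the reproducing kernel $P_n(w_\mu;x,y)$ of $\mathcal V_n^d(w_\mu)$ and hence extends to $L_{1,\mu}$.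 The spaces $\mathcal V_n^d(w_\mu)$ are the eigenspaces, with eigenvalues $-n(n+2\mu+d-1)$, of $D_\mu=\Delta-(x\cdot\nabla)^2-(2\mu+d-1)x\cdot\nabla$. For $r>0$, $(-D_\mu)^{r/2}f=\sum_{k=0}^\infty (k(k+2\mu+d-1))^{r/2}{\rm Proj}_kf$ in the sense of distributions (i.e. $(-D_\mu)^{r/2}f=g\in L_{p,\mu}$ means ${\rm Proj}_kg=(k(k+2\mu+d-1))^{r/2}{\rm Proj}_kf$ for all $k\ge0$). The weighted Sobolev space $W_{p,\mu}^r$ consists of $f\in L_{p,\mu}$ with $\|f\|_{W_{p,\mu}^r}=\|f\|_{p,\mu}+\|(-D_\mu)^{r/2}f\|_{p,\mu}<\infty$, and $BW_{p,\mu}^r$ is its unit ball. If $r>(d+2\mu)/p$, $W_{p,\mu}^r$ is compactly embedded in $C(\mathbb B^d)$, so its elements are regarded as continuous functions. Deterministic algorithms: $\mathcal A_n^{\rm det}$ is the class of all maps $A_n(f)=\varphi_n(f(x_1),\dots,f(x_n))$ where $\varphi_n:\mathbb R^n\to\mathbb R$ is arbitrary and the points $x_j\in\mathbb B^d$ may be chosen adaptively ($x_j$ may depend on the values $f(x_1),\dots,f(x_{j-1})$ already computed). For a class $F$ of continuous functions on $\mathbb B^d$, $$e_n^{\rm det}(F)=\inf_{A_n\in\mathcal A_n^{\rm det}}\ \sup_{f\in F}|{\rm INT}_d(f)-A_n(f)|.$$ *)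

theory Defs
  imports "HOL-Analysis.Analysis"
begin

text \<open>
  The dimension \<open>d\<close> is \<open>CARD('d)\<close>, and the unit ball is \<open>cball 0 1 :: (real ^ 'd) set\<close>.
  A function on the ball is a function on \<open>real ^ 'd\<close> whose values outside the ball never matter.
\<close>

section \<open>The weight and the spaces \<open>L\<^sub>p\<close>\<close>

text \<open>
  On the unit sphere, a null set, \<open>0 powr a = 0\<close> for every \<open>a\<close>.
\<close>

definition ball_const :: "'d::finite itself \<Rightarrow> real \<Rightarrow> real" where
  "ball_const TYPE('d) \<mu> =
     1 / (LINT x|lebesgue_on (cball (0 :: real ^ 'd) 1). (1 - (norm x)\<^sup>2) powr (\<mu> - 1/2))"

definition ball_weight :: "real \<Rightarrow> real ^ 'd::finite \<Rightarrow> real" where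
  "ball_weight \<mu> x = ball_const TYPE('d) \<mu> * (1 - (norm x)\<^sup>2) powr (\<mu> - 1/2)"

definition ball_measure :: "real \<Rightarrow> (real ^ 'd::finite) measure" where
  "ball_measure \<mu> = density (lebesgue_on (cball 0 1)) (\<lambda>x. ennreal (ball_weight \<mu> x))"

text \<open>
  For \<open>p = \<infinity>\<close> the space is \<open>C\<close> of the closed ball with the uniform norm.
\<close>

definition Lp_space :: "real \<Rightarrow> ennreal \<Rightarrow> (real ^ 'd::finite \<Rightarrow> real) set" where
  "Lp_space \<mu> p =
     (if p = \<infinity> then {f. continuous_on (cball 0 1) f}
      else {f \<in> borel_measurable (ball_measure \<mu>).
              integrable (ball_measure \<mu>) (\<lambda>x. \<bar>f x\<bar> powr enn2real p)})"

definition Lp_norm :: "real \<Rightarrow> ennreal \<Rightarrow> (real ^ 'd::finite \<Rightarrow> real) \<Rightarrow> real" where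
  "Lp_norm \<mu> p f =
     (if p = \<infinity> then (SUP x\<in>cball 0 1. \<bar>f x\<bar>)
      else (LINT x|ball_measure \<mu>. \<bar>f x\<bar> powr enn2real p) powr (1 / enn2real p))"

section \<open>Orthogonal polynomials and projections\<close>

definition poly_space :: "nat \<Rightarrow> (real ^ 'd::finite \<Rightarrow> real) set" where
  "poly_space n =
     {q. \<exists>c :: ('d \<Rightarrow> nat) \<Rightarrow> real.
           q = (\<lambda>x. \<Sum>\<alpha> | (\<Sum>i\<in>UNIV. \<alpha> i) \<le> n. c \<alpha> * (\<Prod>i\<in>UNIV. x $ i ^ \<alpha> i))}"

lemma finite_multi_indices: "finite {\<alpha> :: 'd::finite \<Rightarrow> nat. (\<Sum>i\<in>UNIV. \<alpha> i) \<le> n}"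
proof (rule finite_subset)
  show "{\<alpha> :: 'd \<Rightarrow> nat. (\<Sum>i\<in>UNIV. \<alpha> i) \<le> n} \<subseteq> PiE UNIV (\<lambda>_. {..n})"
  proof
    fix \<alpha> :: "'d \<Rightarrow> nat"
    assume "\<alpha> \<in> {\<alpha>. (\<Sum>i\<in>UNIV. \<alpha> i) \<le> n}"
    then have le: "(\<Sum>i\<in>UNIV. \<alpha> i) \<le> n" by simp
    have "\<alpha> i \<le> n" for i
      using member_le_sum[of i UNIV \<alpha>] le by simp
    then show "\<alpha> \<in> PiE UNIV (\<lambda>_. {..n})" by (simp add: PiE_UNIV_domain)
  qed
qed (simp add: finite_PiE)

definition orth_poly_space :: "real \<Rightarrow> nat \<Rightarrow> (real ^ 'd::finite \<Rightarrow> real) set" where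
  "orth_poly_space \<mu> n =
     {q \<in> poly_space n. \<forall>m<n. \<forall>h\<in>poly_space m. (LINT x|ball_measure \<mu>. q x * h x) = 0}"

text \<open>
  A polynomial function on \<open>real ^ 'd\<close> is determined by its values on the ball, so the reproducing
  kernel is unique also for \<open>x\<close> and \<open>y\<close> ranging over the whole space.
\<close>

definition repr_kernel :: "real \<Rightarrow> nat \<Rightarrow> real ^ 'd::finite \<Rightarrow> real ^ 'd \<Rightarrow> real" where
  "repr_kernel \<mu> n =
     (THE K. \<forall>x. K x \<in> orth_poly_space \<mu> n \<and>
        (\<forall>q\<in>orth_poly_space \<mu> n. q x = (LINT y|ball_measure \<mu>. q y * K x y)))"

definition orth_proj :: "real \<Rightarrow> nat \<Rightarrow> (real ^ 'd::finite \<Rightarrow> real) \<Rightarrow> real ^ 'd \<Rightarrow> real" where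
  "orth_proj \<mu> n f x = (LINT y|ball_measure \<mu>. f y * repr_kernel \<mu> n x y)"

section \<open>Sobolev classes\<close>

text \<open>
  \<open>is_frac_power \<mu> r f g\<close> states \<open>(-D\<^sub>\<mu>) powr (r/2) f = g\<close> in the sense of distributions, where
  \<open>k (k + 2 \<mu> + d - 1)\<close> is the eigenvalue of \<open>-D\<^sub>\<mu>\<close> on \<open>orth_poly_space \<mu> k\<close>.
\<close>

definition is_frac_power ::
  "real \<Rightarrow> real \<Rightarrow> (real ^ 'd::finite \<Rightarrow> real) \<Rightarrow> (real ^ 'd \<Rightarrow> real) \<Rightarrow> bool" where
  "is_frac_power \<mu> r f g \<longleftrightarrow>
     (\<forall>k x. orth_proj \<mu> k g x =
        (real k * (real k + 2 * \<mu> + real CARD('d) - 1)) powr (r / 2) * orth_proj \<mu> k f x)"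

text \<open>
  The unit ball of the Sobolev space, each class being represented by its continuous element.
  The function \<open>g\<close> is determined by \<open>f\<close> up to null sets.
\<close>

definition sobolev_ball :: "real \<Rightarrow> ennreal \<Rightarrow> real \<Rightarrow> (real ^ 'd::finite \<Rightarrow> real) set" where
  "sobolev_ball \<mu> p r =
     {f \<in> Lp_space \<mu> p. continuous_on (cball 0 1) f \<and>
        (\<exists>g\<in>Lp_space \<mu> p. is_frac_power \<mu> r f g \<and> Lp_norm \<mu> p f + Lp_norm \<mu> p g \<le> 1)}"

section \<open>Deterministic algorithms\<close>

text \<open>
  \<open>X\<close> maps the list of values already computed to the next point, which may thus also depend on
  the number of steps made.
\<close>

primrec observed_values :: "(real list \<Rightarrow> 'a) \<Rightarrow> ('a \<Rightarrow> real) \<Rightarrow> nat \<Rightarrow> real list" where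
  "observed_values X f 0 = []"
| "observed_values X f (Suc j) =
     observed_values X f j @ [f (X (observed_values X f j))]"

definition det_algorithms :: "nat \<Rightarrow> ((real ^ 'd::finite \<Rightarrow> real) \<Rightarrow> real) set" where
  "det_algorithms n =
     {A. \<exists>\<phi> X. (\<forall>v. X v \<in> cball 0 1) \<and> A = (\<lambda>f. \<phi> (observed_values X f n))}"

definition INT_ball :: "real \<Rightarrow> (real ^ 'd::finite \<Rightarrow> real) \<Rightarrow> real" where
  "INT_ball \<mu> f = (LINT x|ball_measure \<mu>. f x)"

definition det_error :: "real \<Rightarrow> nat \<Rightarrow> (real ^ 'd::finite \<Rightarrow> real) set \<Rightarrow> ennreal" where
  "det_error \<mu> n F = (INF A\<in>det_algorithms n. SUP f\<in>F. ennreal \<bar>INT_ball \<mu> f - A f\<bar>)"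

end

theory Submission
  imports Defs
begin

text \<open>Upper bound: the kernel of the projection onto \<open>orth_poly_space \<mu> k\<close> is an average of zonal
  polynomials, so the Poisson sums \<open>\<Sum>k. exp (- t * k) * Proj k\<close> are positive contractions. A Riemann sum
  thinned out by Caratheodory's argument gives a quadrature rule with positive weights and at most
  \<open>(N + 1) ^ d\<close> nodes that is almost exact in degree \<open>N\<close>. The average of the Poisson
  kernel over its nodes is \<open>O((t * N) powr - (d + 2 * \<mu>))\<close> for \<open>t \<le> 1 / N\<close>, by a doubling inequality, and
  differs from a constant by an exponentially small amount for larger \<open>t\<close>; the constant does not matter because
  \<open>(-D) powr (r/2) f\<close> has mean zero. Since
  \<open>(k * (k + 2 * \<lambda>)) powr (- r / 2)\<close> is a superposition of exponentials, this bounds the quadrature error by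
  \<open>N powr - r\<close> as soon as \<open>r > (d + 2 * \<mu>) / p\<close>.

  Lower bound: for the vector \<open>\<Phi>\<close> of normalised tensor Chebyshev polynomials of degree less than \<open>K\<close> in each
  variable, let \<open>f y\<close> be \<open>K ^ - d\<close> times the squared distance of \<open>\<Phi> y\<close> from the span of the vectors
  \<open>\<Phi> (x i)\<close> at the sampled points. Then \<open>f\<close> vanishes there, is bounded by \<open>2 ^ d\<close>, and by orthonormality
  its integral stays away from \<open>0\<close> if there are at most \<open>c * K ^ d\<close> points. Bernstein's inequality for the
  powers of \<open>- D\<close>, from Cesaro sums and the Poisson semigroup, puts a multiple \<open>c * K powr - r\<close> of \<open>\<plusminus> f\<close> in the
  unit ball.\<close>

section \<open>Gegenbauer weights and their moments\<close>

text \<open>The obstacle for finite \<open>p\<close> is that the quadrature functional must be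
  controlled on \<open>L_p\<close> although nothing is known about where the nodes lie. Positivity
  replaces that knowledge: near time \<open>1 / N\<close> the node average of the Poisson kernel is
  dominated by a polynomial of degree \<open>N\<close>, on which the rule is almost exact, so it is
  O(1) at every point. Going down to smaller \<open>t\<close> costs the power
  \<open>2 * \<lambda> + 1\<close> of \<open>1 / (t * N)\<close>, where
  \<open>\<lambda> = \<mu> + (d - 1) / 2\<close>, so this power is \<open>d + 2 * \<mu>\<close>. A
  function with values in \<open>[0, A]\<close> and integral at most 1 pairs with the unit ball of
  \<open>L_p\<close> to at most \<open>2 * A powr (1 / p)\<close>; hence the loss shrinks to the
  power \<open>(d + 2 * \<mu>) / p\<close>, and it is integrable against
  \<open>t powr (r - 1)\<close> near 0 exactly under the assumption on \<open>r\<close>. Kernels are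
  handled through moments instead of measures. The identities behind them are polynomial, so they
  hold for all \<open>x\<close> and \<open>y\<close>, and the case \<open>\<mu> = 0\<close>, where
  the averaging measure degenerates to two points, is not special until positivity is
  needed.\<close>

definition ball_wt :: "real \<Rightarrow> real \<Rightarrow> 'a::euclidean_space \<Rightarrow> real" where
  "ball_wt b s y = (if (norm y)\<^sup>2 < s then (s - (norm y)\<^sup>2) powr (b - 1) else 0)"

lemma ball_wt_nonneg [simp]: "0 \<le> ball_wt b s y"
  by (simp add: ball_wt_def)

lemma ball_wt_minus [simp]: "ball_wt b s (- y) = ball_wt b s y"
  unfolding ball_wt_def norm_minus_cancel ..

lemma ball_wt_measurable [measurable]:
  "ball_wt b s \<in> borel_measurable borel"
  unfolding ball_wt_def by measurable

lemma ball_wt_measurable2 [measurable]: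
  "(\<lambda>(s, y). ball_wt b s y) \<in> borel_measurable (borel \<Otimes>\<^sub>M borel)"
  unfolding ball_wt_def by measurable

text \<open>The shift \<open>s = (norm y)^2 + v\<close> leaves a Gamma integral. This is why
  \<open>ball_wt\<close> carries the parameter \<open>s\<close>: integrated against
  \<open>exp (- s)\<close>, the Gegenbauer weight becomes a Gaussian.\<close>

lemma nn_integral_ball_wt_exp:
  fixes y :: "'a::euclidean_space"
  assumes "b > 0"
  shows "(\<integral>\<^sup>+s. ennreal (ball_wt b s y * exp (- s)) \<partial>lborel) = ennreal (Gamma b * exp (- (norm y)\<^sup>2))"
proof -
  have [measurable]: "(\<lambda>s. ball_wt b s y) \<in> borel_measurable borel"
    unfolding ball_wt_def by measurable
  have "(\<integral>\<^sup>+s. ennreal (ball_wt b s y * exp (- s)) \<partial>lborel)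
      = ennreal \<bar>1\<bar> * (\<integral>\<^sup>+s. ennreal (ball_wt b ((norm y)\<^sup>2 + 1 * s) y * exp (- ((norm y)\<^sup>2 + 1 * s))) \<partial>lborel)"
    by (rule nn_integral_real_affine) auto
  also have "\<dots> = (\<integral>\<^sup>+s. ennreal (exp (- (norm y)\<^sup>2)) * ennreal (indicator {0..} s * s powr (b - 1) / exp s) \<partial>lborel)"
    unfolding abs_one ennreal_1 mult_1_left
    by (intro nn_integral_cong)
       (auto simp: ball_wt_def exp_add exp_diff exp_minus field_simps indicator_def simp flip: ennreal_mult')
  also have "\<dots> = ennreal (exp (- (norm y)\<^sup>2)) * ennreal (Gamma b)"
    by (subst nn_integral_cmult) (auto simp: Gamma_conv_nn_integral_real[OF assms])
  also have "\<dots> = ennreal (Gamma b * exp (- (norm y)\<^sup>2))"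
    using assms by (simp add: ennreal_mult'' mult.commute)
  finally show ?thesis .
qed

lemma nn_integral_ball_wt_scale:
  fixes c :: "'a::euclidean_space"
  assumes "s > 0"
  shows "(\<integral>\<^sup>+y. ennreal ((c \<bullet> y) ^ (2 * i) * ball_wt b s y) \<partial>lborel)
     = ennreal (s powr (real i + real DIM('a) / 2 + b - 1)) *
       (\<integral>\<^sup>+y. ennreal ((c \<bullet> y) ^ (2 * i) * ball_wt b 1 y) \<partial>lborel)"
proof -
  define q where "q = sqrt s"
  have q: "q > 0" "q\<^sup>2 = s" using assms by (auto simp: q_def)
  have w: "ball_wt b s (q *\<^sub>R y) = s powr (b - 1) * ball_wt b 1 y" for y :: 'a
  proof -
    have "(norm (q *\<^sub>R y))\<^sup>2 = s * (norm y)\<^sup>2" using q by (simp add: power_mult_distrib)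
    moreover have "s - s * (norm y)\<^sup>2 = s * (1 - (norm y)\<^sup>2)" by (simp add: algebra_simps)
    ultimately show ?thesis using assms by (simp add: ball_wt_def powr_mult)
  qed
  have e: "q ^ DIM('a) * (q ^ (2 * i) * s powr (b - 1)) = s powr (real i + real DIM('a) / 2 + b - 1)"
  proof -
    have "q = s powr (1/2)" using assms by (simp add: q_def powr_half_sqrt)
    then have "q ^ DIM('a) = s powr (real DIM('a) / 2)" "q ^ (2 * i) = s powr (real i)"
      using assms q by (simp_all add: powr_powr powr_realpow power_mult flip: powr_realpow)
    then show ?thesis using assms by (simp add: powr_add [symmetric] algebra_simps add_divide_distrib)
  qed
  have "(\<integral>\<^sup>+y. ennreal ((c \<bullet> y) ^ (2 * i) * ball_wt b s y) \<partial>lborel)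
     = (\<integral>\<^sup>+y. ennreal ((c \<bullet> y) ^ (2 * i) * ball_wt b s y) 
          \<partial>(density (distr lborel borel (\<lambda>x. 0 + q *\<^sub>R x)) (\<lambda>_. ennreal (\<bar>q\<bar>^DIM('a)))))"
    using q by (subst lborel_affine[where c = q and t = 0]) auto
  also have "\<dots> = (\<integral>\<^sup>+y. ennreal (q ^ DIM('a)) * ennreal ((c \<bullet> (q *\<^sub>R y)) ^ (2 * i) * ball_wt b s (q *\<^sub>R y)) \<partial>lborel)"
    using q by (subst nn_integral_density) (auto simp: nn_integral_distr)
  also have "\<dots> = (\<integral>\<^sup>+y. ennreal (s powr (real i + real DIM('a) / 2 + b - 1)) *
       ennreal ((c \<bullet> y) ^ (2 * i) * ball_wt b 1 y) \<partial>lborel)"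
  proof (intro nn_integral_cong)
    fix y :: 'a
    have "q ^ DIM('a) * ((c \<bullet> (q *\<^sub>R y)) ^ (2 * i) * ball_wt b s (q *\<^sub>R y)) =
       (q ^ DIM('a) * (q ^ (2 * i) * s powr (b - 1))) * ((c \<bullet> y) ^ (2 * i) * ball_wt b 1 y)"
      by (simp add: w power_mult_distrib algebra_simps)
    then have "q ^ DIM('a) * ((c \<bullet> (q *\<^sub>R y)) ^ (2 * i) * ball_wt b s (q *\<^sub>R y)) =
       s powr (real i + real DIM('a) / 2 + b - 1) * ((c \<bullet> y) ^ (2 * i) * ball_wt b 1 y)"
      unfolding e .
    then show "ennreal (q ^ DIM('a)) * ennreal ((c \<bullet> (q *\<^sub>R y)) ^ (2 * i) * ball_wt b s (q *\<^sub>R y)) =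
       ennreal (s powr (real i + real DIM('a) / 2 + b - 1)) * ennreal ((c \<bullet> y) ^ (2 * i) * ball_wt b 1 y)"
      using q by (simp flip: ennreal_mult')
  qed
  also have "\<dots> = ennreal (s powr (real i + real DIM('a) / 2 + b - 1)) *
       (\<integral>\<^sup>+y. ennreal ((c \<bullet> y) ^ (2 * i) * ball_wt b 1 y) \<partial>lborel)"
    by (rule nn_integral_cmult) measurable
  finally show ?thesis .
qed

text \<open>Write the Gaussian as a superposition of weights, exchange the integrals, and use
  homogeneity in \<open>s\<close>; the remaining integral over \<open>s\<close> is again a Gamma
  integral. In \<open>ennreal\<close> this presupposes no finiteness, so it can be used below to
  prove that the Gaussian integral is finite.\<close>

lemma nn_integral_ball_wt_gauss:
  fixes c :: "'a::euclidean_space"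
  assumes "b > 0"
  shows "ennreal (Gamma b) * (\<integral>\<^sup>+y. ennreal ((c \<bullet> y) ^ (2 * i) * exp (- (norm y)\<^sup>2)) \<partial>lborel)
    = ennreal (Gamma (real i + real DIM('a) / 2 + b)) *
       (\<integral>\<^sup>+y. ennreal ((c \<bullet> y) ^ (2 * i) * ball_wt b 1 y) \<partial>lborel)"
proof -
  let ?I = "\<integral>\<^sup>+y. ennreal ((c \<bullet> y) ^ (2 * i) * ball_wt b 1 y) \<partial>lborel"
  have m: "(\<lambda>(s, y). ennreal ((c \<bullet> y) ^ (2 * i) * (ball_wt b s y * exp (- s)))) \<in> borel_measurable (lborel \<Otimes>\<^sub>M lborel)"
    unfolding ball_wt_def by measurable
  have G: "ennreal (Gamma b) * (\<integral>\<^sup>+y. ennreal ((c \<bullet> y) ^ (2 * i) * exp (- (norm y)\<^sup>2)) \<partial>lborel)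
    = (\<integral>\<^sup>+y. ennreal ((c \<bullet> y) ^ (2 * i)) * (\<integral>\<^sup>+s. ennreal (ball_wt b s y * exp (- s)) \<partial>lborel) \<partial>lborel)"
    using assms unfolding nn_integral_ball_wt_exp[OF assms]
    by (subst nn_integral_cmult [symmetric]) 
       (auto intro!: nn_integral_cong simp: mult_ac zero_le_even_power simp flip: ennreal_mult'')
  also have "\<dots> = (\<integral>\<^sup>+y. \<integral>\<^sup>+s. ennreal ((c \<bullet> y) ^ (2 * i) * (ball_wt b s y * exp (- s))) \<partial>lborel \<partial>lborel)"
  proof (intro nn_integral_cong)
    fix y :: 'a
    have [measurable]: "(\<lambda>s. ball_wt b s y) \<in> borel_measurable borel"
      unfolding ball_wt_def by measurable
    show "ennreal ((c \<bullet> y) ^ (2 * i)) * (\<integral>\<^sup>+s. ennreal (ball_wt b s y * exp (- s)) \<partial>lborel) = 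
      (\<integral>\<^sup>+s. ennreal ((c \<bullet> y) ^ (2 * i) * (ball_wt b s y * exp (- s))) \<partial>lborel)"
      by (subst nn_integral_cmult [symmetric]) (auto simp: ennreal_mult')
  qed
  also have "\<dots> = (\<integral>\<^sup>+s. \<integral>\<^sup>+y. ennreal ((c \<bullet> y) ^ (2 * i) * (ball_wt b s y * exp (- s))) \<partial>lborel \<partial>lborel)"
    by (rule lborel_pair.Fubini'[OF m])
  also have "\<dots> = (\<integral>\<^sup>+s. ennreal (indicator {0..} s * s powr ((real i + real DIM('a) / 2 + b) - 1) / exp s) * ?I \<partial>lborel)"
  proof (intro nn_integral_cong_AE)
    have "AE s in lborel. s \<noteq> (0::real)" by (rule AE_lborel_singleton)
    then show "AE s in lborel. (\<integral>\<^sup>+y. ennreal ((c \<bullet> y) ^ (2 * i) * (ball_wt b s y * exp (- s))) \<partial>lborel) = 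
      ennreal (indicator {0..} s * s powr ((real i + real DIM('a) / 2 + b) - 1) / exp s) * ?I"
    proof eventually_elim
      case (elim s)
      show ?case
      proof (cases "s > 0")
        case True
        have "(\<integral>\<^sup>+y. ennreal ((c \<bullet> y) ^ (2 * i) * (ball_wt b s y * exp (- s))) \<partial>lborel)
          = (\<integral>\<^sup>+y. ennreal (exp (-s)) * ennreal ((c \<bullet> y) ^ (2 * i) * ball_wt b s y) \<partial>lborel)"
          by (intro nn_integral_cong) (simp add: mult_ac flip: ennreal_mult')
        also have "\<dots> = ennreal (exp (-s)) * (\<integral>\<^sup>+y. ennreal ((c \<bullet> y) ^ (2 * i) * ball_wt b s y) \<partial>lborel)"
          by (rule nn_integral_cmult) measurable
        also have "\<dots> = (ennreal (exp (-s)) * ennreal (s powr (real i + real DIM('a) / 2 + b - 1))) * ?I"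
          unfolding nn_integral_ball_wt_scale[OF True] by (simp only: mult.assoc)
        also have "ennreal (exp (-s)) * ennreal (s powr (real i + real DIM('a) / 2 + b - 1)) =
          ennreal (indicator {0..} s * s powr ((real i + real DIM('a) / 2 + b) - 1) / exp s)"
          using True by (subst ennreal_mult'[symmetric]) (auto simp: exp_minus field_simps)
        finally show ?thesis .
      next
        case False
        with elim have "s < 0" by simp
        moreover have "ball_wt b s y = 0" for y :: 'a 
          using False by (auto simp: ball_wt_def not_less intro: order_trans[of s 0])
        ultimately show ?thesis by simp
      qed
    qed
  qed
  also have "\<dots> = ennreal (Gamma (real i + real DIM('a) / 2 + b)) * ?I"
  proof -
    have "real i + real DIM('a) / 2 + b > 0" using assms by (simp add: add_nonneg_pos)
    then show ?thesis
      by (subst nn_integral_multc) (auto simp: Gamma_conv_nn_integral_real)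
  qed
  finally show ?thesis .
qed

definition gauss :: "'a::euclidean_space itself \<Rightarrow> real" where
  "gauss _ = enn2real (\<integral>\<^sup>+y. ennreal (exp (- (norm (y::'a))\<^sup>2)) \<partial>lborel)"

lemma gauss:
  shows "(\<integral>\<^sup>+y. ennreal (exp (- (norm (y::'a::euclidean_space))\<^sup>2)) \<partial>lborel) = ennreal (gauss TYPE('a))"
    and "gauss TYPE('a) > 0"
proof -
  let ?G = "\<integral>\<^sup>+y. ennreal (exp (- (norm (y::'a))\<^sup>2)) \<partial>lborel"
  \<comment> \<open>For \<open>b = 1\<close> the weight is the indicator of the open unit ball, so
    finiteness reduces to that of its volume.\<close>
  have G: "?G = ennreal (Gamma (real DIM('a) / 2 + 1)) * (\<integral>\<^sup>+y. ennreal (ball_wt 1 1 (y::'a)) \<partial>lborel)"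
    using nn_integral_ball_wt_gauss[where b = 1 and c = "0::'a" and i = 0] by simp
  have "(\<integral>\<^sup>+y. ennreal (ball_wt 1 1 (y::'a)) \<partial>lborel) \<le> (\<integral>\<^sup>+y. indicator (cball 0 1) (y::'a) \<partial>lborel)"
    by (intro nn_integral_mono) (auto simp: ball_wt_def indicator_def abs_square_less_1)
  also have "\<dots> < \<infinity>" using emeasure_lborel_cball_finite[of 0 1] by simp
  finally have "(\<integral>\<^sup>+y. ennreal (ball_wt 1 1 (y::'a)) \<partial>lborel) < \<infinity>" .
  then have fin: "?G < \<infinity>"
    unfolding G by (simp add: ennreal_mult_less_top)
  then show 1: "?G = ennreal (gauss TYPE('a))"
    by (simp add: gauss_def)
  have "?G \<noteq> 0"
  proof
    assume "?G = 0"
    then have "AE y::'a in lborel. ennreal (exp (- (norm y)\<^sup>2)) = 0"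
      by (subst (asm) nn_integral_0_iff_AE) auto
    then have "(\<integral>\<^sup>+y. indicator (cbox 0 One) (y::'a) \<partial>lborel) = 0"
      by (subst nn_integral_0_iff_AE) auto
    then have "emeasure lborel (cbox 0 (One::'a)) = 0" by simp
    then show False by (subst (asm) emeasure_lborel_cbox) auto
  qed
  with 1 show "gauss TYPE('a) > 0"
    by (metis ennreal_neg not_le)
qed

lemma nn_integral_gauss_exp:
  fixes c :: "'a::euclidean_space"
  shows "(\<integral>\<^sup>+y. ennreal (exp (c \<bullet> y - (norm y)\<^sup>2)) \<partial>lborel) = ennreal (gauss TYPE('a) * exp ((norm c)\<^sup>2 / 4))"
proof -
  have "(\<integral>\<^sup>+y. ennreal (exp (c \<bullet> y - (norm y)\<^sup>2)) \<partial>lborel)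
     = (\<integral>\<^sup>+y. ennreal (exp (c \<bullet> y - (norm y)\<^sup>2)) 
          \<partial>(density (distr lborel borel (\<lambda>x. c /\<^sub>R 2 + 1 *\<^sub>R x)) (\<lambda>_. ennreal (\<bar>1\<bar>^DIM('a)))))"
    by (subst lborel_affine[where c = 1 and t = "c /\<^sub>R 2"]) auto
  also have "\<dots> = (\<integral>\<^sup>+y. ennreal (exp (c \<bullet> (c /\<^sub>R 2 + y) - (norm (c /\<^sub>R 2 + y))\<^sup>2)) \<partial>lborel)"
    by (subst nn_integral_density) (auto simp: nn_integral_distr)
  also have "\<dots> = (\<integral>\<^sup>+y. ennreal (exp ((norm c)\<^sup>2 / 4)) * ennreal (exp (- (norm (y::'a))\<^sup>2)) \<partial>lborel)"
  proof (intro nn_integral_cong)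
    fix y :: 'a
    have "c \<bullet> (c /\<^sub>R 2 + y) - (norm (c /\<^sub>R 2 + y))\<^sup>2 = (norm c)\<^sup>2 / 4 + - (norm y)\<^sup>2"
      unfolding power2_norm_eq_inner
      by (simp add: inner_simps inner_commute field_simps)
    then show "ennreal (exp (c \<bullet> (c /\<^sub>R 2 + y) - (norm (c /\<^sub>R 2 + y))\<^sup>2)) 
       = ennreal (exp ((norm c)\<^sup>2 / 4)) * ennreal (exp (- (norm y)\<^sup>2))"
      by (simp only: exp_add ennreal_mult' exp_ge_zero)
  qed
  also have "\<dots> = ennreal (exp ((norm c)\<^sup>2 / 4)) * ennreal (gauss TYPE('a))"
    by (subst nn_integral_cmult) (auto simp: gauss)
  finally show ?thesis using gauss(2)[where ?'a='a] by (simp add: ennreal_mult'' mult.commute)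
qed

lemma powser_unique_0:
  fixes a :: "nat \<Rightarrow> real"
  assumes "\<And>x. (\<lambda>n. a n * x ^ n) sums 0"
  shows "a n = 0"
proof (rule ccontr)
  assume "a n \<noteq> 0"
  define m where "m = (LEAST n. a n \<noteq> 0)"
  have m: "a m \<noteq> 0" using \<open>a n \<noteq> 0\<close> unfolding m_def by (rule LeastI)
  have lt: "a k = 0" if "k < m" for k using that not_less_Least[of k] by (auto simp: m_def)
  have s: "(\<lambda>k. a (k + m) * x ^ k) sums 0" if "x \<noteq> 0" for x
  proof -
    have "(\<lambda>k. a (k + m) * x ^ (k + m)) sums (0 - (\<Sum>k<m. a k * x ^ k))"
      by (rule sums_split_initial_segment[OF assms])
    then have "(\<lambda>k. (a (k + m) * x ^ k) * x ^ m) sums 0"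
      using lt by (simp add: power_add mult_ac)
    from sums_divide[OF this, of "x ^ m"] show ?thesis using that by simp
  qed
  have "((\<lambda>x::real. 0::real) \<longlongrightarrow> a (0 + m)) (at 0)"
    by (rule powser_limit_0_strong[of 1 "\<lambda>k. a (k + m)"]) (use s in auto)
  with m show False by (simp add: tendsto_const_iff)
qed

text \<open>Both sides are Taylor coefficients, in \<open>s\<close>, of the Gaussian integral of
  \<open>cosh (s * (c \<bullet> y))\<close>, whose closed form comes from completing the square.
  Taking \<open>cosh\<close> instead of \<open>exp\<close> keeps every term nonnegative, so that sum
  and integral commute.\<close>

lemma nn_integral_gauss_even:
  fixes c :: "'a::euclidean_space"
  shows "(\<integral>\<^sup>+y. ennreal ((c \<bullet> y) ^ (2 * i) * exp (- (norm y)\<^sup>2)) \<partial>lborel)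
    = ennreal (gauss TYPE('a) * (norm c) ^ (2 * i) * pochhammer (1/2) i)"
proof -
  define g where "g n = (\<integral>\<^sup>+y. ennreal ((c \<bullet> y) ^ (2 * n) * exp (- (norm y)\<^sup>2)) \<partial>lborel)" for n
  define K where "K = gauss TYPE('a)"
  have K: "K > 0" using gauss(2) by (simp add: K_def)
  have series: "(\<Sum>n. ennreal (s ^ (2 * n) / fact (2 * n)) * g n) = ennreal (K * exp (s\<^sup>2 * (norm c)\<^sup>2 / 4))" for s
  proof -
    have [measurable]: "(\<lambda>y. ennreal ((s * (c \<bullet> y)) ^ (2 * n) / fact (2 * n) * exp (- (norm y)\<^sup>2))) \<in> borel_measurable lborel" for n
      by measurable
    have "(\<Sum>n. ennreal (s ^ (2 * n) / fact (2 * n)) * g n)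
      = (\<Sum>n. \<integral>\<^sup>+y. ennreal ((s * (c \<bullet> y)) ^ (2 * n) / fact (2 * n) * exp (- (norm y)\<^sup>2)) \<partial>lborel)"
      unfolding g_def
      by (subst nn_integral_cmult [symmetric])
         (auto intro!: suminf_cong nn_integral_cong simp: power_mult_distrib zero_le_even_power mult_ac simp flip: ennreal_mult')
    also have "\<dots> = (\<integral>\<^sup>+y. (\<Sum>n. ennreal ((s * (c \<bullet> y)) ^ (2 * n) / fact (2 * n) * exp (- (norm y)\<^sup>2))) \<partial>lborel)"
      by (subst nn_integral_suminf) auto
    also have "\<dots> = (\<integral>\<^sup>+y. ennreal (cosh (s * (c \<bullet> y)) * exp (- (norm y)\<^sup>2)) \<partial>lborel)"
    proof (intro nn_integral_cong suminf_ennreal_eq)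
      fix y
      define x where "x = s * (c \<bullet> y)"
      have "(\<lambda>n. if even n then x ^ n /\<^sub>R fact n else 0) sums cosh x" by (rule cosh_converges)
      then have "(\<lambda>n. (if even (2 * n) then x ^ (2 * n) /\<^sub>R fact (2 * n) else 0)) sums cosh x"
        by (subst sums_mono_reindex[of "\<lambda>n. 2 * n" "\<lambda>n. if even n then x ^ n /\<^sub>R fact n else 0"])
           (auto simp: strict_mono_def)
      then have "(\<lambda>n. x ^ (2 * n) / fact (2 * n)) sums cosh x" by (simp add: field_simps)
      then show "(\<lambda>n. x ^ (2 * n) / fact (2 * n) * exp (- (norm y)\<^sup>2)) sums (cosh x * exp (- (norm y)\<^sup>2))"
        by (rule sums_mult2)
    qed (auto simp: zero_le_even_power)
    also have "\<dots> = (\<integral>\<^sup>+y. (ennreal (exp ((s *\<^sub>R c) \<bullet> y - (norm y)\<^sup>2)) + ennreal (exp ((- s *\<^sub>R c) \<bullet> y - (norm y)\<^sup>2))) * ennreal (1/2) \<partial>lborel)"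
    proof (intro nn_integral_cong)
      fix y
      have "cosh (s * (c \<bullet> y)) * exp (- (norm y)\<^sup>2) =
        (exp ((s *\<^sub>R c) \<bullet> y - (norm y)\<^sup>2) + exp ((- s *\<^sub>R c) \<bullet> y - (norm y)\<^sup>2)) * (1/2)"
        by (simp add: cosh_def exp_diff exp_minus field_simps)
      then show "ennreal (cosh (s * (c \<bullet> y)) * exp (- (norm y)\<^sup>2)) =
        (ennreal (exp ((s *\<^sub>R c) \<bullet> y - (norm y)\<^sup>2)) + ennreal (exp ((- s *\<^sub>R c) \<bullet> y - (norm y)\<^sup>2))) * ennreal (1/2)"
        by (metis ennreal_mult' ennreal_plus exp_ge_zero add_nonneg_nonneg)
    qed
    also have "\<dots> = (ennreal (K * exp ((norm (s *\<^sub>R c))\<^sup>2 / 4)) + ennreal (K * exp ((norm (- s *\<^sub>R c))\<^sup>2 / 4))) * ennreal (1/2)"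
      unfolding K_def nn_integral_gauss_exp[symmetric]
      by (subst nn_integral_multc, simp) (subst nn_integral_add, auto)
    also have "\<dots> = ennreal (K * exp (s\<^sup>2 * (norm c)\<^sup>2 / 4))"
    proof -
      have "ennreal x * ennreal (1/2) + ennreal x * ennreal (1/2) = ennreal x" if "x \<ge> 0" for x
      proof -
        have "ennreal x * ennreal (1/2) = ennreal (x / 2)" using that by (subst ennreal_mult'[symmetric]) auto
        then show ?thesis using that by (simp only: ennreal_plus[symmetric] divide_nonneg_pos zero_less_numeral field_sum_of_halves)
      qed
      then show ?thesis using K by (simp add: power_mult_distrib distrib_right)
    qed
    finally show ?thesis .
  qed
  have fin: "g n < \<infinity>" for n
  proof -
    have "ennreal (1 / fact (2 * n)) * g n \<le> (\<Sum>n. ennreal (1 ^ (2 * n) / fact (2 * n)) * g n)"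
      using sum_le_suminf[of "\<lambda>n. ennreal (1 ^ (2 * n) / fact (2 * n)) * g n" "{n}"] by simp
    also have "\<dots> < \<infinity>" by (subst series) simp
    finally have "ennreal (1 / fact (2 * n)) * g n < \<infinity>" .
    then show ?thesis by (auto simp: ennreal_mult_less_top)
  qed
  define \<gamma> where "\<gamma> n = enn2real (g n)" for n
  have \<gamma>: "g n = ennreal (\<gamma> n)" "0 \<le> \<gamma> n" for n using fin[of n] by (auto simp: \<gamma>_def)
  have s1: "(\<lambda>n. s ^ (2 * n) / fact (2 * n) * \<gamma> n) sums (K * exp (s\<^sup>2 * (norm c)\<^sup>2 / 4))" for s
  proof -
    have eq: "(\<Sum>n. ennreal (s ^ (2 * n) / fact (2 * n) * \<gamma> n)) = ennreal (K * exp (s\<^sup>2 * (norm c)\<^sup>2 / 4))"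
      using series[of s] by (simp add: \<gamma> zero_le_even_power flip: ennreal_mult')
    have nn: "0 \<le> s ^ (2 * n) / fact (2 * n) * \<gamma> n" for n by (simp add: \<gamma> zero_le_even_power)
    have "summable (\<lambda>n. s ^ (2 * n) / fact (2 * n) * \<gamma> n)"
      by (rule summable_suminf_not_top[OF nn]) (unfold eq, simp)
    note sm = this
    moreover have "(\<Sum>n. s ^ (2 * n) / fact (2 * n) * \<gamma> n) = K * exp (s\<^sup>2 * (norm c)\<^sup>2 / 4)"
    proof -
      have "ennreal (\<Sum>n. s ^ (2 * n) / fact (2 * n) * \<gamma> n) = ennreal (K * exp (s\<^sup>2 * (norm c)\<^sup>2 / 4))"
        using suminf_ennreal2[OF nn sm] eq by simp
      moreover have "0 \<le> (\<Sum>n. s ^ (2 * n) / fact (2 * n) * \<gamma> n)"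
        using suminf_nonneg[OF sm] nn by blast
      moreover have "0 \<le> K * exp (s\<^sup>2 * (norm c)\<^sup>2 / 4)" using K by simp
      ultimately show ?thesis by (simp only: ennreal_inj)
    qed
    ultimately show ?thesis by (simp add: sums_iff)
  qed
  have s2: "(\<lambda>n. s ^ (2 * n) * (K * ((norm c)\<^sup>2 / 4) ^ n / fact n)) sums (K * exp (s\<^sup>2 * (norm c)\<^sup>2 / 4))" for s
  proof -
    have "(\<lambda>n. (s\<^sup>2 * (norm c)\<^sup>2 / 4) ^ n /\<^sub>R fact n) sums exp (s\<^sup>2 * (norm c)\<^sup>2 / 4)" by (rule exp_converges)
    moreover have "K * ((s\<^sup>2 * (norm c)\<^sup>2 / 4) ^ n /\<^sub>R fact n) = s ^ (2 * n) * (K * ((norm c)\<^sup>2 / 4) ^ n / fact n)" for n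
    proof -
      have "s\<^sup>2 * (norm c)\<^sup>2 / 4 = s\<^sup>2 * ((norm c)\<^sup>2 / 4)" by simp
      then show ?thesis by (simp only: power_mult_distrib power_mult real_scaleR_def divide_inverse) (simp only: mult_ac)
    qed
    ultimately show ?thesis using sums_mult[of _ "exp (s\<^sup>2 * (norm c)\<^sup>2 / 4)" K] by fastforce
  qed
  \<comment> \<open>The two even power series have the same sum for every \<open>s\<close>. Padding
    their difference with zeros at odd exponents gives the form needed for uniqueness of
    coefficients.\<close>
  define a where "a n = (if even n then \<gamma> (n div 2) / fact n - K * ((norm c)\<^sup>2 / 4) ^ (n div 2) / fact (n div 2) else 0)" for n
  have "(\<lambda>n. a n * s ^ n) sums 0" for s
  proof -
    have "(\<lambda>n. a (2 * n) * s ^ (2 * n)) sums 0"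
      using sums_diff[OF s1[of s] s2[of s]] by (simp add: a_def algebra_simps)
    then show ?thesis
      by (subst (asm) sums_mono_reindex[of "\<lambda>n. 2 * n" "\<lambda>n. a n * s ^ n"]) (auto simp: strict_mono_def a_def)
  qed
  then have "a (2 * i) = 0" by (rule powser_unique_0)
  then have "\<gamma> i = K * (norm c) ^ (2 * i) * (fact (2 * i) / (4 ^ i * fact i))"
    by (simp add: a_def field_simps power_divide flip: power_mult)
  also have "fact (2 * i) / (4 ^ i * fact i) = pochhammer (1/2 :: real) i"
    using fact_double[of i, where ?'a = real] by (simp add: power_mult)
  finally show ?thesis using \<gamma>(1)[of i] by (simp add: g_def K_def)
qed

text \<open>The moments of the probability measure on \<open>{-1..1}\<close> with density proportional to \<open>(1 - u\<^sup>2) powr (s - 3/2)\<close>; for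
  \<open>s = 1/2\<close> they are those of the uniform distribution on \<open>{-1, 1}\<close>.\<close>

definition arc_mom :: "real \<Rightarrow> nat \<Rightarrow> real" where
  "arc_mom s j = (if even j then pochhammer (1/2) (j div 2) / pochhammer s (j div 2) else 0)"

lemma Gamma_add_nat: "x > 0 \<Longrightarrow> Gamma (x + real i) = pochhammer x i * Gamma x"
proof -
  assume "x > 0"
  then have "x \<notin> \<int>\<^sub>\<le>\<^sub>0" by (auto elim!: nonpos_Ints_cases)
  moreover have "Gamma x \<noteq> 0" using Gamma_real_pos[OF \<open>x > 0\<close>] by linarith
  ultimately show ?thesis by (metis nonzero_divide_eq_eq pochhammer_Gamma)
qed

definition ball_mass :: "'a::euclidean_space itself \<Rightarrow> real \<Rightarrow> real" where
  "ball_mass _ b = Gamma b / Gamma (real DIM('a) / 2 + b) * gauss TYPE('a)"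

lemma ball_mass_pos: "b > 0 \<Longrightarrow> ball_mass TYPE('a::euclidean_space) b > 0"
  using gauss(2)[where ?'a='a] by (simp add: ball_mass_def add_nonneg_pos Gamma_real_pos)

lemma nn_integral_ball_wt_even:
  fixes c :: "'a::euclidean_space"
  assumes "b > 0"
  shows "(\<integral>\<^sup>+y. ennreal ((c \<bullet> y) ^ (2 * i) * ball_wt b 1 y) \<partial>lborel)
    = ennreal (ball_mass TYPE('a) b * (norm c) ^ (2 * i) * pochhammer (1/2) i / pochhammer (real DIM('a) / 2 + b) i)"
proof -
  define e where "e = real DIM('a) / 2 + b"
  have e: "e > 0" "Gamma e > 0" "Gamma b > 0" using assms by (auto simp: e_def add_nonneg_pos Gamma_real_pos)
  have G: "Gamma (real i + e) = pochhammer e i * Gamma e"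
    using Gamma_add_nat[of e i] e by (simp add: add.commute)
  have p: "pochhammer e i > 0" using e by (simp add: pochhammer_pos)
  define I where "I = (\<integral>\<^sup>+y. ennreal ((c \<bullet> y) ^ (2 * i) * ball_wt b 1 y) \<partial>lborel)"
  define A where "A = gauss TYPE('a) * (norm c) ^ (2 * i) * pochhammer (1/2) i"
  have "ennreal (Gamma b) * ennreal A = ennreal (Gamma (real i + e)) * I"
    using nn_integral_ball_wt_gauss[OF assms, of c i] unfolding nn_integral_gauss_even A_def I_def e_def add.assoc .
  then have "ennreal (Gamma b * A) = ennreal (pochhammer e i * Gamma e) * I"
    unfolding G using e by (simp only: ennreal_mult' less_imp_le)
  then have "ennreal (1 / (pochhammer e i * Gamma e)) * ennreal (Gamma b * A)
     = ennreal (1 / (pochhammer e i * Gamma e)) * ennreal (pochhammer e i * Gamma e) * I"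
    by (simp only: mult.assoc)
  also have "ennreal (1 / (pochhammer e i * Gamma e)) * ennreal (pochhammer e i * Gamma e) = 1" 
  proof -
    have "pochhammer e i * Gamma e > 0" using e p by (intro mult_pos_pos)
    then have "1 / (pochhammer e i * Gamma e) * (pochhammer e i * Gamma e) = 1"
      by (simp only: divide_self_if times_divide_eq_left mult_1_left less_irrefl split: if_split) force
    then show ?thesis using \<open>pochhammer e i * Gamma e > 0\<close>
      by (subst ennreal_mult'[symmetric]) (simp_all only: ennreal_1 zero_le_divide_1_iff less_imp_le)
  qed
  also have "ennreal (1 / (pochhammer e i * Gamma e)) * ennreal (Gamma b * A) = ennreal (1 / (pochhammer e i * Gamma e) * (Gamma b * A))" 
    using e p by (subst ennreal_mult'[symmetric]) auto
  also have "1 / (pochhammer e i * Gamma e) * (Gamma b * A) = 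
    ball_mass TYPE('a) b * (norm c) ^ (2 * i) * pochhammer (1/2) i / pochhammer e i"
    by (simp add: ball_mass_def e_def A_def field_simps)
  finally show ?thesis by (simp add: I_def e_def)
qed

text \<open>A Borel twin of \<open>ball_measure\<close> on an arbitrary Euclidean space. The
  generality matters: the same family on \<open>real\<close> serves as the one-dimensional reference
  measure.\<close>

definition ball_prob :: "real \<Rightarrow> 'a::euclidean_space measure" where
  "ball_prob b = density lborel (\<lambda>y. ennreal (ball_wt b 1 y / ball_mass TYPE('a) b))"

lemma sets_ball_prob [measurable_cong, simp]: "sets (ball_prob b) = sets borel"
  and space_ball_prob [simp]: "space (ball_prob b) = UNIV"
  by (simp_all add: ball_prob_def)

lemma integral_uminus_lborel:
  fixes f :: "'a::euclidean_space \<Rightarrow> real"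
  assumes [measurable]: "f \<in> borel_measurable borel"
  shows "(LINT y|lborel. f (- y)) = (LINT y|lborel. f y)"
proof -
  have "(LINT y|lborel. f y) = (LINT y|density (distr lborel borel (\<lambda>x. 0 + (-1) *\<^sub>R x)) (\<lambda>_. ennreal (\<bar>-1\<bar>^DIM('a))). f y)"
    by (subst lborel_affine[of "-1" 0]) auto
  also have "\<dots> = (LINT y|distr lborel borel (\<lambda>x. - x). f y)" by (simp add: density_1)
  also have "\<dots> = (LINT y|lborel. f (- y))" by (subst integral_distr) auto
  finally show ?thesis ..
qed

lemma ball_prob_integral:
  fixes h :: "'a::euclidean_space \<Rightarrow> real"
  assumes "b > 0" and [measurable]: "h \<in> borel_measurable borel"
  shows "(LINT y|ball_prob b. h y) = (LINT y|lborel. ball_wt b 1 y * h y) / ball_mass TYPE('a) b"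
  using ball_mass_pos[OF assms(1), where ?'a='a] unfolding ball_prob_def
  by (subst integral_density) (auto intro!: AE_I2 simp: mult.commute)

lemma ball_wt_add:
  "b > 0 \<Longrightarrow> ball_wt b 1 y * (1 - (norm y)\<^sup>2) ^ j = ball_wt (b + real j) 1 y"
proof (cases "(norm y)\<^sup>2 < 1")
  case True
  then have "(1 - (norm y)\<^sup>2) ^ j = (1 - (norm y)\<^sup>2) powr real j" by (simp add: powr_realpow)
  then have "(1 - (norm y)\<^sup>2) powr (b - 1) * (1 - (norm y)\<^sup>2) ^ j = (1 - (norm y)\<^sup>2) powr (b - 1 + real j)"
    by (simp only: powr_add)
  moreover have "b - 1 + real j = b + real j - 1" by simp
  ultimately show ?thesis using True by (simp add: ball_wt_def)
qed (simp add: ball_wt_def)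

text \<open>Odd moments vanish under \<open>y \<mapsto> - y\<close>. A power of
  \<open>1 - (norm y)^2\<close> only shifts \<open>b\<close> by \<open>j\<close>, so the even case
  is the plain moment formula times a quotient of masses.\<close>

lemma ball_prob_moment:
  fixes c :: "'a::euclidean_space"
  assumes b: "b > 0"
  shows "(LINT y|ball_prob b. (c \<bullet> y) ^ k * (1 - (norm y)\<^sup>2) ^ j)
    = (if even k then (norm c) ^ k * pochhammer (1/2) (k div 2) * pochhammer b j / pochhammer (real DIM('a) / 2 + b) (k div 2 + j) else 0)"
proof -
  have e: "(LINT y|ball_prob b. (c \<bullet> y) ^ k * (1 - (norm y)\<^sup>2) ^ j) =
     (LINT y|lborel. (c \<bullet> y) ^ k * ball_wt (b + real j) 1 y) / ball_mass TYPE('a) b"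
    using b by (subst ball_prob_integral) (simp_all add: ball_wt_add[symmetric] mult_ac)
  show ?thesis
  proof (cases "even k")
    case True
    then obtain i where k: "k = 2 * i" by (auto elim: evenE)
    define e where "e = real DIM('a) / 2 + b"
    have ep: "e > 0" using b by (simp add: e_def add_nonneg_pos)
    have "(LINT y|lborel. (c \<bullet> y) ^ k * ball_wt (b + real j) 1 y)
        = enn2real (\<integral>\<^sup>+y. ennreal ((c \<bullet> y) ^ (2 * i) * ball_wt (b + real j) 1 y) \<partial>lborel)"
      unfolding k by (subst integral_eq_nn_integral) (auto simp: zero_le_even_power)
    also have "\<dots> = ball_mass TYPE('a) (b + j) * (norm c) ^ (2 * i) * pochhammer (1/2) i / pochhammer (e + j) i"
    proof -
      have "real DIM('a) / 2 + (b + real j) = e + real j" by (simp add: e_def)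
      moreover have "0 \<le> ball_mass TYPE('a) (b + j) * (norm c) ^ (2 * i) * pochhammer (1/2) i / pochhammer (e + j) i"
        using b ep ball_mass_pos[of "b + j", where ?'a='a]
        by (intro mult_nonneg_nonneg divide_nonneg_nonneg pochhammer_nonneg) auto
      moreover have "b + real j > 0" using b by simp
      ultimately show ?thesis by (simp only: nn_integral_ball_wt_even enn2real_ennreal)
    qed
    finally have 1: "(LINT y|ball_prob b. (c \<bullet> y) ^ k * (1 - (norm y)\<^sup>2) ^ j) = 
      ball_mass TYPE('a) (b + j) / ball_mass TYPE('a) b * (norm c) ^ (2 * i) * pochhammer (1/2) i / pochhammer (e + j) i"
      using e by simp
    have Gb: "Gamma (b + j) = pochhammer b j * Gamma b" "Gamma (e + j) = pochhammer e j * Gamma e"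
      using Gamma_add_nat b ep by auto
    have pos: "pochhammer b j > 0" "pochhammer e j > 0" "Gamma b > 0" "Gamma e > 0" "gauss TYPE('a) > 0" 
      using b ep by (auto simp: pochhammer_pos Gamma_real_pos gauss)
    have "ball_mass TYPE('a) (b + j) / ball_mass TYPE('a) b = pochhammer b j / pochhammer e j"
      unfolding ball_mass_def e_def[symmetric] add.assoc[symmetric]
      using pos by (simp add: Gb)
    moreover have "pochhammer e (j + i) = pochhammer e j * pochhammer (e + j) i"
      by (simp add: pochhammer_product')
    ultimately show ?thesis using 1 True k pos unfolding e_def[symmetric] by (simp add: add.commute[of j] mult_ac)
  next
    case False
    have "(LINT y|lborel. (c \<bullet> y) ^ k * ball_wt (b + real j) 1 y) = 
       (LINT y|lborel. (c \<bullet> (- y)) ^ k * ball_wt (b + real j) 1 (- y))"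
      by (rule integral_uminus_lborel[symmetric]) measurable
    also have "\<dots> = - (LINT y|lborel. (c \<bullet> y) ^ k * ball_wt (b + real j) 1 y)"
      using False by simp
    finally show ?thesis using e False by simp
  qed
qed

lemma ball_prob_finite:
  assumes b: "b > 0"
  shows "emeasure (ball_prob b :: 'a::euclidean_space measure) UNIV = 1"
proof -
  have "emeasure (ball_prob b :: 'a measure) UNIV = (\<integral>\<^sup>+y. ennreal (1 / ball_mass TYPE('a) b) * ennreal (((0::'a) \<bullet> y) ^ (2 * 0) * ball_wt b 1 y) \<partial>lborel)"
    unfolding ball_prob_def using ball_mass_pos[OF b, where ?'a='a]
    by (subst emeasure_density) (auto intro!: nn_integral_cong simp flip: ennreal_mult')
  also have "\<dots> = ennreal (1 / ball_mass TYPE('a) b) * ennreal (ball_mass TYPE('a) b)"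
    using nn_integral_ball_wt_even[OF b, where c = "0::'a" and i = 0] by (subst nn_integral_cmult) auto
  also have "\<dots> = 1" using ball_mass_pos[OF b, where ?'a='a] by (simp flip: ennreal_mult')
  finally show ?thesis .
qed

lemma finite_measure_ball_prob: "b > 0 \<Longrightarrow> finite_measure (ball_prob b)"
  by (rule finite_measureI) (simp add: ball_prob_finite)

lemma AE_ball_prob: "AE y in ball_prob b. norm y < 1"
  unfolding ball_prob_def by (subst AE_density) (auto simp: ball_wt_def abs_square_less_1 split: if_splits)

text \<open>The mean of \<open>(t + sqrt w * u) ^ j\<close> for \<open>u\<close> with moments \<open>arc_mom s\<close>, written without the square root so that it
  is a polynomial in \<open>t\<close> and \<open>w\<close>, also for \<open>w < 0\<close>.\<close>

definition zpow :: "real \<Rightarrow> nat \<Rightarrow> real \<Rightarrow> real \<Rightarrow> real" where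
  "zpow s j t w = (\<Sum>k\<le>j div 2. real (j choose (2 * k)) * t ^ (j - 2 * k) * w ^ k * arc_mom s (2 * k))"

text \<open>By the duplication formula \<open>pochhammer (1/2) m\<close> is
  \<open>fact (2 * m) / (4 ^ m * fact m)\<close>, and the large factorials cancel. This is what
  collapses the sum in \<open>ball_prob_zpow\<close> to the binomial theorem.\<close>

lemma choose_half: "real ((2 * n) choose (2 * k)) * pochhammer (1/2) k * pochhammer (1/2) (n - k)
    = real (n choose k) * pochhammer (1/2) n" if "k \<le> n"
proof -
  have f: "pochhammer (1/2 :: real) m = fact (2 * m) / (4 ^ m * fact m)" for m
    using fact_double[of m, where ?'a = real] by (simp add: power_mult)
  have e: "2 * n - 2 * k = 2 * (n - k)" by simp
  have p: "(4::real) ^ n = 4 ^ k * 4 ^ (n - k)" using that by (simp flip: power_add)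
  show ?thesis using that by (simp add: binomial_fact f e p)
qed

text \<open>If \<open>2 * b\<close> is a positive integer, \<open>y\<close> is the projection of a
  uniform point of the unit sphere in dimension \<open>DIM('a) + 2 * b\<close>, and
  \<open>sqrt (1 - (norm y)^2) * u\<close> is one further coordinate of that point. The integrand is
  then a power of a linear form, whose mean sees the coefficients only through the squared length
  \<open>(norm v)^2 + B\<close>. The calculation with moments yields the same for every
  \<open>b > 0\<close> and every real \<open>B\<close>.\<close>

lemma ball_prob_zpow:
  fixes v :: "'a::euclidean_space" and B b :: real
  assumes b: "b > 0"
  shows "(LINT y|ball_prob b. zpow b J (v \<bullet> y) (B * (1 - (norm y)\<^sup>2)))
     = (if even J then arc_mom (real DIM('a) / 2 + b) J * ((norm v)\<^sup>2 + B) ^ (J div 2) else 0)"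
proof -
  interpret finite_measure "ball_prob b :: 'a measure" using b by (rule finite_measure_ball_prob)
  define e where "e = real DIM('a) / 2 + b"
  have e: "e > 0" using b by (simp add: e_def add_nonneg_pos)
  have int: "integrable (ball_prob b) (\<lambda>y. (v \<bullet> y) ^ i * (1 - (norm y)\<^sup>2) ^ k)" for i k
  proof (rule integrable_const_bound)
    show "AE y in ball_prob b. norm ((v \<bullet> y) ^ i * (1 - (norm y)\<^sup>2) ^ k) \<le> norm v ^ i"
      using AE_ball_prob[of b]
    proof eventually_elim
      case (elim y)
      have "\<bar>v \<bullet> y\<bar> \<le> norm v * norm y" by (rule Cauchy_Schwarz_ineq2)
      also have "\<dots> \<le> norm v" using elim by (simp add: mult_left_le)
      finally have "\<bar>v \<bullet> y\<bar> ^ i \<le> norm v ^ i" by (simp add: power_mono)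
      moreover have "\<bar>1 - (norm y)\<^sup>2\<bar> ^ k \<le> 1"
        using elim by (intro power_le_one) (auto simp: abs_le_iff power_le_one)
      ultimately have "\<bar>v \<bullet> y\<bar> ^ i * \<bar>1 - (norm y)\<^sup>2\<bar> ^ k \<le> norm v ^ i * 1"
        by (intro mult_mono) auto
      then show ?case by (simp add: abs_mult power_abs)
    qed
  qed measurable
  have "(LINT y|ball_prob b. zpow b J (v \<bullet> y) (B * (1 - (norm y)\<^sup>2))) =
    (LINT y|ball_prob b. (\<Sum>k\<le>J div 2. (real (J choose (2 * k)) * B ^ k * arc_mom b (2 * k)) * ((v \<bullet> y) ^ (J - 2 * k) * (1 - (norm y)\<^sup>2) ^ k)))"
    by (simp add: zpow_def power_mult_distrib mult_ac)
  also have "\<dots> = (\<Sum>k\<le>J div 2. real (J choose (2 * k)) * B ^ k * arc_mom b (2 * k) * (LINT y|ball_prob b. (v \<bullet> y) ^ (J - 2 * k) * (1 - (norm y)\<^sup>2) ^ k))"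
    by (subst Bochner_Integration.integral_sum) (auto intro!: int)
  also have "\<dots> = (if even J then arc_mom e J * ((norm v)\<^sup>2 + B) ^ (J div 2) else 0)"
  proof (cases "even J")
    case True
    then obtain n where J: "J = 2 * n" by (auto elim: evenE)
    have "real (J choose (2 * k)) * B ^ k * arc_mom b (2 * k) * (LINT y|ball_prob b. (v \<bullet> y) ^ (J - 2 * k) * (1 - (norm y)\<^sup>2) ^ k)
       = arc_mom e J * (real (n choose k) * B ^ k * ((norm v)\<^sup>2) ^ (n - k))" if "k \<le> n" for k
    proof -
      have pb: "pochhammer b k > 0" using b by (rule pochhammer_pos)
      have J2: "J - 2 * k = 2 * (n - k)" using J by simp
      have nv: "norm v ^ (2 * (n - k)) = ((norm v)\<^sup>2) ^ (n - k)" by (rule power_mult)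
      have g: "(LINT y|ball_prob b. (v \<bullet> y) ^ (2 * (n - k)) * (1 - (norm y)\<^sup>2) ^ k) =
         ((norm v)\<^sup>2) ^ (n - k) * pochhammer (1/2) (n - k) * pochhammer b k / pochhammer e n"
        using that b by (subst ball_prob_moment) (auto simp: e_def nv)
      have "real (J choose (2 * k)) * B ^ k * arc_mom b (2 * k) * (LINT y|ball_prob b. (v \<bullet> y) ^ (J - 2 * k) * (1 - (norm y)\<^sup>2) ^ k)
        = (real ((2 * n) choose (2 * k)) * pochhammer (1/2) k * pochhammer (1/2) (n - k)) * B ^ k * ((norm v)\<^sup>2) ^ (n - k) / pochhammer e n"
        unfolding J2 g using pb by (simp add: arc_mom_def J)
      also have "\<dots> = arc_mom e J * (real (n choose k) * B ^ k * ((norm v)\<^sup>2) ^ (n - k))"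
        unfolding choose_half[OF that] by (simp add: arc_mom_def J)
      finally show ?thesis .
    qed
    then have "(\<Sum>k\<le>J div 2. real (J choose (2 * k)) * B ^ k * arc_mom b (2 * k) * (LINT y|ball_prob b. (v \<bullet> y) ^ (J - 2 * k) * (1 - (norm y)\<^sup>2) ^ k))
      = (\<Sum>k\<le>n. arc_mom e J * (real (n choose k) * B ^ k * ((norm v)\<^sup>2) ^ (n - k)))"
      using J by (intro sum.cong) auto
    also have "\<dots> = arc_mom e J * (B + (norm v)\<^sup>2) ^ n"
      unfolding binomial_ring by (simp add: sum_distrib_left)
    finally show ?thesis using True J by (simp add: add.commute)
  next
    case False
    have "(LINT y|ball_prob b. (v \<bullet> y) ^ (J - 2 * k) * (1 - (norm y)\<^sup>2) ^ k) = 0" if "k \<le> J div 2" for k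
    proof -
      have "odd (J - 2 * k)" using False that by auto
      then show ?thesis using b by (simp add: ball_prob_moment)
    qed
    then show ?thesis using False by simp
  qed
  finally show ?thesis by (simp add: e_def)
qed

lemma choose_trinomial:
  assumes "m + i \<le> n"
  shows "(n choose i) * ((n - i) choose m) = (n choose m) * ((n - m) choose i)"
proof -
  have "(n choose (i + m)) * ((i + m) choose i) = (n choose i) * ((n - i) choose (i + m - i))"
    using assms by (intro choose_mult) auto
  moreover have "(n choose (i + m)) * ((i + m) choose m) = (n choose m) * ((n - m) choose (i + m - m))"
    using assms by (intro choose_mult) auto
  moreover have "((i + m) choose i) = ((i + m) choose m)"
    using binomial_symmetric[of i "i + m"] by simp
  ultimately show ?thesis by simp
qed

text \<open>Binomial expansion of \<open>((p + sqrt w * u) + t * q) ^ J\<close> in powers of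
  \<open>t\<close>, averaged over \<open>u\<close>.\<close>

lemma zpow_add:
  "zpow s J (p + t * q) w = (\<Sum>m\<le>J. t ^ m * (real (J choose m) * q ^ m * zpow s (J - m) p w))"
proof -
  have "zpow s J (p + t * q) w = 
     (\<Sum>k\<le>J div 2. \<Sum>m\<le>J. if m + 2 * k \<le> J then t ^ m * (real (J choose (2 * k)) * real ((J - 2 * k) choose m) * q ^ m * p ^ (J - 2 * k - m) * w ^ k * arc_mom s (2 * k)) else 0)"
    unfolding zpow_def
  proof (intro sum.cong refl)
    fix k assume "k \<in> {..J div 2}"
    then have k: "2 * k \<le> J" by auto
    have "(p + t * q) ^ (J - 2 * k) = (\<Sum>m\<le>J - 2 * k. real ((J - 2 * k) choose m) * (t * q) ^ m * p ^ (J - 2 * k - m))"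
      unfolding add.commute[of p] by (rule binomial_ring)
    also have "\<dots> = (\<Sum>m\<le>J. if m + 2 * k \<le> J then real ((J - 2 * k) choose m) * (t * q) ^ m * p ^ (J - 2 * k - m) else 0)"
      using k by (intro sum.mono_neutral_cong_left) auto
    finally show "real (J choose (2 * k)) * (p + t * q) ^ (J - 2 * k) * w ^ k * arc_mom s (2 * k) =
      (\<Sum>m\<le>J. if m + 2 * k \<le> J then t ^ m * (real (J choose (2 * k)) * real ((J - 2 * k) choose m) * q ^ m * p ^ (J - 2 * k - m) * w ^ k * arc_mom s (2 * k)) else 0)"
      by (auto simp: sum_distrib_left sum_distrib_right power_mult_distrib mult_ac intro!: sum.cong)
  qed
  also have "\<dots> = (\<Sum>m\<le>J. \<Sum>k\<le>J div 2. if m + 2 * k \<le> J then t ^ m * (real (J choose (2 * k)) * real ((J - 2 * k) choose m) * q ^ m * p ^ (J - 2 * k - m) * w ^ k * arc_mom s (2 * k)) else 0)"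
    by (rule sum.swap)
  also have "\<dots> = (\<Sum>m\<le>J. t ^ m * (real (J choose m) * q ^ m * zpow s (J - m) p w))"
  proof (intro sum.cong refl)
    fix m assume "m \<in> {..J}"
    have "(\<Sum>k\<le>J div 2. if m + 2 * k \<le> J then t ^ m * (real (J choose (2 * k)) * real ((J - 2 * k) choose m) * q ^ m * p ^ (J - 2 * k - m) * w ^ k * arc_mom s (2 * k)) else 0)
      = (\<Sum>k\<le>(J - m) div 2. t ^ m * (real (J choose m) * q ^ m * (real ((J - m) choose (2 * k)) * p ^ (J - m - 2 * k) * w ^ k * arc_mom s (2 * k))))"
    proof (intro sum.mono_neutral_cong_right ballI)
      fix k assume "k \<in> {..(J - m) div 2}"
      then have *: "m + 2 * k \<le> J" using \<open>m \<in> {..J}\<close> by auto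
      have "real (J choose (2 * k)) * real ((J - 2 * k) choose m) = real (J choose m) * real ((J - m) choose (2 * k))"
        using choose_trinomial[OF *] by (metis of_nat_mult)
      moreover have "J - 2 * k - m = J - m - 2 * k" by simp
      ultimately show "(if m + 2 * k \<le> J then t ^ m * (real (J choose (2 * k)) * real ((J - 2 * k) choose m) * q ^ m * p ^ (J - 2 * k - m) * w ^ k * arc_mom s (2 * k)) else 0) =
        t ^ m * (real (J choose m) * q ^ m * (real ((J - m) choose (2 * k)) * p ^ (J - m - 2 * k) * w ^ k * arc_mom s (2 * k)))"
        using * by simp
    qed auto
    then show "(\<Sum>k\<le>J div 2. if m + 2 * k \<le> J then t ^ m * (real (J choose (2 * k)) * real ((J - 2 * k) choose m) * q ^ m * p ^ (J - 2 * k - m) * w ^ k * arc_mom s (2 * k)) else 0)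
      = t ^ m * (real (J choose m) * q ^ m * zpow s (J - m) p w)"
      by (simp add: zpow_def sum_distrib_left)
  qed
  finally show ?thesis .
qed

text \<open>Binomial expansion of \<open>(z + t * (c * z + sqrt w * u)) ^ J\<close> in powers of
  \<open>t\<close>, averaged over \<open>u\<close>. Together with \<open>zpow_add\<close> it allows
  coefficients of \<open>t\<close> to be compared in \<open>ball_prob_zpow\<close>.\<close>

lemma zpow_scale:
  "zpow s J ((1 + t * c) * z) (t\<^sup>2 * w) = (\<Sum>m\<le>J. t ^ m * (real (J choose m) * z ^ (J - m) * zpow s m (c * z) w))"
proof -
  have "zpow s J ((1 + t * c) * z) (t\<^sup>2 * w) = 
     (\<Sum>k\<le>J div 2. \<Sum>m\<le>J. if 2 * k \<le> m then t ^ m * (real (J choose (2 * k)) * real ((J - 2 * k) choose (m - 2 * k)) * z ^ (J - 2 * k) * c ^ (m - 2 * k) * w ^ k * arc_mom s (2 * k)) else 0)"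
    unfolding zpow_def
  proof (intro sum.cong refl)
    fix k assume "k \<in> {..J div 2}"
    then have k: "2 * k \<le> J" by auto
    have "(1 + t * c) ^ (J - 2 * k) = (\<Sum>m\<le>J - 2 * k. real ((J - 2 * k) choose m) * (t * c) ^ m)"
      unfolding add.commute[of 1] using binomial_ring[of "t * c" 1 "J - 2 * k"] by simp
    also have "\<dots> = (\<Sum>m\<in>{2 * k..J}. real ((J - 2 * k) choose (m - 2 * k)) * (t * c) ^ (m - 2 * k))"
      using k by (intro sum.reindex_bij_witness[of _ "\<lambda>m. m - 2 * k" "\<lambda>m. m + 2 * k"]) auto
    also have "\<dots> = (\<Sum>m\<le>J. if 2 * k \<le> m then real ((J - 2 * k) choose (m - 2 * k)) * (t * c) ^ (m - 2 * k) else 0)"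
      by (intro sum.mono_neutral_cong_left) auto
    finally have "real (J choose (2 * k)) * ((1 + t * c) * z) ^ (J - 2 * k) * (t\<^sup>2 * w) ^ k * arc_mom s (2 * k) =
      (\<Sum>m\<le>J. (if 2 * k \<le> m then real ((J - 2 * k) choose (m - 2 * k)) * (t * c) ^ (m - 2 * k) else 0)) * 
        (real (J choose (2 * k)) * z ^ (J - 2 * k) * (t\<^sup>2) ^ k * w ^ k * arc_mom s (2 * k))"
      by (simp add: power_mult_distrib mult_ac)
    also have "\<dots> = (\<Sum>m\<le>J. if 2 * k \<le> m then t ^ m * (real (J choose (2 * k)) * real ((J - 2 * k) choose (m - 2 * k)) * z ^ (J - 2 * k) * c ^ (m - 2 * k) * w ^ k * arc_mom s (2 * k)) else 0)"
      unfolding sum_distrib_right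
    proof (intro sum.cong refl)
      fix m assume "m \<in> {..J}"
      show "(if 2 * k \<le> m then real ((J - 2 * k) choose (m - 2 * k)) * (t * c) ^ (m - 2 * k) else 0) * 
        (real (J choose (2 * k)) * z ^ (J - 2 * k) * (t\<^sup>2) ^ k * w ^ k * arc_mom s (2 * k)) = 
        (if 2 * k \<le> m then t ^ m * (real (J choose (2 * k)) * real ((J - 2 * k) choose (m - 2 * k)) * z ^ (J - 2 * k) * c ^ (m - 2 * k) * w ^ k * arc_mom s (2 * k)) else 0)"
      proof (cases "2 * k \<le> m")
        case True
        then have "t ^ m = t ^ (m - 2 * k) * (t\<^sup>2) ^ k" by (simp flip: power_mult power_add)
        then show ?thesis using True by (simp add: power_mult_distrib)
      qed simp
    qed
    finally show "real (J choose (2 * k)) * ((1 + t * c) * z) ^ (J - 2 * k) * (t\<^sup>2 * w) ^ k * arc_mom s (2 * k) = 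
       (\<Sum>m\<le>J. if 2 * k \<le> m then t ^ m * (real (J choose (2 * k)) * real ((J - 2 * k) choose (m - 2 * k)) * z ^ (J - 2 * k) * c ^ (m - 2 * k) * w ^ k * arc_mom s (2 * k)) else 0)" .
  qed
  also have "\<dots> = (\<Sum>m\<le>J. \<Sum>k\<le>J div 2. if 2 * k \<le> m then t ^ m * (real (J choose (2 * k)) * real ((J - 2 * k) choose (m - 2 * k)) * z ^ (J - 2 * k) * c ^ (m - 2 * k) * w ^ k * arc_mom s (2 * k)) else 0)"
    by (rule sum.swap)
  also have "\<dots> = (\<Sum>m\<le>J. t ^ m * (real (J choose m) * z ^ (J - m) * zpow s m (c * z) w))"
  proof (intro sum.cong refl)
    fix m assume "m \<in> {..J}"
    have "(\<Sum>k\<le>J div 2. if 2 * k \<le> m then t ^ m * (real (J choose (2 * k)) * real ((J - 2 * k) choose (m - 2 * k)) * z ^ (J - 2 * k) * c ^ (m - 2 * k) * w ^ k * arc_mom s (2 * k)) else 0)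
      = (\<Sum>k\<le>m div 2. t ^ m * (real (J choose m) * z ^ (J - m) * (real (m choose (2 * k)) * (c * z) ^ (m - 2 * k) * w ^ k * arc_mom s (2 * k))))"
    proof (intro sum.mono_neutral_cong_right ballI)
      fix k assume "k \<in> {..m div 2}"
      then have *: "2 * k \<le> m" "m \<le> J" using \<open>m \<in> {..J}\<close> by auto
      have "real (J choose (2 * k)) * real ((J - 2 * k) choose (m - 2 * k)) = real (J choose m) * real (m choose (2 * k))"
        using choose_mult[of "2 * k" m J] * by (metis of_nat_mult)
      moreover have "z ^ (J - 2 * k) = z ^ (J - m) * z ^ (m - 2 * k)" using * by (simp flip: power_add)
      ultimately show "(if 2 * k \<le> m then t ^ m * (real (J choose (2 * k)) * real ((J - 2 * k) choose (m - 2 * k)) * z ^ (J - 2 * k) * c ^ (m - 2 * k) * w ^ k * arc_mom s (2 * k)) else 0) =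
        t ^ m * (real (J choose m) * z ^ (J - m) * (real (m choose (2 * k)) * (c * z) ^ (m - 2 * k) * w ^ k * arc_mom s (2 * k)))"
        using * by (simp add: power_mult_distrib)
    qed (use \<open>m \<in> {..J}\<close> in auto)
    then show "(\<Sum>k\<le>J div 2. if 2 * k \<le> m then t ^ m * (real (J choose (2 * k)) * real ((J - 2 * k) choose (m - 2 * k)) * z ^ (J - 2 * k) * c ^ (m - 2 * k) * w ^ k * arc_mom s (2 * k)) else 0)
      = t ^ m * (real (J choose m) * z ^ (J - m) * zpow s m (c * z) w)"
      by (simp add: zpow_def sum_distrib_left)
  qed
  finally show ?thesis .
qed

section \<open>Linear functionals on one-variable polynomials given by their moments\<close>

definition umbral :: "(nat \<Rightarrow> real) \<Rightarrow> real poly \<Rightarrow> real" where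
  "umbral \<psi> F = (\<Sum>i\<le>degree F. coeff F i * \<psi> i)"

lemma umbral_eq: "degree F \<le> n \<Longrightarrow> umbral \<psi> F = (\<Sum>i\<le>n. coeff F i * \<psi> i)"
  unfolding umbral_def by (rule sum.mono_neutral_left) (auto simp: coeff_eq_0)

lemma umbral_0 [simp]: "umbral \<psi> 0 = 0"
  by (simp add: umbral_def)

lemma umbral_add: "umbral \<psi> (F + G) = umbral \<psi> F + umbral \<psi> G"
proof -
  let ?n = "max (degree F) (degree G)"
  have "umbral \<psi> (F + G) = (\<Sum>i\<le>?n. coeff (F + G) i * \<psi> i)" by (rule umbral_eq) (simp add: degree_add_le)
  then show ?thesis by (simp add: umbral_eq[of F ?n] umbral_eq[of G ?n] sum.distrib distrib_right)
qed

lemma umbral_smult: "umbral \<psi> (smult c F) = c * umbral \<psi> F"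
  by (simp add: umbral_eq[of "smult c F" "degree F"] umbral_def sum_distrib_left mult_ac)

lemma umbral_minus: "umbral \<psi> (- F) = - umbral \<psi> F"
  using umbral_smult[of \<psi> "-1" F] by simp

lemma umbral_diff: "umbral \<psi> (F - G) = umbral \<psi> F - umbral \<psi> G"
  using umbral_add[of \<psi> F "- G"] by (simp add: umbral_minus)

lemma umbral_sum: "umbral \<psi> (\<Sum>i\<in>A. F i) = (\<Sum>i\<in>A. umbral \<psi> (F i))"
  by (induction A rule: infinite_finite_induct) (auto simp: umbral_add)

lemma umbral_monom [simp]: "umbral \<psi> (monom c n) = c * \<psi> n"
  by (simp add: umbral_eq[of _ n] degree_monom_le if_distrib if_distribR sum.delta cong: if_cong)

lemma umbral_const [simp]: "umbral \<psi> [:c:] = c * \<psi> 0"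
  by (simp add: umbral_def)

text \<open>Expanding only the first factor reduces claims about products with a fixed
  \<open>G\<close> to the moments of \<open>G\<close>.\<close>

lemma umbral_mult: "umbral \<psi> (F * G) = umbral (\<lambda>j. umbral \<psi> (monom 1 j * G)) F"
proof -
  have "F * G = (\<Sum>i\<le>degree F. smult (coeff F i) (monom 1 i * G))"
    by (subst (1) poly_as_sum_of_monoms[symmetric]) (simp add: sum_distrib_right smult_monom flip: mult_smult_left)
  then have "umbral \<psi> (F * G) = umbral \<psi> (\<Sum>i\<le>degree F. smult (coeff F i) (monom 1 i * G))"
    by (rule arg_cong)
  then show ?thesis by (simp only: umbral_sum umbral_smult umbral_def[of _ F])
qed

lemma umbral_cong: "(\<And>j. j \<le> degree F \<Longrightarrow> \<psi> j = \<psi>' j) \<Longrightarrow> umbral \<psi> F = umbral \<psi>' F"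
  by (simp add: umbral_def)

section \<open>Zonal polynomials\<close>

text \<open>\<open>gegenbauer a n\<close> is the Gegenbauer polynomial \<open>C\<^sub>n\<close> with parameter \<open>a\<close>; \<open>zonal \<lambda> n\<close> is
  \<open>(n + \<lambda>) / \<lambda>\<close> times the one with parameter \<open>\<lambda>\<close>, in a form that also makes sense for \<open>\<lambda> = 0\<close>.\<close>

fun gegenbauer :: "real \<Rightarrow> nat \<Rightarrow> real poly" where
  "gegenbauer a 0 = 1"
| "gegenbauer a (Suc 0) = [:0, 2 * a:]"
| "gegenbauer a (Suc (Suc n)) = smult (1 / (real n + 2))
     (smult (2 * (real n + 1 + a)) (pCons 0 (gegenbauer a (Suc n))) - smult (real n + 2 * a) (gegenbauer a n))"

definition zonal :: "real \<Rightarrow> nat \<Rightarrow> real poly" where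
  "zonal l n = (if n < 2 then gegenbauer (l + 1) n else gegenbauer (l + 1) n - gegenbauer (l + 1) (n - 2))"

lemma degree_gegenbauer: "degree (gegenbauer a n) \<le> n"
proof (induction a n rule: gegenbauer.induct)
  case (3 a n)
  have "degree (pCons 0 (gegenbauer a (Suc n))) \<le> Suc (Suc n)"
    using 3(1) degree_pCons_le order_trans by (metis Suc_le_mono)
  then show ?case using 3(2)
    by (auto intro!: degree_diff_le order.trans[OF degree_smult_le])
qed auto

lemma degree_zonal: "degree (zonal l n) \<le> n"
  unfolding zonal_def using degree_gegenbauer[of "l + 1" n] degree_gegenbauer[of "l + 1" "n - 2"]
  by (auto intro!: degree_diff_le)

definition zonal_up :: "real \<Rightarrow> nat \<Rightarrow> real" where "zonal_up l n = real n / (real n + l)"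
text \<open>For \<open>n = 0\<close> the general quotient equals 2 when \<open>l > 0\<close> but is
  \<open>0 / 0\<close> when \<open>l = 0\<close>; the explicit value continues it to that
  case.\<close>

definition zonal_down :: "real \<Rightarrow> nat \<Rightarrow> real" where "zonal_down l n = (if n = 0 then 2 else (real n + 2 * l) / (real n + l))"

lemma zonal_up_zonal_down: "l \<ge> 0 \<Longrightarrow> zonal_up l n + zonal_down l n = 2"
proof (cases "n = 0")
  assume "n \<noteq> 0" "l \<ge> 0"
  then have "real n + l > 0" by simp
  then have "real n / (real n + l) + (real n + 2 * l) / (real n + l) = 2"
    by (subst add_divide_distrib[symmetric]) (simp add: divide_eq_eq)
  then show ?thesis using \<open>n \<noteq> 0\<close> by (simp add: zonal_up_def zonal_down_def)
qed (simp add: zonal_up_def zonal_down_def)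

lemma gegenbauer_step:
  "smult (2 * (real n + 1 + a)) (pCons 0 (gegenbauer a (Suc n))) = smult (real n + 2) (gegenbauer a (Suc (Suc n))) + smult (real n + 2 * a) (gegenbauer a n)"
  by simp

text \<open>The three-term recurrence of the Gegenbauer polynomials with parameter
  \<open>l + 1\<close>, applied at \<open>n\<close> and at \<open>n - 2\<close> and subtracted.
  Small \<open>n\<close> are separate because \<open>zonal\<close> then lacks its second term or the
  recurrence would reach below degree 0.\<close>

lemma zonal_rec:
  assumes l: "l \<ge> 0"
  shows "smult 2 (pCons 0 (zonal l n)) = smult (zonal_up l (Suc n)) (zonal l (Suc n)) + (if n = 0 then 0 else smult (zonal_down l (n - 1)) (zonal l (n - 1)))"
proof -
  define C where "C = gegenbauer (l + 1)"
  have poly_ext: "F = G" if "\<And>x. poly F x = poly G x" for F G :: "real poly"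
    using that poly_eq_poly_eq_iff by blast
  have st: "2 * (real n + 2 + l) * (x * poly (C (Suc n)) x) = (real n + 2) * poly (C (Suc (Suc n))) x + (real n + 2 * l + 2) * poly (C n) x" for n x
  proof -
    have "poly (smult (2 * (real n + 1 + (l+1))) (pCons 0 (C (Suc n)))) x = poly (smult (real n + 2) (C (Suc (Suc n))) + smult (real n + 2 * (l+1)) (C n)) x"
      unfolding C_def by (subst gegenbauer_step) (rule refl)
    then show ?thesis by (simp add: algebra_simps)
  qed
  have C0: "C 0 = 1" and C1: "C (Suc 0) = [:0, 2 * (l + 1):]" by (simp_all add: C_def)
  consider "n = 0" | "n = 1" | "n = 2" | k where "n = k + 3" 
    by atomize_elim presburger
  then show ?thesis
  proof cases
    case 1
    then show ?thesis using l by (simp add: zonal_def zonal_up_def field_simps)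
  next
    case 2
    show ?thesis
    proof (rule poly_ext)
      fix x
      have "poly (C (Suc (Suc 0))) x = (2 * (2 + l) * (x * poly (C (Suc 0)) x) - (2 * l + 2) * poly (C 0) x) / 2"
        using st[of 0 x] by simp
      then show "poly (smult 2 (pCons 0 (zonal l n))) x = poly (smult (zonal_up l (Suc n)) (zonal l (Suc n)) + (if n = 0 then 0 else smult (zonal_down l (n - 1)) (zonal l (n - 1)))) x"
        using 2 l by (simp add: zonal_def C_def[symmetric] C0 C1 zonal_up_def zonal_down_def divide_simps del: gegenbauer.simps) (simp add: algebra_simps)
    qed
  next
    case 3
    show ?thesis
    proof (rule poly_ext)
      fix x
      have s: "2 * (real 1 + 2 + l) * (x * poly (C 2) x) = 3 * poly (C 3) x + (real 1 + 2 * l + 2) * poly (C 1) x" 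
        using st[of 1 x] by (simp add: numeral_2_eq_2 numeral_3_eq_3)
      define c1 c2 c3 where "c1 = poly (C 1) x" and "c2 = poly (C 2) x" and "c3 = poly (C 3) x"
      have p: "3 + l > 0" "1 + l > 0" using l by auto
      have "c1 = 2 * (l + 1) * x" unfolding c1_def One_nat_def C1 by (simp add: algebra_simps)
      then have x1: "x = c1 / (2 * (1 + l))" using p by (simp add: field_simps)
      have x2: "x * c2 = (3 * c3 + (2 * l + 3) * c1) / (2 * (3 + l))"
        using s p by (simp add: c1_def c2_def c3_def field_simps)
      have "2 * (x * c2 - x) = (3 * c3 + (2 * l + 3) * c1) / (3 + l) - c1 / (1 + l)"
      proof -
        have h: "2 * (A / (2 * B)) = A / B" for A B :: real by simp
        have "2 * x = c1 / (1 + l)" by (subst x1) (rule h)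
        then show ?thesis unfolding right_diff_distrib x2 h by (simp only:)
      qed
      also have "\<dots> = 3 / (3 + l) * (c3 - c1) + (1 + 2 * l) / (1 + l) * c1"
        using p by (simp add: divide_simps) algebra
      finally have "2 * (x * c2 - x) = 3 / (3 + l) * (c3 - c1) + (1 + 2 * l) / (1 + l) * c1" .
      moreover have zz: "zonal l n = C 2 - 1" "zonal l (Suc n) = C 3 - C 1" "zonal l (n - 1) = C 1"
        using 3 C0 by (simp_all add: zonal_def C_def[symmetric] numeral_3_eq_3 del: gegenbauer.simps)
      ultimately show "poly (smult 2 (pCons 0 (zonal l n))) x = poly (smult (zonal_up l (Suc n)) (zonal l (Suc n)) + (if n = 0 then 0 else smult (zonal_down l (n - 1)) (zonal l (n - 1)))) x"
        unfolding zz using 3 by (simp add: zonal_up_def zonal_down_def c1_def c2_def c3_def algebra_simps)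
    qed
  next
    case (4 k)
    show ?thesis
    proof (rule poly_ext)
      fix x
      define c0 c1 c2 c3 c4 where "c0 = poly (C k) x" and "c1 = poly (C (k+1)) x" and "c2 = poly (C (k+2)) x" 
        and "c3 = poly (C (k+3)) x" and "c4 = poly (C (k+4)) x"
      have s1: "2 * (real k + 2 + l) * (x * c1) = (real k + 2) * c2 + (real k + 2 * l + 2) * c0"
        using st[of k x] by (simp add: c0_def c1_def c2_def)
      have s2: "2 * (real k + 4 + l) * (x * c3) = (real k + 4) * c4 + (real k + 2 * l + 4) * c2"
        using st[of "k + 2" x] by (simp add: c2_def c3_def c4_def numeral_3_eq_3 eval_nat_numeral algebra_simps)
      have p: "real k + 2 + l > 0" "real k + 4 + l > 0" using l by auto
      have x1: "x * c1 = ((real k + 2) * c2 + (real k + 2 * l + 2) * c0) / (2 * (real k + 2 + l))"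
        using s1 p by (simp add: field_simps)
      have x3: "x * c3 = ((real k + 4) * c4 + (real k + 2 * l + 4) * c2) / (2 * (real k + 4 + l))"
        using s2 p by (simp add: field_simps)
      have "2 * (x * c3 - x * c1) = (real k + 4) / (real k + 4 + l) * (c4 - c2) + (real k + 2 + 2 * l) / (real k + 2 + l) * (c2 - c0)"
        unfolding x1 x3 using p by (simp add: divide_simps) algebra
      moreover have zz: "zonal l n = C (k+3) - C (k+1)" "zonal l (Suc n) = C (k+4) - C (k+2)" "zonal l (n - 1) = C (k+2) - C k"
        using 4 by (simp_all add: zonal_def C_def[symmetric] numeral_3_eq_3 eval_nat_numeral)
      ultimately show "poly (smult 2 (pCons 0 (zonal l n))) x = poly (smult (zonal_up l (Suc n)) (zonal l (Suc n)) + (if n = 0 then 0 else smult (zonal_down l (n - 1)) (zonal l (n - 1)))) x"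
        unfolding zz using 4 by (simp add: zonal_up_def zonal_down_def c0_def c1_def c2_def c3_def c4_def algebra_simps)
    qed
  qed
qed

text \<open>The squared norm of \<open>zonal l n\<close> for the moments
  \<open>arc_mom (l + 1)\<close>, which is also its value at 1. The recursion expresses that pairing
  \<open>2 * x * zonal l n\<close> with \<open>zonal l (n + 1)\<close> can be evaluated by expanding
  either factor with \<open>zonal_rec\<close>.\<close>

primrec zonal_lead :: "real \<Rightarrow> nat \<Rightarrow> real" where
  "zonal_lead l 0 = 1"
| "zonal_lead l (Suc n) = zonal_down l n * zonal_lead l n * (real n + 1 + l) / (real n + 1)"

definition zonal_mom :: "real \<Rightarrow> nat \<Rightarrow> nat \<Rightarrow> real" where
  "zonal_mom l n i = zonal_lead l n * fact (n + 2 * i) / (2 ^ (n + 2 * i) * fact i * pochhammer (l + 1) (n + i))"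

lemma zonal_lead_al: "l \<ge> 0 \<Longrightarrow> zonal_up l (Suc n) * zonal_lead l (Suc n) = zonal_down l n * zonal_lead l n"
proof -
  assume "l \<ge> 0"
  then have "real n + 1 + l > 0" by simp
  then show ?thesis by (simp add: zonal_up_def add_ac)
qed

text \<open>This is \<open>zonal_rec\<close> paired with the monomial of degree
  \<open>n + 1 + 2 * i\<close>, verified on the closed formula so that the moments can be found by
  induction on \<open>n\<close>.\<close>

lemma zonal_mom_rec:
  assumes l: "l \<ge> 0" 
  shows "zonal_up l (Suc n) * zonal_mom l (Suc n) i = 2 * zonal_mom l n (Suc i) - (if n = 0 then 0 else zonal_down l (n - 1) * zonal_mom l (n - 1) (Suc i))"
proof -
  define X :: real where "X = fact (n + 1 + 2 * i) / (2 ^ (n + 1 + 2 * i) * fact (Suc i) * pochhammer (l + 1) (n + i + 1))"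
  have P: "pochhammer (l + 1) m > 0" for m using l by (intro pochhammer_pos) simp
  have a: "zonal_mom l (Suc n) i = zonal_lead l (Suc n) * (real i + 1) * X"
  proof -
    have "(fact (Suc i) :: real) = (real i + 1) * fact i" by simp
    then show ?thesis unfolding zonal_mom_def X_def by (simp add: divide_simps)
  qed
  have b: "2 * zonal_mom l n (Suc i) = zonal_lead l n * (real n + 2 * real i + 2) * X"
  proof -
    have e: "n + 2 * Suc i = Suc (n + 1 + 2 * i)" by simp
    have "(fact (n + 2 * Suc i) :: real) = (real n + 2 * real i + 2) * fact (n + 1 + 2 * i)"
      unfolding e fact_Suc by simp
    moreover have "(2::real) ^ (n + 2 * Suc i) = 2 * 2 ^ (n + 1 + 2 * i)" unfolding e by simp
    moreover have "n + Suc i = n + i + 1" by simp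
    ultimately show ?thesis unfolding zonal_mom_def X_def by (simp del: fact_Suc power_Suc)
  qed
  have c: "zonal_mom l (n - 1) (Suc i) = zonal_lead l (n - 1) * (l + 1 + real n + real i) * X" if n: "n \<noteq> 0"
  proof -
    have e: "n - 1 + 2 * Suc i = n + 1 + 2 * i" "n - 1 + Suc i = n + i" using n by auto
    have "pochhammer (l + 1) (n + i + 1) = pochhammer (l + 1) (n + i) * (l + 1 + real n + real i)"
      using pochhammer_Suc[of "l + 1" "n + i"] by (simp add: add_ac)
    moreover have "l + 1 + real n + real i > 0" using l by simp
    ultimately show ?thesis unfolding zonal_mom_def X_def e by simp
  qed
  show ?thesis
  proof (cases "n = 0")
    case True
    have "zonal_up l (Suc n) * zonal_mom l (Suc n) i = (zonal_up l (Suc n) * zonal_lead l (Suc n)) * (real i + 1) * X" by (simp add: a)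
    also have "\<dots> = zonal_down l n * zonal_lead l n * (real i + 1) * X" by (simp only: zonal_lead_al[OF l])
    finally show ?thesis using True unfolding b by (simp add: zonal_down_def)
  next
    case False
    then obtain m where m: "n = Suc m" by (cases n) auto
    have 1: "zonal_up l (Suc n) * zonal_mom l (Suc n) i = (zonal_up l (Suc n) * zonal_lead l (Suc n)) * (real i + 1) * X" by (simp add: a)
    have 2: "zonal_down l (n - 1) * zonal_mom l (n - 1) (Suc i) = (zonal_up l n * zonal_lead l n) * (l + 1 + real n + real i) * X"
    proof -
      have "zonal_down l (n - 1) * zonal_lead l (n - 1) = zonal_up l n * zonal_lead l n" using zonal_lead_al[OF l, of m] m by simp
      moreover have "zonal_down l (n - 1) * zonal_mom l (n - 1) (Suc i) = (zonal_down l (n - 1) * zonal_lead l (n - 1)) * (l + 1 + real n + real i) * X"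
        unfolding c[OF False] by (simp only: mult.assoc)
      ultimately show ?thesis by (simp only:)
    qed
    have np: "real n + l > 0" using l False by simp
    have "zonal_up l (Suc n) * zonal_mom l (Suc n) i = zonal_lead l n * X * (zonal_down l n * (real i + 1))"
      unfolding 1 zonal_lead_al[OF l] by (simp add: mult_ac)
    also have "zonal_down l n * (real i + 1) = (real n + 2 * real i + 2) - zonal_up l n * (l + 1 + real n + real i)"
      using False np by (simp add: zonal_down_def zonal_up_def field_simps)
    finally have "zonal_up l (Suc n) * zonal_mom l (Suc n) i = zonal_lead l n * (real n + 2 * real i + 2) * X - (zonal_up l n * zonal_lead l n) * (l + 1 + real n + real i) * X"
      by (simp add: algebra_simps)
    then show ?thesis by (simp only: b 2 False if_False)
  qed
qed

text \<open>The cancellation that makes \<open>zonal l (n + 1)\<close> orthogonal to the monomial of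
  degree \<open>n - 1\<close>.\<close>

lemma zonal_mom_rec0:
  assumes l: "l \<ge> 0" and n: "n > 0"
  shows "2 * zonal_mom l n 0 = zonal_down l (n - 1) * zonal_mom l (n - 1) 0"
proof -
  obtain m where m: "n = Suc m" using n by (cases n) auto
  have "pochhammer (l + 1) m > 0" using l by (intro pochhammer_pos) simp
  moreover have "l + 1 + real m > 0" using l by simp
  ultimately show ?thesis unfolding m zonal_mom_def by (simp add: pochhammer_Suc divide_simps) (simp add: algebra_simps)
qed

lemma zonal_moment:
  assumes l: "l \<ge> 0"
  shows "umbral (arc_mom (l + 1)) (monom 1 j * zonal l n) = (if n \<le> j \<and> even (j + n) then zonal_mom l n ((j - n) div 2) else 0)"
proof (induction n arbitrary: j rule: less_induct)
  case (less n)
  show ?case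
  proof (cases n)
    case 0
    have "umbral (arc_mom (l + 1)) (monom 1 j * zonal l n) = arc_mom (l + 1) j" by (simp add: 0 zonal_def)
    also have "\<dots> = (if even j then zonal_mom l 0 (j div 2) else 0)"
    proof (cases "even j")
      case True
      then obtain i where i: "j = 2 * i" by (auto elim: evenE)
      have "pochhammer (1/2 :: real) i = fact (2 * i) / (4 ^ i * fact i)"
        using fact_double[of i, where ?'a = real] by (simp add: power_mult)
      then show ?thesis by (simp add: arc_mom_def zonal_mom_def i power_mult)
    qed (simp add: arc_mom_def)
    finally show ?thesis by (simp add: 0)
  next
    case (Suc m)
    have ap: "zonal_up l n > 0" using l Suc by (simp add: zonal_up_def add_pos_nonneg)
    have "monom 1 (Suc j) * zonal l m = monom 1 j * pCons 0 (zonal l m)" by (simp add: monom_Suc)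
    then have "smult 2 (monom 1 (Suc j) * zonal l m) = monom 1 j * (smult 2 (pCons 0 (zonal l m)))" by simp
    also have "\<dots> = smult (zonal_up l n) (monom 1 j * zonal l n) + (if m = 0 then 0 else smult (zonal_down l (m - 1)) (monom 1 j * zonal l (m - 1)))"
      unfolding zonal_rec[OF l] by (simp add: Suc distrib_left)
    finally have "umbral (arc_mom (l + 1)) (smult 2 (monom 1 (Suc j) * zonal l m)) = 
       umbral (arc_mom (l + 1)) (smult (zonal_up l n) (monom 1 j * zonal l n) + (if m = 0 then 0 else smult (zonal_down l (m - 1)) (monom 1 j * zonal l (m - 1))))" by simp
    then have r: "zonal_up l n * umbral (arc_mom (l + 1)) (monom 1 j * zonal l n) = 2 * umbral (arc_mom (l + 1)) (monom 1 (Suc j) * zonal l m) - 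
       (if m = 0 then 0 else zonal_down l (m - 1) * umbral (arc_mom (l + 1)) (monom 1 j * zonal l (m - 1)))"
      by (simp add: umbral_add umbral_smult split: if_splits)
    have i1: "umbral (arc_mom (l + 1)) (monom 1 (Suc j) * zonal l m) = (if m \<le> Suc j \<and> even (Suc j + m) then zonal_mom l m ((Suc j - m) div 2) else 0)"
      using less[of m "Suc j"] Suc by simp
    have i2: "m \<noteq> 0 \<Longrightarrow> umbral (arc_mom (l + 1)) (monom 1 j * zonal l (m - 1)) = (if m - 1 \<le> j \<and> even (j + (m - 1)) then zonal_mom l (m - 1) ((j - (m - 1)) div 2) else 0)"
      using less[of "m - 1"] Suc by simp
    have "zonal_up l n * umbral (arc_mom (l + 1)) (monom 1 j * zonal l n) = zonal_up l n * (if n \<le> j \<and> even (j + n) then zonal_mom l n ((j - n) div 2) else 0)"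
    proof -
      \<comment> \<open>Case \<open>b\<close>, the monomial of degree \<open>n - 2\<close>, is the
        only vanishing moment that arises by cancellation; in \<open>c\<close> and \<open>d\<close>
        both terms of the recurrence are already zero, by degree or by parity.\<close>
      consider (a) i where "j = n + 2 * i" | (b) "Suc j = m" | (c) "j < n" "Suc j \<noteq> m" | (d) "j \<ge> n" "odd (j + n)"
      proof (cases "n \<le> j \<and> even (j + n)")
        case True
        then have "even (j - n)" by simp
        then obtain i where "j - n = 2 * i" by (rule evenE)
        then have "j = n + 2 * i" using conjunct1[OF True] by linarith
        then show ?thesis by (rule that(1))
      next
        case False
        then show ?thesis using that(2-4) by (cases "Suc j = m"; cases "j < n") auto
      qed
      then show ?thesis
      proof cases
        case a
        have e: "Suc j - m = 2 * Suc i" "m \<noteq> 0 \<Longrightarrow> j - (m - 1) = 2 * Suc i" using a Suc by auto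
        have A: "umbral (arc_mom (l + 1)) (monom 1 (Suc j) * zonal l m) = zonal_mom l m (Suc i)"
          unfolding i1 e(1) using a Suc by simp
        have B: "umbral (arc_mom (l + 1)) (monom 1 j * zonal l (m - 1)) = zonal_mom l (m - 1) (Suc i)" if "m \<noteq> 0"
          unfolding i2[OF that] e(2)[OF that] using a Suc that by simp
        have "zonal_up l n * umbral (arc_mom (l + 1)) (monom 1 j * zonal l n) = zonal_up l n * zonal_mom l n i"
        proof (cases "m = 0")
          case True
          show ?thesis unfolding r A using zonal_mom_rec[OF l, of m i] unfolding Suc by (simp only: True if_True simp_thms)
        next
          case False
          show ?thesis unfolding r A B[OF False] using zonal_mom_rec[OF l, of m i] unfolding Suc by (simp only: False if_False simp_thms)
        qed
        then show ?thesis using a by simp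
      next
        case b
        have "zonal_up l n * umbral (arc_mom (l + 1)) (monom 1 j * zonal l n) = 2 * zonal_mom l m 0 - zonal_down l (m - 1) * zonal_mom l (m - 1) 0"
          unfolding r i1 using i2 b by auto
        then show ?thesis using b Suc zonal_mom_rec0[OF l, of m] by auto
      next
        case c
        then have "j = m \<or> Suc j < m" using Suc by linarith
        then show ?thesis unfolding r i1 using i2 c Suc by auto
      next
        case d
        then have "odd (Suc j + m)" "m \<noteq> 0 \<Longrightarrow> odd (j + (m - 1))" using Suc by auto
        then show ?thesis unfolding r i1 using i2 d by auto
      qed
    qed
    with ap show ?thesis by simp
  qed
qed

lemma zonal_orth:
  assumes l: "l \<ge> 0" and d: "degree R < n"
  shows "umbral (arc_mom (l + 1)) (R * zonal l n) = 0"
proof -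
  have "umbral (arc_mom (l + 1)) (R * zonal l n) = umbral (\<lambda>j. 0) R"
    unfolding umbral_mult[of _ R] using d by (intro umbral_cong) (auto simp: zonal_moment[OF l])
  then show ?thesis by (simp add: umbral_def)
qed

text \<open>Induction on \<open>j\<close>: multiplication by \<open>2 * x\<close> passes the moment
  at index \<open>n\<close> on to its two neighbours, and after re-indexing each moment carries the
  factor \<open>zonal_up l n + zonal_down l n = 2\<close>. Since the moments vanish beyond index
  \<open>j\<close>, nothing is lost at the upper end.\<close>

lemma zonal_sum_monom:
  assumes l: "l \<ge> 0" 
  shows "j \<le> m \<Longrightarrow> (\<Sum>n\<le>m. umbral (arc_mom (l + 1)) (monom 1 j * zonal l n)) = 1"
proof (induction j arbitrary: m)
  case 0
  have "(\<Sum>n\<le>m. umbral (arc_mom (l + 1)) (monom 1 0 * zonal l n)) = (\<Sum>n\<in>{0}. umbral (arc_mom (l + 1)) (monom 1 0 * zonal l n))"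
  proof (intro sum.mono_neutral_right ballI)
    fix n assume "n \<in> {..m} - {0}"
    then show "umbral (arc_mom (l + 1)) (monom 1 0 * zonal l n) = 0"
      unfolding zonal_moment[OF l] by simp
  qed auto
  also have "\<dots> = 1" unfolding zonal_moment[OF l] by (simp add: zonal_mom_def)
  finally show ?case .
next
  case (Suc j)
  define J where "J n = umbral (arc_mom (l + 1)) (monom 1 j * zonal l n)" for n
  have J0: "J n = 0" if "n > j" for n using that by (simp add: J_def zonal_moment[OF l])
  obtain k where k: "m = Suc k" using Suc.prems by (cases m) auto
  have e: "2 * umbral (arc_mom (l + 1)) (monom 1 (Suc j) * zonal l n) = zonal_up l (Suc n) * J (Suc n) + (if n = 0 then 0 else zonal_down l (n - 1) * J (n - 1))" for n
  proof -
    have "monom 1 (Suc j) * zonal l n = monom 1 j * pCons 0 (zonal l n)" by (simp add: monom_Suc)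
    then have "smult 2 (monom 1 (Suc j) * zonal l n) = monom 1 j * (smult 2 (pCons 0 (zonal l n)))" by simp
    also have "\<dots> = smult (zonal_up l (Suc n)) (monom 1 j * zonal l (Suc n)) + (if n = 0 then 0 else smult (zonal_down l (n - 1)) (monom 1 j * zonal l (n - 1)))"
      unfolding zonal_rec[OF l] by (simp add: distrib_left)
    finally have "umbral (arc_mom (l + 1)) (smult 2 (monom 1 (Suc j) * zonal l n)) = 
       umbral (arc_mom (l + 1)) (smult (zonal_up l (Suc n)) (monom 1 j * zonal l (Suc n)) + (if n = 0 then 0 else smult (zonal_down l (n - 1)) (monom 1 j * zonal l (n - 1))))" by simp
    then show ?thesis by (simp add: umbral_add umbral_smult J_def split: if_splits)
  qed
  have "2 * (\<Sum>n\<le>m. umbral (arc_mom (l + 1)) (monom 1 (Suc j) * zonal l n)) = 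
     (\<Sum>n\<le>m. zonal_up l (Suc n) * J (Suc n)) + (\<Sum>n\<le>m. (if n = 0 then 0 else zonal_down l (n - 1) * J (n - 1)))"
    unfolding sum_distrib_left e by (simp add: sum.distrib)
  also have "(\<Sum>n\<le>m. (if n = 0 then 0 else zonal_down l (n - 1) * J (n - 1))) = (\<Sum>n\<le>k. zonal_down l n * J n)"
    unfolding k by (subst sum.atMost_Suc_shift) simp
  also have "\<dots> = (\<Sum>n\<le>m. zonal_down l n * J n)" using Suc.prems k J0[of m] by simp
  also have "(\<Sum>n\<le>m. zonal_up l (Suc n) * J (Suc n)) = (\<Sum>n\<le>Suc m. zonal_up l n * J n)"
    by (subst sum.atMost_Suc_shift) (simp add: zonal_up_def)
  also have "\<dots> = (\<Sum>n\<le>m. zonal_up l n * J n)" using Suc.prems J0[of "Suc m"] by simp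
  also have "\<dots> + (\<Sum>n\<le>m. zonal_down l n * J n) = (\<Sum>n\<le>m. (zonal_up l n + zonal_down l n) * J n)"
    by (simp add: sum.distrib distrib_right)
  also have "\<dots> = 2 * (\<Sum>n\<le>m. J n)" by (simp add: zonal_up_zonal_down[OF l] sum_distrib_left)
  also have "(\<Sum>n\<le>m. J n) = 1" unfolding J_def using Suc by simp
  finally show ?case by simp
qed

lemma zonal_reproduce:
  assumes l: "l \<ge> 0" and d: "degree R \<le> m"
  shows "(\<Sum>n\<le>m. umbral (arc_mom (l + 1)) (R * zonal l n)) = poly R 1"
proof -
  have "(\<Sum>n\<le>m. umbral (arc_mom (l + 1)) (R * zonal l n)) = (\<Sum>i\<le>degree R. coeff R i * (\<Sum>n\<le>m. umbral (arc_mom (l + 1)) (monom 1 i * zonal l n)))"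
    unfolding umbral_mult[of _ R] umbral_def[of _ R] sum_distrib_left by (rule sum.swap)
  also have "\<dots> = (\<Sum>i\<le>degree R. coeff R i * 1)"
    using d by (intro sum.cong) (auto simp: zonal_sum_monom[OF l])
  finally show ?thesis by (simp add: poly_altdef)
qed

section \<open>Reproducing kernels on the ball\<close>

text \<open>The mean of \<open>(c * z + sqrt (w * (1 - z^2)) * u) ^ m\<close> as a polynomial in
  \<open>z\<close>. In the spherical picture it averages a power of a linear form over the circle of
  latitude at height \<open>z\<close>.\<close>

definition ridge_aux :: "real \<Rightarrow> nat \<Rightarrow> real \<Rightarrow> real \<Rightarrow> real poly" where
  "ridge_aux b m c w = (\<Sum>k\<le>m div 2. smult (real (m choose (2 * k)) * arc_mom b (2 * k)) ([:0, c:] ^ (m - 2 * k) * [:w, 0, - w:] ^ k))"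

lemma poly_ridge_aux: "poly (ridge_aux b m c w) z = zpow b m (c * z) (w * (1 - z\<^sup>2))"
  by (simp add: ridge_aux_def zpow_def poly_sum power2_eq_square algebra_simps)

lemma degree_ridge_aux: "degree (ridge_aux b m c w) \<le> m"
  unfolding ridge_aux_def
proof (rule degree_sum_le)
  fix k assume "k \<in> {..m div 2}"
  then have k: "2 * k \<le> m" by auto
  have "degree ([:0, c:] ^ (m - 2 * k)) \<le> degree [:0, c:] * (m - 2 * k)" by (rule degree_power_le)
  also have "\<dots> \<le> 1 * (m - 2 * k)" by (intro mult_right_mono) auto
  finally have 1: "degree ([:0, c:] ^ (m - 2 * k)) \<le> m - 2 * k" by simp
  have "degree ([:w, 0, - w:] ^ k) \<le> degree [:w, 0, - w:] * k" by (rule degree_power_le)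
  also have "\<dots> \<le> 2 * k" by (intro mult_right_mono) auto
  finally have 2: "degree ([:w, 0, - w:] ^ k) \<le> 2 * k" .
  have "degree ([:0, c:] ^ (m - 2 * k) * [:w, 0, - w:] ^ k) \<le> (m - 2 * k) + 2 * k"
    using degree_mult_le 1 2 add_mono order_trans by metis
  then show "degree (smult (real (m choose (2 * k)) * arc_mom b (2 * k)) ([:0, c:] ^ (m - 2 * k) * [:w, 0, - w:] ^ k)) \<le> m"
    using k order.trans[OF degree_smult_le] by fastforce
qed auto

lemma poly_ridge_aux_1: "poly (ridge_aux b m c w) 1 = c ^ m"
proof -
  have "poly (ridge_aux b m c w) 1 = (\<Sum>k\<le>m div 2. real (m choose (2 * k)) * c ^ (m - 2 * k) * 0 ^ k * arc_mom b (2 * k))"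
    unfolding poly_ridge_aux zpow_def by simp
  also have "\<dots> = (\<Sum>k\<in>{0}. real (m choose (2 * k)) * c ^ (m - 2 * k) * 0 ^ k * arc_mom b (2 * k))"
    by (intro sum.mono_neutral_right) auto
  finally show ?thesis by (simp add: arc_mom_def)
qed

lemma AE_ball_prob_integrable:
  fixes f :: "'a::euclidean_space \<Rightarrow> real"
  assumes "b > 0" "continuous_on UNIV f"
  shows "integrable (ball_prob b) f"
proof -
  interpret finite_measure "ball_prob b :: 'a measure" using assms(1) by (rule finite_measure_ball_prob)
  have "compact (f ` cball 0 1)" by (intro compact_continuous_image continuous_on_subset[OF assms(2)]) auto
  then obtain B where B: "\<And>y. y \<in> cball 0 1 \<Longrightarrow> norm (f y) \<le> B"
    using compact_imp_bounded bounded_iff by (metis imageI)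
  show ?thesis
  proof (rule integrable_const_bound)
    show "AE y in ball_prob b. norm (f y) \<le> B"
      using AE_ball_prob[of b] by eventually_elim (use B in auto)
    show "f \<in> borel_measurable (ball_prob b)"
      by (subst measurable_cong_sets[OF sets_ball_prob refl]) (rule borel_measurable_continuous_onI[OF assms(2)])
  qed
qed

lemma integral_ball_prob_real_poly:
  assumes "b > 0"
  shows "(LINT z|ball_prob b. poly F z) = umbral (arc_mom (b + 1/2)) F"
proof -
  have m: "(LINT z|ball_prob b. z ^ k) = arc_mom (b + 1/2) k" for k
    using ball_prob_moment[OF assms, of "1::real" k 0] by (simp add: arc_mom_def add.commute)
  have "(LINT z|ball_prob b. poly F z) = (LINT z|ball_prob b. (\<Sum>i\<le>degree F. coeff F i * z ^ i))"
    by (simp add: poly_altdef)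
  also have "\<dots> = (\<Sum>i\<le>degree F. coeff F i * (LINT z|ball_prob b. z ^ i))"
    by (subst Bochner_Integration.integral_sum) (auto intro!: AE_ball_prob_integrable assms continuous_intros)
  finally show ?thesis by (simp add: umbral_def m)
qed

text \<open>The mean of \<open>F (x \<bullet> y + sqrt (1 - (norm x)\<^sup>2) * sqrt (1 - (norm y)\<^sup>2) * u)\<close> for \<open>u\<close> with moments \<open>arc_mom b\<close>; for zonal
  \<open>F\<close> this is Xu's formula for the reproducing kernel.\<close>

definition lift :: "real \<Rightarrow> real poly \<Rightarrow> 'a::euclidean_space \<Rightarrow> 'a \<Rightarrow> real" where
  "lift b F x y = umbral (\<lambda>j. zpow b j (x \<bullet> y) ((1 - (norm x)\<^sup>2) * (1 - (norm y)\<^sup>2))) F"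

lemma continuous_zpow [continuous_intros]:
  "continuous_on S f \<Longrightarrow> continuous_on S g \<Longrightarrow> continuous_on S (\<lambda>x. zpow b j (f x) (g x))"
  unfolding zpow_def by (intro continuous_intros)

lemma continuous_lift [continuous_intros]:
  fixes f g :: "'b::topological_space \<Rightarrow> 'a::euclidean_space"
  shows "continuous_on S f \<Longrightarrow> continuous_on S g \<Longrightarrow> continuous_on S (\<lambda>x. lift b F (f x) (g x))"
  unfolding lift_def umbral_def by (intro continuous_intros)

lemma lift_commute: "lift b F x y = lift b F y x"
  by (simp add: lift_def inner_commute mult.commute)

text \<open>A Funk-Hecke formula. Up to the same binomial coefficient, both sides are the
  coefficient of \<open>t ^ m\<close> in an instance of \<open>ball_prob_zpow\<close>: once in the
  given space with \<open>v = x + t *\<^sub>R \<xi>\<close> and \<open>B = 1 - (norm x)^2\<close>,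
  once on the line with \<open>v = 1 + t * u\<close> and \<open>B = t^2 * w\<close>. The parameters
  fit because \<open>c + 1/2 = DIM('a) / 2 + b\<close>.\<close>

lemma ridge_monom:
  fixes x \<xi> :: "'a::euclidean_space"
  assumes b: "b > 0"
  defines "c \<equiv> b + (real DIM('a) - 1) / 2"
  shows "(LINT y|ball_prob b. (\<xi> \<bullet> y) ^ m * zpow b j (x \<bullet> y) ((1 - (norm x)\<^sup>2) * (1 - (norm y)\<^sup>2)))
     = umbral (arc_mom (c + 1/2)) (monom 1 j * ridge_aux c m (x \<bullet> \<xi>) ((norm \<xi>)\<^sup>2 - (x \<bullet> \<xi>)\<^sup>2))"
proof -
  have "real DIM('a) \<ge> 1" using DIM_positive[where 'a = 'a] by linarith
  then have "(real DIM('a) - 1) / 2 \<ge> 0" by (intro divide_nonneg_pos) linarith+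
  then have c: "c > 0" using b unfolding c_def by (rule add_pos_nonneg[rotated])
  have ce: "c + 1/2 = real DIM('a) / 2 + b" by (simp add: c_def field_simps)
  define J where "J = j + m"
  define u where "u = x \<bullet> \<xi>"
  define w where "w = (norm \<xi>)\<^sup>2 - u\<^sup>2"
  define A where "A k = (LINT y|ball_prob b. (\<xi> \<bullet> y) ^ k * zpow b (J - k) (x \<bullet> y) ((1 - (norm x)\<^sup>2) * (1 - (norm y)\<^sup>2)))" for k
  define B where "B k = (LINT z|ball_prob c. z ^ (J - k) * zpow c k (u * z) (w * (1 - z\<^sup>2)))" for k :: nat
  have "(\<Sum>k\<le>J. (real (J choose k) * A k) * t ^ k) = (\<Sum>k\<le>J. (real (J choose k) * B k) * t ^ k)" for t
  proof -
    have "(LINT y|ball_prob b. zpow b J ((x + t *\<^sub>R \<xi>) \<bullet> y) ((1 - (norm x)\<^sup>2) * (1 - (norm y)\<^sup>2)))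
      = (LINT y|ball_prob b. (\<Sum>k\<le>J. (t ^ k * real (J choose k)) * ((\<xi> \<bullet> y) ^ k * zpow b (J - k) (x \<bullet> y) ((1 - (norm x)\<^sup>2) * (1 - (norm y)\<^sup>2)))))"
      by (simp add: inner_add_left zpow_add mult.assoc)
    also have "\<dots> = (\<Sum>k\<le>J. (t ^ k * real (J choose k)) * A k)"
      unfolding A_def
      by (subst Bochner_Integration.integral_sum) (auto intro!: AE_ball_prob_integrable b continuous_intros)
    finally have 1: "(\<Sum>k\<le>J. (real (J choose k) * A k) * t ^ k) = (LINT y|ball_prob b. zpow b J ((x + t *\<^sub>R \<xi>) \<bullet> y) ((1 - (norm x)\<^sup>2) * (1 - (norm y)\<^sup>2)))"
      by (simp add: mult_ac)
    have "(LINT z|ball_prob c. zpow c J ((1 + t * u) \<bullet> z) ((t\<^sup>2 * w) * (1 - (norm z)\<^sup>2)))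
      = (LINT z|ball_prob c. (\<Sum>k\<le>J. (t ^ k * real (J choose k)) * (z ^ (J - k) * zpow c k (u * z) (w * (1 - z\<^sup>2)))))"
      by (simp add: zpow_scale mult.assoc)
    also have "\<dots> = (\<Sum>k\<le>J. (t ^ k * real (J choose k)) * B k)"
      unfolding B_def
      by (subst Bochner_Integration.integral_sum) (auto intro!: AE_ball_prob_integrable c continuous_intros)
    finally have 2: "(\<Sum>k\<le>J. (real (J choose k) * B k) * t ^ k) = (LINT z|ball_prob c. zpow c J ((1 + t * u) \<bullet> z) ((t\<^sup>2 * w) * (1 - (norm z)\<^sup>2)))"
      by (simp add: mult_ac)
    \<comment> \<open>The squared length of one vector in two frames: \<open>x\<close> is completed
      to a unit vector on the left, and that unit vector is the first axis on the right.\<close>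
    have "(norm (x + t *\<^sub>R \<xi>))\<^sup>2 + (1 - (norm x)\<^sup>2) = (norm (1 + t * u))\<^sup>2 + t\<^sup>2 * w"
      unfolding w_def u_def power2_norm_eq_inner
      by (simp add: inner_simps inner_commute power2_eq_square algebra_simps)
    moreover have "real DIM(real) / 2 + c = real DIM('a) / 2 + b" using ce by simp
    ultimately show ?thesis unfolding 1 2 ball_prob_zpow[OF b] ball_prob_zpow[OF c] by (simp only:)
  qed
  then have "\<forall>k\<le>J. real (J choose k) * A k = real (J choose k) * B k"
    by (intro polyfun_eq_coeffs[THEN iffD1] allI)
  then have "real (J choose m) * A m = real (J choose m) * B m"
    by (simp add: J_def)
  then have "A m = B m" by (simp add: J_def)
  also have "B m = (LINT z|ball_prob c. poly (monom 1 j * ridge_aux c m u w) z)"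
    by (simp add: B_def J_def poly_ridge_aux poly_monom)
  also have "\<dots> = umbral (arc_mom (c + 1/2)) (monom 1 j * ridge_aux c m u w)"
    by (rule integral_ball_prob_real_poly[OF c])
  finally show ?thesis by (simp add: A_def J_def u_def w_def)
qed

lemma ridge_lift:
  fixes x \<xi> :: "'a::euclidean_space"
  assumes b: "b > 0"
  defines "c \<equiv> b + (real DIM('a) - 1) / 2"
  shows "(LINT y|ball_prob b. (\<xi> \<bullet> y) ^ m * lift b F x y)
     = umbral (arc_mom (c + 1/2)) (ridge_aux c m (x \<bullet> \<xi>) ((norm \<xi>)\<^sup>2 - (x \<bullet> \<xi>)\<^sup>2) * F)"
proof -
  have "(LINT y|ball_prob b. (\<xi> \<bullet> y) ^ m * lift b F x y) = 
    (LINT y|ball_prob b. (\<Sum>j\<le>degree F. coeff F j * ((\<xi> \<bullet> y) ^ m * zpow b j (x \<bullet> y) ((1 - (norm x)\<^sup>2) * (1 - (norm y)\<^sup>2)))))"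
    by (simp add: lift_def umbral_def sum_distrib_left mult_ac)
  also have "\<dots> = (\<Sum>j\<le>degree F. coeff F j * (LINT y|ball_prob b. (\<xi> \<bullet> y) ^ m * zpow b j (x \<bullet> y) ((1 - (norm x)\<^sup>2) * (1 - (norm y)\<^sup>2))))"
    by (subst Bochner_Integration.integral_sum) (auto intro!: AE_ball_prob_integrable b continuous_intros)
  also have "\<dots> = umbral (arc_mom (c + 1/2)) (F * ridge_aux c m (x \<bullet> \<xi>) ((norm \<xi>)\<^sup>2 - (x \<bullet> \<xi>)\<^sup>2))"
    unfolding umbral_mult[of _ F] umbral_def[of _ F] ridge_monom[OF b] c_def ..
  finally show ?thesis by (simp add: mult.commute)
qed

definition ball_kernel :: "real \<Rightarrow> nat \<Rightarrow> 'a::euclidean_space \<Rightarrow> 'a \<Rightarrow> real" where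
  "ball_kernel b n = lift b (zonal (b + real DIM('a) / 2 - 1) n)"

text \<open>Integration against the kernel turns the ridge power into \<open>ridge_aux\<close>, a
  polynomial of degree at most \<open>m\<close>, so one-dimensional orthogonality suffices.\<close>

lemma ball_kernel_ridge_0:
  fixes x \<xi> :: "'a::euclidean_space"
  assumes b: "b \<ge> 1/2" and "m < n"
  shows "(LINT y|ball_prob b. (\<xi> \<bullet> y) ^ m * ball_kernel b n x y) = 0"
proof -
  have "real DIM('a) \<ge> 1" using DIM_positive[where 'a = 'a] by linarith
  then have l: "b + real DIM('a) / 2 - 1 \<ge> 0" using b by linarith
  have e: "b + (real DIM('a) - 1) / 2 + 1/2 = (b + real DIM('a) / 2 - 1) + 1" by (simp add: field_simps)
  have "b > 0" using b by simp
  then show ?thesis unfolding ball_kernel_def ridge_lift[OF \<open>b > 0\<close>] e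
    using assms(2) degree_ridge_aux le_less_trans by (intro zonal_orth[OF l]) blast
qed

text \<open>The one-dimensional reproduction formula evaluates \<open>ridge_aux\<close> at 1, where
  it equals the ridge power at \<open>x\<close>.\<close>

lemma ball_kernel_ridge_sum:
  fixes x \<xi> :: "'a::euclidean_space"
  assumes b: "b \<ge> 1/2" and "m \<le> n"
  shows "(\<Sum>k\<le>n. LINT y|ball_prob b. (\<xi> \<bullet> y) ^ m * ball_kernel b k x y) = (\<xi> \<bullet> x) ^ m"
proof -
  have "real DIM('a) \<ge> 1" using DIM_positive[where 'a = 'a] by linarith
  then have l: "b + real DIM('a) / 2 - 1 \<ge> 0" using b by linarith
  have e: "b + (real DIM('a) - 1) / 2 + 1/2 = (b + real DIM('a) / 2 - 1) + 1" by (simp add: field_simps)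
  have "b > 0" using b by simp
  have "degree (ridge_aux (b + (real DIM('a) - 1) / 2) m (x \<bullet> \<xi>) ((norm \<xi>)\<^sup>2 - (x \<bullet> \<xi>)\<^sup>2)) \<le> n"
    using assms(2) degree_ridge_aux le_trans by blast
  from zonal_reproduce[OF l this] show ?thesis 
    unfolding ball_kernel_def ridge_lift[OF \<open>b > 0\<close>] e poly_ridge_aux_1 inner_commute[of \<xi> x] .
qed

text \<open>For \<open>b > 1/2\<close> these are the moments of \<open>ball_prob (b - 1/2)\<close>
  on the line; for \<open>b = 1/2\<close> they belong to the two-point measure at 1 and -1. With
  \<open>b = \<mu> + 1/2\<close> this is where \<open>\<mu> \<ge> 0\<close> enters.\<close>

lemma arc_mom_positive:
  assumes b: "b \<ge> 1/2" and G: "\<And>u. \<bar>u\<bar> \<le> 1 \<Longrightarrow> poly G u \<ge> 0"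
  shows "umbral (arc_mom b) G \<ge> 0"
proof (cases "b = 1/2")
  case True
  have m: "arc_mom b i = (1 ^ i + (-1) ^ i) / 2" for i
  proof -
    have "pochhammer (1/2 :: real) (i div 2) \<noteq> 0" using pochhammer_pos[of "1/2 :: real" "i div 2"] by linarith
    then show ?thesis by (simp add: arc_mom_def True)
  qed
  have "umbral (arc_mom b) G = (poly G 1 + poly G (-1)) / 2"
    unfolding umbral_def m poly_altdef by (simp add: sum.distrib[symmetric] sum_divide_distrib distrib_left)
  then show ?thesis using G[of 1] G[of "-1"] by simp
next
  case False
  then have c: "b - 1/2 > 0" using b by simp
  have "umbral (arc_mom b) G = (LINT u|ball_prob (b - 1/2). poly G u)"
    using integral_ball_prob_real_poly[OF c, of G] by simp
  also have "\<dots> \<ge> 0"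
    by (rule integral_nonneg_AE) (use AE_ball_prob[of "b - 1/2", where 'a = real] G in \<open>auto elim!: eventually_mono\<close>)
  finally show ?thesis .
qed

lemma umbral_linear_power:
  "umbral (arc_mom b) ([:t, s:] ^ j) = zpow b j t (s\<^sup>2)"
proof -
  have e: "[:t, s:] = monom s 1 + [:t:]" by (simp add: monom_altdef)
  have p: "[:t, s:] ^ j = (\<Sum>k\<le>j. smult (real (j choose k) * t ^ (j - k)) (monom (s ^ k) k))"
    unfolding e binomial_ring
    by (intro sum.cong refl) (simp add: monom_power poly_const_pow of_nat_poly smult_monom mult_ac)
  have "umbral (arc_mom b) ([:t, s:] ^ j) = (\<Sum>k\<le>j. real (j choose k) * t ^ (j - k) * s ^ k * arc_mom b k)"
    unfolding p by (simp add: umbral_sum umbral_smult mult.assoc)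
  also have "\<dots> = (\<Sum>k\<in>(\<lambda>k. 2 * k) ` {..j div 2}. real (j choose k) * t ^ (j - k) * s ^ k * arc_mom b k)"
    by (intro sum.mono_neutral_right) (auto simp: arc_mom_def elim!: evenE)
  also have "\<dots> = zpow b j t (s\<^sup>2)"
    unfolding zpow_def by (subst sum.reindex) (auto simp: inj_on_def power_mult)
  finally show ?thesis .
qed

text \<open>When the product of the two factors is a square, as it is inside the ball,
  \<open>lift\<close> is a genuine mean of \<open>F\<close> over the points
  \<open>x \<bullet> y + s * u\<close>.\<close>

lemma lift_pcompose:
  assumes w: "(1 - (norm x)\<^sup>2) * (1 - (norm y)\<^sup>2) = s\<^sup>2"
  shows "lift b F x y = umbral (arc_mom b) (pcompose F [:x \<bullet> y, s:])"
proof -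
  have "poly (pcompose F [:x \<bullet> y, s:]) = poly (\<Sum>i\<le>degree F. smult (coeff F i) ([:x \<bullet> y, s:] ^ i))"
    by (rule ext) (simp add: poly_pcompose poly_sum poly_altdef[of F])
  then have "pcompose F [:x \<bullet> y, s:] = (\<Sum>i\<le>degree F. smult (coeff F i) ([:x \<bullet> y, s:] ^ i))"
    by (simp only: poly_eq_poly_eq_iff)
  then show ?thesis
    by (simp add: lift_def umbral_def[of _ F] umbral_sum umbral_smult umbral_linear_power w)
qed

lemma lift_nonneg:
  fixes x y :: "'a::euclidean_space"
  assumes b: "b \<ge> 1/2" and xy: "norm x \<le> 1" "norm y \<le> 1" 
    and F: "\<And>z. \<bar>z\<bar> \<le> 1 \<Longrightarrow> poly F z \<ge> 0"
  shows "lift b F x y \<ge> 0"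
proof -
  define p q where "p = sqrt (1 - (norm x)\<^sup>2)" and "q = sqrt (1 - (norm y)\<^sup>2)"
  have pq: "p \<ge> 0" "q \<ge> 0" "p\<^sup>2 = 1 - (norm x)\<^sup>2" "q\<^sup>2 = 1 - (norm y)\<^sup>2"
    using xy by (auto simp: p_def q_def abs_square_le_1)
  have "\<bar>x \<bullet> y + u * (p * q)\<bar> \<le> 1" if "\<bar>u\<bar> \<le> 1" for u
  proof -
    have "\<bar>x \<bullet> y\<bar> \<le> norm x * norm y" by (rule Cauchy_Schwarz_ineq2)
    also have "2 * (norm x * norm y) \<le> (norm x)\<^sup>2 + (norm y)\<^sup>2" using sum_squares_bound[of "norm x" "norm y"] by simp
    finally have 1: "2 * \<bar>x \<bullet> y\<bar> \<le> (norm x)\<^sup>2 + (norm y)\<^sup>2" by simp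
    have "\<bar>u * (p * q)\<bar> \<le> p * q" using that pq by (simp add: abs_mult mult_left_le_one_le)
    also have "2 * (p * q) \<le> p\<^sup>2 + q\<^sup>2" using sum_squares_bound[of p q] by simp
    finally show ?thesis using 1 pq by simp
  qed
  then have "poly (pcompose F [:x \<bullet> y, p * q:]) u \<ge> 0" if "\<bar>u\<bar> \<le> 1" for u
    using that F by (simp add: poly_pcompose)
  moreover have "(1 - (norm x)\<^sup>2) * (1 - (norm y)\<^sup>2) = (p * q)\<^sup>2" by (simp add: power_mult_distrib pq)
  ultimately show ?thesis by (simp add: lift_pcompose arc_mom_positive[OF b])
qed

lemma lift_add: "lift b (F + G) x y = lift b F x y + lift b G x y"
  and lift_smult: "lift b (smult c F) x y = c * lift b F x y"
  and lift_diff: "lift b (F - G) x y = lift b F x y - lift b G x y"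
  and lift_sum: "lift b (\<Sum>i\<in>A. H i) x y = (\<Sum>i\<in>A. lift b (H i) x y)"
  by (simp_all add: lift_def umbral_add umbral_smult umbral_diff umbral_sum)

lemma lift_const: "lift b [:c:] x y = c"
  by (simp add: lift_def zpow_def arc_mom_def)

section \<open>Polynomial functions of several variables and polarisation\<close>

abbreviation mpow :: "('d::finite \<Rightarrow> nat) \<Rightarrow> real ^ 'd \<Rightarrow> real" where
  "mpow \<alpha> x \<equiv> (\<Prod>i\<in>UNIV. x $ i ^ \<alpha> i)"

lemma poly_spaceI: "q = (\<lambda>x. \<Sum>\<alpha> | (\<Sum>i\<in>UNIV. \<alpha> i) \<le> n. c \<alpha> * mpow \<alpha> x) \<Longrightarrow> q \<in> poly_space n"
  unfolding poly_space_def by blast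

lemma poly_spaceE:
  assumes "q \<in> poly_space n"
  obtains c where "q = (\<lambda>x. \<Sum>\<alpha> | (\<Sum>i\<in>UNIV. \<alpha> i) \<le> n. c \<alpha> * mpow \<alpha> x)"
  using assms unfolding poly_space_def by blast

lemma poly_space_add: "f \<in> poly_space n \<Longrightarrow> g \<in> poly_space n \<Longrightarrow> (\<lambda>x. f x + g x) \<in> poly_space n"
proof (elim poly_spaceE)
  fix c d assume "f = (\<lambda>x. \<Sum>\<alpha> | (\<Sum>i\<in>UNIV. \<alpha> i) \<le> n. c \<alpha> * mpow \<alpha> x)" "g = (\<lambda>x. \<Sum>\<alpha> | (\<Sum>i\<in>UNIV. \<alpha> i) \<le> n. d \<alpha> * mpow \<alpha> x)"
  then show ?thesis
    by (intro poly_spaceI[where c = "\<lambda>\<alpha>. c \<alpha> + d \<alpha>"]) (simp add: sum.distrib distrib_right)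
qed

lemma poly_space_cmult: "f \<in> poly_space n \<Longrightarrow> (\<lambda>x. c * f x) \<in> poly_space n"
proof (elim poly_spaceE)
  fix d assume "f = (\<lambda>x. \<Sum>\<alpha> | (\<Sum>i\<in>UNIV. \<alpha> i) \<le> n. d \<alpha> * mpow \<alpha> x)"
  then show ?thesis
    by (intro poly_spaceI[where c = "\<lambda>\<alpha>. c * d \<alpha>"]) (simp add: sum_distrib_left mult.assoc)
qed

lemma poly_space_mpow: "(\<Sum>i\<in>UNIV. \<alpha> i) \<le> n \<Longrightarrow> mpow \<alpha> \<in> poly_space n"
  by (intro poly_spaceI[where c = "\<lambda>\<beta>. if \<beta> = \<alpha> then 1 else 0"])
     (auto simp: if_distribR if_distrib[of "\<lambda>x. x * _"] sum.delta finite_multi_indices cong: if_cong)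

lemma poly_space_0: "(\<lambda>x. 0) \<in> poly_space n"
  by (intro poly_spaceI[where c = "\<lambda>_. 0"]) simp

lemma poly_space_sum: "(\<And>i. i \<in> A \<Longrightarrow> f i \<in> poly_space n) \<Longrightarrow> (\<lambda>x. \<Sum>i\<in>A. f i x) \<in> poly_space n"
  by (induction A rule: infinite_finite_induct) (auto intro: poly_space_0 poly_space_add)

lemma poly_space_le: "f \<in> poly_space m \<Longrightarrow> m \<le> n \<Longrightarrow> f \<in> poly_space n"
proof (elim poly_spaceE)
  fix c assume f: "f = (\<lambda>x. \<Sum>\<alpha> | (\<Sum>i\<in>UNIV. \<alpha> i) \<le> m. c \<alpha> * mpow \<alpha> x)" and "m \<le> n"
  then show "f \<in> poly_space n"
    unfolding f by (intro poly_space_sum poly_space_cmult poly_space_mpow) auto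
qed

lemma poly_space_const: "(\<lambda>x. c) \<in> poly_space n"
  using poly_space_cmult[OF poly_space_mpow[of "\<lambda>_. 0" n], of c] by simp

lemma poly_space_mult: 
  assumes "f \<in> poly_space m" "g \<in> poly_space n"
  shows "(\<lambda>x. f x * g x) \<in> poly_space (m + n)"
proof -
  from assms obtain c d where f: "f = (\<lambda>x. \<Sum>\<alpha> | (\<Sum>i\<in>UNIV. \<alpha> i) \<le> m. c \<alpha> * mpow \<alpha> x)"
    and g: "g = (\<lambda>x. \<Sum>\<alpha> | (\<Sum>i\<in>UNIV. \<alpha> i) \<le> n. d \<alpha> * mpow \<alpha> x)"
    by (elim poly_spaceE) blast
  have "(\<lambda>x. f x * g x) = (\<lambda>x. \<Sum>\<alpha> | (\<Sum>i\<in>UNIV. \<alpha> i) \<le> m. \<Sum>\<beta> | (\<Sum>i\<in>UNIV. \<beta> i) \<le> n. (c \<alpha> * d \<beta>) * mpow (\<lambda>i. \<alpha> i + \<beta> i) x)"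
    unfolding f g sum_product by (simp add: power_add prod.distrib mult_ac)
  also have "\<dots> \<in> poly_space (m + n)"
    by (intro poly_space_sum poly_space_cmult poly_space_mpow) (auto simp: sum.distrib intro: add_mono)
  finally show ?thesis .
qed

lemma poly_space_power: "f \<in> poly_space m \<Longrightarrow> (\<lambda>x. f x ^ k) \<in> poly_space (m * k)"
proof (induction k)
  case (Suc k)
  then show ?case using poly_space_mult[of f m "\<lambda>x. f x ^ k" "m * k"] by simp
qed (simp add: poly_space_const)

lemma poly_space_coord: "(\<lambda>x. x $ i) \<in> poly_space 1"
proof -
  have "(\<lambda>x. x $ i) = mpow (\<lambda>j. if j = i then 1 else 0)"
    by (auto simp: fun_eq_iff if_distrib cong: if_cong)
  then show ?thesis using poly_space_mpow[of "\<lambda>j. if j = i then 1 else 0" 1] by simp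
qed

lemma poly_space_inner: "(\<lambda>x. \<xi> \<bullet> x) \<in> poly_space 1"
  unfolding inner_vec_def inner_real_def by (intro poly_space_sum poly_space_cmult poly_space_coord)

lemma poly_space_norm2: "(\<lambda>x. c * (1 - (norm x)\<^sup>2)) \<in> poly_space 2"
proof -
  have "(\<lambda>x :: real ^ 'a. c * (1 - (norm x)\<^sup>2)) = (\<lambda>x. c + (\<Sum>i\<in>UNIV. (- c) * (x $ i * x $ i)))"
    unfolding power2_norm_eq_inner inner_vec_def inner_real_def
    by (simp add: fun_eq_iff sum_negf sum_distrib_left algebra_simps)
  also have "\<dots> \<in> poly_space (1 + 1)"
    by (intro poly_space_add poly_space_const poly_space_sum poly_space_cmult poly_space_mult poly_space_coord)
  finally show ?thesis by (simp add: numeral_2_eq_2)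
qed

lemma poly_space_lift: "lift b F x \<in> poly_space (degree F)"
proof -
  have z: "(\<lambda>y. zpow b j (x \<bullet> y) ((1 - (norm x)\<^sup>2) * (1 - (norm y)\<^sup>2))) \<in> poly_space j" for j
  proof -
    have "(\<lambda>y. (real (j choose (2 * k)) * arc_mom b (2 * k)) * ((x \<bullet> y) ^ (j - 2 * k) * ((1 - (norm x)\<^sup>2) * (1 - (norm y)\<^sup>2)) ^ k)) \<in> poly_space j"
      if "k \<in> {..j div 2}" for k
    proof -
      have "(\<lambda>y. (x \<bullet> y) ^ (j - 2 * k) * ((1 - (norm x)\<^sup>2) * (1 - (norm y)\<^sup>2)) ^ k) \<in> poly_space (1 * (j - 2 * k) + 2 * k)"
        by (intro poly_space_mult poly_space_power poly_space_inner poly_space_norm2)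
      moreover have "1 * (j - 2 * k) + 2 * k = j" using that by auto
      ultimately show ?thesis by (intro poly_space_cmult) simp
    qed
    then show ?thesis unfolding zpow_def
      by (intro poly_space_sum) (simp add: mult_ac)
  qed
  show ?thesis
    unfolding lift_def[abs_def] umbral_def
    by (intro poly_space_sum poly_space_cmult poly_space_le[OF z]) auto
qed

lemma continuous_poly_space: "q \<in> poly_space n \<Longrightarrow> continuous_on S q"
  by (elim poly_spaceE) (auto intro!: continuous_intros)

lemma poly_space_line:
  assumes "q \<in> poly_space n"
  obtains e where "\<And>t. q (t *\<^sub>R x) = (\<Sum>k\<le>n. e k * t ^ k)"
proof -
  from assms obtain c where q: "q = (\<lambda>x. \<Sum>\<alpha> | (\<Sum>i\<in>UNIV. \<alpha> i) \<le> n. c \<alpha> * mpow \<alpha> x)"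
    by (rule poly_spaceE)
  have "q (t *\<^sub>R x) = (\<Sum>k\<le>n. (\<Sum>\<alpha> | (\<Sum>i\<in>UNIV. \<alpha> i) \<le> n. if (\<Sum>i\<in>UNIV. \<alpha> i) = k then c \<alpha> * mpow \<alpha> x else 0) * t ^ k)" for t
  proof -
    have "q (t *\<^sub>R x) = (\<Sum>\<alpha> | (\<Sum>i\<in>UNIV. \<alpha> i) \<le> n. c \<alpha> * mpow \<alpha> x * t ^ (\<Sum>i\<in>UNIV. \<alpha> i))"
      by (simp add: q power_mult_distrib prod.distrib power_sum mult_ac)
    also have "\<dots> = (\<Sum>\<alpha> | (\<Sum>i\<in>UNIV. \<alpha> i) \<le> n. \<Sum>k\<le>n. if (\<Sum>i\<in>UNIV. \<alpha> i) = k then c \<alpha> * mpow \<alpha> x * t ^ k else 0)"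
      by (intro sum.cong refl) (simp add: sum.delta)
    also have "\<dots> = (\<Sum>k\<le>n. \<Sum>\<alpha> | (\<Sum>i\<in>UNIV. \<alpha> i) \<le> n. if (\<Sum>i\<in>UNIV. \<alpha> i) = k then c \<alpha> * mpow \<alpha> x * t ^ k else 0)"
      by (rule sum.swap)
    finally show ?thesis by (simp add: sum_distrib_right if_distribR if_distrib[of "\<lambda>x. x * _"] cong: if_cong)
  qed
  then show ?thesis by (rule that)
qed

text \<open>On the line through 0 and \<open>x\<close> the function is a univariate polynomial with
  infinitely many zeros near 0.\<close>

lemma poly_space_zero:
  assumes "q \<in> poly_space n" "\<And>x. norm x < 1 \<Longrightarrow> q x = 0"
  shows "q x = 0"
proof -
  obtain e where e: "\<And>t. q (t *\<^sub>R x) = (\<Sum>k\<le>n. e k * t ^ k)"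
    using poly_space_line[OF assms(1)] by blast
  have z: "(\<Sum>k\<le>n. e k * t ^ k) = 0" if "t \<in> {0<..<1 / (1 + norm x)}" for t
  proof -
    have "1 + norm x > 0" by (simp add: add_pos_nonneg)
    then have "t * (1 + norm x) < 1" using that by (simp add: field_simps)
    moreover have "t * norm x \<le> t * (1 + norm x)" using that by (simp add: algebra_simps)
    ultimately have "t * norm x < 1" by linarith
    then have "norm (t *\<^sub>R x) < 1" using that by simp
    then have "q (t *\<^sub>R x) = 0" using assms(2) by blast
    then show ?thesis unfolding e .
  qed
  have "infinite {0<..<1 / (1 + norm x)}"
    by (intro infinite_Ioo) (simp add: add_pos_nonneg)
  then have "infinite {t. (\<Sum>k\<le>n. e k * t ^ k) = 0}"
    by (rule infinite_super[rotated]) (use z in auto)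
  then have "\<forall>k\<le>n. e k = 0"
    using polyfun_finite_roots[of e n] by blast
  then have "q (1 *\<^sub>R x) = 0" unfolding e by simp
  then show ?thesis by simp
qed

definition all_polys :: "(real ^ 'd::finite \<Rightarrow> real) set" where
  "all_polys = (\<Union>n. poly_space n)"

lemma all_polysI: "q \<in> poly_space n \<Longrightarrow> q \<in> all_polys"
  by (auto simp: all_polys_def)

lemma all_polys_add: "f \<in> all_polys \<Longrightarrow> g \<in> all_polys \<Longrightarrow> (\<lambda>x. f x + g x) \<in> all_polys"
proof -
  assume "f \<in> all_polys" "g \<in> all_polys"
  then obtain m n where "f \<in> poly_space m" "g \<in> poly_space n" by (auto simp: all_polys_def)
  then have "f \<in> poly_space (max m n)" "g \<in> poly_space (max m n)" by (auto intro: poly_space_le)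
  then show ?thesis by (intro all_polysI poly_space_add)
qed

lemma all_polys_mult: "f \<in> all_polys \<Longrightarrow> g \<in> all_polys \<Longrightarrow> (\<lambda>x. f x * g x) \<in> all_polys"
  unfolding all_polys_def using poly_space_mult by blast

lemma all_polys_const: "(\<lambda>x. c) \<in> all_polys"
  using poly_space_const all_polysI by blast

lemma all_polys_inner: "(\<lambda>x. \<xi> \<bullet> x) \<in> all_polys"
  using poly_space_inner all_polysI by blast

lemma all_polys_power: "f \<in> all_polys \<Longrightarrow> (\<lambda>x. f x ^ k) \<in> all_polys"
  unfolding all_polys_def using poly_space_power by blast

lemma all_polys_sum: "(\<And>i. i \<in> A \<Longrightarrow> f i \<in> all_polys) \<Longrightarrow> (\<lambda>x. \<Sum>i\<in>A. f i x) \<in> all_polys"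
  by (induction A rule: infinite_finite_induct) (auto intro: all_polys_const all_polys_add)

lemma all_polys_prod_list: "(\<lambda>x. \<Prod>\<eta>\<leftarrow>\<eta>s. \<eta> \<bullet> x) \<in> all_polys"
  by (induction \<eta>s) (auto intro: all_polys_const all_polys_mult all_polys_inner)

lemma mpow_as_product:
  fixes \<alpha> :: "'d::finite \<Rightarrow> nat"
  obtains \<eta>s :: "(real ^ 'd) list" where "length \<eta>s = (\<Sum>i\<in>UNIV. \<alpha> i)" "\<And>x. mpow \<alpha> x = (\<Prod>\<eta>\<leftarrow>\<eta>s. \<eta> \<bullet> x)"
proof -
  obtain ds :: "'d list" where ds: "set ds = UNIV" "distinct ds" using finite_distinct_list[of "UNIV :: 'd set"] by auto
  define \<eta>s where "\<eta>s = concat (map (\<lambda>i. replicate (\<alpha> i) (axis i 1 :: real ^ 'd)) ds)"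
  have "length \<eta>s = (\<Sum>i\<leftarrow>ds. \<alpha> i)" unfolding \<eta>s_def by (induction ds) auto
  also have "\<dots> = (\<Sum>i\<in>UNIV. \<alpha> i)" using ds by (metis sum.distinct_set_conv_list)
  finally have 1: "length \<eta>s = (\<Sum>i\<in>UNIV. \<alpha> i)" .
  have "(\<Prod>\<eta>\<leftarrow>\<eta>s. \<eta> \<bullet> x) = (\<Prod>i\<leftarrow>ds. x $ i ^ \<alpha> i)" for x
    unfolding \<eta>s_def by (induction ds) (auto simp: prod_list_replicate inner_commute[of "axis _ _"] inner_axis)
  also have "\<dots> x = mpow \<alpha> x" for x using ds prod.distinct_set_conv_list[of ds "\<lambda>i. x $ i ^ \<alpha> i"] by simp
  finally show ?thesis using that[of \<eta>s] 1 by simp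
qed

text \<open>Polarisation: products of linear forms lie in the span of powers of linear forms. It
  reduces every statement about integrals of polynomials against a kernel to ridge powers, for which
  the Funk-Hecke formula is available. Linearity is asked only on \<open>all_polys\<close> because
  \<open>D\<close> will be built from integrals.\<close>

lemma poly_space_ridge_induct:
  fixes D :: "(real ^ 'd::finite \<Rightarrow> real) \<Rightarrow> real"
  assumes add: "\<And>f g. f \<in> all_polys \<Longrightarrow> g \<in> all_polys \<Longrightarrow> D (\<lambda>x. f x + g x) = D f + D g"
    and cmult: "\<And>c f. f \<in> all_polys \<Longrightarrow> D (\<lambda>x. c * f x) = c * D f"
    and ridge: "\<And>\<xi> m. m \<le> M \<Longrightarrow> D (\<lambda>x. (\<xi> \<bullet> x) ^ m) = 0"
    and q: "q \<in> poly_space M"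
  shows "D q = 0"
proof -
  have sm: "D (\<lambda>x. \<Sum>i\<in>A. c i * f i x) = (\<Sum>i\<in>A. c i * D (f i))" 
    if "finite A" "\<And>i. i \<in> A \<Longrightarrow> f i \<in> all_polys" for A :: "'i set" and c f
    using that
  proof (induction A rule: finite_induct)
    case empty
    show ?case using cmult[OF all_polys_const, of 0 0] by simp
  next
    case (insert a A)
    have "D (\<lambda>x. \<Sum>i\<in>insert a A. c i * f i x) = D (\<lambda>x. c a * f a x + (\<Sum>i\<in>A. c i * f i x))"
      using insert by simp
    also have "\<dots> = c a * D (f a) + (\<Sum>i\<in>A. c i * D (f i))"
      using insert by (subst add) (auto intro!: all_polys_mult all_polys_const all_polys_sum simp: cmult)
    finally show ?case using insert by simp
  qed
  have sm1: "D (\<lambda>x. \<Sum>i\<le>k. c i * f i x) = (\<Sum>i\<le>k. c i * D (f i))" 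
    if "\<And>i. f i \<in> all_polys" for k :: nat and c f
  proof (induction k)
    case 0
    show ?case using cmult that by simp
  next
    case (Suc k)
    have "D (\<lambda>x. \<Sum>i\<le>Suc k. c i * f i x) = D (\<lambda>x. (\<Sum>i\<le>k. c i * f i x) + c (Suc k) * f (Suc k) x)"
      by simp
    also have "\<dots> = (\<Sum>i\<le>k. c i * D (f i)) + c (Suc k) * D (f (Suc k))"
      using that Suc by (subst add) (auto intro!: all_polys_mult all_polys_const all_polys_sum simp: cmult)
    finally show ?case by simp
  qed
  have P: "D (\<lambda>x. (\<xi> \<bullet> x) ^ m * (\<Prod>\<eta>\<leftarrow>\<eta>s. \<eta> \<bullet> x)) = 0" if "m + length \<eta>s \<le> M" for \<xi> m \<eta>s
    using that
  proof (induction \<eta>s arbitrary: \<xi> m)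
    case Nil
    then show ?case using ridge by simp
  next
    case (Cons \<eta> \<eta>s)
    define f where "f i = (\<lambda>x. (\<eta> \<bullet> x) ^ i * (\<xi> \<bullet> x) ^ (Suc m - i) * (\<Prod>\<eta>\<leftarrow>\<eta>s. \<eta> \<bullet> x))" for i
    have fp: "f i \<in> all_polys" for i
      unfolding f_def by (intro all_polys_mult all_polys_power all_polys_inner all_polys_prod_list)
    \<comment> \<open>Replacing \<open>\<xi>\<close> by \<open>\<xi> + t *\<^sub>R \<eta>\<close> in
      the induction hypothesis gives a polynomial identity in \<open>t\<close>; its linear
      coefficient splits off the factor \<open>\<eta> \<bullet> x\<close>.\<close>
    have "(\<Sum>i\<le>Suc m. (real (Suc m choose i) * D (f i)) * t ^ i) = (\<Sum>i\<le>Suc m. 0 * t ^ i)" for t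
    proof -
      have "0 = D (\<lambda>x. ((\<xi> + t *\<^sub>R \<eta>) \<bullet> x) ^ Suc m * (\<Prod>\<eta>\<leftarrow>\<eta>s. \<eta> \<bullet> x))"
        using Cons.IH[of "Suc m" "\<xi> + t *\<^sub>R \<eta>"] Cons.prems by (simp del: power_Suc)
      also have "(\<lambda>x. ((\<xi> + t *\<^sub>R \<eta>) \<bullet> x) ^ Suc m * (\<Prod>\<eta>\<leftarrow>\<eta>s. \<eta> \<bullet> x)) = 
         (\<lambda>x. \<Sum>i\<le>Suc m. (real (Suc m choose i) * t ^ i) * f i x)"
      proof
        fix x
        have "((\<xi> + t *\<^sub>R \<eta>) \<bullet> x) ^ Suc m = (t * (\<eta> \<bullet> x) + \<xi> \<bullet> x) ^ Suc m" by (simp add: inner_add_left add.commute)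
        also have "\<dots> = (\<Sum>i\<le>Suc m. real (Suc m choose i) * (t * (\<eta> \<bullet> x)) ^ i * (\<xi> \<bullet> x) ^ (Suc m - i))"
          by (rule binomial_ring)
        finally have eq: "((\<xi> + t *\<^sub>R \<eta>) \<bullet> x) ^ Suc m = (\<Sum>i\<le>Suc m. real (Suc m choose i) * (t * (\<eta> \<bullet> x)) ^ i * (\<xi> \<bullet> x) ^ (Suc m - i))" .
        show "((\<xi> + t *\<^sub>R \<eta>) \<bullet> x) ^ Suc m * (\<Prod>\<eta>\<leftarrow>\<eta>s. \<eta> \<bullet> x) = 
          (\<Sum>i\<le>Suc m. (real (Suc m choose i) * t ^ i) * f i x)"
          unfolding eq f_def sum_distrib_right power_mult_distrib by (simp only: mult_ac)
      qed
      finally show ?thesis unfolding sm1[OF fp] by (simp add: mult_ac)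
    qed
    then have "\<forall>i\<le>Suc m. real (Suc m choose i) * D (f i) = 0"
      by (intro polyfun_eq_coeffs[THEN iffD1] allI)
    from spec[OF this, of 1] have "D (f 1) = 0" by simp
    then show ?case by (simp add: f_def mult_ac)
  qed
  have "D (mpow \<alpha>) = 0" if le: "(\<Sum>i\<in>UNIV. \<alpha> i) \<le> M" for \<alpha>
  proof -
    obtain \<eta>s where 1: "length \<eta>s = (\<Sum>i\<in>UNIV. \<alpha> i)" and 2: "\<And>x. mpow \<alpha> x = (\<Prod>\<eta>\<leftarrow>\<eta>s. \<eta> \<bullet> x)"
      by (rule mpow_as_product[of \<alpha>]) blast
    have "D (\<lambda>x. (0 \<bullet> x) ^ 0 * (\<Prod>\<eta>\<leftarrow>\<eta>s. \<eta> \<bullet> x)) = 0"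
      by (rule P) (simp add: 1 le)
    then show ?thesis by (simp add: 2)
  qed
  moreover from q obtain c where "q = (\<lambda>x. \<Sum>\<alpha> | (\<Sum>i\<in>UNIV. \<alpha> i) \<le> M. c \<alpha> * mpow \<alpha> x)"
    by (rule poly_spaceE)
  ultimately show ?thesis
    by (simp add: sm finite_multi_indices all_polysI[OF poly_space_mpow[OF order_refl]])
qed

section \<open>The weighted measure on the ball and the identification of its reproducing
  kernels\<close>

lemma space_ball_measure [simp]: "space (ball_measure \<mu>) = cball 0 1"
  by (simp add: ball_measure_def)

lemma sets_ball_measure: "sets (ball_measure \<mu>) = sets (lebesgue_on (cball 0 1))"
  by (simp add: ball_measure_def)

text \<open>On the sphere both sides are 0, the left one by the convention
  \<open>0 powr a = 0\<close>, so the identity holds everywhere and not only almost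
  everywhere.\<close>

lemma ball_wt_cball:
  "indicator (cball 0 1) x * (1 - (norm x)\<^sup>2) powr (\<mu> - 1/2) = ball_wt (\<mu> + 1/2) 1 x"
proof (cases "norm x < 1")
  case True
  then have "(norm x)\<^sup>2 < 1" by (simp add: abs_square_less_1)
  then show ?thesis using True by (simp add: ball_wt_def)
next
  case False
  then have "\<not> (norm x)\<^sup>2 < 1" by (simp add: abs_square_less_1)
  then show ?thesis using False by (cases "norm x = 1") (auto simp: ball_wt_def)
qed

lemma LINT_lebesgue_on_cball:
  fixes h :: "real ^ 'd::finite \<Rightarrow> real"
  assumes "(\<lambda>x. indicator (cball 0 1) x * h x) \<in> borel_measurable borel"
  shows "(LINT x|lebesgue_on (cball 0 1). h x) = (LINT x|lborel. indicator (cball 0 1) x * h x)"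
proof -
  have "(LINT x|lebesgue_on (cball 0 1). h x) = (LINT x|lebesgue. indicator (cball 0 1) x * h x)"
    by (subst integral_restrict_space) (auto simp: real_scaleR_def)
  also have "\<dots> = (LINT x|lborel. indicator (cball 0 1) x * h x)"
    using assms by (subst integral_completion) auto
  finally show ?thesis .
qed

lemma LINT_ball_wt:
  assumes b: "b > 0"
  shows "(LINT x|lborel. ball_wt b 1 (x::'a::euclidean_space)) = ball_mass TYPE('a) b"
proof -
  have "(LINT x|lborel. ball_wt b 1 (x::'a)) = enn2real (\<integral>\<^sup>+x. ennreal (ball_wt b 1 (x::'a)) \<partial>lborel)"
    by (subst integral_eq_nn_integral) auto
  also have "(\<integral>\<^sup>+x. ennreal (ball_wt b 1 (x::'a)) \<partial>lborel) = ennreal (ball_mass TYPE('a) b)"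
    using nn_integral_ball_wt_even[OF b, where c = "0::'a" and i = 0] by simp
  finally show ?thesis using ball_mass_pos[OF b, where 'a = 'a] by simp
qed

context
  fixes \<mu> :: real
  assumes mu: "\<mu> \<ge> 0"
begin

lemma ball_const_eq: "ball_const TYPE('d::finite) \<mu> = 1 / ball_mass TYPE(real ^ 'd) (\<mu> + 1/2)"
proof -
  have b: "\<mu> + 1/2 > 0" using mu by simp
  have "(LINT x|lebesgue_on (cball (0 :: real ^ 'd) 1). (1 - (norm x)\<^sup>2) powr (\<mu> - 1/2)) = (LINT x|lborel. ball_wt (\<mu> + 1/2) 1 (x :: real ^ 'd))"
    by (subst LINT_lebesgue_on_cball) (simp_all only: ball_wt_cball ball_wt_measurable)
  then show ?thesis unfolding ball_const_def LINT_ball_wt[OF b] by simp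
qed

lemma ball_weight_cball: 
  fixes x :: "real ^ 'd::finite"
  shows "indicator (cball 0 1) x * ball_weight \<mu> x = ball_wt (\<mu> + 1/2) 1 x / ball_mass TYPE(real ^ 'd) (\<mu> + 1/2)"
  unfolding ball_weight_def ball_const_eq ball_wt_cball[symmetric] by simp

lemma ball_weight_nonneg: 
  fixes x :: "real ^ 'd::finite"
  shows "0 \<le> ball_weight \<mu> x"
  using ball_mass_pos[of "\<mu> + 1/2", where 'a = "real ^ 'd"] mu unfolding ball_weight_def ball_const_eq by simp

lemma measurable_ball_weight: "ball_weight \<mu> \<in> borel_measurable (lebesgue_on (cball (0 :: real ^ 'd::finite) 1))"
proof -
  have "ball_weight \<mu> \<in> borel_measurable (lborel :: (real ^ 'd) measure)"
    unfolding ball_weight_def[abs_def] by measurable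
  then have "ball_weight \<mu> \<in> borel_measurable (lebesgue :: (real ^ 'd) measure)"
    by (rule measurable_completion)
  then show ?thesis by (rule measurable_restrict_space1)
qed

lemma emeasure_ball_measure: "emeasure (ball_measure \<mu> :: (real ^ 'd::finite) measure) (cball 0 1) = 1"
proof -
  have b: "\<mu> + 1/2 > 0" using mu by simp
  have "emeasure (ball_measure \<mu> :: (real ^ 'd) measure) (cball 0 1) = (\<integral>\<^sup>+x. ennreal (ball_weight \<mu> x) * indicator (cball 0 1) x \<partial>lebesgue_on (cball (0 :: real ^ 'd) 1))"
    unfolding ball_measure_def
    by (subst emeasure_density) (auto simp: sets_restrict_space intro: measurable_compose[OF measurable_ball_weight measurable_ennreal])
  also have "\<dots> = (\<integral>\<^sup>+x. (ennreal (ball_weight \<mu> x) * indicator (cball 0 1) x) * indicator (cball 0 1) (x :: real ^ 'd) \<partial>lebesgue)"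
    by (subst nn_integral_restrict_space) auto
  also have "\<dots> = (\<integral>\<^sup>+x. ennreal (ball_wt (\<mu> + 1/2) 1 (x :: real ^ 'd) / ball_mass TYPE(real ^ 'd) (\<mu> + 1/2)) \<partial>lebesgue)"
    unfolding ball_weight_cball[symmetric] by (intro nn_integral_cong) (auto simp: indicator_def)
  also have "\<dots> = (\<integral>\<^sup>+x. ennreal (ball_wt (\<mu> + 1/2) 1 (x :: real ^ 'd) / ball_mass TYPE(real ^ 'd) (\<mu> + 1/2)) \<partial>lborel)"
    by (rule nn_integral_completion)
  also have "\<dots> = emeasure (ball_prob (\<mu> + 1/2) :: (real ^ 'd) measure) UNIV"
    unfolding ball_prob_def by (subst emeasure_density) auto
  finally show ?thesis using ball_prob_finite[OF b] by simp
qed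

lemma finite_measure_ball: "finite_measure (ball_measure \<mu>)"
  by (rule finite_measureI) (simp add: emeasure_ball_measure)

lemma measure_ball_measure [simp]: "measure (ball_measure \<mu>) (cball 0 1) = 1"
  by (simp add: measure_def emeasure_ball_measure)

lemma measurable_ball_continuous:
  fixes f :: "real ^ 'd::finite \<Rightarrow> real"
  assumes "continuous_on (cball 0 1) f"
  shows "f \<in> borel_measurable (ball_measure \<mu>)"
  unfolding measurable_cong_sets[OF sets_ball_measure refl]
  by (intro continuous_imp_measurable_on_sets_lebesgue assms) simp

lemma integrable_ball_bounded:
  fixes f :: "real ^ 'd::finite \<Rightarrow> real"
  assumes "f \<in> borel_measurable (ball_measure \<mu>)" "\<And>x. norm x \<le> 1 \<Longrightarrow> \<bar>f x\<bar> \<le> B"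
  shows "integrable (ball_measure \<mu>) f"
proof -
  interpret finite_measure "ball_measure \<mu> :: (real ^ 'd) measure" by (rule finite_measure_ball)
  show ?thesis by (rule integrable_const_bound[of _ B]) (use assms in auto)
qed

lemma integrable_ball_continuous:
  fixes f :: "real ^ 'd::finite \<Rightarrow> real"
  assumes "continuous_on (cball 0 1) f"
  shows "integrable (ball_measure \<mu>) f"
proof -
  have "compact (f ` cball 0 1)" by (intro compact_continuous_image assms) auto
  then obtain B where B: "\<And>y. y \<in> cball 0 1 \<Longrightarrow> norm (f y) \<le> B"
    using compact_imp_bounded bounded_iff by (metis imageI)
  show ?thesis by (rule integrable_ball_bounded[OF measurable_ball_continuous[OF assms]]) (use B in auto)
qed

text \<open>Carries integrals of Borel functions from the restricted and completed measure of the
  statement to \<open>ball_prob\<close>, for which the moments are known.\<close>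

lemma LINT_ball_ball_prob:
  fixes h :: "real ^ 'd::finite \<Rightarrow> real"
  assumes [measurable]: "h \<in> borel_measurable borel"
  shows "(LINT x|ball_measure \<mu>. h x) = (LINT x|ball_prob (\<mu> + 1/2). h x)"
proof -
  have b: "\<mu> + 1/2 > 0" using mu by simp
  have hm: "h \<in> borel_measurable (lebesgue_on (cball 0 1))"
    by (intro measurable_restrict_space1 measurable_completion) simp
  have "(LINT x|ball_measure \<mu>. h x) = (LINT x|lebesgue_on (cball 0 1). ball_weight \<mu> x * h x)"
    unfolding ball_measure_def using measurable_ball_weight hm ball_weight_nonneg
    by (subst integral_density) auto
  also have "\<dots> = (LINT x|lborel. (indicator (cball 0 1) x * ball_weight \<mu> x) * h x)"
  proof -
    have [measurable]: "(cball 0 1 :: (real ^ 'd) set) \<in> sets borel" by (simp add: borel_closed)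
    have "(\<lambda>x. indicator (cball 0 1) x * (ball_weight \<mu> x * h x)) \<in> borel_measurable borel"
      unfolding ball_weight_def by measurable
    from LINT_lebesgue_on_cball[OF this] show ?thesis by (simp only: mult.assoc)
  qed
  also have "\<dots> = (LINT x|ball_prob (\<mu> + 1/2). h x)"
    unfolding ball_weight_cball by (simp add: ball_prob_integral[OF b])
  finally show ?thesis .
qed

definition proj_kernel :: "nat \<Rightarrow> real ^ 'd::finite \<Rightarrow> real ^ 'd \<Rightarrow> real" where
  "proj_kernel = ball_kernel (\<mu> + 1/2)"

lemma all_polys_continuous: "f \<in> all_polys \<Longrightarrow> continuous_on S f"
  unfolding all_polys_def by (auto intro: continuous_poly_space)

lemma all_polys_integrable: "f \<in> all_polys \<Longrightarrow> integrable (ball_measure \<mu>) f"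
  by (rule integrable_ball_continuous[OF all_polys_continuous])

lemma proj_kernel_commute: "proj_kernel n x y = proj_kernel n y x"
  by (simp add: proj_kernel_def ball_kernel_def lift_commute)

lemma proj_kernel_poly_space: "proj_kernel n x \<in> poly_space n"
  unfolding proj_kernel_def ball_kernel_def using poly_space_lift degree_zonal by (blast intro: poly_space_le)

lemma proj_kernel_all_polys: "proj_kernel n x \<in> all_polys"
  using proj_kernel_poly_space all_polysI by blast

lemma all_polys_borel: "f \<in> all_polys \<Longrightarrow> f \<in> borel_measurable borel"
  by (rule borel_measurable_continuous_onI[OF all_polys_continuous])

lemma proj_kernel_0: "proj_kernel 0 x y = 1"
proof -
  have "zonal l 0 = [:1:]" for l by (simp add: zonal_def one_pCons)
  then show ?thesis by (simp add: proj_kernel_def ball_kernel_def lift_const)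
qed

lemma proj_kernel_ridge:
  fixes x :: "real ^ 'd::finite"
  shows "(LINT y|ball_measure \<mu>. (\<xi> \<bullet> y) ^ m * proj_kernel n x y) = (LINT y|ball_prob (\<mu> + 1/2). (\<xi> \<bullet> y) ^ m * ball_kernel (\<mu> + 1/2) n x y)"
  unfolding proj_kernel_def[symmetric]
  by (intro LINT_ball_ball_prob all_polys_borel all_polys_mult all_polys_power all_polys_inner proj_kernel_all_polys)

text \<open>By polarisation this, like \<open>proj_kernel_sum\<close>, has to be checked on ridge
  powers only.\<close>

lemma proj_kernel_orth:
  fixes x :: "real ^ 'd::finite"
  assumes "q \<in> poly_space m" "m < n"
  shows "(LINT y|ball_measure \<mu>. q y * proj_kernel n x y) = 0"
proof (rule poly_space_ridge_induct[where q = q and M = m])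
  fix f g :: "real ^ 'd \<Rightarrow> real" assume "f \<in> all_polys" "g \<in> all_polys"
  then show "(LINT y|ball_measure \<mu>. (f y + g y) * proj_kernel n x y) = (LINT y|ball_measure \<mu>. f y * proj_kernel n x y) + (LINT y|ball_measure \<mu>. g y * proj_kernel n x y)"
    by (simp add: distrib_right all_polys_integrable all_polys_mult proj_kernel_all_polys)
next
  fix \<xi> :: "real ^ 'd" and k assume "k \<le> m"
  then show "(LINT y|ball_measure \<mu>. (\<xi> \<bullet> y) ^ k * proj_kernel n x y) = 0"
    unfolding proj_kernel_ridge using assms mu by (intro ball_kernel_ridge_0) auto
qed (use assms in \<open>auto simp: mult.assoc\<close>)

lemma proj_kernel_sum:
  fixes x :: "real ^ 'd::finite"
  assumes "q \<in> poly_space n"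
  shows "(\<Sum>k\<le>n. LINT y|ball_measure \<mu>. q y * proj_kernel k x y) = q x"
proof -
  have "(\<Sum>k\<le>n. LINT y|ball_measure \<mu>. q y * proj_kernel k x y) - q x = 0"
  proof (rule poly_space_ridge_induct[where q = q and M = n])
    fix f g :: "real ^ 'd \<Rightarrow> real" assume "f \<in> all_polys" "g \<in> all_polys"
    then show "(\<Sum>k\<le>n. LINT y|ball_measure \<mu>. (f y + g y) * proj_kernel k x y) - (f x + g x) = 
      (\<Sum>k\<le>n. LINT y|ball_measure \<mu>. f y * proj_kernel k x y) - f x + ((\<Sum>k\<le>n. LINT y|ball_measure \<mu>. g y * proj_kernel k x y) - g x)"
      by (simp add: distrib_right all_polys_integrable all_polys_mult proj_kernel_all_polys sum.distrib)
  next
    fix \<xi> :: "real ^ 'd" and k assume "k \<le> n"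
    then show "(\<Sum>j\<le>n. LINT y|ball_measure \<mu>. (\<xi> \<bullet> y) ^ k * proj_kernel j x y) - (\<xi> \<bullet> x) ^ k = 0"
      unfolding proj_kernel_ridge using mu by (subst ball_kernel_ridge_sum) auto
  qed (use assms in \<open>auto simp: mult.assoc sum_distrib_left right_diff_distrib\<close>)
  then show ?thesis by simp
qed

lemma proj_kernel_orth_poly_space: "proj_kernel n x \<in> orth_poly_space \<mu> n"
  unfolding orth_poly_space_def using proj_kernel_poly_space proj_kernel_orth[of _ _ n x] by (auto simp: mult.commute)

lemma proj_kernel_reproduce:
  assumes q: "q \<in> orth_poly_space \<mu> n"
  shows "(LINT y|ball_measure \<mu>. q y * proj_kernel n x y) = q x"
proof -
  have "(LINT y|ball_measure \<mu>. q y * proj_kernel k x y) = 0" if "k < n" for k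
    using q that proj_kernel_poly_space[of k x] by (auto simp: orth_poly_space_def)
  then have "(\<Sum>k\<le>n. LINT y|ball_measure \<mu>. q y * proj_kernel k x y) = (LINT y|ball_measure \<mu>. q y * proj_kernel n x y)"
    by (simp add: lessThan_Suc_atMost[symmetric])
  then show ?thesis using proj_kernel_sum[of q n x] q by (simp add: orth_poly_space_def)
qed

lemma orth_poly_space_diff:
  assumes "f \<in> orth_poly_space \<mu> n" "g \<in> orth_poly_space \<mu> n"
  shows "(\<lambda>x. f x - g x) \<in> orth_poly_space \<mu> n"
proof -
  have "(\<lambda>x. f x + (-1) * g x) \<in> poly_space n"
    using assms by (intro poly_space_add poly_space_cmult) (auto simp: orth_poly_space_def)
  moreover have "(LINT x|ball_measure \<mu>. (f x - g x) * h x) = 0" if "m < n" "h \<in> poly_space m" for m h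
  proof -
    have "f \<in> all_polys" "g \<in> all_polys" "h \<in> all_polys" using assms that by (auto simp: orth_poly_space_def all_polysI)
    then show ?thesis using assms that
      by (simp add: left_diff_distrib all_polys_integrable all_polys_mult orth_poly_space_def)
  qed
  ultimately show ?thesis by (simp add: orth_poly_space_def)
qed

text \<open>The weight is positive inside the ball, so \<open>d\<close> vanishes almost everywhere
  there; the set where it does not vanish is open and null, hence empty.\<close>

lemma poly_null:
  fixes d :: "real ^ 'd::finite \<Rightarrow> real"
  assumes d: "d \<in> poly_space n" and z: "(LINT y|ball_measure \<mu>. d y * d y) = 0"
  shows "d x = 0"
proof (rule poly_space_zero[OF d])
  fix x :: "real ^ 'd" assume x: "norm x < 1"
  have b: "\<mu> + 1/2 > 0" using mu by simp
  have dm [measurable]: "d \<in> borel_measurable borel"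
    by (rule all_polys_borel[OF all_polysI[OF d]])
  have "(LINT y|ball_prob (\<mu> + 1/2). d y * d y) = 0"
    using z by (subst LINT_ball_ball_prob[symmetric]) auto
  moreover have "integrable (ball_prob (\<mu> + 1/2)) (\<lambda>y. d y * d y)"
    by (intro AE_ball_prob_integrable b continuous_intros continuous_poly_space[OF d])
  ultimately have "AE y in ball_prob (\<mu> + 1/2). d y * d y = 0"
    by (subst (asm) integral_nonneg_eq_0_iff_AE) auto
  then have "AE y in lborel. 0 < ennreal (ball_wt (\<mu> + 1/2) 1 y / ball_mass TYPE(real ^ 'd) (\<mu> + 1/2)) \<longrightarrow> d y = 0"
    unfolding ball_prob_def by (subst (asm) AE_density) auto
  then have ae: "AE y in lborel. y \<in> ball 0 1 \<longrightarrow> d y = 0"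
  proof eventually_elim
    case (elim y)
    show ?case
    proof
      assume "y \<in> ball 0 1"
      then have "(norm y)\<^sup>2 < 1" by (simp add: abs_square_less_1)
      then have "ball_wt (\<mu> + 1/2) 1 y > 0" by (simp add: ball_wt_def)
      then show "d y = 0" using elim ball_mass_pos[OF b, where 'a = "real ^ 'd"] by simp
    qed
  qed
  show "d x = 0"
  proof (rule ccontr)
    assume nz: "d x \<noteq> 0"
    define U where "U = {y \<in> ball 0 1. d y \<noteq> 0}"
    have "U = ball 0 1 \<inter> d -` (- {0})" by (auto simp: U_def)
    moreover have "open (ball 0 1 \<inter> d -` (- {0}))"
      by (intro continuous_open_preimage continuous_poly_space[OF d]) auto
    ultimately have "open U" by simp
    moreover have "x \<in> U" using nz x by (simp add: U_def)
    moreover have "U \<in> null_sets lborel"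
      using ae \<open>open U\<close> by (subst AE_iff_null_sets) (auto simp: U_def elim!: eventually_mono)
    then have "negligible U"
      by (simp add: negligible_iff_null_sets null_sets_completionI)
    ultimately show False using open_not_negligible by blast
  qed
qed

lemma repr_kernel_eq: "repr_kernel \<mu> n = (proj_kernel n :: real ^ 'd::finite \<Rightarrow> _)"
  unfolding repr_kernel_def
proof (rule the_equality)
  show "\<forall>x. proj_kernel n x \<in> orth_poly_space \<mu> n \<and> (\<forall>q\<in>orth_poly_space \<mu> n. q x = (LINT y|ball_measure \<mu>. q y * proj_kernel n (x :: real ^ 'd) y))"
    using proj_kernel_orth_poly_space proj_kernel_reproduce by metis
next
  fix K :: "real ^ 'd \<Rightarrow> real ^ 'd \<Rightarrow> real"
  assume K: "\<forall>x. K x \<in> orth_poly_space \<mu> n \<and> (\<forall>q\<in>orth_poly_space \<mu> n. q x = (LINT y|ball_measure \<mu>. q y * K x y))"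
  show "K = proj_kernel n"
  proof (intro ext)
    fix x y
    \<comment> \<open>Both kernels reproduce the difference \<open>d\<close>, so its squared norm is
      \<open>d x - d x\<close>.\<close>
    define d where "d = (\<lambda>y. K x y - proj_kernel n x y)"
    have dV: "d \<in> orth_poly_space \<mu> n"
      unfolding d_def using K proj_kernel_orth_poly_space by (intro orth_poly_space_diff) auto
    then have dp: "d \<in> poly_space n" "K x \<in> poly_space n" using K by (auto simp: orth_poly_space_def)
    have "(LINT y|ball_measure \<mu>. d y * K x y) = d x" "(LINT y|ball_measure \<mu>. d y * proj_kernel n x y) = d x"
      using K dV proj_kernel_reproduce[OF dV] by auto
    moreover have "(LINT y|ball_measure \<mu>. d y * d y) = (LINT y|ball_measure \<mu>. d y * K x y) - (LINT y|ball_measure \<mu>. d y * proj_kernel n x y)"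
      unfolding d_def right_diff_distrib
      by (subst Bochner_Integration.integral_diff[symmetric])
         (auto simp: d_def[symmetric] intro!: all_polys_integrable all_polys_mult all_polysI[OF dp(1)] all_polysI[OF dp(2)] proj_kernel_all_polys Bochner_Integration.integral_cong)
    ultimately have "(LINT y|ball_measure \<mu>. d y * d y) = 0" by simp
    then have "d y = 0" by (rule poly_null[OF dp(1)])
    then show "K x y = proj_kernel n x y" by (simp add: d_def)
  qed
qed

lemma orth_proj_eq: "orth_proj \<mu> n f x = (LINT y|ball_measure \<mu>. f y * proj_kernel n x y)"
  by (simp add: orth_proj_def repr_kernel_eq)

end

section \<open>Positivity of Cesaro sums and the Poisson kernel\<close>

text \<open>The coefficients obey \<open>(n + 1) * F (n + 1) = (\<Sum>k. S k * F (n - k))\<close>,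
  so a majorant of the logarithmic derivative propagates to the series. The point is that
  logarithmic derivatives of the products below are explicit while their coefficients are
  not.\<close>

lemma fps_logderiv_bound:
  fixes F G S T :: "real fps"
  assumes F: "fps_deriv F = S * F" and G: "fps_deriv G = T * G"
    and ST: "\<And>k. \<bar>fps_nth S k\<bar> \<le> fps_nth T k" and 0: "\<bar>fps_nth F 0\<bar> \<le> fps_nth G 0"
  shows "\<bar>fps_nth F n\<bar> \<le> fps_nth G n"
proof (induction n rule: less_induct)
  case (less n)
  show ?case
  proof (cases n)
    case (Suc m)
    have F1: "real (Suc m) * fps_nth F (Suc m) = (\<Sum>k=0..m. fps_nth S k * fps_nth F (m - k))"
      using arg_cong[OF F, of "\<lambda>f. fps_nth f m"] by (simp add: fps_mult_nth)
    have G1: "real (Suc m) * fps_nth G (Suc m) = (\<Sum>k=0..m. fps_nth T k * fps_nth G (m - k))"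
      using arg_cong[OF G, of "\<lambda>f. fps_nth f m"] by (simp add: fps_mult_nth)
    have "real (Suc m) * \<bar>fps_nth F (Suc m)\<bar> = \<bar>\<Sum>k=0..m. fps_nth S k * fps_nth F (m - k)\<bar>"
      unfolding F1[symmetric] by (simp add: abs_mult)
    also have "\<dots> \<le> (\<Sum>k=0..m. \<bar>fps_nth S k * fps_nth F (m - k)\<bar>)" by (rule sum_abs)
    also have "\<dots> \<le> (\<Sum>k=0..m. fps_nth T k * fps_nth G (m - k))"
    proof (rule sum_mono)
      fix k assume "k \<in> {0..m}"
      have "\<bar>fps_nth F (m - k)\<bar> \<le> fps_nth G (m - k)" using less[of "m - k"] Suc by simp
      moreover have "0 \<le> fps_nth T k" using ST[of k] by simp
      ultimately show "\<bar>fps_nth S k * fps_nth F (m - k)\<bar> \<le> fps_nth T k * fps_nth G (m - k)"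
        unfolding abs_mult using ST[of k] by (intro mult_mono) auto
    qed
    finally have "real (Suc m) * \<bar>fps_nth F (Suc m)\<bar> \<le> real (Suc m) * fps_nth G (Suc m)" unfolding G1 .
    then show ?thesis unfolding Suc by (simp only: mult_le_cancel_left_pos of_nat_0_less_iff zero_less_Suc)
  qed (use 0 in simp)
qed

lemma fps_logderiv_nonneg:
  fixes F S :: "real fps"
  assumes F: "fps_deriv F = S * F" and S: "\<And>k. 0 \<le> fps_nth S k" and 0: "0 \<le> fps_nth F 0"
  shows "0 \<le> fps_nth F n"
proof -
  have "\<bar>fps_nth F n\<bar> \<le> fps_nth F n"
    by (rule fps_logderiv_bound[OF F F]) (use S 0 in auto)
  then show ?thesis by linarith
qed

text \<open>The coefficients of \<open>(1 - x) powr (- c)\<close>, that is, the Cesaro numbers of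
  order \<open>c - 1\<close>.\<close>

definition rising_binom :: "real \<Rightarrow> nat \<Rightarrow> real" where
  "rising_binom c n = pochhammer c n / fact n"

lemma rising_binom_0 [simp]: "rising_binom c 0 = 1"
  by (simp add: rising_binom_def)

lemma rising_binom_Suc: "real (Suc n) * rising_binom c (Suc n) = (c + real n) * rising_binom c n"
  unfolding rising_binom_def pochhammer_Suc fact_Suc by (simp add: mult_ac del: of_nat_Suc)

lemma rising_binom_nonneg: "c \<ge> 0 \<Longrightarrow> rising_binom c n \<ge> 0"
  by (cases "c = 0") (auto simp: rising_binom_def pochhammer_0_left intro!: less_imp_le pochhammer_pos divide_pos_pos)

lemma rising_binom_sums:
  assumes "\<bar>x\<bar> < 1"
  shows "(\<lambda>n. rising_binom c n * x ^ n) sums ((1 - x) powr (- c))"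
proof -
  have "(\<lambda>n. ((- c) gchoose n) * (- x) ^ n) sums (1 + (- x)) powr (- c)"
    by (rule gen_binomial_real) (use assms in simp)
  moreover have "((- c) gchoose n) * (- x) ^ n = rising_binom c n * x ^ n" for n
  proof -
    have "(-1::real) ^ n * (-1) ^ n = 1" by (simp flip: power_mult_distrib)
    moreover have "(- x) ^ n = (-1) ^ n * x ^ n" by (rule power_minus)
    moreover have "(-1) ^ n * pochhammer c n / fact n * ((-1) ^ n * x ^ n) = ((-1) ^ n * (-1) ^ n) * (pochhammer c n / fact n * x ^ n)" by simp
    ultimately show ?thesis by (simp add: gbinomial_pochhammer rising_binom_def)
  qed
  ultimately show ?thesis by simp
qed

section \<open>Generating functions of Gegenbauer and zonal polynomials\<close>

definition geom_fps :: "real fps" where "geom_fps = Abs_fps (\<lambda>_. 1)"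

lemma geom_fps_mult: "geom_fps * (1 - fps_X) = 1"
  by (rule fps_ext) (simp add: geom_fps_def right_diff_distrib fps_X_mult_right_nth)

lemma fps_deriv_rising_binom: "fps_deriv (Abs_fps (rising_binom c)) = fps_const c * geom_fps * Abs_fps (rising_binom c)"
proof -
  have 1: "fps_deriv (Abs_fps (rising_binom c)) * (1 - fps_X) = fps_const c * Abs_fps (rising_binom c)"
  proof (rule fps_ext)
    fix n
    show "fps_nth (fps_deriv (Abs_fps (rising_binom c)) * (1 - fps_X)) n = fps_nth (fps_const c * Abs_fps (rising_binom c)) n"
    proof (cases n)
      case 0
      then show ?thesis using rising_binom_Suc[of 0 c] by (simp add: right_diff_distrib)
    next
      case (Suc m)
      have "fps_nth (fps_deriv (Abs_fps (rising_binom c)) * (1 - fps_X)) n = real (Suc n) * rising_binom c (Suc n) - real n * rising_binom c n"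
        using Suc by (simp add: right_diff_distrib fps_X_mult_right_nth)
      then show ?thesis unfolding rising_binom_Suc by (simp add: algebra_simps)
    qed
  qed
  have "fps_deriv (Abs_fps (rising_binom c)) = fps_deriv (Abs_fps (rising_binom c)) * (geom_fps * (1 - fps_X))"
    by (simp add: geom_fps_mult)
  also have "\<dots> = geom_fps * (fps_deriv (Abs_fps (rising_binom c)) * (1 - fps_X))" by (simp only: mult_ac)
  finally show ?thesis unfolding 1 by (simp only: mult_ac)
qed

definition gegenbauer_fps :: "real \<Rightarrow> real \<Rightarrow> real fps" where
  "gegenbauer_fps a z = Abs_fps (\<lambda>n. poly (gegenbauer a n) z)"

lemma gegenbauer_rec: 
  "real (Suc (Suc n)) * poly (gegenbauer a (Suc (Suc n))) z = 2 * (real n + 1 + a) * z * poly (gegenbauer a (Suc n)) z - (real n + 2 * a) * poly (gegenbauer a n) z"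
proof -
  have "poly (smult (2 * (real n + 1 + a)) (pCons 0 (gegenbauer a (Suc n)))) z = poly (smult (real n + 2) (gegenbauer a (Suc (Suc n))) + smult (real n + 2 * a) (gegenbauer a n)) z"
    by (subst gegenbauer_step) (rule refl)
  then show ?thesis by (simp add: algebra_simps del: gegenbauer.simps)
qed

lemma gegenbauer_fps_ode:
  "(1 - fps_const (2 * z) * fps_X + fps_X * fps_X) * fps_deriv (gegenbauer_fps a z) = fps_const (2 * a) * (fps_const z - fps_X) * gegenbauer_fps a z"
  (is "?L = ?R")
proof (rule fps_ext)
  fix n
  define h where "h n = poly (gegenbauer a n) z" for n
  have D: "fps_nth (fps_deriv (gegenbauer_fps a z)) k = real (Suc k) * h (Suc k)" for k
    by (simp add: gegenbauer_fps_def h_def del: gegenbauer.simps)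
  have G: "fps_nth (gegenbauer_fps a z) k = h k" for k by (simp add: gegenbauer_fps_def h_def)
  have L: "?L = fps_deriv (gegenbauer_fps a z) - fps_const (2 * z) * (fps_X * fps_deriv (gegenbauer_fps a z)) + fps_X * (fps_X * fps_deriv (gegenbauer_fps a z))"
    by (simp add: algebra_simps)
  have R: "?R = fps_const (2 * a) * (fps_const z * gegenbauer_fps a z - fps_X * gegenbauer_fps a z)"
    by (simp add: algebra_simps)
  have h0: "h 0 = 1" "h (Suc 0) = 2 * a * z" by (simp_all add: h_def)
  have hr: "real (Suc (Suc k)) * h (Suc (Suc k)) = 2 * (real k + 1 + a) * z * h (Suc k) - (real k + 2 * a) * h k" for k
    unfolding h_def by (rule gegenbauer_rec)
  consider "n = 0" | "n = 1" | k where "n = Suc (Suc k)" 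
    by (metis One_nat_def not0_implies_Suc)
  then show "fps_nth ?L n = fps_nth ?R n"
  proof cases
    case 1
    then show ?thesis unfolding L R by (simp add: D G h0 fps_X_mult_nth del: fps_deriv_nth)
  next
    case 2
    then show ?thesis unfolding L R using hr[of 0] 
      by (simp add: D G h0 fps_X_mult_nth algebra_simps del: fps_deriv_nth)
  next
    case (3 k)
    show ?thesis unfolding L R 3 using hr[of "Suc k"] 
      by (simp add: D G fps_X_mult_nth algebra_simps del: fps_deriv_nth)
  qed
qed

text \<open>The logarithmic derivative of
  \<open>(1 - 2 * cos \<theta> * x + x^2) powr (- a)\<close>.\<close>

definition cosine_fps :: "real \<Rightarrow> real \<Rightarrow> real fps" where
  "cosine_fps a \<theta> = Abs_fps (\<lambda>k. 2 * a * cos (real (Suc k) * \<theta>))"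

lemma cos_rec: "cos (real (Suc (Suc k)) * \<theta>) = 2 * cos \<theta> * cos (real (Suc k) * \<theta>) - cos (real k * \<theta>)"
proof -
  have "cos (real (Suc k) * \<theta> + \<theta>) + cos (real (Suc k) * \<theta> - \<theta>) = 2 * cos (real (Suc k) * \<theta>) * cos \<theta>"
    by (simp add: cos_add cos_diff)
  moreover have e: "real (Suc k) * \<theta> + \<theta> = real (Suc (Suc k)) * \<theta>" "real (Suc k) * \<theta> - \<theta> = real k * \<theta>"
    by (simp_all add: algebra_simps)
  ultimately show ?thesis unfolding e by algebra
qed

lemma cosine_fps_eq:
  "(1 - fps_const (2 * cos \<theta>) * fps_X + fps_X * fps_X) * cosine_fps a \<theta> = fps_const (2 * a) * (fps_const (cos \<theta>) - fps_X)"
  (is "?L = ?R")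
proof (rule fps_ext)
  fix n
  have L: "?L = cosine_fps a \<theta> - fps_const (2 * cos \<theta>) * (fps_X * cosine_fps a \<theta>) + fps_X * (fps_X * cosine_fps a \<theta>)"
    by (simp add: algebra_simps)
  have G: "fps_nth (cosine_fps a \<theta>) k = 2 * a * cos (real (Suc k) * \<theta>)" for k by (simp add: cosine_fps_def)
  consider "n = 0" | "n = 1" | k where "n = Suc (Suc k)" 
    by (metis One_nat_def not0_implies_Suc)
  then show "fps_nth ?L n = fps_nth ?R n"
  proof cases
    case 1
    then show ?thesis unfolding L by (simp add: G fps_X_mult_nth)
  next
    case 2
    have "fps_nth ?L n = 2 * a * (cos (real (Suc (Suc 0)) * \<theta>) - 2 * cos \<theta> * cos (real (Suc 0) * \<theta>))"
      unfolding L 2 by (simp add: G fps_X_mult_nth algebra_simps)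
    also have "\<dots> = - (2 * a)" by (subst cos_rec) simp
    finally show ?thesis by (simp add: 2)
  next
    case (3 k)
    have "fps_nth ?L n = 2 * a * (cos (real (Suc (Suc (Suc k))) * \<theta>) - 2 * cos \<theta> * cos (real (Suc (Suc k)) * \<theta>) + cos (real (Suc k) * \<theta>))"
      unfolding L 3 by (simp add: G fps_X_mult_nth algebra_simps)
    also have "\<dots> = 0" by (subst cos_rec) simp
    finally show ?thesis by (simp add: 3)
  qed
qed

lemma gegenbauer_fps_logderiv: "fps_deriv (gegenbauer_fps a (cos \<theta>)) = cosine_fps a \<theta> * gegenbauer_fps a (cos \<theta>)"
proof -
  let ?Q = "1 - fps_const (2 * cos \<theta>) * fps_X + fps_X * fps_X :: real fps"
  have "fps_nth ?Q 0 = 1" by simp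
  then have "?Q \<noteq> 0" by (metis fps_zero_nth zero_neq_one)
  moreover have "?Q * fps_deriv (gegenbauer_fps a (cos \<theta>)) = ?Q * (cosine_fps a \<theta> * gegenbauer_fps a (cos \<theta>))"
    unfolding gegenbauer_fps_ode mult.assoc[symmetric] cosine_fps_eq ..
  ultimately show ?thesis by simp
qed

lemma arccos_repr: "\<bar>z :: real\<bar> \<le> 1 \<Longrightarrow> \<exists>\<theta>. z = cos \<theta>"
  by (intro exI[of _ "arccos z"]) (simp add: cos_arccos_abs)

text \<open>The logarithmic derivative has coefficients of modulus at most \<open>2 * a\<close>, and
  the constant sequence \<open>2 * a\<close> belongs to
  \<open>(1 - x) powr (- 2 * a)\<close>.\<close>

lemma gegenbauer_bound:
  assumes a: "a \<ge> 0" and z: "\<bar>z\<bar> \<le> 1"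
  shows "\<bar>poly (gegenbauer a n) z\<bar> \<le> rising_binom (2 * a) n"
proof -
  obtain \<theta> where \<theta>: "z = cos \<theta>" using arccos_repr[OF z] by blast
  have "\<bar>fps_nth (gegenbauer_fps a (cos \<theta>)) n\<bar> \<le> fps_nth (Abs_fps (rising_binom (2 * a))) n"
  proof (rule fps_logderiv_bound[OF gegenbauer_fps_logderiv fps_deriv_rising_binom])
    fix k
    have "\<bar>2 * a * cos (real (Suc k) * \<theta>)\<bar> \<le> 2 * a * 1"
      unfolding abs_mult using a by (intro mult_mono) (auto simp del: of_nat_Suc)
    then show "\<bar>fps_nth (cosine_fps a \<theta>) k\<bar> \<le> fps_nth (fps_const (2 * a) * geom_fps) k"
      by (simp add: cosine_fps_def geom_fps_def)
  qed (simp add: gegenbauer_fps_def)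
  then show ?thesis by (simp add: gegenbauer_fps_def \<theta>)
qed

lemma zonal_fps: "Abs_fps (\<lambda>n. poly (zonal l n) z) = (1 - fps_X * fps_X) * gegenbauer_fps (l + 1) z"
proof (rule fps_ext)
  fix n
  have L: "(1 - fps_X * fps_X) * gegenbauer_fps (l + 1) z = gegenbauer_fps (l + 1) z - fps_X * (fps_X * gegenbauer_fps (l + 1) z)"
    by (simp add: algebra_simps)
  consider "n = 0" | "n = 1" | k where "n = Suc (Suc k)" 
    by (metis One_nat_def not0_implies_Suc)
  then show "fps_nth (Abs_fps (\<lambda>n. poly (zonal l n) z)) n = fps_nth ((1 - fps_X * fps_X) * gegenbauer_fps (l + 1) z) n"
    unfolding L by cases (simp_all add: zonal_def gegenbauer_fps_def fps_X_mult_nth del: gegenbauer.simps)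
qed

text \<open>Unnormalised Cesaro sums of order \<open>c - 1\<close>; their positivity follows from that of the
  logarithmic derivative of the generating function.\<close>

definition cesaro :: "real \<Rightarrow> real \<Rightarrow> nat \<Rightarrow> real poly" where
  "cesaro l c n = (\<Sum>k\<le>n. smult (rising_binom c (n - k)) (zonal l k))"

text \<open>The generating function is \<open>(1 - x^2) * (1 - 2 * z * x + x^2) powr (- (l + 1)) *
  (1 - x) powr (- c)\<close>. Its logarithmic derivative has coefficients at least
  \<open>- 2 - 2 * (l + 1) + c\<close>, which explains the threshold
  \<open>2 * l + 4\<close>.\<close>

lemma cesaro_nonneg:
  assumes l: "l \<ge> 0" and c: "c \<ge> 2 * l + 4" and z: "\<bar>z\<bar> \<le> 1"
  shows "poly (cesaro l c n) z \<ge> 0"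
proof -
  obtain \<theta> where \<theta>: "z = cos \<theta>" using arccos_repr[OF z] by blast
  define W :: "real fps" where "W = 1 - fps_X * fps_X"
  define SW :: "real fps" where "SW = Abs_fps (\<lambda>k. - (1 + (-1) ^ Suc k))"
  have "W * SW = SW - fps_X * (fps_X * SW)" by (simp add: W_def algebra_simps)
  also have "\<dots> = - (2 * fps_X)"
  proof (rule fps_ext)
    fix n
    consider "n = 0" | "n = 1" | k where "n = Suc (Suc k)" 
      by (metis One_nat_def not0_implies_Suc)
    then show "fps_nth (SW - fps_X * (fps_X * SW)) n = fps_nth (- (2 * fps_X)) n"
      by cases (simp_all add: SW_def fps_X_mult_nth numeral_fps_const)
  qed
  also have "\<dots> = fps_deriv W" by (simp add: W_def)
  finally have W: "fps_deriv W = SW * W" by (simp add: mult.commute)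
  define P where "P = Abs_fps (rising_binom c)"
  have P: "fps_deriv P = fps_const c * geom_fps * P" unfolding P_def by (rule fps_deriv_rising_binom)
  define F where "F = W * gegenbauer_fps (l + 1) z * P"
  have "fps_deriv F = (SW + cosine_fps (l + 1) \<theta> + fps_const c * geom_fps) * F"
    unfolding F_def \<theta> by (simp add: W P gegenbauer_fps_logderiv algebra_simps)
  then have "0 \<le> fps_nth F n"
  proof (rule fps_logderiv_nonneg)
    fix k
    define C e where "C = 2 * (l + 1) * cos (real (Suc k) * \<theta>)" and "e = (- 1 :: real) ^ Suc k"
    have "2 * (l + 1) * (-1) \<le> C" unfolding C_def using l by (intro mult_left_mono) auto
    then have "C \<ge> - 2 * l - 2" by simp
    moreover have "\<bar>e\<bar> = 1" by (simp add: e_def power_abs)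
    then have "e \<le> 1" by simp
    ultimately have "0 \<le> - (1 + e) + C + c" using c by linarith
    then show "0 \<le> fps_nth (SW + cosine_fps (l + 1) \<theta> + fps_const c * geom_fps) k"
      by (simp add: SW_def cosine_fps_def geom_fps_def C_def e_def)
  qed (simp add: F_def W_def gegenbauer_fps_def P_def)
  also have "fps_nth F n = (\<Sum>k=0..n. poly (zonal l k) z * rising_binom c (n - k))"
    unfolding F_def W_def zonal_fps[symmetric] P_def by (simp add: fps_mult_nth)
  also have "\<dots> = poly (cesaro l c n) z" by (simp add: cesaro_def poly_sum atMost_atLeast0 mult.commute)
  finally show ?thesis .
qed

lemma rising_binom_summable: "\<bar>x\<bar> < 1 \<Longrightarrow> summable (\<lambda>n. rising_binom c n * x ^ n)"
  using rising_binom_sums sums_summable by blast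

lemma gegenbauer_fps_conv_radius:
  assumes a: "a \<ge> 0" and z: "\<bar>z\<bar> \<le> 1"
  shows "fps_conv_radius (gegenbauer_fps a z) \<ge> 1"
  unfolding fps_conv_radius_def
proof (rule conv_radius_geI_ex)
  fix r :: real assume r: "r > 0" "ereal r < 1"
  have "summable (\<lambda>n. fps_nth (gegenbauer_fps a z) n * r ^ n)"
  proof (rule summable_comparison_test'[OF rising_binom_summable])
    fix n 
    show "norm (fps_nth (gegenbauer_fps a z) n * r ^ n) \<le> rising_binom (2 * a) n * r ^ n"
      using gegenbauer_bound[OF a z, of n] r by (simp add: gegenbauer_fps_def abs_mult mult_right_mono)
  qed (use r in auto)
  then show "\<exists>x::real. norm x = r \<and> summable (\<lambda>n. fps_nth (gegenbauer_fps a z) n * x ^ n)"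
    using r by (intro exI[of _ r]) simp
qed

section \<open>The Poisson kernel in closed form and its doubling inequality\<close>

definition poisson_denom :: "real \<Rightarrow> real \<Rightarrow> real" where
  "poisson_denom \<rho> z = 1 - 2 * \<rho> * z + \<rho>\<^sup>2"

lemma poisson_denom_ge: "\<bar>z\<bar> \<le> 1 \<Longrightarrow> poisson_denom \<rho> z \<ge> (1 - \<bar>\<rho>\<bar>)\<^sup>2"
proof -
  assume z: "\<bar>z\<bar> \<le> 1"
  have "\<rho> * z \<le> \<bar>\<rho>\<bar> * \<bar>z\<bar>" by (metis abs_ge_self abs_mult)
  also have "\<dots> \<le> \<bar>\<rho>\<bar>" using z by (simp add: mult_left_le)
  finally show ?thesis by (simp add: poisson_denom_def power2_eq_square algebra_simps)
qed

lemma poisson_denom_pos: "\<bar>z\<bar> \<le> 1 \<Longrightarrow> \<bar>\<rho>\<bar> < 1 \<Longrightarrow> poisson_denom \<rho> z > 0"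
proof -
  assume z: "\<bar>z\<bar> \<le> 1" and r: "\<bar>\<rho>\<bar> < 1"
  then have "(1 - \<bar>\<rho>\<bar>)\<^sup>2 > 0" by simp
  with poisson_denom_ge[OF z, of \<rho>] show ?thesis by linarith
qed

text \<open>The recurrence is a first-order differential equation for the sum; the sum times
  \<open>poisson_denom x z powr a\<close> therefore has derivative 0 in \<open>x\<close> and keeps
  its value 1 at the origin.\<close>

lemma gegenbauer_sums:
  assumes a: "a \<ge> 0" and z: "\<bar>z\<bar> \<le> 1" and r: "\<bar>\<rho>\<bar> < 1"
  shows "(\<lambda>n. poly (gegenbauer a n) z * \<rho> ^ n) sums (poisson_denom \<rho> z powr (- a))"
proof -
  define H where "H = gegenbauer_fps a z"
  have rad: "ereal (norm x) < fps_conv_radius H" if "\<bar>x\<bar> < 1" for x :: real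
  proof -
    have "ereal (norm x) < 1" using that by simp
    then show ?thesis using gegenbauer_fps_conv_radius[OF a z] unfolding H_def by (rule less_le_trans)
  qed
  define Q where "Q = fps_of_poly [:1, - 2 * z, 1:]"
  have Qeq: "Q = 1 - fps_const (2 * z) * fps_X + fps_X * fps_X"
    unfolding Q_def by (simp add: fps_of_poly_pCons algebra_simps)
  have ode: "eval_fps (fps_deriv H) x * poisson_denom x z = 2 * a * (z - x) * eval_fps H x" if x: "\<bar>x\<bar> < 1" for x
  proof -
    have rd: "ereal (norm x) < fps_conv_radius (fps_deriv H)"
      using rad[OF x] fps_conv_radius_deriv[of H] by (rule less_le_trans)
    have "Q * fps_deriv H = fps_of_poly [:2 * a * z, - 2 * a:] * H"
      unfolding Qeq H_def gegenbauer_fps_ode by (simp add: fps_of_poly_pCons algebra_simps flip: fps_const_neg)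
    then have "eval_fps (Q * fps_deriv H) x = eval_fps (fps_of_poly [:2 * a * z, - 2 * a:] * H) x" by simp
    moreover have "eval_fps (Q * fps_deriv H) x = poisson_denom x z * eval_fps (fps_deriv H) x"
      unfolding Q_def using rd by (subst eval_fps_mult) (auto simp: poisson_denom_def power2_eq_square algebra_simps)
    moreover have "eval_fps (fps_of_poly [:2 * a * z, - 2 * a:] * H) x = (2 * a * z + x * (- 2 * a)) * eval_fps H x"
      using rad[OF x] by (subst eval_fps_mult) auto
    ultimately show ?thesis by (simp add: algebra_simps)
  qed
  define g where "g x = eval_fps H x * poisson_denom x z powr a" for x
  have "(g has_field_derivative 0) (at x)" if x: "x \<in> ball 0 1" for x
  proof -
    have x1: "\<bar>x\<bar> < 1" using x by (simp add: dist_real_def)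
    have gp: "poisson_denom x z > 0" using poisson_denom_pos[OF z x1] .
    have "((\<lambda>x. poisson_denom x z) has_field_derivative (2 * x - 2 * z)) (at x)"
      unfolding poisson_denom_def by (auto intro!: derivative_eq_intros)
    then have d1: "((\<lambda>x. poisson_denom x z powr a) has_field_derivative (a * poisson_denom x z powr (a - 1) * (2 * x - 2 * z))) (at x)"
      using gp by (auto intro!: derivative_eq_intros)
    have d2: "(eval_fps H has_field_derivative eval_fps (fps_deriv H) x) (at x)"
      by (rule has_field_derivative_eval_fps[OF rad[OF x1]])
    have "(g has_field_derivative (eval_fps (fps_deriv H) x * poisson_denom x z powr a + a * poisson_denom x z powr (a - 1) * (2 * x - 2 * z) * eval_fps H x)) (at x)"
      unfolding g_def by (rule DERIV_mult[OF d2 d1])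
    moreover have "poisson_denom x z powr a = poisson_denom x z powr (a - 1) * poisson_denom x z"
      using gp by (simp add: powr_mult_base[symmetric] powr_diff)
    then have "eval_fps (fps_deriv H) x * poisson_denom x z powr a + a * poisson_denom x z powr (a - 1) * (2 * x - 2 * z) * eval_fps H x =
        poisson_denom x z powr (a - 1) * (eval_fps (fps_deriv H) x * poisson_denom x z - 2 * a * (z - x) * eval_fps H x)"
      by (simp add: algebra_simps)
    then have "eval_fps (fps_deriv H) x * poisson_denom x z powr a + a * poisson_denom x z powr (a - 1) * (2 * x - 2 * z) * eval_fps H x = 0"
      using ode[OF x1] by simp
    ultimately show ?thesis by simp
  qed
  then have "\<exists>c. \<forall>x\<in>ball 0 1. g x = c"
    by (intro has_field_derivative_zero_constant) (auto intro: has_field_derivative_at_within)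
  then have "g \<rho> = g 0" using r by (auto simp: dist_real_def)
  also have "g 0 = 1" by (simp add: g_def H_def eval_fps_at_0 gegenbauer_fps_def poisson_denom_def)
  finally have "eval_fps H \<rho> = poisson_denom \<rho> z powr (- a)"
    using poisson_denom_pos[OF z r] by (simp add: g_def powr_minus field_simps)
  moreover have "(\<lambda>n. fps_nth H n * \<rho> ^ n) sums eval_fps H \<rho>"
    by (rule sums_eval_fps[OF rad[OF r]])
  ultimately show ?thesis by (simp add: H_def gegenbauer_fps_def)
qed

definition poisson :: "real \<Rightarrow> real \<Rightarrow> real \<Rightarrow> real" where
  "poisson l \<rho> z = (1 - \<rho>\<^sup>2) * poisson_denom \<rho> z powr (- (l + 1))"

lemma sums_shift2:
  fixes f :: "nat \<Rightarrow> real"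
  assumes "(\<lambda>n. f n * x ^ n) sums s"
  shows "(\<lambda>n. (if n < 2 then 0 else f (n - 2)) * x ^ n) sums (x\<^sup>2 * s)"
proof -
  have "(\<lambda>n. x\<^sup>2 * (f n * x ^ n)) sums (x\<^sup>2 * s)" using assms by (rule sums_mult)
  then have "(\<lambda>n. (if n + 2 < 2 then 0 else f (n + 2 - 2)) * x ^ (n + 2)) sums (x\<^sup>2 * s)"
    by (simp add: power_add power2_eq_square mult_ac)
  then show ?thesis
    using sums_iff_shift'[of "\<lambda>n. (if n < 2 then 0 else f (n - 2)) * x ^ n" 2 "x\<^sup>2 * s"] 
    by (simp add: numeral_2_eq_2)
qed

lemma zonal_sums:
  assumes l: "l \<ge> 0" and z: "\<bar>z\<bar> \<le> 1" and r: "\<bar>\<rho>\<bar> < 1"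
  shows "(\<lambda>n. poly (zonal l n) z * \<rho> ^ n) sums poisson l \<rho> z"
proof -
  have "l + 1 \<ge> 0" using l by simp
  note g = gegenbauer_sums[OF this z r]
  have "(\<lambda>n. poly (gegenbauer (l + 1) n) z * \<rho> ^ n - (if n < 2 then 0 else poly (gegenbauer (l + 1) (n - 2)) z) * \<rho> ^ n) sums
     (poisson_denom \<rho> z powr (- (l + 1)) - \<rho>\<^sup>2 * poisson_denom \<rho> z powr (- (l + 1)))"
    by (rule sums_diff[OF g sums_shift2[OF g]])
  moreover have "poly (gegenbauer (l + 1) n) z * \<rho> ^ n - (if n < 2 then 0 else poly (gegenbauer (l + 1) (n - 2)) z) * \<rho> ^ n = poly (zonal l n) z * \<rho> ^ n" for n
    by (simp add: zonal_def left_diff_distrib)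
  ultimately show ?thesis by (simp add: poisson_def algebra_simps)
qed

text \<open>A majorant of \<open>zonal l n\<close> on the interval from -1 to 1 that does not depend
  on the point. It grows polynomially in \<open>n\<close> and serves convergence and
  domination.\<close>

definition zonal_bd :: "real \<Rightarrow> nat \<Rightarrow> real" where
  "zonal_bd l n = rising_binom (2 * (l + 1)) n + (if n < 2 then 0 else rising_binom (2 * (l + 1)) (n - 2))"

lemma zonal_bound:
  assumes l: "l \<ge> 0" and z: "\<bar>z\<bar> \<le> 1"
  shows "\<bar>poly (zonal l n) z\<bar> \<le> zonal_bd l n"
proof -
  have "l + 1 \<ge> 0" using l by simp
  note g = gegenbauer_bound[OF this z]
  show ?thesis using g[of n] g[of "n - 2"] by (auto simp: zonal_def zonal_bd_def)
qed

lemma zonal_bd_summable: "\<bar>x\<bar> < 1 \<Longrightarrow> summable (\<lambda>n. zonal_bd l n * x ^ n)"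
  using summable_add[OF sums_summable[OF rising_binom_sums[of x "2 * (l + 1)"]] sums_summable[OF sums_shift2[OF rising_binom_sums[of x "2 * (l + 1)"]]]]
  by (simp add: zonal_bd_def distrib_right)

lemma cesaro_sums:
  assumes l: "l \<ge> 0" and c: "c \<ge> 0" and z: "\<bar>z\<bar> \<le> 1" and r: "0 \<le> \<rho>" "\<rho> < 1"
  shows "(\<lambda>n. poly (cesaro l c n) z * \<rho> ^ n) sums (poisson l \<rho> z * (1 - \<rho>) powr (- c))"
proof -
  have r': "\<bar>\<rho>\<bar> < 1" using r by simp
  have s1: "summable (\<lambda>n. norm (poly (zonal l n) z * \<rho> ^ n))"
  proof (rule summable_comparison_test'[OF zonal_bd_summable[OF r', of l]])
    fix n show "norm (norm (poly (zonal l n) z * \<rho> ^ n)) \<le> zonal_bd l n * \<rho> ^ n"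
      using zonal_bound[OF l z, of n] r by (simp add: abs_mult mult_right_mono)
  qed
  have s2: "summable (\<lambda>n. norm (rising_binom c n * \<rho> ^ n))"
    using rising_binom_summable[OF r', of c] r rising_binom_nonneg[OF c] by (simp add: abs_mult)
  have "(\<lambda>n. \<Sum>i\<le>n. (poly (zonal l i) z * \<rho> ^ i) * (rising_binom c (n - i) * \<rho> ^ (n - i))) sums 
    ((\<Sum>n. poly (zonal l n) z * \<rho> ^ n) * (\<Sum>n. rising_binom c n * \<rho> ^ n))"
    by (rule Cauchy_product_sums[OF s1 s2])
  moreover have "(\<Sum>i\<le>n. (poly (zonal l i) z * \<rho> ^ i) * (rising_binom c (n - i) * \<rho> ^ (n - i))) = poly (cesaro l c n) z * \<rho> ^ n" for n
  proof -
    have "(poly (zonal l i) z * \<rho> ^ i) * (rising_binom c (n - i) * \<rho> ^ (n - i)) = rising_binom c (n - i) * poly (zonal l i) z * \<rho> ^ n" if "i \<le> n" for i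
    proof -
      have "\<rho> ^ n = \<rho> ^ i * \<rho> ^ (n - i)" using that by (simp flip: power_add)
      then show ?thesis by simp
    qed
    then show ?thesis unfolding cesaro_def poly_sum sum_distrib_right poly_smult by (intro sum.cong) auto
  qed
  moreover have "(\<Sum>n. poly (zonal l n) z * \<rho> ^ n) = poisson l \<rho> z" "(\<Sum>n. rising_binom c n * \<rho> ^ n) = (1 - \<rho>) powr (- c)"
    using zonal_sums[OF l z r'] rising_binom_sums[OF r', of c] by (auto simp: sums_iff)
  ultimately show ?thesis by simp
qed

lemma exp_lower: "0 \<le> t \<Longrightarrow> t \<le> 1 \<Longrightarrow> t / 2 \<le> 1 - exp (- t :: real)"
proof -
  assume t: "0 \<le> t" "t \<le> 1"
  have "exp (- t) \<le> 1 / (1 + t)" using exp_ge_add_one_self[of t] t by (simp add: exp_minus field_simps)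
  also have "\<dots> \<le> 1 - t / 2" using t by (simp add: field_simps) (use t in \<open>simp add: mult_left_le\<close>)
  finally show ?thesis by simp
qed

lemma exp_upper: "1 - exp (- t :: real) \<le> t"
  using exp_ge_add_one_self[of "- t"] by simp

lemma poisson_nonneg: "0 \<le> \<rho> \<Longrightarrow> \<rho> \<le> 1 \<Longrightarrow> 0 \<le> poisson l \<rho> z"
  unfolding poisson_def by (intro mult_nonneg_nonneg) (auto simp: power_le_one)

definition doubling_const :: "real \<Rightarrow> real" where "doubling_const l = 4 powr (l + 2)"

lemma doubling_const_pos: "doubling_const l > 0" by (simp add: doubling_const_def)

text \<open>The denominator is \<open>(1 - \<rho>)^2 + 2 * \<rho> * (1 - z)\<close>, so passing from
  \<open>t\<close> to \<open>T\<close> enlarges it by at most \<open>4 * (T / t)^2\<close>, while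
  \<open>1 - \<rho>^2\<close> compares like \<open>t / T\<close>. The exponents combine to
  \<open>2 * (l + 1) - 1 = 2 * l + 1\<close>, which becomes \<open>d + 2 * \<mu>\<close> for
  \<open>l = \<mu> + (d - 1) / 2\<close>.\<close>

lemma poisson_doubling:
  assumes l: "l \<ge> 0" and z: "\<bar>z\<bar> \<le> 1" and t: "0 < t" "t \<le> T" "T \<le> 1"
  shows "poisson l (exp (- t)) z \<le> doubling_const l * (T / t) powr (2 * l + 1) * poisson l (exp (- T)) z"
proof -
  define \<rho> \<sigma> where "\<rho> = exp (- t)" and "\<sigma> = exp (- T)"
  have rs: "0 < \<rho>" "0 < \<sigma>" "\<sigma> \<le> \<rho>" "\<rho> < 1" "\<sigma> < 1" using t by (auto simp: \<rho>_def \<sigma>_def)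
  have gp: "poisson_denom \<rho> z > 0" "poisson_denom \<sigma> z > 0" using poisson_denom_pos[OF z] rs by auto
  have e: "poisson_denom x z = (1 - x)\<^sup>2 + 2 * x * (1 - z)" for x by (simp add: poisson_denom_def power2_eq_square algebra_simps)
  have Tt: "T / t \<ge> 1" using t by simp
  have g: "poisson_denom \<sigma> z \<le> 4 * (T / t)\<^sup>2 * poisson_denom \<rho> z"
  proof -
    have "(1 - \<sigma>)\<^sup>2 \<le> T\<^sup>2" using exp_upper[of T] rs by (intro power_mono) (auto simp: \<sigma>_def)
    also have "\<dots> = 4 * (T / t)\<^sup>2 * (t / 2)\<^sup>2" using t by (simp add: power_divide)
    also have "\<dots> \<le> 4 * (T / t)\<^sup>2 * (1 - \<rho>)\<^sup>2"
      using exp_lower[of t] t by (intro mult_left_mono power_mono) (auto simp: \<rho>_def)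
    finally have 1: "(1 - \<sigma>)\<^sup>2 \<le> 4 * (T / t)\<^sup>2 * (1 - \<rho>)\<^sup>2" .
    have "1 \<le> (T / t)\<^sup>2" using Tt by simp
    then have "1 * (2 * \<sigma> * (1 - z)) \<le> 4 * (T / t)\<^sup>2 * (2 * \<rho> * (1 - z))"
      using rs z by (intro mult_mono) auto
    with 1 show ?thesis unfolding e by (simp add: algebra_simps)
  qed
  have p: "1 - \<rho>\<^sup>2 \<le> 4 * (t / T) * (1 - \<sigma>\<^sup>2)"
  proof -
    have "\<rho>\<^sup>2 = exp (- (2 * t))" by (simp add: \<rho>_def power2_eq_square flip: exp_add)
    then have "1 - \<rho>\<^sup>2 \<le> 2 * t" using exp_upper[of "2 * t"] by simp
    also have "2 * t = 4 * (t / T) * (T / 2)" using t by simp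
    also have "\<dots> \<le> 4 * (t / T) * (1 - \<sigma>\<^sup>2)"
    proof (rule mult_left_mono)
      have "\<sigma>\<^sup>2 \<le> \<sigma>" using rs by (simp add: power2_eq_square mult_left_le)
      then show "T / 2 \<le> 1 - \<sigma>\<^sup>2" using exp_lower[of T] t by (simp add: \<sigma>_def)
    qed (use t in simp)
    finally show ?thesis .
  qed
  have "poisson_denom \<rho> z powr (- (l + 1)) \<le> (poisson_denom \<sigma> z / (4 * (T / t)\<^sup>2)) powr (- (l + 1))"
    using g gp t l by (intro powr_mono2') (auto simp: field_simps)
  also have "\<dots> = (4 * (T / t)\<^sup>2) powr (l + 1) * poisson_denom \<sigma> z powr (- (l + 1))"
  proof -
    define x where "x = 4 * (T / t)\<^sup>2"
    have "x > 0" using t by (simp add: x_def)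
    then have "(poisson_denom \<sigma> z / x) powr (- (l + 1)) = x powr (l + 1) * poisson_denom \<sigma> z powr (- (l + 1))"
      using gp by (simp only: powr_divide powr_minus_divide[of x]) simp
    then show ?thesis by (simp only: x_def)
  qed
  finally have q: "poisson_denom \<rho> z powr (- (l + 1)) \<le> (4 * (T / t)\<^sup>2) powr (l + 1) * poisson_denom \<sigma> z powr (- (l + 1))" .
  have "poisson l \<rho> z \<le> (4 * (t / T) * (1 - \<sigma>\<^sup>2)) * ((4 * (T / t)\<^sup>2) powr (l + 1) * poisson_denom \<sigma> z powr (- (l + 1)))"
    unfolding poisson_def using p q rs t
    by (intro mult_mono) (auto simp: power_le_one)
  also have "\<dots> = (4 * (t / T) * (4 * (T / t)\<^sup>2) powr (l + 1)) * poisson l \<sigma> z"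
    by (simp add: poisson_def)
  also have "4 * (t / T) * (4 * (T / t)\<^sup>2) powr (l + 1) = doubling_const l * (T / t) powr (2 * l + 1)"
  proof -
    define x where "x = T / t"
    have x: "x > 0" "t / T = x powr (-1)" using t by (auto simp: x_def powr_minus_divide)
    have "4 * (t / T) * (4 * x\<^sup>2) powr (l + 1) = (4 * 4 powr (l + 1)) * (x powr (-1) * x powr (2 * (l + 1)))"
    proof -
      have "x\<^sup>2 = x powr 2" using x by simp
      then have "(x\<^sup>2) powr (l + 1) = x powr (2 * (l + 1))" by (simp only: powr_powr)
      then show ?thesis unfolding powr_mult x(2) by (simp only: mult_ac)
    qed
    also have "4 * 4 powr (l + 1) = (4::real) powr (l + 2)" by (simp add: powr_add)
    also have "x powr (-1) * x powr (2 * (l + 1)) = x powr (2 * l + 1)"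
      unfolding powr_add[symmetric] by (rule arg_cong[where f = "\<lambda>y. x powr y"]) simp
    finally show ?thesis by (simp add: doubling_const_def x_def)
  qed
  finally show ?thesis by (simp add: \<rho>_def \<sigma>_def)
qed

section \<open>Positive functionals\<close>

text \<open>Fixing \<open>y\<close>, both the evaluation of a lifted polynomial at a pair of points
  and its average over the quadrature nodes are functionals of this kind. Every estimate proved here
  then holds at each \<open>y\<close> with the same constants.\<close>

locale pos_fun =
  fixes \<Lambda> :: "real poly \<Rightarrow> real"
  assumes \<Lambda>_add: "\<Lambda> (F + G) = \<Lambda> F + \<Lambda> G"
    and \<Lambda>_smult: "\<Lambda> (smult c F) = c * \<Lambda> F"
    and \<Lambda>_pos: "(\<And>z. \<bar>z\<bar> \<le> 1 \<Longrightarrow> poly F z \<ge> 0) \<Longrightarrow> \<Lambda> F \<ge> 0"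
    and \<Lambda>_one: "\<Lambda> 1 = 1"
begin

lemma \<Lambda>_diff: "\<Lambda> (F - G) = \<Lambda> F - \<Lambda> G"
  using \<Lambda>_add[of F "smult (-1) G"] \<Lambda>_smult[of "-1" G] by simp

lemma \<Lambda>_0: "\<Lambda> 0 = 0"
  using \<Lambda>_smult[of 0 1] by simp

lemma \<Lambda>_sum: "\<Lambda> (\<Sum>i\<in>A. F i) = (\<Sum>i\<in>A. \<Lambda> (F i))"
  by (induction A rule: infinite_finite_induct) (auto simp: \<Lambda>_add \<Lambda>_0)

lemma \<Lambda>_const: "\<Lambda> [:c:] = c"
  using \<Lambda>_smult[of c 1] \<Lambda>_one by (simp add: one_pCons)

lemma \<Lambda>_mono: "(\<And>z. \<bar>z\<bar> \<le> 1 \<Longrightarrow> poly F z \<le> poly G z) \<Longrightarrow> \<Lambda> F \<le> \<Lambda> G"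
  using \<Lambda>_pos[of "G - F"] by (simp add: \<Lambda>_diff)

lemma \<Lambda>_abs: "(\<And>z. \<bar>z\<bar> \<le> 1 \<Longrightarrow> \<bar>poly F z\<bar> \<le> B) \<Longrightarrow> \<bar>\<Lambda> F\<bar> \<le> B"
proof -
  assume B: "\<And>z. \<bar>z\<bar> \<le> 1 \<Longrightarrow> \<bar>poly F z\<bar> \<le> B"
  have "poly F z \<le> poly [:B:] z" "poly [:-B:] z \<le> poly F z" if "\<bar>z\<bar> \<le> 1" for z
    using B[OF that] by auto
  then have "\<Lambda> F \<le> \<Lambda> [:B:]" "\<Lambda> [:-B:] \<le> \<Lambda> F" by (blast intro: \<Lambda>_mono)+
  then show ?thesis unfolding \<Lambda>_const by linarith
qed

text \<open>\<open>\<Lambda>\<close> acts on polynomials only. A partial sum plus the tail of the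
  majorant is a polynomial that is nonnegative for \<open>\<bar>z\<bar> \<le> 1\<close>, so
  positivity applies to it, and the tail tends to 0.\<close>

lemma \<Lambda>_series_nonneg:
  assumes B: "\<And>n z. \<bar>z\<bar> \<le> 1 \<Longrightarrow> \<bar>poly (F n) z\<bar> \<le> B n" and sB: "summable B"
    and pos: "\<And>z. \<bar>z\<bar> \<le> 1 \<Longrightarrow> (\<Sum>n. poly (F n) z) \<ge> 0"
  shows "summable (\<lambda>n. \<Lambda> (F n))" "(\<Sum>n. \<Lambda> (F n)) \<ge> 0"
proof -
  have LB: "\<bar>\<Lambda> (F n)\<bar> \<le> B n" for n by (rule \<Lambda>_abs) (rule B)
  show s: "summable (\<lambda>n. \<Lambda> (F n))"
    by (rule summable_comparison_test'[OF sB]) (use LB in simp)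
  have "- (\<Sum>n. B (n + N)) \<le> (\<Sum>n<N. \<Lambda> (F n))" for N
  proof -
    have "poly [:- (\<Sum>n. B (n + N)):] z \<le> poly (\<Sum>n<N. F n) z" if z: "\<bar>z\<bar> \<le> 1" for z
    proof -
      have sz: "summable (\<lambda>n. poly (F n) z)"
        by (rule summable_comparison_test'[OF sB]) (use B[OF z] in simp)
      have sBN: "summable (\<lambda>n. B (n + N))" using sB by (rule summable_ignore_initial_segment)
      have szN: "summable (\<lambda>n. poly (F (n + N)) z)" using sz by (rule summable_ignore_initial_segment)
      have "(\<Sum>n. poly (F n) z) = (\<Sum>n. poly (F (n + N)) z) + (\<Sum>n<N. poly (F n) z)"
        by (rule suminf_split_initial_segment[OF sz])
      moreover have "(\<Sum>n. poly (F (n + N)) z) \<le> (\<Sum>n. B (n + N))"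
        by (rule suminf_le[OF _ szN sBN]) (use B[OF z] abs_le_D1 in blast)
      ultimately show ?thesis using pos[OF z] by (simp add: poly_sum)
    qed
    from \<Lambda>_mono[OF this] show ?thesis by (simp only: \<Lambda>_const \<Lambda>_sum)
  qed
  moreover have "(\<lambda>N. - (\<Sum>n. B (n + N))) \<longlonglongrightarrow> - 0"
    by (intro tendsto_minus suminf_exist_split2[OF sB])
  moreover have "(\<lambda>N. \<Sum>n<N. \<Lambda> (F n)) \<longlonglongrightarrow> (\<Sum>n. \<Lambda> (F n))"
    using summable_LIMSEQ[OF s] .
  ultimately have "- 0 \<le> (\<Sum>n. \<Lambda> (F n))" by (intro LIMSEQ_le) auto
  then show "(\<Sum>n. \<Lambda> (F n)) \<ge> 0" by simp
qed

text \<open>The value of the functional at the Poisson kernel with parameter \<open>exp (- t)\<close>\<close>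

definition abel :: "real \<Rightarrow> real \<Rightarrow> real" where
  "abel l t = (\<Sum>n. \<Lambda> (zonal l n) * exp (- t) ^ n)"

lemma zonal_scaled_bound:
  assumes "l \<ge> 0" "\<bar>z\<bar> \<le> 1" "\<rho> \<ge> 0"
  shows "\<bar>poly (smult (\<rho> ^ n) (zonal l n)) z\<bar> \<le> zonal_bd l n * \<rho> ^ n"
  using zonal_bound[OF assms(1,2), of n] assms(3) by (simp add: abs_mult mult.commute[of "zonal_bd l n"] mult_left_mono)

lemma abel_summable:
  assumes l: "l \<ge> 0" and t: "t > 0"
  shows "summable (\<lambda>n. \<bar>\<Lambda> (zonal l n)\<bar> * exp (- t) ^ n)"
proof (rule summable_comparison_test'[OF zonal_bd_summable[of "exp (- t)" l]])
  fix n
  have "\<bar>\<Lambda> (zonal l n)\<bar> \<le> zonal_bd l n" by (rule \<Lambda>_abs) (rule zonal_bound[OF l])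
  then show "norm (\<bar>\<Lambda> (zonal l n)\<bar> * exp (- t) ^ n) \<le> zonal_bd l n * exp (- t) ^ n"
    by (simp add: mult_right_mono)
qed (use t in simp)

text \<open>Lets a pointwise inequality between Poisson kernels and a polynomial be applied under
  \<open>\<Lambda>\<close>, although the Poisson kernel is not a polynomial: the difference of both
  sides is a dominated series of polynomials with nonnegative sum.\<close>

lemma abel_ge:
  assumes l: "l \<ge> 0" and t: "t > 0" and d: "d > 0"
    and le: "\<And>z. \<bar>z\<bar> \<le> 1 \<Longrightarrow> poly G z + c * poisson l (exp (- d)) z \<le> a * poisson l (exp (- t)) z"
  shows "\<Lambda> G + c * abel l d \<le> a * abel l t"
proof -
  define F where "F n = smult (a * exp (- t) ^ n) (zonal l n) - smult (c * exp (- d) ^ n) (zonal l n) - (if n = 0 then G else 0)" for n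
  obtain BG where BG: "\<And>z. \<bar>z\<bar> \<le> 1 \<Longrightarrow> \<bar>poly G z\<bar> \<le> BG"
  proof -
    have "compact (poly G ` {-1..1})" by (intro compact_continuous_image continuous_intros) auto
    then obtain B where "\<And>z. z \<in> {-1..1} \<Longrightarrow> norm (poly G z) \<le> B"
      using compact_imp_bounded bounded_iff by (metis imageI)
    then show ?thesis using that by (auto simp: abs_le_iff)
  qed
  define B where "B n = \<bar>a\<bar> * (zonal_bd l n * exp (- t) ^ n) + \<bar>c\<bar> * (zonal_bd l n * exp (- d) ^ n) + (if n = 0 then BG else 0)" for n
  have s0: "(\<lambda>n. (if n = 0 then x else 0)) sums x" for x :: real
    using sums_If_finite_set[of "{0::nat}" "\<lambda>_. x"] by simp
  have sB: "summable B" unfolding B_def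
    using t d s0[of BG] by (intro summable_add summable_mult zonal_bd_summable) (auto simp: sums_iff)
  have bd: "\<bar>poly (F n) z\<bar> \<le> B n" if z: "\<bar>z\<bar> \<le> 1" for n z
  proof -
    have 1: "\<bar>a * (exp (- t) ^ n * poly (zonal l n) z)\<bar> \<le> \<bar>a\<bar> * (zonal_bd l n * exp (- t) ^ n)"
      using zonal_scaled_bound[OF l z, of "exp (- t)" n] by (simp add: abs_mult mult_left_mono)
    have 2: "\<bar>c * (exp (- d) ^ n * poly (zonal l n) z)\<bar> \<le> \<bar>c\<bar> * (zonal_bd l n * exp (- d) ^ n)"
      using zonal_scaled_bound[OF l z, of "exp (- d)" n] by (simp add: abs_mult mult_left_mono)
    have 3: "\<bar>poly (if n = 0 then G else 0) z\<bar> \<le> (if n = 0 then BG else 0)" using BG[OF z] by simp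
    have "poly (F n) z = a * (exp (- t) ^ n * poly (zonal l n) z) - c * (exp (- d) ^ n * poly (zonal l n) z) - poly (if n = 0 then G else 0) z"
      by (simp add: F_def)
    then show ?thesis using 1 2 3 unfolding B_def by linarith
  qed
  have sz: "(\<lambda>n. poly (F n) z) sums (a * poisson l (exp (- t)) z - c * poisson l (exp (- d)) z - poly G z)" if z: "\<bar>z\<bar> \<le> 1" for z
  proof -
    have "(\<lambda>n. a * (poly (zonal l n) z * exp (- t) ^ n) - c * (poly (zonal l n) z * exp (- d) ^ n) - (if n = 0 then poly G z else 0)) sums
      (a * poisson l (exp (- t)) z - c * poisson l (exp (- d)) z - poly G z)"
      using t d by (intro sums_diff sums_mult zonal_sums l z s0) auto
    moreover have "poly (F n) z = a * (poly (zonal l n) z * exp (- t) ^ n) - c * (poly (zonal l n) z * exp (- d) ^ n) - (if n = 0 then poly G z else 0)" for n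
      by (simp add: F_def)
    ultimately show ?thesis by simp
  qed
  have ps: "(\<Sum>n. poly (F n) z) \<ge> 0" if z: "\<bar>z\<bar> \<le> 1" for z
    using sz[OF z] le[OF z] by (simp add: sums_iff)
  have "(\<Sum>n. \<Lambda> (F n)) \<ge> 0"
    by (rule \<Lambda>_series_nonneg(2)[where F = F and B = B]) (use bd sB ps in auto)
  moreover have "(\<lambda>n. \<Lambda> (F n)) sums (a * abel l t - c * abel l d - \<Lambda> G)"
  proof -
    have sm: "(\<lambda>n. \<Lambda> (zonal l n) * exp (- x) ^ n) sums abel l x" if "x > 0" for x
    proof -
      have "summable (\<lambda>n. \<bar>\<Lambda> (zonal l n) * exp (- x) ^ n\<bar>)" using abel_summable[OF l that] by (simp add: abs_mult)
      then show ?thesis unfolding abel_def by (rule summable_sums[OF summable_rabs_cancel])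
    qed
    have "(\<lambda>n. a * (\<Lambda> (zonal l n) * exp (- t) ^ n) - c * (\<Lambda> (zonal l n) * exp (- d) ^ n) - (if n = 0 then \<Lambda> G else 0)) sums (a * abel l t - c * abel l d - \<Lambda> G)"
      using t d by (intro sums_diff sums_mult sm s0)
    moreover have "\<Lambda> (F n) = a * (\<Lambda> (zonal l n) * exp (- t) ^ n) - c * (\<Lambda> (zonal l n) * exp (- d) ^ n) - (if n = 0 then \<Lambda> G else 0)" for n
      by (simp add: F_def \<Lambda>_diff \<Lambda>_smult \<Lambda>_0)
    ultimately show ?thesis by simp
  qed
  ultimately show ?thesis by (simp add: sums_iff)
qed

end

text \<open>The Poisson kernel is an Abel sum of Cesaro sums; truncating that series, rather than the expansion in
  zonal polynomials, keeps the truncation nonnegative.\<close>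

definition trunc :: "real \<Rightarrow> real \<Rightarrow> nat \<Rightarrow> real \<Rightarrow> real poly" where
  "trunc l c N t = smult ((1 - exp (- t)) powr c) (\<Sum>k\<le>N. smult (exp (- t) ^ k) (cesaro l c k))"

text \<open>Beyond index \<open>N\<close> one has \<open>r ^ n \<le> (r / s) ^ N * s ^ n\<close>.
  Because the coefficients are nonnegative, the tail at \<open>r\<close> is thus controlled by the
  whole series at \<open>s\<close>.\<close>

lemma suminf_tail_weighted:
  fixes a :: "nat \<Rightarrow> real"
  assumes a: "\<And>n. a n \<ge> 0" and r: "0 < r" "r \<le> s" 
    and ss: "(\<lambda>n. a n * s ^ n) sums S" and rr: "(\<lambda>n. a n * r ^ n) sums R"
  shows "R - (\<Sum>k\<le>N. a k * r ^ k) \<le> (r / s) ^ N * S"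
proof -
  have s: "s > 0" using r by simp
  have q: "0 \<le> r / s" "r / s \<le> 1" using r by auto
  have "(\<Sum>n. a (n + Suc N) * r ^ (n + Suc N)) \<le> (\<Sum>n. (r / s) ^ N * (a (n + Suc N) * s ^ (n + Suc N)))"
  proof (rule suminf_le)
    fix n
    have "r ^ (n + Suc N) = (r / s) ^ (n + Suc N) * s ^ (n + Suc N)" using s by (simp add: power_divide)
    also have "\<dots> \<le> (r / s) ^ N * s ^ (n + Suc N)"
      using q s by (intro mult_right_mono power_decreasing) auto
    finally show "a (n + Suc N) * r ^ (n + Suc N) \<le> (r / s) ^ N * (a (n + Suc N) * s ^ (n + Suc N))"
      using a[of "n + Suc N"] by (metis mult.left_commute mult_left_mono)
  next
    show "summable (\<lambda>n. a (n + Suc N) * r ^ (n + Suc N))"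
      using rr by (intro summable_ignore_initial_segment[of "\<lambda>n. a n * r ^ n"]) (simp add: sums_iff)
    show "summable (\<lambda>n. (r / s) ^ N * (a (n + Suc N) * s ^ (n + Suc N)))"
      using ss by (intro summable_mult summable_ignore_initial_segment[of "\<lambda>n. a n * s ^ n"]) (simp add: sums_iff)
  qed
  also have "\<dots> = (r / s) ^ N * (\<Sum>n. a (n + Suc N) * s ^ (n + Suc N))"
    using ss by (intro suminf_mult summable_ignore_initial_segment[of "\<lambda>n. a n * s ^ n"]) (simp add: sums_iff)
  also have "\<dots> \<le> (r / s) ^ N * S"
  proof (rule mult_left_mono)
    have sS: "summable (\<lambda>n. a n * s ^ n)" "(\<Sum>n. a n * s ^ n) = S" using ss by (auto simp: sums_iff)
    have "0 \<le> (\<Sum>n<Suc N. a n * s ^ n)" using a s by (intro sum_nonneg) auto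
    then show "(\<Sum>n. a (n + Suc N) * s ^ (n + Suc N)) \<le> S"
      using suminf_split_initial_segment[OF sS(1), of "Suc N"] sS(2) by linarith
  qed (use q in simp)
  finally have 1: "(\<Sum>n. a (n + Suc N) * r ^ (n + Suc N)) \<le> (r / s) ^ N * S" .
  have sR: "summable (\<lambda>n. a n * r ^ n)" "(\<Sum>n. a n * r ^ n) = R" using rr by (auto simp: sums_iff)
  have "R = (\<Sum>n. a (n + Suc N) * r ^ (n + Suc N)) + (\<Sum>n<Suc N. a n * r ^ n)"
    using suminf_split_initial_segment[OF sR(1), of "Suc N"] sR(2) by simp
  with 1 show ?thesis by (simp only: lessThan_Suc_atMost)
qed

lemma poly_trunc: "poly (trunc l c N t) z = (1 - exp (- t)) powr c * (\<Sum>k\<le>N. poly (cesaro l c k) z * exp (- t) ^ k)"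
  by (simp add: trunc_def poly_sum mult.commute)

lemma cesaro_sums_exp:
  assumes l: "l \<ge> 0" and c: "c \<ge> 0" and z: "\<bar>z\<bar> \<le> 1" and t: "t > 0"
  shows "(\<lambda>n. poly (cesaro l c n) z * exp (- t) ^ n) sums (poisson l (exp (- t)) z * (1 - exp (- t)) powr (- c))"
  using t by (intro cesaro_sums l c z) auto

lemma trunc_le:
  assumes l: "l \<ge> 0" and c: "c \<ge> 2 * l + 4" and z: "\<bar>z\<bar> \<le> 1" and t: "t > 0"
  shows "poly (trunc l c N t) z \<le> poisson l (exp (- t)) z"
proof -
  have c0: "c \<ge> 0" using l c by simp
  have "(\<Sum>k\<le>N. poly (cesaro l c k) z * exp (- t) ^ k) \<le> poisson l (exp (- t)) z * (1 - exp (- t)) powr (- c)"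
    using cesaro_sums_exp[OF l c0 z t] sum_le_suminf[of "\<lambda>n. poly (cesaro l c n) z * exp (- t) ^ n" "{..N}"] cesaro_nonneg[OF l c z]
    by (simp add: sums_iff)
  then have "(1 - exp (- t)) powr c * (\<Sum>k\<le>N. poly (cesaro l c k) z * exp (- t) ^ k) \<le> (1 - exp (- t)) powr c * (poisson l (exp (- t)) z * (1 - exp (- t)) powr (- c))"
    by (rule mult_left_mono) simp
  also have "\<dots> = poisson l (exp (- t)) z * ((1 - exp (- t)) powr c * (1 - exp (- t)) powr (- c))" by simp
  also have "(1 - exp (- t)) powr c * (1 - exp (- t)) powr (- c) = 1"
    using t by (simp flip: powr_add)
  finally show ?thesis by (simp add: poly_trunc)
qed

text \<open>Nonnegative Cesaro sums bound the tail at time \<open>t\<close> by the full Poisson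
  kernel at the earlier time \<open>d\<close>, with an exponentially small factor. The quotient of
  powers is the price for the different normalisations at the two times.\<close>

lemma trunc_tail:
  assumes l: "l \<ge> 0" and c: "c \<ge> 2 * l + 4" and z: "\<bar>z\<bar> \<le> 1" and d: "0 < d" "d \<le> t"
  shows "poisson l (exp (- t)) z - poly (trunc l c N t) z \<le> ((1 - exp (- t)) / (1 - exp (- d))) powr c * exp (- (t - d) * real N) * poisson l (exp (- d)) z"
proof -
  have c0: "c \<ge> 0" using l c by simp
  have t: "t > 0" using d by simp
  define A where "A x = poisson l (exp (- x)) z * (1 - exp (- x)) powr (- c)" for x
  have e: "(1 - exp (- x)) powr c * A x = poisson l (exp (- x)) z" if "x > 0" for x
  proof -
    have "(1 - exp (- x)) powr c * (1 - exp (- x)) powr (- c) = 1"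
      using that by (simp flip: powr_add)
    then show ?thesis by (simp add: A_def mult.left_commute)
  qed
  have "A t - (\<Sum>k\<le>N. poly (cesaro l c k) z * exp (- t) ^ k) \<le> (exp (- t) / exp (- d)) ^ N * A d"
    unfolding A_def using d 
    by (intro suminf_tail_weighted cesaro_nonneg[OF l c z] cesaro_sums_exp[OF l c0 z]) auto
  also have "(exp (- t) / exp (- d)) ^ N = exp (- (t - d) * real N)"
    by (simp add: exp_diff[symmetric] exp_of_nat_mult[symmetric] mult.commute)
  finally have "(1 - exp (- t)) powr c * (A t - (\<Sum>k\<le>N. poly (cesaro l c k) z * exp (- t) ^ k)) \<le> (1 - exp (- t)) powr c * (exp (- (t - d) * real N) * A d)"
    by (rule mult_left_mono) simp
  then have "poisson l (exp (- t)) z - poly (trunc l c N t) z \<le> (1 - exp (- t)) powr c * (exp (- (t - d) * real N) * A d)"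
    unfolding right_diff_distrib e[OF t] poly_trunc .
  also have "\<dots> = ((1 - exp (- t)) / (1 - exp (- d))) powr c * exp (- (t - d) * real N) * poisson l (exp (- d)) z"
  proof -
    have "((1 - exp (- t)) / (1 - exp (- d))) powr c = (1 - exp (- t)) powr c * (1 - exp (- d)) powr (- c)"
      using d by (simp add: powr_divide powr_minus_divide)
    then show ?thesis by (simp add: A_def)
  qed
  finally show ?thesis .
qed

lemma smult_sum_right: "smult c (\<Sum>i\<in>A. F i) = (\<Sum>i\<in>A. smult c (F i))"
  by (induction A rule: infinite_finite_induct) (auto simp: smult_add_right)

lemma trunc_zonal:
  assumes c: "c \<ge> 0" and t: "t > 0"
  obtains m where "trunc l c N t = (\<Sum>k\<le>N. smult (m k) (zonal l k))" "\<And>k. 0 \<le> m k" "\<And>k. m k \<le> exp (- t) ^ k"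
proof -
  define \<rho> where "\<rho> = exp (- t)"
  have r: "0 < \<rho>" "\<rho> < 1" using t by (auto simp: \<rho>_def)
  \<comment> \<open>The truncation cuts the binomial series of
    \<open>(1 - \<rho>) powr (- c)\<close> short; with the full series \<open>m k\<close> would be
    exactly \<open>\<rho> ^ k\<close>.\<close>
  define m where "m k = (1 - \<rho>) powr c * (\<Sum>j\<in>{k..N}. \<rho> ^ j * rising_binom c (j - k))" for k
  have "(\<Sum>k\<le>N. smult (\<rho> ^ k) (cesaro l c k)) = (\<Sum>j\<le>N. \<Sum>k\<le>j. smult (\<rho> ^ j * rising_binom c (j - k)) (zonal l k))"
    by (simp add: cesaro_def smult_sum_right)
  also have "\<dots> = (\<Sum>k\<le>N. \<Sum>j\<in>{k..N}. smult (\<rho> ^ j * rising_binom c (j - k)) (zonal l k))"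
    by (subst sum.Sigma, simp, simp, subst sum.Sigma, simp, simp)
       (intro sum.reindex_bij_witness[of _ "\<lambda>(k, j). (j, k)" "\<lambda>(j, k). (k, j)"], auto)
  finally have "trunc l c N t = (\<Sum>k\<le>N. smult (m k) (zonal l k))"
    by (simp add: trunc_def \<rho>_def[symmetric] m_def smult_sum smult_sum_right sum_distrib_left)
  moreover have "0 \<le> m k" for k
    unfolding m_def using r c by (intro mult_nonneg_nonneg sum_nonneg rising_binom_nonneg) auto
  moreover have "m k \<le> \<rho> ^ k" for k
  proof -
    have "(\<Sum>j\<in>{k..N}. \<rho> ^ j * rising_binom c (j - k)) = (\<Sum>i\<in>{..<Suc N - k}. \<rho> ^ k * (rising_binom c i * \<rho> ^ i))"
      by (intro sum.reindex_bij_witness[of _ "\<lambda>i. i + k" "\<lambda>j. j - k"]) (auto simp: power_add[symmetric])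
    also have "\<dots> = \<rho> ^ k * (\<Sum>i\<in>{..<Suc N - k}. rising_binom c i * \<rho> ^ i)" by (simp add: sum_distrib_left)
    also have "\<dots> \<le> \<rho> ^ k * (1 - \<rho>) powr (- c)"
    proof (rule mult_left_mono)
      have "(\<lambda>n. rising_binom c n * \<rho> ^ n) sums ((1 - \<rho>) powr (- c))" using r by (intro rising_binom_sums) simp
      then show "(\<Sum>i\<in>{..<Suc N - k}. rising_binom c i * \<rho> ^ i) \<le> (1 - \<rho>) powr (- c)"
        using sum_le_suminf[of "\<lambda>n. rising_binom c n * \<rho> ^ n" "{..<Suc N - k}"] r rising_binom_nonneg[OF c] by (simp add: sums_iff)
    qed (use r in simp)
    finally have "m k \<le> (1 - \<rho>) powr c * (\<rho> ^ k * (1 - \<rho>) powr (- c))"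
      unfolding m_def by (rule mult_left_mono) simp
    also have "\<dots> = \<rho> ^ k * ((1 - \<rho>) powr c * (1 - \<rho>) powr (- c))" by simp
    also have "(1 - \<rho>) powr c * (1 - \<rho>) powr (- c) = 1" using r by (simp flip: powr_add)
    finally show ?thesis by simp
  qed
  ultimately show ?thesis using that[of m] by (simp add: \<rho>_def)
qed

text \<open>With this choice of \<open>N\<close> the truncated series still carries at least half of the Poisson kernel at time \<open>d\<close>.\<close>

definition trunc_ok :: "real \<Rightarrow> nat \<Rightarrow> real \<Rightarrow> bool" where
  "trunc_ok l N d \<longleftrightarrow> 0 < d \<and> d \<le> 1 \<and> exp (- (d * real N / 2)) * 2 powr (2 * l + 4) * doubling_const l * 2 powr (2 * l + 1) \<le> 1/2"

context pos_fun
begin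

text \<open>\<open>trunc_tail\<close> from time \<open>d / 2\<close> to \<open>d\<close>, then
  doubling back from \<open>d / 2\<close> to \<open>d\<close>; \<open>trunc_ok\<close> says that the
  product of the factors is at most one half.\<close>

lemma trunc_half:
  assumes l: "l \<ge> 0" and ok: "trunc_ok l N d" and z: "\<bar>z\<bar> \<le> 1"
  shows "poisson l (exp (- d)) z \<le> 2 * poly (trunc l (2 * l + 4) N d) z"
proof -
  define c where "c = 2 * l + 4"
  have d: "0 < d" "d \<le> 1" and e: "exp (- (d * real N / 2)) * 2 powr c * doubling_const l * 2 powr (2 * l + 1) \<le> 1/2"
    using ok by (auto simp: trunc_ok_def c_def)
  have p0: "poisson l (exp (- d)) z \<ge> 0" using d by (intro poisson_nonneg) auto
  have "poisson l (exp (- d)) z - poly (trunc l c N d) z \<le> ((1 - exp (- d)) / (1 - exp (- (d / 2)))) powr c * exp (- (d - d / 2) * real N) * poisson l (exp (- (d / 2))) z"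
    using d by (intro trunc_tail l z) (auto simp: c_def)
  also have "\<dots> \<le> 2 powr c * exp (- (d - d / 2) * real N) * (doubling_const l * 2 powr (2 * l + 1) * poisson l (exp (- d)) z)"
  proof (intro mult_mono)
    have "exp (- d) = exp (- (d / 2)) * exp (- (d / 2))" by (simp flip: exp_add)
    then have "1 - exp (- d) = (1 - exp (- (d / 2))) * (1 + exp (- (d / 2)))" by (simp add: algebra_simps)
    moreover have "1 - exp (- (d / 2)) > 0" using d by simp
    ultimately have "(1 - exp (- d)) / (1 - exp (- (d / 2))) = 1 + exp (- (d / 2))" by simp
    then show "((1 - exp (- d)) / (1 - exp (- (d / 2)))) powr c \<le> 2 powr c"
      using d l by (intro powr_mono2) (auto simp: c_def add_nonneg_nonneg)
    show "poisson l (exp (- (d / 2))) z \<le> doubling_const l * 2 powr (2 * l + 1) * poisson l (exp (- d)) z"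
      using poisson_doubling[OF l z, of "d / 2" d] d by simp
  qed (use d in \<open>auto intro!: poisson_nonneg mult_nonneg_nonneg simp: doubling_const_pos less_imp_le\<close>)
  also have "\<dots> = (exp (- (d * real N / 2)) * 2 powr c * doubling_const l * 2 powr (2 * l + 1)) * poisson l (exp (- d)) z"
    by (simp add: field_simps)
  also have "\<dots> \<le> 1/2 * poisson l (exp (- d)) z"
    using e p0 by (rule mult_right_mono)
  finally show ?thesis by (simp add: c_def)
qed

lemma abel_nonneg:
  assumes l: "l \<ge> 0" and t: "t > 0"
  shows "abel l t \<ge> 0"
proof -
  have "\<Lambda> 0 + 0 * abel l t \<le> 1 * abel l t"
    using t by (intro abel_ge l) (auto intro!: poisson_nonneg)
  then show ?thesis by (simp add: \<Lambda>_0)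
qed

lemma zonal_0 [simp]: "zonal l 0 = 1"
  by (simp add: zonal_def)

lemma \<Lambda>_zon_sum:
  assumes m: "\<And>k. 0 \<le> m k" "\<And>k. m k \<le> exp (- t) ^ k" and t: "t \<ge> 0"
    and e: "\<And>j. 1 \<le> j \<Longrightarrow> j \<le> N \<Longrightarrow> \<bar>\<Lambda> (zonal l j)\<bar> \<le> e" "e \<ge> 0"
  shows "\<bar>\<Lambda> (\<Sum>k\<le>N. smult (m k) (zonal l k)) - m 0\<bar> \<le> e * real N * exp (- t)"
proof -
  have "\<Lambda> (\<Sum>k\<le>N. smult (m k) (zonal l k)) = (\<Sum>k\<le>N. m k * \<Lambda> (zonal l k))"
    by (simp add: \<Lambda>_sum \<Lambda>_smult)
  also have "\<dots> = m 0 + (\<Sum>k\<in>{1..N}. m k * \<Lambda> (zonal l k))"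
    by (simp add: atMost_atLeast0 sum.atLeast_Suc_atMost \<Lambda>_one)
  finally have "\<bar>\<Lambda> (\<Sum>k\<le>N. smult (m k) (zonal l k)) - m 0\<bar> = \<bar>\<Sum>k\<in>{1..N}. m k * \<Lambda> (zonal l k)\<bar>" by simp
  also have "\<dots> \<le> (\<Sum>k\<in>{1..N}. \<bar>m k * \<Lambda> (zonal l k)\<bar>)" by (rule sum_abs)
  also have "\<dots> \<le> (\<Sum>k\<in>{1..N}. exp (- t) * e)"
  proof (rule sum_mono)
    fix k assume k: "k \<in> {1..N}"
    have "m k \<le> exp (- t) ^ k" by (rule m)
    also have "\<dots> \<le> exp (- t) ^ 1" using k t by (intro power_decreasing) auto
    finally show "\<bar>m k * \<Lambda> (zonal l k)\<bar> \<le> exp (- t) * e"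
      unfolding abs_mult using m(1)[of k] e k by (intro mult_mono) auto
  qed
  finally show ?thesis by (simp add: mult_ac)
qed

text \<open>The Poisson kernel at time \<open>d\<close> is at most twice its truncation. On the
  truncation \<open>\<Lambda>\<close> gives the coefficient of degree 0, at most 1, plus an error of
  at most \<open>e * N \<le> 1\<close> from the other degrees.\<close>

lemma abel_at:
  assumes l: "l \<ge> 0" and ok: "trunc_ok l N d"
    and e: "\<And>j. 1 \<le> j \<Longrightarrow> j \<le> N \<Longrightarrow> \<bar>\<Lambda> (zonal l j)\<bar> \<le> e" "e \<ge> 0" and eN: "e * real N \<le> 1"
  shows "abel l d \<le> 4"
proof -
  have d: "0 < d" "d \<le> 1" using ok by (auto simp: trunc_ok_def)
  have c0: "2 * l + 4 \<ge> 0" using l by simp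
  obtain m where m: "trunc l (2 * l + 4) N d = (\<Sum>k\<le>N. smult (m k) (zonal l k))" "\<And>k. 0 \<le> m k" "\<And>k. m k \<le> exp (- d) ^ k"
    using trunc_zonal[OF c0 d(1)] by blast
  have "\<Lambda> (smult (-1) (trunc l (2 * l + 4) N d)) + 1/2 * abel l d \<le> 0 * abel l d"
  proof (rule abel_ge[OF l d(1) d(1)])
    fix z :: real assume z: "\<bar>z\<bar> \<le> 1"
    show "poly (smult (- 1) (trunc l (2 * l + 4) N d)) z + 1 / 2 * poisson l (exp (- d)) z \<le> 0 * poisson l (exp (- d)) z"
      using trunc_half[OF l ok z] by simp
  qed
  then have "abel l d \<le> 2 * \<Lambda> (trunc l (2 * l + 4) N d)" unfolding \<Lambda>_smult by linarith
  moreover have "\<bar>\<Lambda> (trunc l (2 * l + 4) N d) - m 0\<bar> \<le> e * real N * exp (- d)"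
    unfolding m(1) using d by (intro \<Lambda>_zon_sum m e) auto
  moreover have "e * real N * exp (- d) \<le> 1 * 1"
    using eN d e(2) by (intro mult_mono) auto
  moreover have "m 0 \<le> 1" using m(3)[of 0] by simp
  ultimately show ?thesis by linarith
qed

lemma abel_small:
  assumes l: "l \<ge> 0" and ok: "trunc_ok l N d"
    and e: "\<And>j. 1 \<le> j \<Longrightarrow> j \<le> N \<Longrightarrow> \<bar>\<Lambda> (zonal l j)\<bar> \<le> e" "e \<ge> 0" and eN: "e * real N \<le> 1"
    and t: "0 < t" "t \<le> d"
  shows "abel l t \<le> 4 * doubling_const l * (d / t) powr (2 * l + 1)"
proof -
  have d: "0 < d" "d \<le> 1" using ok by (auto simp: trunc_ok_def)
  have "\<Lambda> 0 + 1 * abel l t \<le> (doubling_const l * (d / t) powr (2 * l + 1)) * abel l d"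
    using poisson_doubling[OF l _ t(1) t(2) d(2)] by (intro abel_ge l t d) auto
  also have "\<dots> \<le> (doubling_const l * (d / t) powr (2 * l + 1)) * 4"
    using abel_at[OF l ok e eN] by (intro mult_left_mono) (auto simp: doubling_const_pos less_imp_le)
  finally show ?thesis by (simp add: \<Lambda>_0 mult_ac)
qed

text \<open>The number \<open>m 0\<close> depends on \<open>t\<close> and \<open>N\<close> but not
  on \<open>\<Lambda>\<close>. When \<open>\<Lambda>\<close> later varies with the point
  \<open>y\<close>, it is a constant in \<open>y\<close> and disappears against functions of mean
  zero.\<close>

lemma abel_large:
  assumes l: "l \<ge> 0" and ok: "trunc_ok l N d"
    and e: "\<And>j. 1 \<le> j \<Longrightarrow> j \<le> N \<Longrightarrow> \<bar>\<Lambda> (zonal l j)\<bar> \<le> e" "e \<ge> 0" and eN: "e * real N \<le> 1"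
    and t: "d \<le> t" 
    and m: "trunc l (2 * l + 4) N t = (\<Sum>k\<le>N. smult (m k) (zonal l k))" "\<And>k. 0 \<le> m k" "\<And>k. m k \<le> exp (- t) ^ k"
  shows "\<bar>abel l t - m 0\<bar> \<le> e * real N * exp (- t) + 4 * (2 * t / d) powr (2 * l + 4) * exp (- (t - d) * real N)"
proof -
  define c where "c = 2 * l + 4"
  define G where "G = trunc l c N t"
  have c: "c \<ge> 2 * l + 4" by (simp add: c_def)
  have d: "0 < d" "d \<le> 1" using ok by (auto simp: trunc_ok_def)
  have t0: "t > 0" using d t by simp
  have "\<Lambda> G + 0 * abel l d \<le> 1 * abel l t"
    unfolding G_def using trunc_le[OF l c _ t0] by (intro abel_ge l d t0) auto
  then have 1: "\<Lambda> G \<le> abel l t" by simp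
  define A where "A = ((1 - exp (- t)) / (1 - exp (- d))) powr c * exp (- (t - d) * real N)"
  have "\<Lambda> (smult (-1) G) + 1 * abel l t \<le> A * abel l d"
    unfolding G_def A_def using trunc_tail[OF l c _ d(1) t] by (intro abel_ge l d t0) (simp add: algebra_simps)
  then have "abel l t - \<Lambda> G \<le> A * abel l d" unfolding \<Lambda>_smult by simp
  also have "\<dots> \<le> A * 4"
    using abel_at[OF l ok e eN] by (intro mult_left_mono) (auto simp: A_def)
  also have "\<dots> \<le> ((2 * t / d) powr c * exp (- (t - d) * real N)) * 4"
  proof -
    have "(1 - exp (- t)) / (1 - exp (- d)) \<le> t / (d / 2)"
      using exp_upper[of t] exp_lower[of d] d t0 by (intro frac_le) auto
    then have "((1 - exp (- t)) / (1 - exp (- d))) powr c \<le> (2 * t / d) powr c"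
      using d t0 l by (intro powr_mono2) (auto simp: c_def field_simps)
    then show ?thesis unfolding A_def by (intro mult_right_mono) auto
  qed
  finally have 2: "abel l t - \<Lambda> G \<le> 4 * (2 * t / d) powr c * exp (- (t - d) * real N)" by (simp add: mult_ac)
  have "\<bar>\<Lambda> G - m 0\<bar> \<le> e * real N * exp (- t)"
    unfolding G_def c_def m(1) using t0 by (intro \<Lambda>_zon_sum m e) auto
  then show ?thesis using 1 2 unfolding c_def by linarith
qed

end

text \<open>Pointwise inequality that replaces Jensen's inequality in the passage from \<open>L\<^sub>1\<close> to \<open>L\<^sub>p\<close>\<close>

lemma le_powr_split:
  fixes x a p :: real
  assumes "x \<ge> 0" "a > 0" "p \<ge> 1"
  shows "x \<le> x powr p * a powr (1 - p) + a"
proof (cases "x \<le> a")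
  case False
  then have x: "x > 0" "a < x" using assms by auto
  have "x = x powr p * x powr (1 - p)" using x by (simp flip: powr_add)
  also have "\<dots> \<le> x powr p * a powr (1 - p)"
    using x assms by (intro mult_left_mono powr_mono2') auto
  finally show ?thesis using assms by simp
qed (simp add: add_increasing)

definition nodes_fun :: "('i \<Rightarrow> real) \<Rightarrow> 'i set \<Rightarrow> ('i \<Rightarrow> 'a::euclidean_space) \<Rightarrow> real \<Rightarrow> 'a \<Rightarrow> real poly \<Rightarrow> real" where
  "nodes_fun w I x b y F = (\<Sum>i\<in>I. w i * lift b F (x i) y)"

lemma pos_fun_nodes:
  assumes "finite I" "\<And>i. i \<in> I \<Longrightarrow> w i \<ge> 0" "(\<Sum>i\<in>I. w i) = 1" "\<And>i. i \<in> I \<Longrightarrow> norm (x i) \<le> 1" "norm y \<le> 1" "b \<ge> 1/2"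
  shows "pos_fun (nodes_fun w I x b y)"
proof
  show "nodes_fun w I x b y 1 = 1"
    using assms(3) by (simp add: nodes_fun_def one_pCons lift_const)
  show "nodes_fun w I x b y F \<ge> 0" if "\<And>z. \<bar>z\<bar> \<le> 1 \<Longrightarrow> poly F z \<ge> 0" for F
    unfolding nodes_fun_def using assms that by (intro sum_nonneg mult_nonneg_nonneg lift_nonneg) auto
qed (simp_all add: nodes_fun_def lift_add lift_smult sum.distrib distrib_left sum_distrib_left mult_ac)

lemma pos_fun_lift:
  "norm x \<le> 1 \<Longrightarrow> norm y \<le> 1 \<Longrightarrow> b \<ge> 1/2 \<Longrightarrow> pos_fun (\<lambda>F. lift b F x y)"
  by unfold_locales (auto simp: lift_add lift_smult lift_nonneg one_pCons lift_const)

section \<open>Quadrature with positive weights\<close>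

text \<open>Elimination: a functional that does not vanish at \<open>x0\<close> determines the
  coefficient there, which leaves one functional and one point fewer.\<close>

lemma linear_dependence:
  fixes \<phi> :: "'i \<Rightarrow> 'x \<Rightarrow> real"
  assumes "finite I" "finite X" "card I < card X"
  shows "\<exists>b. (\<exists>x\<in>X. b x \<noteq> 0) \<and> (\<forall>\<alpha>\<in>I. (\<Sum>x\<in>X. b x * \<phi> \<alpha> x) = 0)"
  using assms
proof (induction I arbitrary: X \<phi> rule: finite_induct)
  case empty
  then have "X \<noteq> {}" by auto
  then show ?case by (intro exI[of _ "\<lambda>_. 1"]) auto
next
  case (insert \<alpha> I)
  show ?case
  proof (cases "\<forall>x\<in>X. \<phi> \<alpha> x = 0")
    case True
    have "card I < card X" using insert by simp
    from insert.IH[OF insert.prems(1) this, of \<phi>] show ?thesis using True by auto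
  next
    case False
    then obtain x0 where x0: "x0 \<in> X" "\<phi> \<alpha> x0 \<noteq> 0" by auto
    define X' where "X' = X - {x0}"
    have fX: "finite X'" "X = insert x0 X'" "x0 \<notin> X'" using insert x0 by (auto simp: X'_def)
    have "card I < card X'" using insert.prems insert.hyps x0 by (simp add: X'_def)
    from insert.IH[OF fX(1) this, of "\<lambda>\<beta> x. \<phi> \<beta> x - \<phi> \<beta> x0 * \<phi> \<alpha> x / \<phi> \<alpha> x0"]
    obtain b where b: "\<exists>x\<in>X'. b x \<noteq> 0" and b0: "\<And>\<beta>. \<beta> \<in> I \<Longrightarrow> (\<Sum>x\<in>X'. b x * (\<phi> \<beta> x - \<phi> \<beta> x0 * \<phi> \<alpha> x / \<phi> \<alpha> x0)) = 0" by blast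
    define s where "s = (\<Sum>x\<in>X'. b x * \<phi> \<alpha> x)"
    define b' where "b' x = (if x = x0 then - s / \<phi> \<alpha> x0 else b x)" for x
    have sum': "(\<Sum>x\<in>X. b' x * \<phi> \<beta> x) = (\<Sum>x\<in>X'. b x * \<phi> \<beta> x) - s / \<phi> \<alpha> x0 * \<phi> \<beta> x0" for \<beta>
    proof -
      have "(\<Sum>x\<in>X'. b' x * \<phi> \<beta> x) = (\<Sum>x\<in>X'. b x * \<phi> \<beta> x)" using fX by (intro sum.cong) (auto simp: b'_def)
      then show ?thesis using fX by (simp add: b'_def)
    qed
    have "(\<Sum>x\<in>X. b' x * \<phi> \<beta> x) = 0" if "\<beta> \<in> I" for \<beta>
    proof -
      have "(\<Sum>x\<in>X'. b x * (\<phi> \<beta> x - \<phi> \<beta> x0 * \<phi> \<alpha> x / \<phi> \<alpha> x0)) = (\<Sum>x\<in>X'. b x * \<phi> \<beta> x) - s / \<phi> \<alpha> x0 * \<phi> \<beta> x0"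
        unfolding s_def sum_divide_distrib sum_distrib_right sum_subtractf[symmetric]
        by (intro sum.cong) (auto simp: algebra_simps)
      then show ?thesis using b0[OF that] sum' by simp
    qed
    moreover have "(\<Sum>x\<in>X. b' x * \<phi> \<alpha> x) = 0" using sum' x0 by (simp add: s_def)
    moreover have "\<exists>x\<in>X. b' x \<noteq> 0" using b fX by (auto simp: b'_def)
    ultimately show ?thesis by (intro exI[of _ b']) auto
  qed
qed

lemma caratheodory_reduction:
  fixes \<phi> :: "'i \<Rightarrow> 'x \<Rightarrow> real"
  assumes "finite I" "finite X" "\<And>x. x \<in> X \<Longrightarrow> w x \<ge> 0"
  shows "\<exists>Y v. Y \<subseteq> X \<and> card Y \<le> card I \<and> (\<forall>x\<in>Y. v x \<ge> 0) \<and> (\<forall>\<alpha>\<in>I. (\<Sum>x\<in>Y. v x * \<phi> \<alpha> x) = (\<Sum>x\<in>X. w x * \<phi> \<alpha> x))"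
  using assms(2,3)
proof (induction "card X" arbitrary: X w rule: less_induct)
  case less
  show ?case
  proof (cases "card X \<le> card I")
    case True
    then show ?thesis using less by blast
  next
    case False
    then have "card I < card X" by simp
    from linear_dependence[OF assms(1) less.prems(1) this, of \<phi>]
    obtain b0 where b0: "\<exists>x\<in>X. b0 x \<noteq> 0" "\<And>\<alpha>. \<alpha> \<in> I \<Longrightarrow> (\<Sum>x\<in>X. b0 x * \<phi> \<alpha> x) = 0" by blast
    obtain b where b: "\<exists>x\<in>X. b x > 0" "\<And>\<alpha>. \<alpha> \<in> I \<Longrightarrow> (\<Sum>x\<in>X. b x * \<phi> \<alpha> x) = 0"
    proof (cases "\<exists>x\<in>X. b0 x > 0")
      case True
      then show ?thesis using that b0 by blast
    next
      case False
      then have "\<exists>x\<in>X. - b0 x > 0" using b0(1) by force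
      moreover have "(\<Sum>x\<in>X. - b0 x * \<phi> \<alpha> x) = 0" if "\<alpha> \<in> I" for \<alpha> using b0(2)[OF that] by (simp add: sum_negf)
      ultimately show ?thesis using that[of "\<lambda>x. - b0 x"] by blast
    qed
    define P where "P = {x \<in> X. b x > 0}"
    \<comment> \<open>The largest multiple of the relation that can be subtracted while all weights
      stay nonnegative; at the minimising point the weight becomes 0.\<close>
    define \<theta> where "\<theta> = Min ((\<lambda>x. w x / b x) ` P)"
    have fP: "finite P" "P \<noteq> {}" using less.prems b by (auto simp: P_def)
    then have "\<theta> \<in> (\<lambda>x. w x / b x) ` P" unfolding \<theta>_def by (intro Min_in) auto
    then obtain x1 where x1: "x1 \<in> P" "\<theta> = w x1 / b x1" by auto
    have th: "\<theta> \<le> w x / b x" if "x \<in> P" for x unfolding \<theta>_def using that fP by (intro Min_le) auto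
    have th0: "\<theta> \<ge> 0" using x1 less.prems by (simp add: P_def)
    define w' where "w' x = w x - \<theta> * b x" for x
    have w'0: "w' x \<ge> 0" if "x \<in> X" for x
    proof (cases "b x > 0")
      case True
      then have "\<theta> \<le> w x / b x" using th that by (simp add: P_def)
      then show ?thesis using True by (simp add: w'_def field_simps)
    next
      case False
      then have "\<theta> * b x \<le> 0" using th0 by (simp add: mult_nonneg_nonpos)
      then show ?thesis using less.prems(2)[OF that] by (simp add: w'_def)
    qed
    have w'1: "w' x1 = 0" using x1 by (simp add: w'_def P_def)
    have x1X: "x1 \<in> X" using x1 by (simp add: P_def)
    have "card (X - {x1}) < card X" by (rule card_Diff1_less[OF less.prems(1) x1X])
    moreover have "finite (X - {x1})" using less.prems by simp
    ultimately obtain Y v where Y: "Y \<subseteq> X - {x1}" "card Y \<le> card I" "\<forall>x\<in>Y. v x \<ge> 0"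
      "\<forall>\<alpha>\<in>I. (\<Sum>x\<in>Y. v x * \<phi> \<alpha> x) = (\<Sum>x\<in>X - {x1}. w' x * \<phi> \<alpha> x)"
      using less.hyps[of "X - {x1}" w'] w'0 by auto
    have "(\<Sum>x\<in>X - {x1}. w' x * \<phi> \<alpha> x) = (\<Sum>x\<in>X. w x * \<phi> \<alpha> x)" if "\<alpha> \<in> I" for \<alpha>
    proof -
      have "(\<Sum>x\<in>X - {x1}. w' x * \<phi> \<alpha> x) = (\<Sum>x\<in>X. w' x * \<phi> \<alpha> x)"
        using w'1 less.prems x1X by (simp add: sum.remove[of X x1])
      also have "\<dots> = (\<Sum>x\<in>X. w x * \<phi> \<alpha> x) - \<theta> * (\<Sum>x\<in>X. b x * \<phi> \<alpha> x)"
        by (simp add: w'_def sum_subtractf left_diff_distrib sum_distrib_left mult.assoc)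
      finally show ?thesis using b(2)[OF that] by simp
    qed
    then show ?thesis using Y by (intro exI[of _ Y] exI[of _ v]) auto
  qed
qed

text \<open>Nodes and weights come from a partition of the ball into measurable pieces of radius
  \<open>\<eta>\<close>. They are fixed before \<open>f\<close> and \<open>e\<close>, so that one
  rule serves finitely many kernels and all their parameters at once.\<close>

lemma ball_riemann:
  fixes \<mu> \<eta> e :: real
  assumes mu: "\<mu> \<ge> 0" and eta: "\<eta> > 0" 
  obtains m :: nat and w :: "nat \<Rightarrow> real" and x :: "nat \<Rightarrow> real ^ 'd::finite"
  where "\<And>i. w i \<ge> 0" "\<And>i. norm (x i) \<le> 1" "(\<Sum>i<m. w i) = 1"
    "\<And>f e. continuous_on (cball 0 1) f \<Longrightarrow> (\<And>u v. norm u \<le> 1 \<Longrightarrow> norm v \<le> 1 \<Longrightarrow> dist u v < \<eta> \<Longrightarrow> \<bar>f u - f v\<bar> \<le> e) \<Longrightarrow>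
      \<bar>(LINT y|ball_measure \<mu>. f y) - (\<Sum>i<m. w i * f (x i))\<bar> \<le> e"
proof -
  let ?B = "ball_measure \<mu> :: (real ^ 'd) measure"
  interpret finite_measure ?B by (rule finite_measure_ball[OF mu])
  have "cball (0 :: real ^ 'd) 1 \<subseteq> (\<Union>c\<in>cball 0 1. ball c \<eta>)" using eta by auto
  then obtain C where C: "C \<subseteq> cball (0 :: real ^ 'd) 1" "finite C" "cball 0 1 \<subseteq> (\<Union>c\<in>C. ball c \<eta>)"
    using compactE_image[of "cball (0 :: real ^ 'd) 1" "cball 0 1" "\<lambda>c. ball c \<eta>"] by auto
  obtain m :: nat and c where c: "C = c ` {..<m}"
    using finite_imp_nat_seg_image_inj_on[OF C(2)] by (auto simp: lessThan_def)
  define x where "x i = (if i < m then c i else 0)" for i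
  define U where "U i = (if i < m then cball 0 1 \<inter> ball (x i) \<eta> else {})" for i
  define A where "A = disjointed U"
  have xn: "norm (x i) \<le> 1" for i using C(1) c by (auto simp: x_def)
  have "U i \<in> sets ?B" for i
  proof -
    have "cball 0 1 \<inter> ball (x i) \<eta> \<in> sets ?B"
      unfolding sets_ball_measure by (subst sets_restrict_space_iff) auto
    then show ?thesis by (simp add: U_def)
  qed
  then have As: "A i \<in> sets ?B" for i
    unfolding A_def using sets.range_disjointed_sets[of U ?B] by auto
  have Ad: "disjoint_family A" unfolding A_def by (rule disjoint_family_disjointed)
  have AU: "A i \<subseteq> U i" for i unfolding A_def by (rule disjointed_subset)
  have Acov: "\<exists>i<m. y \<in> A i" if "norm y \<le> 1" for y
  proof -
    have "y \<in> (\<Union>i. U i)"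
    proof -
      obtain c' where "c' \<in> C" "y \<in> ball c' \<eta>" using C(3) \<open>norm y \<le> 1\<close> by auto
      then obtain i where "i < m" "y \<in> ball (x i) \<eta>" using c by (auto simp: x_def)
      then show ?thesis using that by (auto simp: U_def)
    qed
    then have "y \<in> (\<Union>i. A i)" unfolding A_def UN_disjointed_eq .
    then obtain i where "y \<in> A i" by auto
    moreover have "i < m" using AU[of i] calculation by (auto simp: U_def split: if_splits)
    ultimately show ?thesis by auto
  qed
  define w where "w i = measure ?B (A i)" for i
  have step: "(\<Sum>i<m. g i * indicator (A i) y) = g j" if "j < m" "y \<in> A j" for g :: "nat \<Rightarrow> real" and y j
  proof -
    have "g i * indicator (A i) y = (if i = j then g j else 0)" for i
      using Ad that by (auto simp: disjoint_family_on_def indicator_def)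
    then show ?thesis using that by simp
  qed
  have intA: "integrable ?B (\<lambda>y. g * indicator (A i) y)" for g :: real and i
    using As by (intro integrable_mult_right integrable_real_indicator) (auto simp: emeasure_finite less_top[symmetric])
  have stepint: "(LINT y|?B. (\<Sum>i<m. g i * indicator (A i) y)) = (\<Sum>i<m. w i * g i)" for g :: "nat \<Rightarrow> real"
  proof -
    have "A i \<inter> cball 0 1 = A i" for i using AU[of i] by (auto simp: U_def split: if_splits)
    then show ?thesis using intA As by (subst Bochner_Integration.integral_sum) (auto simp: w_def mult.commute)
  qed
  have "(\<Sum>i<m. w i) = (LINT y|?B. (\<Sum>i<m. 1 * indicator (A i) y))" using stepint[of "\<lambda>_. 1"] by simp
  also have "\<dots> = (LINT y|?B. 1)"
  proof (rule Bochner_Integration.integral_cong[OF refl])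
    fix y assume "y \<in> space ?B"
    then obtain j where "j < m" "y \<in> A j" using Acov by auto
    then show "(\<Sum>i<m. 1 * indicator (A i) y) = (1 :: real)" by (rule step)
  qed
  also have "\<dots> = 1" using mu by simp
  finally have w1: "(\<Sum>i<m. w i) = 1" .
  have main: "\<bar>(LINT y|?B. f y) - (\<Sum>i<m. w i * f (x i))\<bar> \<le> e"
    if f: "continuous_on (cball 0 1) f" and uc: "\<And>u v. norm u \<le> 1 \<Longrightarrow> norm v \<le> 1 \<Longrightarrow> dist u v < \<eta> \<Longrightarrow> \<bar>f u - f v\<bar> \<le> e" for f e
  proof -
    let ?s = "\<lambda>y. (\<Sum>i<m. f (x i) * indicator (A i) y)"
    have i1: "integrable ?B f" by (rule integrable_ball_continuous[OF mu f])
    have i2: "integrable ?B ?s" by (intro Bochner_Integration.integrable_sum intA)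
    have "(LINT y|?B. f y) - (\<Sum>i<m. w i * f (x i)) = (LINT y|?B. f y - ?s y)"
      by (simp only: Bochner_Integration.integral_diff[OF i1 i2] stepint)
    also have "\<bar>\<dots>\<bar> \<le> (LINT y|?B. \<bar>f y - ?s y\<bar>)" by (rule integral_abs_bound)
    also have "\<dots> \<le> (LINT y|?B. e)"
    proof (rule integral_mono)
      show "integrable ?B (\<lambda>y. \<bar>f y - ?s y\<bar>)" using i1 i2 by auto
      fix y assume y: "y \<in> space ?B"
      then obtain j where j: "j < m" "y \<in> A j" using Acov by auto
      have "dist y (x j) < \<eta>" using AU[of j] j by (auto simp: U_def dist_commute)
      then have "\<bar>f y - f (x j)\<bar> \<le> e" using uc[of y "x j"] y xn by simp
      then show "\<bar>f y - ?s y\<bar> \<le> e" using step[OF j, of "\<lambda>i. f (x i)"] by simp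
    qed simp
    also have "\<dots> = e" using mu by simp
    finally show ?thesis .
  qed
  show ?thesis by (rule that[of w x m]) (use w1 xn main in \<open>auto simp: w_def\<close>)
qed

lemma card_multi_indices: "card {\<alpha> :: 'd::finite \<Rightarrow> nat. (\<Sum>i\<in>UNIV. \<alpha> i) \<le> n} \<le> (n + 1) ^ CARD('d)"
proof -
  have "{\<alpha> :: 'd \<Rightarrow> nat. (\<Sum>i\<in>UNIV. \<alpha> i) \<le> n} \<subseteq> PiE UNIV (\<lambda>_. {..n})"
  proof
    fix \<alpha> :: "'d \<Rightarrow> nat"
    assume "\<alpha> \<in> {\<alpha>. (\<Sum>i\<in>UNIV. \<alpha> i) \<le> n}"
    then have le: "(\<Sum>i\<in>UNIV. \<alpha> i) \<le> n" by simp
    have "\<alpha> i \<le> n" for i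
      using member_le_sum[of i UNIV \<alpha>] le by simp
    then show "\<alpha> \<in> PiE UNIV (\<lambda>_. {..n})" by (simp add: PiE_UNIV_domain)
  qed
  then have "card {\<alpha> :: 'd \<Rightarrow> nat. (\<Sum>i\<in>UNIV. \<alpha> i) \<le> n} \<le> card (PiE (UNIV :: 'd set) (\<lambda>_. {..n}))"
    by (intro card_mono finite_PiE) auto
  then show ?thesis by (simp add: card_PiE)
qed

text \<open>A Riemann sum for a common modulus of continuity has error at most \<open>e\<close> on
  the kernels of degree 1 to \<open>N\<close>. The reduction keeps its values on all monomials of
  degree at most \<open>N\<close>, of which there are at most \<open>(N + 1) ^ d\<close>; hence the
  error does not change, and the constant monomial keeps the total weight 1.\<close>

lemma ball_quadrature:
  fixes \<mu> e :: real
  assumes mu: "\<mu> \<ge> 0" and e: "e > 0" 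
  obtains J :: "nat set" and w :: "nat \<Rightarrow> real" and x :: "nat \<Rightarrow> real ^ 'd::finite"
  where "finite J" "card J \<le> (N + 1) ^ CARD('d)" "\<And>i. i \<in> J \<Longrightarrow> w i \<ge> 0" "\<And>i. norm (x i) \<le> 1" "(\<Sum>i\<in>J. w i) = 1"
    "\<And>j y. 1 \<le> j \<Longrightarrow> j \<le> N \<Longrightarrow> norm y \<le> 1 \<Longrightarrow> \<bar>\<Sum>i\<in>J. w i * proj_kernel \<mu> j (x i) y\<bar> \<le> e"
proof -
  have "\<exists>\<eta>>0. \<forall>u v y :: real ^ 'd. norm u \<le> 1 \<longrightarrow> norm v \<le> 1 \<longrightarrow> norm y \<le> 1 \<longrightarrow> dist u v < \<eta> \<longrightarrow> \<bar>proj_kernel \<mu> j u y - proj_kernel \<mu> j v y\<bar> \<le> e" for j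
  proof -
    let ?f = "\<lambda>p :: (real ^ 'd) \<times> (real ^ 'd). proj_kernel \<mu> j (fst p) (snd p)"
    have "continuous_on (cball 0 1 \<times> cball 0 1) ?f"
      unfolding proj_kernel_def[OF mu] ball_kernel_def by (intro continuous_intros)
    then have "uniformly_continuous_on (cball 0 1 \<times> cball 0 1) ?f"
      by (rule compact_uniformly_continuous) (intro compact_Times compact_cball)
    then obtain \<eta> where \<eta>: "\<eta> > 0" "\<And>p q. p \<in> cball 0 1 \<times> cball 0 1 \<Longrightarrow> q \<in> cball 0 1 \<times> cball 0 1 \<Longrightarrow> dist q p < \<eta> \<Longrightarrow> dist (?f q) (?f p) < e"
      unfolding uniformly_continuous_on_def using e by meson
    have "\<bar>proj_kernel \<mu> j u y - proj_kernel \<mu> j v y\<bar> \<le> e" if "norm u \<le> 1" "norm v \<le> 1" "norm y \<le> 1" "dist u v < \<eta>" for u v y :: "real ^ 'd"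
      using \<eta>(2)[of "(v, y)" "(u, y)"] that by (simp add: dist_Pair_Pair dist_real_def)
    then show ?thesis using \<eta>(1) by blast
  qed
  then have "\<forall>j. \<exists>\<eta>. \<eta> > 0 \<and> (\<forall>u v y :: real ^ 'd. norm u \<le> 1 \<longrightarrow> norm v \<le> 1 \<longrightarrow> norm y \<le> 1 \<longrightarrow> dist u v < \<eta> \<longrightarrow> \<bar>proj_kernel \<mu> j u y - proj_kernel \<mu> j v y\<bar> \<le> e)" by blast
  from choice[OF this] obtain \<eta>f where \<eta>f': "\<forall>j. \<eta>f j > 0 \<and> (\<forall>u v y :: real ^ 'd. norm u \<le> 1 \<longrightarrow> norm v \<le> 1 \<longrightarrow> norm y \<le> 1 \<longrightarrow> dist u v < \<eta>f j \<longrightarrow> \<bar>proj_kernel \<mu> j u y - proj_kernel \<mu> j v y\<bar> \<le> e)" by blast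
  then have \<eta>f: "\<And>j. \<eta>f j > 0" "\<And>j u v y. norm (u :: real ^ 'd) \<le> 1 \<Longrightarrow> norm (v :: real ^ 'd) \<le> 1 \<Longrightarrow> norm (y :: real ^ 'd) \<le> 1 \<Longrightarrow> dist u v < \<eta>f j \<Longrightarrow> \<bar>proj_kernel \<mu> j u y - proj_kernel \<mu> j v y\<bar> \<le> e"
    by blast+
  define \<eta> where "\<eta> = Min (\<eta>f ` {..N})"
  have "\<eta> > 0" unfolding \<eta>_def using \<eta>f by (subst Min_gr_iff) auto
  have \<eta>le: "\<eta> \<le> \<eta>f j" if "j \<le> N" for j unfolding \<eta>_def using that by (intro Min_le) auto
  obtain m :: nat and w0 :: "nat \<Rightarrow> real" and x :: "nat \<Rightarrow> real ^ 'd" where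
    w0: "\<And>i. w0 i \<ge> 0" and x: "\<And>i. norm (x i) \<le> 1" and w01: "(\<Sum>i<m. w0 i) = 1" and
    rie: "\<And>f e. continuous_on (cball 0 1) f \<Longrightarrow> (\<And>u v. norm u \<le> 1 \<Longrightarrow> norm v \<le> 1 \<Longrightarrow> dist u v < \<eta> \<Longrightarrow> \<bar>f u - f v\<bar> \<le> e) \<Longrightarrow>
      \<bar>(LINT y|ball_measure \<mu>. f y) - (\<Sum>i<m. w0 i * f (x i))\<bar> \<le> e"
    by (rule ball_riemann[OF mu \<open>\<eta> > 0\<close>]) blast
  let ?I = "{\<alpha> :: 'd \<Rightarrow> nat. (\<Sum>i\<in>UNIV. \<alpha> i) \<le> N}"
  obtain J w where J: "J \<subseteq> {..<m}" "card J \<le> card ?I" "\<forall>i\<in>J. w i \<ge> 0"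
    "\<forall>\<alpha>\<in>?I. (\<Sum>i\<in>J. w i * mpow \<alpha> (x i)) = (\<Sum>i<m. w0 i * mpow \<alpha> (x i))"
    using caratheodory_reduction[OF finite_multi_indices[of N], of "{..<m}" w0 "\<lambda>\<alpha> i. mpow \<alpha> (x i)"] w0 by (auto simp del: mem_Collect_eq)
  have same: "(\<Sum>i\<in>J. w i * q (x i)) = (\<Sum>i<m. w0 i * q (x i))" if q: "q \<in> poly_space N" for q
  proof -
    from q obtain c where c: "q = (\<lambda>x. \<Sum>\<alpha>\<in>?I. c \<alpha> * mpow \<alpha> x)" by (rule poly_spaceE)
    have sw: "(\<Sum>i\<in>K. v i * q (x i)) = (\<Sum>\<alpha>\<in>?I. c \<alpha> * (\<Sum>i\<in>K. v i * mpow \<alpha> (x i)))" for K v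
    proof -
      have "(\<Sum>i\<in>K. v i * q (x i)) = (\<Sum>i\<in>K. \<Sum>\<alpha>\<in>?I. c \<alpha> * (v i * mpow \<alpha> (x i)))"
        unfolding c sum_distrib_left by (simp only: mult.left_commute)
      also have "\<dots> = (\<Sum>\<alpha>\<in>?I. \<Sum>i\<in>K. c \<alpha> * (v i * mpow \<alpha> (x i)))" by (rule sum.swap)
      finally show ?thesis by (simp only: sum_distrib_left)
    qed
    show ?thesis unfolding sw using J(4) by (intro sum.cong) auto
  qed
  show ?thesis
  proof (rule that[of J w x])
    show "finite J" using J(1) finite_subset by blast
    show "card J \<le> (N + 1) ^ CARD('d)" using J(2) card_multi_indices[where 'd = 'd, of N] by linarith
    show "(\<Sum>i\<in>J. w i) = 1" using same[OF poly_space_const[of 1 N]] w01 by simp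
    fix j y assume j: "1 \<le> j" "j \<le> N" and y: "norm (y :: real ^ 'd) \<le> 1"
    have "(\<lambda>u. proj_kernel \<mu> j u y) = proj_kernel \<mu> j y" using proj_kernel_commute[OF mu] by auto
    moreover have "proj_kernel \<mu> j y \<in> poly_space N" using proj_kernel_poly_space[OF mu] j(2) poly_space_le by blast
    ultimately have "(\<Sum>i\<in>J. w i * proj_kernel \<mu> j (x i) y) = (\<Sum>i<m. w0 i * proj_kernel \<mu> j (x i) y)"
      using same[of "\<lambda>u. proj_kernel \<mu> j u y"] by simp
    moreover have "\<bar>(LINT u|ball_measure \<mu>. proj_kernel \<mu> j u y) - (\<Sum>i<m. w0 i * proj_kernel \<mu> j (x i) y)\<bar> \<le> e"
    proof (rule rie)
      show "continuous_on (cball 0 1) (\<lambda>u. proj_kernel \<mu> j u y)"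
        unfolding proj_kernel_def[OF mu] ball_kernel_def by (intro continuous_intros)
      show "\<bar>proj_kernel \<mu> j u y - proj_kernel \<mu> j v y\<bar> \<le> e" if "norm u \<le> 1" "norm v \<le> 1" "dist u v < \<eta>" for u v
        using \<eta>f(2)[of u v y j] \<eta>le[OF j(2)] that y by linarith
    qed
    moreover have "(LINT u|ball_measure \<mu>. proj_kernel \<mu> j u y) = 0"
      using proj_kernel_orth[OF mu poly_space_const[of 1 0], of j y] j by (simp add: proj_kernel_commute[OF mu, of j _ y])
    ultimately show "\<bar>\<Sum>i\<in>J. w i * proj_kernel \<mu> j (x i) y\<bar> \<le> e" by simp
  qed (use J x in auto)
qed

section \<open>The error of the quadrature rule on Sobolev classes\<close>

lemma has_bochner_integral_Gamma:
  fixes a x :: real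
  assumes a: "a > 0" and x: "x > 0"
  shows "has_bochner_integral lborel (\<lambda>v. indicator {0..} v * (v powr (a - 1) * exp (- (x * v)))) (Gamma a * x powr (- a))"
proof (rule has_bochner_integral_nn_integral)
  have "ennreal (Gamma a) = (\<integral>\<^sup>+t. ennreal (indicator {0..} t * t powr (a - 1) / exp t) \<partial>lborel)"
    by (rule Gamma_conv_nn_integral_real[OF a])
  also have "\<dots> = ennreal \<bar>x\<bar> * (\<integral>\<^sup>+v. ennreal (indicator {0..} (0 + x * v) * (0 + x * v) powr (a - 1) / exp (0 + x * v)) \<partial>lborel)"
    using x by (intro nn_integral_real_affine) auto
  also have "\<dots> = (\<integral>\<^sup>+v. ennreal \<bar>x\<bar> * ennreal (indicator {0..} (0 + x * v) * (0 + x * v) powr (a - 1) / exp (0 + x * v)) \<partial>lborel)"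
    by (subst nn_integral_cmult) auto
  also have "\<dots> = (\<integral>\<^sup>+v. ennreal (x powr a) * ennreal (indicator {0..} v * (v powr (a - 1) * exp (- (x * v)))) \<partial>lborel)"
  proof (intro nn_integral_cong)
    fix v :: real
    have xa: "x powr a = x * x powr (a - 1)" using x by (simp add: powr_diff)
    have "indicator {0..} (0 + x * v) = (indicator {0..} v :: real)" using x by (auto simp: indicator_def zero_le_mult_iff)
    then have "\<bar>x\<bar> * (indicator {0..} (0 + x * v) * (0 + x * v) powr (a - 1) / exp (0 + x * v)) =
       x powr a * (indicator {0..} v * (v powr (a - 1) * exp (- (x * v))))"
      using x by (simp add: xa powr_mult exp_minus divide_inverse mult_ac)
    then show "ennreal \<bar>x\<bar> * ennreal (indicator {0..} (0 + x * v) * (0 + x * v) powr (a - 1) / exp (0 + x * v)) = 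
       ennreal (x powr a) * ennreal (indicator {0..} v * (v powr (a - 1) * exp (- (x * v))))"
      by (subst (1 2) ennreal_mult'[symmetric]) auto
  qed
  also have "\<dots> = ennreal (x powr a) * (\<integral>\<^sup>+v. ennreal (indicator {0..} v * (v powr (a - 1) * exp (- (x * v)))) \<partial>lborel)"
    by (subst nn_integral_cmult) auto
  finally have "ennreal (x powr (- a)) * ennreal (Gamma a) = ennreal (x powr (- a)) * (ennreal (x powr a) * (\<integral>\<^sup>+v. ennreal (indicator {0..} v * (v powr (a - 1) * exp (- (x * v)))) \<partial>lborel))"
    by simp
  also have "\<dots> = ennreal (x powr (- a) * x powr a) * (\<integral>\<^sup>+v. ennreal (indicator {0..} v * (v powr (a - 1) * exp (- (x * v)))) \<partial>lborel)"
    by (subst ennreal_mult'[of "x powr (- a)" "x powr a"]) (simp_all only: powr_ge_zero mult.assoc)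
  also have "x powr (- a) * x powr a = 1" using x by (simp flip: powr_add)
  finally show "(\<integral>\<^sup>+v. ennreal (indicator {0..} v * (v powr (a - 1) * exp (- (x * v)))) \<partial>lborel) = ennreal (Gamma a * x powr (- a))"
    using Gamma_real_pos[OF a] by (simp add: ennreal_mult'' mult.commute)
qed (use Gamma_real_pos[OF a] in \<open>auto simp: less_imp_le\<close>)

text \<open>One half of the fractional integration: multiplying the coefficients by \<open>(n + c) powr (- \<alpha>)\<close>
  amounts to integrating the exponential series against \<open>v powr (\<alpha> - 1) * exp (- c * v)\<close>.\<close>

lemma laplace_step:
  fixes e :: "nat \<Rightarrow> real" and c \<alpha> d C \<epsilon> \<sigma>1 \<sigma>2 t :: real
  assumes e0: "e 0 = 0" and sm: "\<And>t. t > 0 \<Longrightarrow> summable (\<lambda>n. \<bar>e n\<bar> * exp (- t) ^ n)"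
    and bd: "\<And>t. t > 0 \<Longrightarrow> \<bar>\<Sum>n. e n * exp (- t) ^ n\<bar> \<le> C * (d / t) powr (\<sigma>1 + \<sigma>2) * exp (- (t / d)) + \<epsilon> * exp (- t)"
    and par: "c \<ge> 0" "\<alpha> > 0" "\<sigma>1 \<ge> 0" "\<sigma>2 \<ge> 0" "\<sigma>2 < \<alpha>" "d > 0" "C \<ge> 0" "\<epsilon> \<ge> 0"
  shows "\<And>t. t > 0 \<Longrightarrow> summable (\<lambda>n. \<bar>e n * (real n + c) powr (- \<alpha>)\<bar> * exp (- t) ^ n)"
    and "\<And>t. t > 0 \<Longrightarrow> \<bar>\<Sum>n. (e n * (real n + c) powr (- \<alpha>)) * exp (- t) ^ n\<bar>
      \<le> (C * d powr \<alpha> * Gamma (\<alpha> - \<sigma>2) / Gamma \<alpha>) * (d / t) powr \<sigma>1 * exp (- (t / d)) + \<epsilon> * exp (- t)"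
proof -
  have le1: "\<bar>e n * (real n + c) powr (- \<alpha>)\<bar> \<le> \<bar>e n\<bar>" for n
  proof (cases "n = 0")
    case False
    then have "(real n + c) powr (- \<alpha>) \<le> 1 powr (- \<alpha>)" using par by (intro powr_mono2') auto
    then show ?thesis by (simp add: abs_mult mult_left_le)
  qed (simp add: e0)
  show sm': "summable (\<lambda>n. \<bar>e n * (real n + c) powr (- \<alpha>)\<bar> * exp (- t) ^ n)" if "t > 0" for t
    by (rule summable_comparison_test'[OF sm[OF that]]) (simp add: mult_right_mono le1)
  fix t :: real assume t: "t > 0"
  define k where "k v = indicator {0..} v * v powr (\<alpha> - 1)" for v :: real
  define f where "f n v = e n * exp (- t) ^ n * (indicator {0..} v * (v powr (\<alpha> - 1) * exp (- ((real n + c) * v))))" for n v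
  have f_eq: "f n v = k v * exp (- (c * v)) * (e n * exp (- (t + v)) ^ n)" for n v
  proof -
    have "exp (- ((real n + c) * v)) = exp (- v) ^ n * exp (- (c * v))"
      by (simp add: exp_of_nat_mult[symmetric] exp_add[symmetric] algebra_simps)
    moreover have "exp (- (t + v)) ^ n = exp (- t) ^ n * exp (- v) ^ n"
    proof -
      have "exp (- (t + v)) = exp (- t) * exp (- v)" by (simp flip: exp_add)
      then show ?thesis by (simp only: power_mult_distrib)
    qed
    ultimately show ?thesis by (simp add: f_def k_def)
  qed
  have hb: "has_bochner_integral lborel (f n) (e n * exp (- t) ^ n * (Gamma \<alpha> * (real n + c) powr (- \<alpha>)))" for n
  proof (cases "n = 0")
    case True
    have "f 0 = (\<lambda>v. 0)" by (simp add: f_def e0 fun_eq_iff)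
    then show ?thesis using True by (simp add: e0 has_bochner_integral_zero)
  next
    case False
    then have "real n + c > 0" using par by (simp add: add_pos_nonneg)
    then show ?thesis unfolding f_def using par by (intro has_bochner_integral_mult_right has_bochner_integral_Gamma)
  qed
  have fi: "integrable lborel (f n)" and fv: "(LINT v|lborel. f n v) = e n * exp (- t) ^ n * (Gamma \<alpha> * (real n + c) powr (- \<alpha>))" for n
    using hb[of n] by (auto simp: has_bochner_integral_iff)
  have fabs: "(LINT v|lborel. norm (f n v)) = Gamma \<alpha> * (\<bar>e n * (real n + c) powr (- \<alpha>)\<bar> * exp (- t) ^ n)" for n
  proof (cases "n = 0")
    case True
    then show ?thesis by (simp add: f_def e0)
  next
    case False
    then have "real n + c > 0" using par by (simp add: add_pos_nonneg)
    from has_bochner_integral_mult_right[OF has_bochner_integral_Gamma[OF par(2) this], of "\<bar>e n\<bar> * exp (- t) ^ n"]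
    have "(LINT v|lborel. \<bar>e n\<bar> * exp (- t) ^ n * (indicator {0..} v * (v powr (\<alpha> - 1) * exp (- ((real n + c) * v))))) = \<bar>e n\<bar> * exp (- t) ^ n * (Gamma \<alpha> * (real n + c) powr (- \<alpha>))"
      by (simp add: has_bochner_integral_iff)
    moreover have "norm (f n v) = \<bar>e n\<bar> * exp (- t) ^ n * (indicator {0..} v * (v powr (\<alpha> - 1) * exp (- ((real n + c) * v))))" for v
      by (simp add: f_def abs_mult)
    ultimately show ?thesis by (simp add: abs_mult)
  qed
  have sumnorm: "summable (\<lambda>n. LINT v|lborel. norm (f n v))"
    unfolding fabs by (intro summable_mult sm' t)
  have fsum: "summable (\<lambda>n. norm (f n v))" for v
  proof (cases "v \<ge> 0")
    case True
    then have "t + v > 0" using t by simp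
    from summable_mult[OF sm[OF this], of "\<bar>k v * exp (- (c * v))\<bar>"] show ?thesis
      by (simp add: f_eq abs_mult mult.assoc)
  qed (simp add: f_def)
  have Ssum: "(\<Sum>n. f n v) = k v * exp (- (c * v)) * (\<Sum>n. e n * exp (- (t + v)) ^ n)" for v
  proof (cases "v \<ge> 0")
    case True
    then have "t + v > 0" using t by simp
    then have "summable (\<lambda>n. e n * exp (- (t + v)) ^ n)"
      using sm[of "t + v"] by (intro summable_rabs_cancel[of "\<lambda>n. e n * exp (- (t + v)) ^ n"]) (simp add: abs_mult)
    then show ?thesis unfolding f_eq by (rule suminf_mult)
  qed (simp add: f_def k_def)
  have isum: "integrable lborel (\<lambda>v. \<Sum>n. f n v)"
    and vsum: "(LINT v|lborel. (\<Sum>n. f n v)) = (\<Sum>n. LINT v|lborel. f n v)"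
    using integrable_suminf[OF fi AE_I2[OF fsum] sumnorm] integral_suminf[OF fi AE_I2[OF fsum] sumnorm] by auto
  \<comment> \<open>The singularity is shared out by \<open>(d / (t + v)) powr (\<sigma>1 +
    \<sigma>2) \<le> (d / t) powr \<sigma>1 * (d / v) powr \<sigma>2\<close>: the part in
    \<open>v\<close> is integrated here, which requires \<open>\<sigma>2 < \<alpha>\<close>, and the
    part in \<open>t\<close> is left for the next application.\<close>
  define b where "b v = (C * (d / t) powr \<sigma>1 * exp (- (t / d)) * d powr \<sigma>2) * (indicator {0..} v * (v powr ((\<alpha> - \<sigma>2) - 1) * exp (- (1 / d * v)))) + (\<epsilon> * exp (- t)) * (indicator {0..} v * (v powr (\<alpha> - 1) * exp (- (1 * v))))" for v
  have bi: "has_bochner_integral lborel b ((C * (d / t) powr \<sigma>1 * exp (- (t / d)) * d powr \<sigma>2) * (Gamma (\<alpha> - \<sigma>2) * (1 / d) powr (- (\<alpha> - \<sigma>2))) + (\<epsilon> * exp (- t)) * (Gamma \<alpha> * 1 powr (- \<alpha>)))"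
    unfolding b_def using par by (intro has_bochner_integral_add has_bochner_integral_mult_right has_bochner_integral_Gamma) auto
  have ptw: "\<bar>\<Sum>n. f n v\<bar> \<le> b v" if v: "v \<noteq> 0" for v
  proof (cases "v > 0")
    case True
    have tv: "t + v > 0" using t True by simp
    have kv: "k v = v powr (\<alpha> - 1)" using True by (simp add: k_def)
    have "\<bar>\<Sum>n. f n v\<bar> = k v * exp (- (c * v)) * \<bar>\<Sum>n. e n * exp (- (t + v)) ^ n\<bar>"
      unfolding Ssum abs_mult by (simp add: kv)
    also have "\<dots> \<le> k v * 1 * (C * (d / (t + v)) powr (\<sigma>1 + \<sigma>2) * exp (- ((t + v) / d)) + \<epsilon> * exp (- (t + v)))"
      using bd[OF tv] True par by (intro mult_mono) (auto simp: kv)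
    also have "\<dots> \<le> k v * (C * ((d / t) powr \<sigma>1 * (d / v) powr \<sigma>2) * exp (- ((t + v) / d)) + \<epsilon> * exp (- (t + v)))"
    proof -
      have "(d / (t + v)) powr (\<sigma>1 + \<sigma>2) = (d / (t + v)) powr \<sigma>1 * (d / (t + v)) powr \<sigma>2" by (rule powr_add)
      also have "\<dots> \<le> (d / t) powr \<sigma>1 * (d / v) powr \<sigma>2"
        using t True par by (intro mult_mono powr_mono2 divide_left_mono) auto
      finally show ?thesis using par by (simp add: kv) (intro mult_left_mono add_right_mono mult_right_mono, auto)
    qed
    also have "\<dots> = b v"
    proof -
      have 1: "(d / v) powr \<sigma>2 = d powr \<sigma>2 * v powr (- \<sigma>2)" using True par by (simp add: powr_divide powr_minus_divide)
      have 2: "v powr ((\<alpha> - \<sigma>2) - 1) = v powr (\<alpha> - 1) * v powr (- \<sigma>2)" by (simp add: algebra_simps flip: powr_add)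
      have 3: "exp (- ((t + v) / d)) = exp (- (t / d)) * exp (- (1 / d * v))" by (simp add: add_divide_distrib flip: exp_add)
      have 4: "exp (- (t + v)) = exp (- t) * exp (- (1 * v))" by (simp flip: exp_add)
      show ?thesis unfolding b_def kv 1 2 3 4 using True by (simp add: algebra_simps)
    qed
    finally show ?thesis .
  next
    case False
    then show ?thesis using v by (simp add: f_def b_def)
  qed
  have "\<bar>\<Sum>n. LINT v|lborel. f n v\<bar> = \<bar>LINT v|lborel. (\<Sum>n. f n v)\<bar>" by (simp add: vsum)
  also have "\<dots> \<le> (LINT v|lborel. \<bar>\<Sum>n. f n v\<bar>)" by (rule integral_abs_bound)
  also have "\<dots> \<le> (LINT v|lborel. b v)"
    using isum bi AE_lborel_singleton[of 0] by (intro integral_mono_AE) (auto simp: has_bochner_integral_iff elim!: eventually_mono intro: ptw)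
  also have "\<dots> = (C * (d / t) powr \<sigma>1 * exp (- (t / d)) * d powr \<sigma>2) * (Gamma (\<alpha> - \<sigma>2) * (1 / d) powr (- (\<alpha> - \<sigma>2))) + (\<epsilon> * exp (- t)) * (Gamma \<alpha> * 1 powr (- \<alpha>))"
    using bi by (simp add: has_bochner_integral_iff)
  also have "\<dots> = Gamma \<alpha> * ((C * d powr \<alpha> * Gamma (\<alpha> - \<sigma>2) / Gamma \<alpha>) * (d / t) powr \<sigma>1 * exp (- (t / d)) + \<epsilon> * exp (- t))"
  proof -
    have "(1 / d) powr (- (\<alpha> - \<sigma>2)) = d powr (\<alpha> - \<sigma>2)" by (subst powr_minus_divide) (simp add: powr_divide)
    then have "d powr \<sigma>2 * (1 / d) powr (- (\<alpha> - \<sigma>2)) = d powr \<alpha>" by (simp flip: powr_add)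
    moreover have "Gamma \<alpha> \<noteq> 0" using Gamma_real_pos[OF par(2)] by linarith
    ultimately show ?thesis by (simp add: field_simps)
  qed
  finally have "\<bar>\<Sum>n. LINT v|lborel. f n v\<bar> \<le> Gamma \<alpha> * ((C * d powr \<alpha> * Gamma (\<alpha> - \<sigma>2) / Gamma \<alpha>) * (d / t) powr \<sigma>1 * exp (- (t / d)) + \<epsilon> * exp (- t))" .
  moreover have "(\<Sum>n. LINT v|lborel. f n v) = Gamma \<alpha> * (\<Sum>n. (e n * (real n + c) powr (- \<alpha>)) * exp (- t) ^ n)"
  proof -
    have "summable (\<lambda>n. (e n * (real n + c) powr (- \<alpha>)) * exp (- t) ^ n)"
      using sm'[OF t] by (intro summable_rabs_cancel[of "\<lambda>n. (e n * (real n + c) powr (- \<alpha>)) * exp (- t) ^ n"]) (simp add: abs_mult)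
    then show ?thesis unfolding fv by (subst suminf_mult[symmetric]) (auto simp: mult_ac)
  qed
  ultimately show "\<bar>\<Sum>n. (e n * (real n + c) powr (- \<alpha>)) * exp (- t) ^ n\<bar> \<le> (C * d powr \<alpha> * Gamma (\<alpha> - \<sigma>2) / Gamma \<alpha>) * (d / t) powr \<sigma>1 * exp (- (t / d)) + \<epsilon> * exp (- t)"
    using Gamma_real_pos[OF par(2)] by (simp add: abs_mult)
qed

lemma powr_exp_bound: "x > 0 \<Longrightarrow> m > 0 \<Longrightarrow> x powr m * exp (- x) \<le> m powr (m :: real)"
proof -
  assume x: "x > 0" and m: "m > 0"
  have "x / m \<le> exp (x / m)" using exp_ge_add_one_self[of "x / m"] by linarith
  then have "(x / m) powr m \<le> exp (x / m) powr m" using x m by (intro powr_mono2) auto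
  also have "exp (x / m) powr m = exp x" using m by (simp add: powr_def)
  finally have "x powr m \<le> m powr m * exp x" using x m by (simp add: powr_divide field_simps)
  then show ?thesis by (simp add: exp_minus field_simps)
qed

lemma proj_kernel_lift:
  fixes x :: "real ^ 'd::finite"
  assumes "\<mu> \<ge> 0"
  shows "proj_kernel \<mu> n x y = lift (\<mu> + 1/2) (zonal (\<mu> + (real CARD('d) - 1) / 2) n) x y"
proof -
  have "\<mu> + 1/2 + real DIM(real ^ 'd) / 2 - 1 = \<mu> + (real CARD('d) - 1) / 2" by (simp add: field_simps)
  then show ?thesis unfolding proj_kernel_def[OF assms] ball_kernel_def by (simp only:)
qed

section \<open>Averages of the projection and Poisson kernels over weighted nodes\<close>

locale ball_nodes =
  fixes \<mu> :: real and w :: "nat \<Rightarrow> real" and J :: "nat set" and x :: "nat \<Rightarrow> real ^ 'd::finite"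
  assumes mu: "\<mu> \<ge> 0" and finJ: "finite J" and w0: "\<And>i. i \<in> J \<Longrightarrow> w i \<ge> 0" and w1: "(\<Sum>i\<in>J. w i) = 1"
    and xn: "\<And>i. norm (x i) \<le> 1"
begin

definition lam :: real where "lam = \<mu> + (real CARD('d) - 1) / 2"

lemma lam_nonneg: "lam \<ge> 0"
proof -
  have "real CARD('d) \<ge> 1" using zero_less_card_finite[where 'a = 'd] by linarith
  then have "(real CARD('d) - 1) / 2 \<ge> 0" by (intro divide_nonneg_pos) linarith+
  then show ?thesis using mu unfolding lam_def by (rule add_nonneg_nonneg[rotated])
qed

definition node_fun :: "real ^ 'd \<Rightarrow> real poly \<Rightarrow> real" where
  "node_fun y = nodes_fun w J x (\<mu> + 1/2) y"

definition node_kernel :: "nat \<Rightarrow> real ^ 'd \<Rightarrow> real" where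
  "node_kernel n y = (\<Sum>i\<in>J. w i * proj_kernel \<mu> n (x i) y)"

lemma node_fun_zonal: "node_fun y (zonal lam n) = node_kernel n y"
  by (simp add: node_fun_def nodes_fun_def node_kernel_def proj_kernel_lift[OF mu] lam_def)

lemma pos_fun_node_fun: "norm y \<le> 1 \<Longrightarrow> pos_fun (node_fun y)"
  unfolding node_fun_def using finJ w0 w1 xn mu by (intro pos_fun_nodes) auto

lemma node_kernel_bound: "norm y \<le> 1 \<Longrightarrow> \<bar>node_kernel n y\<bar> \<le> zonal_bd lam n"
  unfolding node_fun_zonal[symmetric] using pos_fun.\<Lambda>_abs[OF pos_fun_node_fun] zonal_bound[OF lam_nonneg] by blast

definition node_poisson :: "real \<Rightarrow> real ^ 'd \<Rightarrow> real" where
  "node_poisson t y = (\<Sum>n. node_kernel n y * exp (- t) ^ n)"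

lemma node_poisson_abel: "norm y \<le> 1 \<Longrightarrow> node_poisson t y = pos_fun.abel (node_fun y) lam t"
  by (simp add: node_poisson_def pos_fun.abel_def[OF pos_fun_node_fun] node_fun_zonal)

lemma node_kernel_all_polys: "node_kernel n \<in> all_polys"
proof -
  have "(\<lambda>y. \<Sum>i\<in>J. w i * proj_kernel \<mu> n (x i) y) \<in> all_polys"
    by (intro all_polys_sum all_polys_mult all_polys_const) (rule proj_kernel_all_polys[OF mu])
  then show ?thesis by (simp add: node_kernel_def[abs_def])
qed

lemma node_kernel_measurable [measurable]: "node_kernel n \<in> borel_measurable (ball_measure \<mu>)"
  by (rule measurable_ball_continuous[OF mu all_polys_continuous[OF mu node_kernel_all_polys]])

lemma node_poisson_measurable [measurable]: "node_poisson t \<in> borel_measurable (ball_measure \<mu>)"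
  unfolding node_poisson_def by measurable

definition node_coeff :: "(real ^ 'd \<Rightarrow> real) \<Rightarrow> nat \<Rightarrow> real" where
  "node_coeff g n = (LINT y|ball_measure \<mu>. g y * node_kernel n y)"

lemma integrable_times_bounded:
  fixes g h :: "real ^ 'd \<Rightarrow> real"
  assumes g: "integrable (ball_measure \<mu>) g" and h: "h \<in> borel_measurable (ball_measure \<mu>)" "\<And>y. norm y \<le> 1 \<Longrightarrow> \<bar>h y\<bar> \<le> B"
  shows "integrable (ball_measure \<mu>) (\<lambda>y. g y * h y)"
proof (rule Bochner_Integration.integrable_bound[of _ "\<lambda>y. B * g y"])
  show "integrable (ball_measure \<mu>) (\<lambda>y. B * g y)" using g by simp
  show "(\<lambda>y. g y * h y) \<in> borel_measurable (ball_measure \<mu>)" using g h by auto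
  show "AE y in ball_measure \<mu>. norm (g y * h y) \<le> norm (B * g y)"
  proof (rule AE_I2)
    fix y :: "real ^ 'd" assume "y \<in> space (ball_measure \<mu>)"
    then have "\<bar>h y\<bar> \<le> B" using h(2) by simp
    then have "\<bar>h y\<bar> * \<bar>g y\<bar> \<le> \<bar>B\<bar> * \<bar>g y\<bar>" by (intro mult_right_mono) auto
    then show "norm (g y * h y) \<le> norm (B * g y)" by (simp add: abs_mult mult.commute)
  qed
qed

lemma node_coeff_proj:
  assumes g: "integrable (ball_measure \<mu>) g"
  shows "node_coeff g n = (\<Sum>i\<in>J. w i * orth_proj \<mu> n g (x i))"
proof -
  have int: "integrable (ball_measure \<mu>) (\<lambda>y. g y * proj_kernel \<mu> n (x i) y)" for i
  proof (rule integrable_times_bounded[OF g])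
    show "proj_kernel \<mu> n (x i) \<in> borel_measurable (ball_measure \<mu>)"
      by (rule measurable_ball_continuous[OF mu all_polys_continuous[OF mu proj_kernel_all_polys[OF mu]]])
    show "\<bar>proj_kernel \<mu> n (x i) y\<bar> \<le> zonal_bd lam n" if "norm y \<le> 1" for y
    proof -
      interpret pos_fun "\<lambda>F. lift (\<mu> + 1/2) F (x i) y" using xn that mu by (intro pos_fun_lift) auto
      show ?thesis unfolding proj_kernel_lift[OF mu] lam_def[symmetric] by (rule \<Lambda>_abs) (rule zonal_bound[OF lam_nonneg])
    qed
  qed
  have "node_coeff g n = (LINT y|ball_measure \<mu>. (\<Sum>i\<in>J. w i * (g y * proj_kernel \<mu> n (x i) y)))"
    by (simp add: node_coeff_def node_kernel_def sum_distrib_left mult_ac)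
  also have "\<dots> = (\<Sum>i\<in>J. w i * (LINT y|ball_measure \<mu>. g y * proj_kernel \<mu> n (x i) y))"
    using int by (subst Bochner_Integration.integral_sum) auto
  finally show ?thesis by (simp add: orth_proj_eq[OF mu])
qed

lemma node_coeff_bound:
  assumes g: "integrable (ball_measure \<mu>) g"
  shows "\<bar>node_coeff g n\<bar> \<le> zonal_bd lam n * (LINT y|ball_measure \<mu>. \<bar>g y\<bar>)"
proof -
  have "\<bar>node_coeff g n\<bar> \<le> (LINT y|ball_measure \<mu>. \<bar>g y * node_kernel n y\<bar>)"
    unfolding node_coeff_def by (rule integral_abs_bound)
  also have "\<dots> \<le> (LINT y|ball_measure \<mu>. zonal_bd lam n * \<bar>g y\<bar>)"
  proof (rule integral_mono)
    show "integrable (ball_measure \<mu>) (\<lambda>y. \<bar>g y * node_kernel n y\<bar>)"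
      by (intro integrable_abs integrable_times_bounded[OF g node_kernel_measurable node_kernel_bound])
    fix y :: "real ^ 'd" assume "y \<in> space (ball_measure \<mu>)"
    then show "\<bar>g y * node_kernel n y\<bar> \<le> zonal_bd lam n * \<bar>g y\<bar>"
      using node_kernel_bound[of y n] by (simp add: abs_mult mult.commute[of "\<bar>g y\<bar>"] mult_right_mono)
  qed (use g in auto)
  finally show ?thesis by simp
qed

lemma node_coeff_summable:
  assumes g: "integrable (ball_measure \<mu>) g" and t: "t > 0"
  shows "summable (\<lambda>n. \<bar>node_coeff g n\<bar> * exp (- t) ^ n)"
proof (rule summable_comparison_test'[OF summable_mult])
  show "summable (\<lambda>n. zonal_bd lam n * exp (- t) ^ n)" using t by (intro zonal_bd_summable) simp
  fix n
  show "norm (\<bar>node_coeff g n\<bar> * exp (- t) ^ n) \<le> (LINT y|ball_measure \<mu>. \<bar>g y\<bar>) * (zonal_bd lam n * exp (- t) ^ n)"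
    using mult_right_mono[OF node_coeff_bound[OF g, of n], of "exp (- t) ^ n"] by (simp add: mult_ac)
qed

lemma node_coeff_sum:
  assumes g: "integrable (ball_measure \<mu>) g" and t: "t > 0"
  shows "integrable (ball_measure \<mu>) (\<lambda>y. g y * node_poisson t y)"
    and "(\<Sum>n. node_coeff g n * exp (- t) ^ n) = (LINT y|ball_measure \<mu>. g y * node_poisson t y)"
proof -
  let ?f = "\<lambda>n y. g y * node_kernel n y * exp (- t) ^ n"
  have i1: "integrable (ball_measure \<mu>) (?f n)" for n
    using integrable_times_bounded[OF g node_kernel_measurable node_kernel_bound] by simp
  have zs: "summable (\<lambda>n. zonal_bd lam n * exp (- t) ^ n)" using t by (intro zonal_bd_summable) simp
  have i2: "AE y in ball_measure \<mu>. summable (\<lambda>n. norm (?f n y))"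
  proof (rule AE_I2)
    fix y :: "real ^ 'd" assume y: "y \<in> space (ball_measure \<mu>)"
    show "summable (\<lambda>n. norm (?f n y))"
    proof (rule summable_comparison_test'[OF summable_mult[OF zs]])
      fix n
      have "\<bar>node_kernel n y\<bar> \<le> zonal_bd lam n" using node_kernel_bound[of y n] y by simp
      then have "\<bar>g y\<bar> * (\<bar>node_kernel n y\<bar> * exp (- t) ^ n) \<le> \<bar>g y\<bar> * (zonal_bd lam n * exp (- t) ^ n)"
        by (intro mult_left_mono mult_right_mono) auto
      then show "norm (norm (?f n y)) \<le> \<bar>g y\<bar> * (zonal_bd lam n * exp (- t) ^ n)"
        by (simp add: abs_mult mult.assoc)
    qed
  qed
  have i3: "summable (\<lambda>n. LINT y|ball_measure \<mu>. norm (?f n y))"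
  proof (rule summable_comparison_test'[OF summable_mult[OF zs]])
    fix n
    have "(LINT y|ball_measure \<mu>. norm (?f n y)) \<le> (LINT y|ball_measure \<mu>. (zonal_bd lam n * exp (- t) ^ n) * \<bar>g y\<bar>)"
    proof (rule integral_mono)
      fix y :: "real ^ 'd" assume "y \<in> space (ball_measure \<mu>)"
      then have "\<bar>node_kernel n y\<bar> \<le> zonal_bd lam n" using node_kernel_bound[of y n] by simp
      then have "\<bar>node_kernel n y\<bar> * exp (- t) ^ n * \<bar>g y\<bar> \<le> zonal_bd lam n * exp (- t) ^ n * \<bar>g y\<bar>"
        by (intro mult_right_mono) auto
      then show "norm (?f n y) \<le> (zonal_bd lam n * exp (- t) ^ n) * \<bar>g y\<bar>"
        by (simp add: abs_mult mult_ac)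
    qed (use g i1 in auto)
    then show "norm (LINT y|ball_measure \<mu>. norm (?f n y)) \<le> (LINT y|ball_measure \<mu>. \<bar>g y\<bar>) * (zonal_bd lam n * exp (- t) ^ n)"
      by (simp add: mult_ac integral_nonneg_AE)
  qed
  have s: "(\<Sum>n. ?f n y) = g y * node_poisson t y" if "y \<in> space (ball_measure \<mu>)" for y
  proof -
    have "norm y \<le> 1" using that by simp
    then interpret pos_fun "node_fun y" by (rule pos_fun_node_fun)
    have "summable (\<lambda>n. \<bar>node_kernel n y * exp (- t) ^ n\<bar>)" using abel_summable[OF lam_nonneg t] by (simp add: node_fun_zonal abs_mult)
    then have "summable (\<lambda>n. node_kernel n y * exp (- t) ^ n)" by (rule summable_rabs_cancel)
    then show ?thesis unfolding node_poisson_def by (subst suminf_mult[symmetric]) (auto simp: mult.assoc)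
  qed
  have "integrable (ball_measure \<mu>) (\<lambda>y. \<Sum>n. ?f n y)" by (rule integrable_suminf[OF i1 i2 i3])
  then show "integrable (ball_measure \<mu>) (\<lambda>y. g y * node_poisson t y)"
    by (subst Bochner_Integration.integrable_cong[OF refl s[symmetric]])
  have "(LINT y|ball_measure \<mu>. g y * node_poisson t y) = (LINT y|ball_measure \<mu>. (\<Sum>n. ?f n y))"
    by (rule Bochner_Integration.integral_cong[OF refl s[symmetric]])
  also have "\<dots> = (\<Sum>n. LINT y|ball_measure \<mu>. ?f n y)" by (rule integral_suminf[OF i1 i2 i3])
  finally show "(\<Sum>n. node_coeff g n * exp (- t) ^ n) = (LINT y|ball_measure \<mu>. g y * node_poisson t y)"
    by (simp add: node_coeff_def)
qed

lemma node_poisson_nonneg: "norm y \<le> 1 \<Longrightarrow> t > 0 \<Longrightarrow> node_poisson t y \<ge> 0"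
  using pos_fun.abel_nonneg[OF pos_fun_node_fun lam_nonneg] by (simp add: node_poisson_abel)

lemma node_kernel_0: "node_kernel 0 y = 1"
  using w1 by (simp add: node_kernel_def proj_kernel_0[OF mu])

lemma node_coeff_one: "node_coeff (\<lambda>_. 1) n = (if n = 0 then 1 else 0)"
proof (cases "n = 0")
  case False
  have "(LINT y|ball_measure \<mu>. 1 * proj_kernel \<mu> n (x i) y) = 0" for i
    using proj_kernel_orth[OF mu poly_space_const[of 1 0], of n "x i"] False by simp
  then show ?thesis using False mu by (subst node_coeff_proj) (auto simp: orth_proj_eq[OF mu] integrable_ball_continuous[OF mu])
next
  case True
  then show ?thesis using mu by (simp add: node_coeff_def node_kernel_0)
qed

lemma node_poisson_integral: "t > 0 \<Longrightarrow> (LINT y|ball_measure \<mu>. node_poisson t y) = 1"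
proof -
  assume t: "t > 0"
  have "integrable (ball_measure \<mu>) (\<lambda>_ :: real ^ 'd. 1 :: real)" by (intro integrable_ball_continuous mu) auto
  from node_coeff_sum(2)[OF this t] have "(LINT y|ball_measure \<mu>. node_poisson t y) = (\<Sum>n. node_coeff (\<lambda>_. 1) n * exp (- t) ^ n)" by simp
  also have "\<dots> = (\<Sum>n\<in>{0}. node_coeff (\<lambda>_. 1) n * exp (- t) ^ n)"
    by (intro suminf_finite) (auto simp: node_coeff_one)
  finally show ?thesis by (simp add: node_coeff_one)
qed

text \<open>The node average of the Poisson kernel is nonnegative and has integral 1. For a single
  node this is the contraction property of the Poisson semigroup, which the lower bound uses as
  well.\<close>

lemma abs_node_coeff_sum_le:
  assumes g: "integrable (ball_measure \<mu>) g" and B: "\<And>y. norm y \<le> 1 \<Longrightarrow> \<bar>g y\<bar> \<le> B" and t: "t > 0"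
  shows "\<bar>\<Sum>n. node_coeff g n * exp (- t) ^ n\<bar> \<le> B"
proof -
  have ip: "integrable (ball_measure \<mu>) (node_poisson t)"
  proof -
    have "integrable (ball_measure \<mu>) (\<lambda>_ :: real ^ 'd. 1 :: real)" by (intro integrable_ball_continuous mu) auto
    from node_coeff_sum(1)[OF this t] show ?thesis by simp
  qed
  have "\<bar>\<Sum>n. node_coeff g n * exp (- t) ^ n\<bar> \<le> (LINT y|ball_measure \<mu>. \<bar>g y * node_poisson t y\<bar>)"
    unfolding node_coeff_sum(2)[OF g t] by (rule integral_abs_bound)
  also have "\<dots> \<le> (LINT y|ball_measure \<mu>. B * node_poisson t y)"
  proof (rule integral_mono)
    fix y :: "real ^ 'd" assume "y \<in> space (ball_measure \<mu>)"
    then have "norm y \<le> 1" by simp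
    then show "\<bar>g y * node_poisson t y\<bar> \<le> B * node_poisson t y"
      using B[of y] node_poisson_nonneg[of y t] t by (simp add: abs_mult mult_right_mono)
  qed (use ip node_coeff_sum(1)[OF g t] in auto)
  also have "\<dots> = B" by (simp add: node_poisson_integral[OF t])
  finally show ?thesis .
qed

definition node_ok :: "nat \<Rightarrow> real \<Rightarrow> real \<Rightarrow> bool" where
  "node_ok N d e \<longleftrightarrow> trunc_ok lam N d \<and> e \<ge> 0 \<and> e * real N \<le> 1 \<and> (\<forall>j y. 1 \<le> j \<longrightarrow> j \<le> N \<longrightarrow> norm y \<le> 1 \<longrightarrow> \<bar>node_kernel j y\<bar> \<le> e)"

text \<open>The only property of the class \<open>L\<^sub>p\<close> that is used, with \<open>\<theta> = 1 / p\<close>\<close>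

definition level_bound :: "real \<Rightarrow> (real ^ 'd \<Rightarrow> real) \<Rightarrow> bool" where
  "level_bound \<theta> g \<longleftrightarrow> (\<forall>A \<psi>. A \<ge> 1 \<longrightarrow> \<psi> \<in> borel_measurable (ball_measure \<mu>) \<longrightarrow> (\<forall>y. norm y \<le> 1 \<longrightarrow> 0 \<le> \<psi> y \<and> \<psi> y \<le> A) \<longrightarrow>
     (LINT y|ball_measure \<mu>. \<psi> y) \<le> 1 \<longrightarrow> (LINT y|ball_measure \<mu>. \<bar>g y\<bar> * \<psi> y) \<le> 2 * A powr \<theta>)"

lemma level_bound_L1: "level_bound \<theta> g \<Longrightarrow> (LINT y|ball_measure \<mu>. \<bar>g y\<bar>) \<le> 2"
  unfolding level_bound_def using mu by (elim allE[of _ 1] allE[of _ "\<lambda>_. 1"]) auto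

text \<open>\<open>level_bound\<close> is applied to the node average itself, with the pointwise
  bound from \<open>abel_small\<close> as \<open>A\<close>; this turns the exponent
  \<open>2 * lam + 1\<close> into \<open>(2 * lam + 1) * \<theta>\<close>.\<close>

lemma node_coeff_sum_small:
  assumes g: "integrable (ball_measure \<mu>) g" and lb: "level_bound \<theta> g" and th: "0 \<le> \<theta>" "\<theta> \<le> 1" and fn: "node_ok N d e" and t: "0 < t" "t \<le> d"
  shows "\<bar>\<Sum>n. node_coeff g n * exp (- t) ^ n\<bar> \<le> 8 * doubling_const lam * (d / t) powr ((2 * lam + 1) * \<theta>)"
proof -
  define A where "A = 4 * doubling_const lam * (d / t) powr (2 * lam + 1)"
  have ps: "node_poisson t y \<le> A" if y: "norm y \<le> 1" for y
  proof -
    interpret pos_fun "node_fun y" using y by (rule pos_fun_node_fun)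
    show ?thesis unfolding node_poisson_abel[OF y] A_def
      using fn y t by (intro abel_small[OF lam_nonneg]) (auto simp: node_ok_def node_fun_zonal)
  qed
  have D1: "4 * doubling_const lam \<ge> 1"
  proof -
    have "(1::real) \<le> 4 powr (lam + 2)" using lam_nonneg by (intro ge_one_powr_ge_zero) auto
    then show ?thesis by (simp add: doubling_const_def)
  qed
  have dt: "(d / t) powr (2 * lam + 1) \<ge> 1" using t lam_nonneg by (intro ge_one_powr_ge_zero) auto
  have A1: "A \<ge> 1" unfolding A_def using mult_mono[OF D1 dt] doubling_const_pos[of lam] by simp
  have "\<bar>\<Sum>n. node_coeff g n * exp (- t) ^ n\<bar> \<le> (LINT y|ball_measure \<mu>. \<bar>g y * node_poisson t y\<bar>)"
    unfolding node_coeff_sum(2)[OF g t(1)] by (rule integral_abs_bound)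
  also have "\<dots> = (LINT y|ball_measure \<mu>. \<bar>g y\<bar> * node_poisson t y)"
    using node_poisson_nonneg[OF _ t(1)] by (intro Bochner_Integration.integral_cong) (auto simp: abs_mult)
  also have "\<dots> \<le> 2 * A powr \<theta>"
    using lb A1 node_poisson_measurable ps node_poisson_nonneg[OF _ t(1)] node_poisson_integral[OF t(1)] unfolding level_bound_def by auto
  also have "A powr \<theta> = (4 * doubling_const lam) powr \<theta> * (d / t) powr ((2 * lam + 1) * \<theta>)"
    unfolding A_def powr_mult by (simp add: powr_powr)
  also have "\<dots> \<le> (4 * doubling_const lam) powr 1 * (d / t) powr ((2 * lam + 1) * \<theta>)"
    using D1 th by (intro mult_right_mono powr_mono) auto
  finally show ?thesis using D1 by simp
qed

text \<open>As \<open>g\<close> has mean zero, the constant \<open>m 0\<close> of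
  \<open>abel_large\<close> may be subtracted from the node average; the rest is uniformly small and
  only the \<open>L_1\<close> norm of \<open>g\<close> is needed.\<close>

lemma node_coeff_sum_large:
  assumes g: "integrable (ball_measure \<mu>) g" and lb: "level_bound \<theta> g" and g0: "(LINT y|ball_measure \<mu>. g y) = 0" 
    and fn: "node_ok N d e" and t: "d \<le> t"
  shows "\<bar>\<Sum>n. node_coeff g n * exp (- t) ^ n\<bar> \<le> 2 * (e * real N * exp (- t) + 4 * (2 * t / d) powr (2 * lam + 4) * exp (- (t - d) * real N))"
proof -
  have d: "d > 0" using fn by (auto simp: node_ok_def trunc_ok_def)
  then have t0: "t > 0" using t by simp
  have c0: "2 * lam + 4 \<ge> 0" using lam_nonneg by simp
  obtain m where m: "trunc lam (2 * lam + 4) N t = (\<Sum>k\<le>N. smult (m k) (zonal lam k))" "\<And>k. 0 \<le> m k" "\<And>k. m k \<le> exp (- t) ^ k"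
    using trunc_zonal[OF c0 t0] by blast
  define E where "E = e * real N * exp (- t) + 4 * (2 * t / d) powr (2 * lam + 4) * exp (- (t - d) * real N)"
  have ps: "\<bar>node_poisson t y - m 0\<bar> \<le> E" if y: "norm y \<le> 1" for y
  proof -
    interpret pos_fun "node_fun y" using y by (rule pos_fun_node_fun)
    show ?thesis unfolding node_poisson_abel[OF y] E_def
      using fn y by (intro abel_large[OF lam_nonneg] t m) (auto simp: node_ok_def node_fun_zonal)
  qed
  have E0: "E \<ge> 0" using ps[of 0] by simp
  have i0: "integrable (ball_measure \<mu>) (\<lambda>y. g y * (node_poisson t y - m 0))"
    by (rule integrable_times_bounded[OF g _ ps]) measurable
  have "(LINT y|ball_measure \<mu>. g y * (node_poisson t y - m 0)) = (LINT y|ball_measure \<mu>. g y * node_poisson t y) - (LINT y|ball_measure \<mu>. m 0 * g y)"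
    using g node_coeff_sum(1)[OF g t0] by (subst Bochner_Integration.integral_diff[symmetric]) (auto simp: right_diff_distrib mult_ac)
  then have "(\<Sum>n. node_coeff g n * exp (- t) ^ n) = (LINT y|ball_measure \<mu>. g y * (node_poisson t y - m 0))"
    using node_coeff_sum(2)[OF g t0] g0 by simp
  also have "\<bar>\<dots>\<bar> \<le> (LINT y|ball_measure \<mu>. \<bar>g y * (node_poisson t y - m 0)\<bar>)" by (rule integral_abs_bound)
  also have "\<dots> \<le> (LINT y|ball_measure \<mu>. E * \<bar>g y\<bar>)"
  proof (rule integral_mono)
    fix y :: "real ^ 'd" assume "y \<in> space (ball_measure \<mu>)"
    then show "\<bar>g y * (node_poisson t y - m 0)\<bar> \<le> E * \<bar>g y\<bar>"
      using ps[of y] by (simp add: abs_mult mult.commute[of "\<bar>g y\<bar>"] mult_right_mono)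
  qed (use g i0 in auto)
  also have "\<dots> = E * (LINT y|ball_measure \<mu>. \<bar>g y\<bar>)" by simp
  also have "\<dots> \<le> E * 2" using level_bound_L1[OF lb] E0 by (rule mult_left_mono)
  finally show ?thesis by (simp add: E_def mult.commute)
qed

end

section \<open>Abel means at the nodes as the time tends to 0\<close>

lemma real_polynomial_function_all_polys:
  "real_polynomial_function g \<Longrightarrow> g \<in> all_polys" for g :: "real ^ 'd::finite \<Rightarrow> real"
proof (induction g rule: real_polynomial_function.induct)
  case (linear f)
  then have "linear f" by (rule bounded_linear.linear)
  have "f x = (\<Sum>b\<in>Basis. (b \<bullet> x) * f b)" for x
  proof -
    have "(\<Sum>b\<in>Basis. (b \<bullet> x) *\<^sub>R b) = x" unfolding inner_commute[of _ x] by (rule euclidean_representation)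
    then have "f x = f (\<Sum>b\<in>Basis. (b \<bullet> x) *\<^sub>R b)" by simp
    also have "\<dots> = (\<Sum>b\<in>Basis. (b \<bullet> x) * f b)"
      by (simp add: linear_sum[OF \<open>linear f\<close>] linear_scale[OF \<open>linear f\<close>])
    finally show ?thesis .
  qed
  then have "f = (\<lambda>x. \<Sum>b\<in>Basis. (b \<bullet> x) * f b)" by blast
  also have "\<dots> \<in> all_polys" by (intro all_polys_sum all_polys_mult all_polys_inner all_polys_const)
  finally show ?case .
qed (auto intro: all_polys_const all_polys_add all_polys_mult)

context ball_nodes
begin

lemma node_coeff_add: "integrable (ball_measure \<mu>) f \<Longrightarrow> integrable (ball_measure \<mu>) g \<Longrightarrow> node_coeff (\<lambda>x. f x - g x) n = node_coeff f n - node_coeff g n"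
  unfolding node_coeff_def left_diff_distrib
  by (intro Bochner_Integration.integral_diff integrable_times_bounded[OF _ node_kernel_measurable node_kernel_bound])

lemma poly_abel_limit:
  assumes q: "q \<in> poly_space N"
  shows "((\<lambda>t. \<Sum>n. node_coeff q n * exp (- t) ^ n) \<longlongrightarrow> (\<Sum>i\<in>J. w i * q (x i))) (at_right 0)"
proof -
  have qi: "integrable (ball_measure \<mu>) q" by (rule all_polys_integrable[OF mu all_polysI[OF q]])
  have z: "node_coeff q n = 0" if "n > N" for n
    unfolding node_coeff_proj[OF qi] orth_proj_eq[OF mu] using proj_kernel_orth[OF mu q that] by simp
  have e: "(\<Sum>n. node_coeff q n * exp (- t) ^ n) = (\<Sum>n\<le>N. node_coeff q n * exp (- t) ^ n)" for t
    using z by (intro suminf_finite) auto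
  have "((\<lambda>t. \<Sum>n\<le>N. node_coeff q n * exp (- t) ^ n) \<longlongrightarrow> (\<Sum>n\<le>N. node_coeff q n * exp (- 0) ^ n)) (at_right 0)"
    by (intro tendsto_intros)
  also have "(\<Sum>n\<le>N. node_coeff q n * exp (- 0) ^ n) = (\<Sum>n\<le>N. \<Sum>i\<in>J. w i * orth_proj \<mu> n q (x i))"
    by (simp add: node_coeff_proj[OF qi])
  also have "\<dots> = (\<Sum>i\<in>J. w i * (\<Sum>n\<le>N. orth_proj \<mu> n q (x i)))"
    by (subst sum.swap) (simp add: sum_distrib_left)
  also have "\<dots> = (\<Sum>i\<in>J. w i * q (x i))"
    unfolding orth_proj_eq[OF mu] proj_kernel_sum[OF mu q] ..
  finally show ?thesis unfolding e .
qed

text \<open>The Abel means tend to the quadrature sum as \<open>t\<close> tends to 0. For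
  polynomials the series is finite; Stone-Weierstrass extends this to continuous \<open>f\<close>,
  because the means do not increase the uniform norm. A bound valid for all \<open>t > 0\<close>
  thus becomes a bound of the quadrature error.\<close>

lemma abel_limit_bound:
  assumes f: "continuous_on (cball 0 1) f" and bd: "\<And>t. t > 0 \<Longrightarrow> \<bar>(\<Sum>n. node_coeff f n * exp (- t) ^ n) - I\<bar> \<le> B"
  shows "\<bar>I - (\<Sum>i\<in>J. w i * f (x i))\<bar> \<le> B"
proof (rule field_le_epsilon)
  fix e :: real assume e: "e > 0"
  then have e3: "e / 3 > 0" by simp
  obtain q where q: "real_polynomial_function q" "\<And>x. x \<in> cball 0 1 \<Longrightarrow> \<bar>f x - q x\<bar> < e / 3"
    using Stone_Weierstrass_real_polynomial_function[OF compact_cball f e3] by blast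
  then obtain N where qN: "q \<in> poly_space N" using real_polynomial_function_all_polys by (auto simp: all_polys_def)
  have fi: "integrable (ball_measure \<mu>) f" by (rule integrable_ball_continuous[OF mu f])
  have qi: "integrable (ball_measure \<mu>) q" by (rule all_polys_integrable[OF mu all_polysI[OF qN]])
  have "\<forall>\<^sub>F t in at_right 0. dist (\<Sum>n. node_coeff q n * exp (- t) ^ n) (\<Sum>i\<in>J. w i * q (x i)) < e / 3"
    using poly_abel_limit[OF qN] e3 by (rule tendstoD)
  then have "\<forall>\<^sub>F t in at_right 0. t > 0 \<and> dist (\<Sum>n. node_coeff q n * exp (- t) ^ n) (\<Sum>i\<in>J. w i * q (x i)) < e / 3"
    using eventually_at_right_less[of "0::real"] by (auto elim: eventually_elim2)
  then obtain t where t: "t > 0" "\<bar>(\<Sum>n. node_coeff q n * exp (- t) ^ n) - (\<Sum>i\<in>J. w i * q (x i))\<bar> < e / 3"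
    using eventually_happens[of _ "at_right (0::real)"] by (auto simp: dist_real_def)
  have "\<bar>\<Sum>n. node_coeff (\<lambda>x. f x - q x) n * exp (- t) ^ n\<bar> \<le> e / 3"
  proof (rule abs_node_coeff_sum_le[OF _ _ t(1)])
    show "integrable (ball_measure \<mu>) (\<lambda>x. f x - q x)" using fi qi by simp
    show "\<bar>f y - q y\<bar> \<le> e / 3" if "norm y \<le> 1" for y using q(2)[of y] that by simp
  qed
  moreover have "(\<Sum>n. node_coeff (\<lambda>x. f x - q x) n * exp (- t) ^ n) = (\<Sum>n. node_coeff f n * exp (- t) ^ n) - (\<Sum>n. node_coeff q n * exp (- t) ^ n)"
  proof -
    have sm: "summable (\<lambda>n. node_coeff h n * exp (- t) ^ n)" if "integrable (ball_measure \<mu>) h" for h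
    proof -
      have "summable (\<lambda>n. \<bar>node_coeff h n * exp (- t) ^ n\<bar>)" using node_coeff_summable[OF that t(1)] by (simp add: abs_mult)
      then show ?thesis by (rule summable_rabs_cancel)
    qed
    show ?thesis unfolding node_coeff_add[OF fi qi] left_diff_distrib by (rule suminf_diff[OF sm[OF fi] sm[OF qi], symmetric])
  qed
  moreover have "\<bar>(\<Sum>i\<in>J. w i * q (x i)) - (\<Sum>i\<in>J. w i * f (x i))\<bar> \<le> e / 3"
  proof -
    have "\<bar>(\<Sum>i\<in>J. w i * q (x i)) - (\<Sum>i\<in>J. w i * f (x i))\<bar> = \<bar>\<Sum>i\<in>J. w i * (q (x i) - f (x i))\<bar>"
      by (simp add: sum_subtractf right_diff_distrib)
    also have "\<dots> \<le> (\<Sum>i\<in>J. \<bar>w i * (q (x i) - f (x i))\<bar>)" by (rule sum_abs)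
    also have "\<dots> \<le> (\<Sum>i\<in>J. w i * (e / 3))"
    proof (rule sum_mono)
      fix i assume i: "i \<in> J"
      have "\<bar>q (x i) - f (x i)\<bar> \<le> e / 3" using q(2)[of "x i"] xn[of i] by (simp add: abs_minus_commute)
      then show "\<bar>w i * (q (x i) - f (x i))\<bar> \<le> w i * (e / 3)"
        unfolding abs_mult abs_of_nonneg[OF w0[OF i]] by (rule mult_left_mono) (rule w0[OF i])
    qed
    also have "\<dots> = e / 3" using w1 by (simp add: sum_divide_distrib[symmetric] flip: sum_distrib_right)
    finally show ?thesis .
  qed
  moreover have "\<bar>(\<Sum>n. node_coeff f n * exp (- t) ^ n) - I\<bar> \<le> B" by (rule bd[OF t(1)])
  ultimately show "\<bar>I - (\<Sum>i\<in>J. w i * f (x i))\<bar> \<le> B + e" using t(2) by linarith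
qed

end

text \<open>The first summand covers the times \<open>t \<le> d\<close>, where doubling is used, and
  the second the times \<open>t > d\<close>, where truncation is used.\<close>

definition error_const :: "real \<Rightarrow> real \<Rightarrow> real \<Rightarrow> real" where
  "error_const l \<sigma> K = 8 * doubling_const l * exp 1 + 8 * 2 powr (2 * l + 4) * exp K * (2 * l + 4 + \<sigma>) powr (2 * l + 4 + \<sigma>)"

lemma error_const_nonneg: "error_const l \<sigma> K \<ge> 0"
  unfolding error_const_def by (intro add_nonneg_nonneg mult_nonneg_nonneg) (auto simp: doubling_const_pos less_imp_le)

context ball_nodes
begin

text \<open>Brings the estimates for small and for large times into the single shape that
  \<open>laplace_step\<close> takes as hypothesis.\<close>

lemma node_coeff_sum_bound:
  assumes g: "integrable (ball_measure \<mu>) g" and lb: "level_bound \<theta> g" and g0: "(LINT y|ball_measure \<mu>. g y) = 0" 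
    and th: "0 \<le> \<theta>" "\<theta> \<le> 1" and fn: "node_ok N d e" and K: "d * real N = K" "K \<ge> 2" and t: "t > 0"
  shows "\<bar>\<Sum>n. node_coeff g n * exp (- t) ^ n\<bar> \<le> error_const lam ((2 * lam + 1) * \<theta>) K * (d / t) powr ((2 * lam + 1) * \<theta>) * exp (- (t / d)) + (2 * e * real N) * exp (- t)"
proof -
  define \<sigma> where "\<sigma> = (2 * lam + 1) * \<theta>"
  define c where "c = 2 * lam + 4"
  have d: "d > 0" using fn by (auto simp: node_ok_def trunc_ok_def)
  have e0: "e \<ge> 0" using fn by (auto simp: node_ok_def)
  have s0: "\<sigma> \<ge> 0" "c > 0" using lam_nonneg th by (auto simp: \<sigma>_def c_def)
  define C1 where "C1 = 8 * doubling_const lam * exp 1"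
  define C2 where "C2 = 8 * 2 powr c * exp K * (c + \<sigma>) powr (c + \<sigma>)"
  have C: "error_const lam \<sigma> K = C1 + C2" by (simp add: error_const_def C1_def C2_def c_def)
  have Cp: "C1 \<ge> 0" "C2 \<ge> 0" by (auto simp: C1_def C2_def doubling_const_pos less_imp_le)
  define X where "X = (d / t) powr \<sigma> * exp (- (t / d))"
  have X: "X \<ge> 0" by (simp add: X_def)
  have "\<bar>\<Sum>n. node_coeff g n * exp (- t) ^ n\<bar> \<le> (C1 + C2) * X + 2 * e * real N * exp (- t)"
  proof (cases "t \<le> d")
    case True
    have "\<bar>\<Sum>n. node_coeff g n * exp (- t) ^ n\<bar> \<le> 8 * doubling_const lam * (d / t) powr \<sigma>"
      unfolding \<sigma>_def by (rule node_coeff_sum_small[OF g lb th fn t True])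
    also have "\<dots> \<le> 8 * doubling_const lam * (d / t) powr \<sigma> * (exp 1 * exp (- (t / d)))"
    proof -
      have "t / d \<le> 1" using True d by simp
      then have "1 \<le> exp (1 - t / d)" by simp
      then have "1 \<le> exp 1 * exp (- (t / d))" by (simp flip: exp_add)
      from mult_left_mono[OF this, of "8 * doubling_const lam * (d / t) powr \<sigma>"] show ?thesis by (simp add: doubling_const_pos less_imp_le)
    qed
    also have "\<dots> = C1 * X" by (simp add: C1_def X_def)
    also have "\<dots> \<le> (C1 + C2) * X + 2 * e * real N * exp (- t)"
    proof -
      have "0 \<le> C2 * X" "0 \<le> 2 * e * real N * exp (- t)" using Cp X e0 by auto
      then show ?thesis by (simp add: distrib_right)
    qed
    finally show ?thesis .
  next
    case False
    then have dt: "d \<le> t" by simp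
    define \<tau> where "\<tau> = t / d"
    have tau: "\<tau> \<ge> 1" using dt d by (simp add: \<tau>_def)
    have "(t - d) * real N = K * \<tau> - K"
    proof -
      have "real N = K / d" using K(1) d by (simp add: field_simps)
      then show ?thesis using d by (simp add: \<tau>_def field_simps)
    qed
    then have "- (t - d) * real N = K + - (K * \<tau>)" by (simp add: algebra_simps)
    then have ex: "exp (- (t - d) * real N) = exp K * exp (- (K * \<tau>))" by (simp only: exp_add)
    have "4 * (2 * t / d) powr c * exp (- (t - d) * real N) = 4 * 2 powr c * exp K * (\<tau> powr c * exp (- (K * \<tau>)))"
      unfolding ex using d t by (simp add: \<tau>_def powr_mult flip: times_divide_eq_right)
    \<comment> \<open>Since \<open>K \<ge> 2\<close> there are two factors
      \<open>exp (- \<tau>)\<close>: one absorbs the power \<open>c + \<sigma>\<close> of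
      \<open>\<tau>\<close>, the other is kept as decay.\<close>
    also have "\<tau> powr c * exp (- (K * \<tau>)) \<le> X * (c + \<sigma>) powr (c + \<sigma>)"
    proof -
      have 1: "\<tau> powr c = \<tau> powr (c + \<sigma>) * \<tau> powr (- \<sigma>)" using tau by (simp flip: powr_add)
      have 2: "exp (- (K * \<tau>)) \<le> exp (- \<tau>) * exp (- \<tau>)"
        using mult_right_mono[OF K(2), of \<tau>] tau by (simp flip: exp_add)
      have 3: "\<tau> powr (c + \<sigma>) * exp (- \<tau>) \<le> (c + \<sigma>) powr (c + \<sigma>)"
        using tau s0 by (intro powr_exp_bound) auto
      have 4: "\<tau> powr (- \<sigma>) * exp (- \<tau>) = X"
      proof -
        have "d / t = inverse \<tau>" by (simp add: \<tau>_def)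
        then have "(d / t) powr \<sigma> = \<tau> powr (- \<sigma>)" by (simp add: powr_minus inverse_powr)
        then show ?thesis by (simp add: X_def \<tau>_def)
      qed
      have "\<tau> powr c * exp (- (K * \<tau>)) \<le> \<tau> powr c * (exp (- \<tau>) * exp (- \<tau>))"
        using 2 by (rule mult_left_mono) simp
      also have "\<dots> = (\<tau> powr (- \<sigma>) * exp (- \<tau>)) * (\<tau> powr (c + \<sigma>) * exp (- \<tau>))" unfolding 1 by (simp only: mult_ac)
      also have "\<dots> = X * (\<tau> powr (c + \<sigma>) * exp (- \<tau>))" unfolding 4 ..
      also have "\<dots> \<le> X * (c + \<sigma>) powr (c + \<sigma>)" using 3 X by (rule mult_left_mono)
      finally show ?thesis .
    qed
    finally have "4 * (2 * t / d) powr c * exp (- (t - d) * real N) \<le> 4 * 2 powr c * exp K * (X * (c + \<sigma>) powr (c + \<sigma>))" by simp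
    then have "2 * (4 * (2 * t / d) powr c * exp (- (t - d) * real N)) \<le> C2 * X" by (simp add: C2_def mult_ac)
    moreover have "\<bar>\<Sum>n. node_coeff g n * exp (- t) ^ n\<bar> \<le> 2 * (e * real N * exp (- t) + 4 * (2 * t / d) powr c * exp (- (t - d) * real N))"
      unfolding c_def by (rule node_coeff_sum_large[OF g lb g0 fn dt])
    moreover have "0 \<le> C1 * X" using Cp X by simp
    ultimately show ?thesis by (simp add: algebra_simps)
  qed
  then show ?thesis unfolding \<sigma>_def[symmetric] C X_def by (simp only: mult.assoc)
qed

text \<open>The inverse of the eigenvalue power splits into
  \<open>(n + 2 * lam) powr (- r / 2)\<close> and \<open>n powr (- r / 2)\<close>, and
  \<open>laplace_step\<close> is applied once for each. Each application consumes half of the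
  singularity \<open>\<sigma> = (2 * lam + 1) * \<theta>\<close>, which works because
  \<open>\<sigma> / 2 < r / 2\<close>.\<close>

lemma nodes_error:
  assumes f: "continuous_on (cball 0 1) f" and fg: "is_frac_power \<mu> r f g" and r: "r > 0"
    and g: "integrable (ball_measure \<mu>) g" and lb: "level_bound \<theta> g"
    and th: "0 \<le> \<theta>" "\<theta> \<le> 1" "(2 * lam + 1) * \<theta> < r" and fn: "node_ok N d e" and K: "d * real N = K" "K \<ge> 2"
  shows "\<bar>(LINT y|ball_measure \<mu>. f y) - (\<Sum>i\<in>J. w i * f (x i))\<bar> \<le>
     error_const lam ((2 * lam + 1) * \<theta>) K * (Gamma (r / 2 - (2 * lam + 1) * \<theta> / 2) / Gamma (r / 2))\<^sup>2 * d powr r + 2 * e * real N"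
proof -
  define \<sigma> where "\<sigma> = (2 * lam + 1) * \<theta>"
  define \<alpha> where "\<alpha> = r / 2"
  define Q where "Q = Gamma (\<alpha> - \<sigma> / 2) / Gamma \<alpha>"
  define C where "C = error_const lam \<sigma> K"
  define eps where "eps = 2 * e * real N"
  have d: "d > 0" using fn by (auto simp: node_ok_def trunc_ok_def)
  have s0: "\<sigma> \<ge> 0" using lam_nonneg th by (auto simp: \<sigma>_def)
  have sa: "\<sigma> / 2 < \<alpha>" "\<alpha> > 0" using th r by (auto simp: \<sigma>_def \<alpha>_def)
  have eps: "eps \<ge> 0" using fn by (auto simp: eps_def node_ok_def)
  have C0: "C \<ge> 0" unfolding C_def by (rule error_const_nonneg)
  have Q0: "Q \<ge> 0" unfolding Q_def using sa by (intro divide_nonneg_nonneg less_imp_le[OF Gamma_real_pos]) auto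
  have fi: "integrable (ball_measure \<mu>) f" by (rule integrable_ball_continuous[OF mu f])
  have pr: "orth_proj \<mu> n g y = (real n * (real n + 2 * lam)) powr \<alpha> * orth_proj \<mu> n f y" for n y
  proof -
    have "real n + 2 * \<mu> + real CARD('d) - 1 = real n + 2 * lam" by (simp add: lam_def field_simps)
    then show ?thesis using fg unfolding is_frac_power_def \<alpha>_def by metis
  qed
  \<comment> \<open>The eigenvalue at \<open>k = 0\<close> is 0 and
    \<open>0 powr (r / 2) = 0\<close>, so the projection of \<open>g\<close> to the constants
    vanishes.\<close>
  have g0: "(LINT y|ball_measure \<mu>. g y) = 0"
    using pr[of 0 0] by (simp add: orth_proj_eq[OF mu] proj_kernel_0[OF mu])
  have e0: "node_coeff g 0 = 0" using g0 by (simp add: node_coeff_def node_kernel_0)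
  have bd: "\<bar>\<Sum>n. node_coeff g n * exp (- t) ^ n\<bar> \<le> C * (d / t) powr (\<sigma> / 2 + \<sigma> / 2) * exp (- (t / d)) + eps * exp (- t)" if "t > 0" for t
    using node_coeff_sum_bound[OF g lb g0 th(1,2) fn K that] unfolding C_def eps_def field_sum_of_halves \<sigma>_def .
  define e1 where "e1 n = node_coeff g n * (real n + 2 * lam) powr (- \<alpha>)" for n
  define C1 where "C1 = C * d powr \<alpha> * Gamma (\<alpha> - \<sigma> / 2) / Gamma \<alpha>"
  have e10: "e1 0 = 0" by (simp add: e1_def e0)
  have l2: "2 * lam \<ge> 0" using lam_nonneg by simp
  note par1 = l2 sa(2) divide_nonneg_pos[OF s0 zero_less_numeral] divide_nonneg_pos[OF s0 zero_less_numeral] sa(1) d C0 eps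
  have e1s: "summable (\<lambda>n. \<bar>e1 n\<bar> * exp (- t) ^ n)" if "t > 0" for t
    unfolding e1_def using laplace_step(1)[OF e0 node_coeff_summable[OF g] bd par1 that] .
  have C1eq: "C1 = C * d powr \<alpha> * Q" by (simp add: C1_def Q_def)
  have C10: "C1 \<ge> 0" unfolding C1eq using C0 Q0 by simp
  have e1b: "\<bar>\<Sum>n. e1 n * exp (- t) ^ n\<bar> \<le> C1 * (d / t) powr (0 + \<sigma> / 2) * exp (- (t / d)) + eps * exp (- t)" if "t > 0" for t
    unfolding e1_def C1_def using laplace_step(2)[OF e0 node_coeff_summable[OF g] bd par1 that] by simp
  define e2 where "e2 n = e1 n * (real n + 0) powr (- \<alpha>)" for n
  note par2 = order_refl[of "0::real"] sa(2) order_refl[of "0::real"] divide_nonneg_pos[OF s0 zero_less_numeral] sa(1) d C10 eps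
  have e2s: "summable (\<lambda>n. \<bar>e2 n\<bar> * exp (- t) ^ n)" if "t > 0" for t
    unfolding e2_def using laplace_step(1)[OF e10 e1s e1b par2 that] .
  have e2b: "\<bar>\<Sum>n. e2 n * exp (- t) ^ n\<bar> \<le> (C1 * d powr \<alpha> * Gamma (\<alpha> - \<sigma> / 2) / Gamma \<alpha>) * (d / t) powr 0 * exp (- (t / d)) + eps * exp (- t)" if "t > 0" for t
    unfolding e2_def using laplace_step(2)[OF e10 e1s e1b par2 that] .
  have ef: "node_coeff f n = e2 n" if "n > 0" for n
  proof -
    have np: "real n > 0" "real n + 2 * lam > 0" using that lam_nonneg by auto
    have "node_coeff g n = (real n * (real n + 2 * lam)) powr \<alpha> * node_coeff f n"
      unfolding node_coeff_proj[OF g] node_coeff_proj[OF fi] pr sum_distrib_left by (intro sum.cong refl) (simp only: mult_ac)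
    then have "e2 n = ((real n * (real n + 2 * lam)) powr \<alpha> * ((real n + 2 * lam) powr (- \<alpha>) * (real n) powr (- \<alpha>))) * node_coeff f n"
      by (simp add: e2_def e1_def mult_ac)
    also have "(real n * (real n + 2 * lam)) powr \<alpha> * ((real n + 2 * lam) powr (- \<alpha>) * (real n) powr (- \<alpha>)) = 1"
      using np unfolding powr_mult powr_minus by (simp add: field_simps del: distrib_left distrib_right)
    finally show ?thesis by simp
  qed
  have B: "\<bar>(\<Sum>n. node_coeff f n * exp (- t) ^ n) - (LINT y|ball_measure \<mu>. f y)\<bar> \<le> C * Q\<^sup>2 * d powr r + eps" if t: "t > 0" for t
  proof -
    have s1: "summable (\<lambda>n. node_coeff f n * exp (- t) ^ n)"
    proof -
      have "summable (\<lambda>n. \<bar>node_coeff f n * exp (- t) ^ n\<bar>)" using node_coeff_summable[OF fi t] by (simp add: abs_mult)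
      then show ?thesis by (rule summable_rabs_cancel)
    qed
    have s2: "summable (\<lambda>n. e2 n * exp (- t) ^ n)"
    proof -
      have "summable (\<lambda>n. \<bar>e2 n * exp (- t) ^ n\<bar>)" using e2s[OF t] by (simp add: abs_mult)
      then show ?thesis by (rule summable_rabs_cancel)
    qed
    have "(\<Sum>n. node_coeff f n * exp (- t) ^ n) = (\<Sum>n. node_coeff f (Suc n) * exp (- t) ^ Suc n) + node_coeff f 0"
      using suminf_split_head[OF s1] by simp
    also have "(\<Sum>n. node_coeff f (Suc n) * exp (- t) ^ Suc n) = (\<Sum>n. e2 (Suc n) * exp (- t) ^ Suc n)"
      using ef by simp
    also have "\<dots> = (\<Sum>n. e2 n * exp (- t) ^ n)"
      using suminf_split_head[OF s2] by (simp add: e2_def e10)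
    finally have "(\<Sum>n. node_coeff f n * exp (- t) ^ n) - (LINT y|ball_measure \<mu>. f y) = (\<Sum>n. e2 n * exp (- t) ^ n)"
      by (simp add: node_coeff_def node_kernel_0)
    also have "\<bar>\<dots>\<bar> \<le> (C1 * d powr \<alpha> * Gamma (\<alpha> - \<sigma> / 2) / Gamma \<alpha>) * (d / t) powr 0 * exp (- (t / d)) + eps * exp (- t)"
      by (rule e2b[OF t])
    also have "\<dots> = (C * Q\<^sup>2 * d powr r) * exp (- (t / d)) + eps * exp (- t)"
    proof -
      have "d powr r = d powr \<alpha> * d powr \<alpha>" by (simp add: \<alpha>_def flip: powr_add)
      moreover have "(d / t) powr 0 = 1" using d t by simp
      ultimately show ?thesis by (simp add: C1eq Q_def power2_eq_square)
    qed
    also have "\<dots> \<le> (C * Q\<^sup>2 * d powr r) * 1 + eps * 1"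
      using C0 eps d t by (intro add_mono mult_left_mono) auto
    finally show ?thesis by simp
  qed
  show ?thesis
    using abel_limit_bound[OF f B] by (simp add: C_def \<sigma>_def Q_def \<alpha>_def eps_def)
qed

lemma level_bound_Lp:
  assumes g: "g \<in> Lp_space \<mu> p" and n1: "Lp_norm \<mu> p g \<le> 1" and p: "1 \<le> p"
  shows "integrable (ball_measure \<mu>) g \<and> level_bound (if p = \<infinity> then 0 else 1 / enn2real p) g"
proof (cases "p = \<infinity>")
  case True
  then have gc: "continuous_on (cball 0 1) g" and sup: "(SUP x\<in>cball 0 1. \<bar>g x\<bar>) \<le> 1"
    using g n1 by (auto simp: Lp_space_def Lp_norm_def)
  have "bdd_above ((\<lambda>x. \<bar>g x\<bar>) ` cball 0 1)"
    by (intro bounded_imp_bdd_above compact_imp_bounded compact_continuous_image continuous_intros gc) auto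
  then have g1: "\<bar>g y\<bar> \<le> 1" if "norm y \<le> 1" for y
    using cSUP_upper[of y "cball 0 1" "\<lambda>x. \<bar>g x\<bar>"] sup that by (auto intro: order_trans)
  have gi: "integrable (ball_measure \<mu>) g" by (rule integrable_ball_continuous[OF mu gc])
  have "level_bound 0 g"
    unfolding level_bound_def
  proof (intro allI impI)
    fix A :: real and \<psi> :: "real ^ 'd \<Rightarrow> real"
    assume A: "1 \<le> A" and m: "\<psi> \<in> borel_measurable (ball_measure \<mu>)" and b: "\<forall>y. norm y \<le> 1 \<longrightarrow> 0 \<le> \<psi> y \<and> \<psi> y \<le> A"
      and i: "(LINT y|ball_measure \<mu>. \<psi> y) \<le> 1"
    have pi: "integrable (ball_measure \<mu>) \<psi>" by (rule integrable_ball_bounded[OF mu m, of A]) (use b in auto)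
    have "(LINT y|ball_measure \<mu>. \<bar>g y\<bar> * \<psi> y) \<le> (LINT y|ball_measure \<mu>. \<psi> y)"
    proof (rule integral_mono)
      show "integrable (ball_measure \<mu>) (\<lambda>y. \<bar>g y\<bar> * \<psi> y)"
        by (rule integrable_times_bounded[OF _ m, of _ A]) (use gi b in auto)
      fix y :: "real ^ 'd" assume "y \<in> space (ball_measure \<mu>)"
      then show "\<bar>g y\<bar> * \<psi> y \<le> \<psi> y" using g1[of y] b by (simp add: mult_left_le_one_le)
    qed (rule pi)
    then show "(LINT y|ball_measure \<mu>. \<bar>g y\<bar> * \<psi> y) \<le> 2 * A powr 0" using i A by simp
  qed
  then show ?thesis using gi True by simp
next
  case False
  define q where "q = enn2real p"
  have pq: "p = ennreal q" using False by (cases p) (auto simp: q_def)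
  have q: "q \<ge> 1" using p unfolding pq by simp
  have ball_prob: "g \<in> borel_measurable (ball_measure \<mu>)" and gq: "integrable (ball_measure \<mu>) (\<lambda>x. \<bar>g x\<bar> powr q)"
    and nq: "(LINT x|ball_measure \<mu>. \<bar>g x\<bar> powr q) powr (1 / q) \<le> 1"
    using g n1 False by (auto simp: Lp_space_def Lp_norm_def q_def)
  have int1: "(LINT x|ball_measure \<mu>. \<bar>g x\<bar> powr q) \<le> 1"
  proof (rule ccontr)
    assume "\<not> ?thesis"
    then have "1 powr (1 / q) < (LINT x|ball_measure \<mu>. \<bar>g x\<bar> powr q) powr (1 / q)"
      using q by (intro powr_less_mono2) auto
    then show False using nq by simp
  qed
  have split: "\<bar>g y\<bar> \<le> \<bar>g y\<bar> powr q * a powr (1 - q) + a" if "a > 0" for a y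
    using le_powr_split[of "\<bar>g y\<bar>" a q] that q by simp
  have gi: "integrable (ball_measure \<mu>) g"
  proof (rule Bochner_Integration.integrable_bound)
    show "integrable (ball_measure \<mu>) (\<lambda>y. \<bar>g y\<bar> powr q + 1)" 
      by (intro Bochner_Integration.integrable_add gq integrable_ball_continuous[OF mu] continuous_on_const)
    show "AE y in ball_measure \<mu>. norm (g y) \<le> norm (\<bar>g y\<bar> powr q + 1)"
      using split[of 1] by (intro AE_I2) (simp add: add_nonneg_nonneg)
  qed (rule ball_prob)
  have "level_bound (1 / q) g"
    unfolding level_bound_def
  proof (intro allI impI)
    fix A :: real and \<psi> :: "real ^ 'd \<Rightarrow> real"
    assume A: "1 \<le> A" and m: "\<psi> \<in> borel_measurable (ball_measure \<mu>)" and b: "\<forall>y. norm y \<le> 1 \<longrightarrow> 0 \<le> \<psi> y \<and> \<psi> y \<le> A"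
      and i: "(LINT y|ball_measure \<mu>. \<psi> y) \<le> 1"
    \<comment> \<open>The level at which the two terms \<open>a powr (1 - q) * A\<close> and
      \<open>a\<close> of the splitting are equal.\<close>
    define a where "a = A powr (1 / q)"
    have a: "a > 0" using A by (simp add: a_def)
    have pi: "integrable (ball_measure \<mu>) \<psi>" by (rule integrable_ball_bounded[OF mu m, of A]) (use b in auto)
    have "(LINT y|ball_measure \<mu>. \<bar>g y\<bar> * \<psi> y) \<le> (LINT y|ball_measure \<mu>. (a powr (1 - q) * A) * \<bar>g y\<bar> powr q + a * \<psi> y)"
    proof (rule integral_mono)
      show "integrable (ball_measure \<mu>) (\<lambda>y. \<bar>g y\<bar> * \<psi> y)"
        by (rule integrable_times_bounded[OF _ m, of _ A]) (use gi b in auto)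
      show "integrable (ball_measure \<mu>) (\<lambda>y. (a powr (1 - q) * A) * \<bar>g y\<bar> powr q + a * \<psi> y)"
        using gq pi by simp
      fix y :: "real ^ 'd" assume "y \<in> space (ball_measure \<mu>)"
      then have py: "0 \<le> \<psi> y" "\<psi> y \<le> A" using b by auto
      have "\<bar>g y\<bar> * \<psi> y \<le> (\<bar>g y\<bar> powr q * a powr (1 - q) + a) * \<psi> y"
        using split[OF a] py by (intro mult_right_mono) auto
      also have "\<dots> \<le> (a powr (1 - q) * A) * \<bar>g y\<bar> powr q + a * \<psi> y"
        using mult_left_mono[OF py(2), of "\<bar>g y\<bar> powr q * a powr (1 - q)"] by (simp add: algebra_simps)
      finally show "\<bar>g y\<bar> * \<psi> y \<le> (a powr (1 - q) * A) * \<bar>g y\<bar> powr q + a * \<psi> y" .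
    qed
    also have "\<dots> = (a powr (1 - q) * A) * (LINT y|ball_measure \<mu>. \<bar>g y\<bar> powr q) + a * (LINT y|ball_measure \<mu>. \<psi> y)"
      using gq pi by simp
    also have "\<dots> \<le> (a powr (1 - q) * A) * 1 + a * 1"
      using int1 i a A by (intro add_mono mult_left_mono) auto
    also have "a powr (1 - q) * A = a"
    proof -
      have "A = a powr q" using A q by (simp add: a_def powr_powr)
      then have "a powr (1 - q) * A = a powr (1 - q) * a powr q" by simp
      also have "\<dots> = a" using a by (simp flip: powr_add)
      finally show ?thesis .
    qed
    finally show "(LINT y|ball_measure \<mu>. \<bar>g y\<bar> * \<psi> y) \<le> 2 * A powr (1 / q)" by (simp add: a_def)
  qed
  then show ?thesis using gi False by (simp add: q_def)
qed

end

section \<open>Algorithms and the upper bound\<close>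

lemma length_observed_values [simp]: "length (observed_values X f n) = n"
  by (induction n) auto

lemma nth_observed_values: "k < n \<Longrightarrow> observed_values X f n ! k = f (X (observed_values X f k))"
  by (induction n) (auto simp: nth_append less_Suc_eq)

lemma linear_algorithm:
  fixes x :: "nat \<Rightarrow> real ^ 'd::finite"
  assumes "finite J" "card J \<le> n" "\<And>i. norm (x i) \<le> 1"
  shows "(\<lambda>f. \<Sum>i\<in>J. w i * f (x i)) \<in> det_algorithms n"
proof -
  obtain h where h: "bij_betw h {0..<card J} J" using ex_bij_betw_nat_finite[OF assms(1)] by blast
  \<comment> \<open>After the nodes are exhausted \<open>h\<close> takes unspecified values; the
    queried points remain in the ball because \<open>x\<close> maps every index into it, and
    \<open>\<phi>\<close> ignores those answers.\<close>
  define X where "X v = x (h (length v))" for v :: "real list"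
  define \<phi> where "\<phi> vs = (\<Sum>k\<in>{0..<card J}. w (h k) * vs ! k)" for vs
  have "(\<Sum>i\<in>J. w i * f (x i)) = \<phi> (observed_values X f n)" for f
  proof -
    have "\<phi> (observed_values X f n) = (\<Sum>k\<in>{0..<card J}. w (h k) * f (x (h k)))"
      unfolding \<phi>_def using assms(2) by (intro sum.cong) (auto simp: nth_observed_values X_def)
    also have "\<dots> = (\<Sum>i\<in>J. w i * f (x i))" by (rule sum.reindex_bij_betw[OF h])
    finally show ?thesis by simp
  qed
  moreover have "X v \<in> cball 0 1" for v using assms(3) by (simp add: X_def)
  ultimately show ?thesis unfolding det_algorithms_def by blast
qed

lemma det_error_le:
  assumes "A \<in> det_algorithms n" "\<And>f. f \<in> F \<Longrightarrow> \<bar>INT_ball \<mu> f - A f\<bar> \<le> c"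
  shows "det_error \<mu> n F \<le> ennreal c"
proof -
  have "(SUP f\<in>F. ennreal \<bar>INT_ball \<mu> f - A f\<bar>) \<le> ennreal c"
    using assms(2) by (intro SUP_least ennreal_leI)
  then show ?thesis unfolding det_error_def using assms(1) by (rule INF_lower2[rotated])
qed

lemma Lp_norm_nonneg: "continuous_on (cball 0 1) f \<or> p \<noteq> \<infinity> \<Longrightarrow> Lp_norm \<mu> p f \<ge> 0"
proof (cases "p = \<infinity>")
  case True
  assume "continuous_on (cball 0 1) f \<or> p \<noteq> \<infinity>"
  then have c: "continuous_on (cball 0 1) f" using True by simp
  have "bdd_above ((\<lambda>x. \<bar>f x\<bar>) ` cball 0 1)"
    by (intro bounded_imp_bdd_above compact_imp_bounded compact_continuous_image continuous_intros c) auto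
  then have "\<bar>f 0\<bar> \<le> (SUP x\<in>cball 0 1. \<bar>f x\<bar>)" by (intro cSUP_upper) auto
  then have "0 \<le> (SUP x\<in>cball 0 1. \<bar>f x\<bar>)" by (rule order_trans[OF abs_ge_zero])
  then show ?thesis by (simp add: Lp_norm_def True)
qed (simp add: Lp_norm_def)

lemma upper_bound:
  fixes \<mu> r :: real and p :: ennreal
  assumes mu: "\<mu> \<ge> 0" and p: "1 \<le> p"
    and pr: "ennreal (real CARD('d::finite) + 2 * \<mu>) / p < ennreal r"
  shows "\<exists>c>0. \<forall>n\<ge>1. det_error \<mu> n (sobolev_ball \<mu> p r :: (real ^ 'd \<Rightarrow> real) set)
        \<le> ennreal (c * real n powr (- r / real CARD('d)))"
proof -
  define dd where "dd = CARD('d)"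
  define l where "l = \<mu> + (real CARD('d) - 1) / 2"
  define s where "s = 2 * l + 1"
  have s: "s = real CARD('d) + 2 * \<mu>" by (simp add: s_def l_def field_simps)
  have dd1: "real dd \<ge> 1" using zero_less_card_finite[where 'a = 'd] unfolding dd_def by linarith
  have l0: "l \<ge> 0"
  proof -
    have "(real dd - 1) / 2 \<ge> 0" using dd1 by (intro divide_nonneg_pos) linarith+
    then show ?thesis using mu unfolding l_def dd_def by (rule add_nonneg_nonneg[rotated])
  qed
  define \<theta> where "\<theta> = (if p = \<infinity> then 0 else 1 / enn2real p)"
  have r0: "r > 0" using pr by (metis ennreal_less_zero_iff ennreal_neg linorder_not_le not_less_zero)
  have th: "0 \<le> \<theta>" "\<theta> \<le> 1" "s * \<theta> < r"
  proof -
    have "0 \<le> \<theta> \<and> \<theta> \<le> 1 \<and> s * \<theta> < r"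
    proof (cases "p = \<infinity>")
      case True
      then show ?thesis using r0 by (simp add: \<theta>_def)
    next
      case False
      define q where "q = enn2real p"
      have pq: "p = ennreal q" using False by (cases p) (auto simp: q_def)
      have q: "q \<ge> 1" using p unfolding pq by simp
      have s0: "s \<ge> 0" using l0 by (simp add: s_def)
      have "ennreal s / ennreal q < ennreal r" using pr unfolding s pq .
      then have "ennreal (s / q) < ennreal r" using s0 q by (simp add: divide_ennreal)
      then have "s / q < r" using r0 s0 q by (simp add: ennreal_less_iff)
      then show ?thesis using q False by (simp add: \<theta>_def q_def[symmetric])
    qed
    then show "0 \<le> \<theta>" "\<theta> \<le> 1" "s * \<theta> < r" by auto
  qed
  define D where "D = 2 powr (2 * l + 4) * doubling_const l * 2 powr (2 * l + 1)"
  have D: "D \<ge> 1"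
  proof -
    have "(1::real) \<le> 2 powr (2 * l + 4)" "(1::real) \<le> 2 powr (2 * l + 1)" "1 \<le> doubling_const l"
      unfolding doubling_const_def using l0 by (auto intro!: ge_one_powr_ge_zero)
    then have "1 * 1 * 1 \<le> D" unfolding D_def by (intro mult_mono) auto
    then show ?thesis by simp
  qed
  \<comment> \<open>With \<open>d * N = K\<close> this makes
    \<open>exp (- K / 2) * D \<le> 1/2\<close>, the smallness demanded by \<open>trunc_ok\<close>;
    the summand 2 gives \<open>K \<ge> 2\<close>.\<close>
  define K where "K = 2 * ln (2 * D) + 2"
  have K: "K \<ge> 2" using D by (simp add: K_def)
  have KD: "exp (- (K / 2)) * D \<le> 1/2"
  proof -
    have "exp (- (K / 2)) = exp (- ln (2 * D)) * exp (- 1)" by (simp add: K_def field_simps flip: exp_add)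
    also have "\<dots> = exp (- 1) / (2 * D)" using D by (simp add: exp_minus field_simps)
    finally have "exp (- (K / 2)) * D = exp (- 1) / 2" using D by simp
    moreover have "exp (- 1 :: real) \<le> 1" by simp
    ultimately show ?thesis by simp
  qed
  define C where "C = error_const l (s * \<theta>) K * (Gamma (r / 2 - s * \<theta> / 2) / Gamma (r / 2))\<^sup>2"
  have C0: "C \<ge> 0" unfolding C_def by (intro mult_nonneg_nonneg error_const_nonneg) auto
  \<comment> \<open>Below this value of \<open>n powr (1 / dim)\<close> the zero algorithm is good
    enough; above it the degree satisfies \<open>N \<ge> K\<close>, so that \<open>d = K / N\<close>
    is at most 1.\<close>
  define M where "M = max 4 (2 * K)"
  define c where "c = 2 * M powr r + (C + 2) * (2 * K) powr r"
  have M: "M \<ge> 4" "M \<ge> 2 * K" by (auto simp: M_def)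
  have c: "c > 0" unfolding c_def using M C0 K by (intro add_pos_nonneg mult_nonneg_nonneg) auto
  have fL: "integrable (ball_measure \<mu>) f \<and> ball_nodes.level_bound \<mu> \<theta> f" if "f \<in> Lp_space \<mu> p" "Lp_norm \<mu> p f \<le> 1" for f :: "real ^ 'd \<Rightarrow> real"
  proof -
    \<comment> \<open>A dummy rule with one node: \<open>level_bound\<close> depends on
      \<open>\<mu>\<close> alone, but its properties live in the locale of nodes.\<close>
    interpret ball_nodes \<mu> "\<lambda>_. 1" "{0}" "\<lambda>_. 0 :: real ^ 'd" by unfold_locales (auto simp: mu)
    show ?thesis unfolding \<theta>_def by (rule level_bound_Lp[OF that p])
  qed
  have "det_error \<mu> n (sobolev_ball \<mu> p r :: (real ^ 'd \<Rightarrow> real) set) \<le> ennreal (c * real n powr (- r / real CARD('d)))" if n: "n \<ge> 1" for n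
  proof -
    define R where "R = real n powr (1 / real dd)"
    have R1: "R \<ge> 1" unfolding R_def using n dd1 by (intro ge_one_powr_ge_zero) auto
    have Rr: "real n powr (- r / real CARD('d)) = R powr (- r)"
      by (simp add: R_def powr_powr dd_def)
    show ?thesis
    proof (cases "R < M")
      case True
      have "det_error \<mu> n (sobolev_ball \<mu> p r :: (real ^ 'd \<Rightarrow> real) set) \<le> ennreal 2"
      proof (rule det_error_le)
        show "(\<lambda>f. \<Sum>i\<in>{}. 0 * f (0 :: real ^ 'd)) \<in> det_algorithms n"
          using linear_algorithm[of "{}" n "\<lambda>_. 0 :: real ^ 'd" "\<lambda>_. 0"] by simp
        fix f :: "real ^ 'd \<Rightarrow> real" assume f: "f \<in> sobolev_ball \<mu> p r"
        then obtain g :: "real ^ 'd \<Rightarrow> real" where g: "f \<in> Lp_space \<mu> p" "continuous_on (cball 0 1) f" "g \<in> Lp_space \<mu> p" "Lp_norm \<mu> p f + Lp_norm \<mu> p g \<le> 1"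
          by (auto simp: sobolev_ball_def)
        have "Lp_norm \<mu> p g \<ge> 0" using g(3) by (intro Lp_norm_nonneg) (auto simp: Lp_space_def)
        then have "Lp_norm \<mu> p f \<le> 1" using g(4) by linarith
        then have lb: "ball_nodes.level_bound \<mu> \<theta> f" using fL[OF g(1)] by simp
        interpret ball_nodes \<mu> "\<lambda>_. 1" "{0}" "\<lambda>_. 0 :: real ^ 'd" by unfold_locales (auto simp: mu)
        have "\<bar>INT_ball \<mu> f\<bar> \<le> (LINT y|ball_measure \<mu>. \<bar>f y\<bar>)" unfolding INT_ball_def by (rule integral_abs_bound)
        also have "\<dots> \<le> 2" by (rule level_bound_L1[OF lb])
        finally show "\<bar>INT_ball \<mu> f - (\<Sum>i\<in>{}. 0 * f 0)\<bar> \<le> 2" by simp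
      qed
      also have "2 \<le> c * R powr (- r)"
      proof -
        have "1 = M powr r * M powr (- r)" using M by (simp flip: powr_add)
        also have "\<dots> \<le> M powr r * R powr (- r)" using True R1 r0 by (intro mult_left_mono powr_mono2') auto
        finally have "2 \<le> (2 * M powr r) * R powr (- r)" by simp
        also have "\<dots> \<le> c * R powr (- r)" unfolding c_def using C0 by (intro mult_right_mono) auto
        finally show ?thesis .
      qed
      finally show ?thesis unfolding Rr by (simp add: ennreal_leI)
    next
      case False
      \<comment> \<open>The largest degree with \<open>N + 1 \<le> R\<close>, so that the at most
        \<open>(N + 1) ^ dd\<close> nodes fit into the budget \<open>n\<close>.\<close>
      define N where "N = nat \<lfloor>R\<rfloor> - 1"
      have fl: "real (nat \<lfloor>R\<rfloor>) \<le> R" "real (nat \<lfloor>R\<rfloor>) \<ge> R - 1" using R1 by linarith+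
      have N1: "real N + 1 = real (nat \<lfloor>R\<rfloor>)" unfolding N_def using R1 by (simp add: of_nat_diff le_nat_iff)
      have Nle: "real N + 1 \<le> R" and Nge: "real N \<ge> R / 2" using N1 fl False M by linarith+
      have NK: "real N \<ge> K" using Nge False M by linarith
      have Np: "real N > 0" using NK K by linarith
      have card: "(N + 1) ^ dd \<le> n"
      proof -
        have "(real N + 1) ^ dd \<le> R ^ dd" using Nle by (intro power_mono) auto
        also have "R ^ dd = real n" unfolding R_def using n dd1 by (simp add: powr_power)
        finally have "real ((N + 1) ^ dd) \<le> real n" by (simp add: add.commute)
        then show ?thesis by (simp only: of_nat_le_iff)
      qed
      define d where "d = K / real N"
      have d: "d > 0" "d \<le> 1" "d * real N = K" using NK Np K by (auto simp: d_def)
      \<comment> \<open>Makes the contribution \<open>e * N\<close> of inexactness equal to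
        \<open>d powr r\<close>, the size of the main error, and at most 1 as \<open>node_ok\<close>
        requires.\<close>
      define e where "e = d powr r / real N"
      have e: "e > 0" "e * real N = d powr r" using d Np by (auto simp: e_def)
      have dr: "d powr r \<le> 1" using d r0 by (intro powr_le1) auto
      obtain J :: "nat set" and w :: "nat \<Rightarrow> real" and x :: "nat \<Rightarrow> real ^ 'd" where
        J: "finite J" "card J \<le> (N + 1) ^ CARD('d)" "\<And>i. i \<in> J \<Longrightarrow> w i \<ge> 0" "\<And>i. norm (x i) \<le> 1" "(\<Sum>i\<in>J. w i) = 1"
        and q: "\<And>j y. 1 \<le> j \<Longrightarrow> j \<le> N \<Longrightarrow> norm y \<le> 1 \<Longrightarrow> \<bar>\<Sum>i\<in>J. w i * proj_kernel \<mu> j (x i) y\<bar> \<le> e"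
        by (rule ball_quadrature[OF mu e(1), of N]) blast
      interpret B: ball_nodes \<mu> w J x by unfold_locales (use mu J in auto)
      have Bl: "B.lam = l" by (simp add: B.lam_def l_def)
      have ok: "B.node_ok N d e"
        unfolding B.node_ok_def trunc_ok_def Bl B.node_kernel_def using d e dr q KD
        by (auto simp: D_def mult.assoc)
      have "det_error \<mu> n (sobolev_ball \<mu> p r :: (real ^ 'd \<Rightarrow> real) set) \<le> ennreal ((C + 2) * d powr r)"
      proof (rule det_error_le)
        show "(\<lambda>f. \<Sum>i\<in>J. w i * f (x i)) \<in> det_algorithms n"
          using J card by (intro linear_algorithm) (auto simp: dd_def)
        fix f :: "real ^ 'd \<Rightarrow> real" assume f: "f \<in> sobolev_ball \<mu> p r"
        then obtain g :: "real ^ 'd \<Rightarrow> real" where g: "f \<in> Lp_space \<mu> p" "continuous_on (cball 0 1) f" "g \<in> Lp_space \<mu> p" "is_frac_power \<mu> r f g" "Lp_norm \<mu> p f + Lp_norm \<mu> p g \<le> 1"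
          by (auto simp: sobolev_ball_def)
        have "Lp_norm \<mu> p f \<ge> 0" using g(2) by (intro Lp_norm_nonneg) auto
        then have "Lp_norm \<mu> p g \<le> 1" using g(5) by linarith
        then have gi: "integrable (ball_measure \<mu>) g" and lb: "B.level_bound \<theta> g" using fL[OF g(3)] by auto
        have "\<bar>INT_ball \<mu> f - (\<Sum>i\<in>J. w i * f (x i))\<bar> \<le> C * d powr r + 2 * e * real N"
          using B.nodes_error[OF g(2,4) r0 gi lb th(1,2) _ ok d(3) K] th(3)
          unfolding INT_ball_def Bl s_def[symmetric] C_def by simp
        also have "\<dots> = (C + 2) * d powr r" using e(2) by (simp add: algebra_simps)
        finally show "\<bar>INT_ball \<mu> f - (\<Sum>i\<in>J. w i * f (x i))\<bar> \<le> (C + 2) * d powr r" .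
      qed
      also have "(C + 2) * d powr r \<le> c * R powr (- r)"
      proof -
        have "d \<le> 2 * K / R" unfolding d_def using Nge Np R1 K by (simp add: field_simps)
        then have "d powr r \<le> (2 * K / R) powr r" using d r0 by (intro powr_mono2) auto
        also have "\<dots> = (2 * K) powr r * R powr (- r)" by (simp add: powr_divide powr_minus_divide)
        finally have "(C + 2) * d powr r \<le> (C + 2) * ((2 * K) powr r * R powr (- r))" using C0 by (intro mult_left_mono) auto
        also have "\<dots> = ((C + 2) * (2 * K) powr r) * R powr (- r)" by simp
        also have "\<dots> \<le> c * R powr (- r)" unfolding c_def by (intro mult_right_mono) auto
        finally show ?thesis .
      qed
      finally show ?thesis unfolding Rr by (simp add: ennreal_leI)
    qed
  qed
  then show ?thesis using c by blast
qed

section \<open>Multipliers and Bernstein's inequality\<close>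

lemma zonal_param_nonneg: "\<mu> \<ge> 0 \<Longrightarrow> \<mu> + (real CARD('d::finite) - 1) / 2 \<ge> 0"
proof -
  assume "\<mu> \<ge> 0"
  then interpret ball_nodes \<mu> "\<lambda>_. 1" "{0}" "\<lambda>_. 0 :: real ^ 'd" by unfold_locales auto
  show ?thesis using lam_nonneg unfolding lam_def .
qed

lemma proj_kernel_abs_le:
  fixes x y :: "real ^ 'd::finite"
  assumes mu: "\<mu> \<ge> 0" and "norm x \<le> 1" "norm y \<le> 1"
  shows "\<bar>proj_kernel \<mu> k x y\<bar> \<le> zonal_bd (\<mu> + (real CARD('d) - 1) / 2) k"
proof -
  interpret pos_fun "\<lambda>F. lift (\<mu> + 1/2) F x y" using assms by (intro pos_fun_lift) auto
  show ?thesis unfolding proj_kernel_lift[OF mu] by (rule \<Lambda>_abs) (rule zonal_bound[OF zonal_param_nonneg[OF mu]])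
qed

lemma continuous_proj_kernel:
  fixes f g :: "'b::topological_space \<Rightarrow> real ^ 'd::finite"
  assumes "\<mu> \<ge> 0" "continuous_on S f" "continuous_on S g"
  shows "continuous_on S (\<lambda>p. proj_kernel \<mu> k (f p) (g p))"
  unfolding proj_kernel_lift[OF assms(1)] by (intro continuous_lift assms)

lemma integrable_times_proj_kernel:
  fixes q :: "real ^ 'd::finite \<Rightarrow> real"
  assumes "\<mu> \<ge> 0" "continuous_on (cball 0 1) q"
  shows "integrable (ball_measure \<mu>) (\<lambda>y. q y * proj_kernel \<mu> k x y)"
  by (intro integrable_ball_continuous continuous_on_mult continuous_proj_kernel continuous_intros assms)

lemma continuous_orth_proj:
  fixes q :: "real ^ 'd::finite \<Rightarrow> real"
  assumes mu: "\<mu> \<ge> 0" and q: "continuous_on (cball 0 1) q"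
  shows "continuous_on (cball 0 1) (orth_proj \<mu> k q)"
  unfolding continuous_on_sequentially
proof (intro allI ballI impI, elim conjE)
  fix X :: "nat \<Rightarrow> real ^ 'd" and a assume a: "a \<in> cball 0 1" and X: "\<forall>n. X n \<in> cball 0 1" "X \<longlonglongrightarrow> a"
  have "(\<lambda>i. LINT y|ball_measure \<mu>. q y * proj_kernel \<mu> k (X i) y) \<longlonglongrightarrow> (LINT y|ball_measure \<mu>. q y * proj_kernel \<mu> k a y)"
  proof (rule integral_dominated_convergence[where w = "\<lambda>y. \<bar>q y\<bar> * zonal_bd (\<mu> + (real CARD('d) - 1) / 2) k"])
    show "integrable (ball_measure \<mu>) (\<lambda>y. \<bar>q y\<bar> * zonal_bd (\<mu> + (real CARD('d) - 1) / 2) k)"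
      by (intro integrable_ball_continuous mu continuous_intros q)
    show "AE y in ball_measure \<mu>. (\<lambda>i. q y * proj_kernel \<mu> k (X i) y) \<longlonglongrightarrow> q y * proj_kernel \<mu> k a y"
    proof (rule AE_I2, rule tendsto_mult_left)
      fix y :: "real ^ 'd"
      have "continuous_on UNIV (\<lambda>x. proj_kernel \<mu> k x y)" by (intro continuous_proj_kernel mu continuous_intros)
      then have "isCont (\<lambda>x. proj_kernel \<mu> k x y) a" by (simp add: continuous_on_eq_continuous_at)
      then show "(\<lambda>i. proj_kernel \<mu> k (X i) y) \<longlonglongrightarrow> proj_kernel \<mu> k a y" using X(2) by (rule isCont_tendsto_compose)
    qed
    show "AE y in ball_measure \<mu>. norm (q y * proj_kernel \<mu> k (X i) y) \<le> \<bar>q y\<bar> * zonal_bd (\<mu> + (real CARD('d) - 1) / 2) k" for i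
    proof (rule AE_I2)
      fix y assume "y \<in> space (ball_measure \<mu> :: (real ^ 'd) measure)"
      then show "norm (q y * proj_kernel \<mu> k (X i) y) \<le> \<bar>q y\<bar> * zonal_bd (\<mu> + (real CARD('d) - 1) / 2) k"
        using proj_kernel_abs_le[OF mu, of "X i" y k] X(1) mu by (auto simp: abs_mult intro!: mult_left_mono)
    qed
  qed (use integrable_times_proj_kernel[OF mu q] in auto)
  then show "(orth_proj \<mu> k q \<circ> X) \<longlonglongrightarrow> orth_proj \<mu> k q a"
    by (simp add: orth_proj_eq[OF mu] comp_def)
qed

text \<open>Fubini leaves the pairing of two projection kernels, which vanishes for different
  degrees and reproduces for equal ones. It applies to continuous \<open>q\<close>, so that
  multiplier operators can be composed without showing that their values are polynomials.\<close>

lemma orth_proj_orth_proj: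
  fixes q :: "real ^ 'd::finite \<Rightarrow> real"
  assumes mu: "\<mu> \<ge> 0" and q: "continuous_on (cball 0 1) q"
  shows "orth_proj \<mu> j (orth_proj \<mu> k q) x = (if j = k then orth_proj \<mu> k q x else 0)"
proof -
  let ?M = "ball_measure \<mu> :: (real ^ 'd) measure"
  interpret F: finite_measure ?M by (rule finite_measure_ball[OF mu])
  interpret PP: pair_sigma_finite ?M ?M ..
  define f where "f y z = q z * proj_kernel \<mu> k y z * proj_kernel \<mu> j x y" for y z
  obtain Q where Q: "\<And>z. norm z \<le> 1 \<Longrightarrow> \<bar>q z\<bar> \<le> Q"
    using compact_imp_bounded[OF compact_continuous_image[OF q compact_cball]]
    unfolding bounded_iff by fastforce
  have kc: "continuous_on (cball 0 1) (proj_kernel \<mu> j x)" by (intro all_polys_continuous[OF mu] proj_kernel_all_polys[OF mu])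
  obtain R where R: "\<And>z. norm z \<le> 1 \<Longrightarrow> \<bar>proj_kernel \<mu> j x z\<bar> \<le> R"
    using compact_imp_bounded[OF compact_continuous_image[OF kc compact_cball]]
    unfolding bounded_iff by fastforce
  let ?Z = "zonal_bd (\<mu> + (real CARD('d) - 1) / 2) k"
  have bd: "\<bar>f y z\<bar> \<le> Q * ?Z * R" if "norm y \<le> 1" "norm z \<le> 1" for y z
  proof -
    have "\<bar>q z\<bar> * \<bar>proj_kernel \<mu> k y z\<bar> \<le> Q * ?Z"
      using Q[OF that(2)] proj_kernel_abs_le[OF mu that] by (intro mult_mono) auto
    then have "\<bar>q z\<bar> * \<bar>proj_kernel \<mu> k y z\<bar> * \<bar>proj_kernel \<mu> j x y\<bar> \<le> Q * ?Z * R"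
      using R[OF that(1)] order_trans[OF mult_nonneg_nonneg[OF abs_ge_zero abs_ge_zero], of "q z" "proj_kernel \<mu> k y z" "Q * ?Z"]
      by (intro mult_mono[of "_ * _"]) auto
    then show ?thesis by (simp add: f_def abs_mult)
  qed
  interpret FP: finite_measure "?M \<Otimes>\<^sub>M ?M" by (rule finite_measure_pair_measure) unfold_locales
  have idm: "(\<lambda>y. y) \<in> measurable ?M borel"
  proof -
    have "(\<lambda>y :: real ^ 'd. y) \<in> measurable lebesgue borel" by (rule measurable_completion) simp
    then show ?thesis unfolding ball_measure_def by (simp add: measurable_restrict_space1)
  qed
  \<comment> \<open>The factors carry Lebesgue measurable sets, so joint measurability of the
    continuous kernel is obtained through the Borel sets of the product.\<close>
  have kb: "(\<lambda>p. proj_kernel \<mu> k (fst p) (snd p)) \<in> borel_measurable (?M \<Otimes>\<^sub>M ?M)"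
  proof -
    have "(\<lambda>p. (fst p, snd p)) \<in> measurable (?M \<Otimes>\<^sub>M ?M) (borel \<Otimes>\<^sub>M borel)"
      by (intro measurable_Pair measurable_compose[OF measurable_fst idm] measurable_compose[OF measurable_snd idm])
    then have "(\<lambda>p. (fst p, snd p)) \<in> measurable (?M \<Otimes>\<^sub>M ?M) borel" unfolding borel_prod .
    moreover have "(\<lambda>p. proj_kernel \<mu> k (fst p) (snd p)) \<in> borel_measurable borel"
      by (intro borel_measurable_continuous_onI continuous_proj_kernel mu continuous_intros)
    ultimately have "(\<lambda>p. proj_kernel \<mu> k (fst (fst p, snd p)) (snd (fst p, snd p))) \<in> borel_measurable (?M \<Otimes>\<^sub>M ?M)"
      by (rule measurable_compose)
    then show ?thesis by simp
  qed
  have qm: "q \<in> borel_measurable ?M" by (rule measurable_ball_continuous[OF mu q])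
  have jm: "proj_kernel \<mu> j x \<in> borel_measurable ?M"
    by (intro measurable_ball_continuous[OF mu] all_polys_continuous[OF mu] proj_kernel_all_polys[OF mu])
  have "integrable (?M \<Otimes>\<^sub>M ?M) (\<lambda>p. f (fst p) (snd p))"
  proof (rule FP.integrable_const_bound)
    show "AE p in ?M \<Otimes>\<^sub>M ?M. norm (f (fst p) (snd p)) \<le> Q * ?Z * R"
      using bd mu by (intro AE_I2) (auto simp: space_pair_measure)
    show "(\<lambda>p. f (fst p) (snd p)) \<in> borel_measurable (?M \<Otimes>\<^sub>M ?M)"
      unfolding f_def by (intro borel_measurable_times kb measurable_compose[OF measurable_snd qm] measurable_compose[OF measurable_fst jm])
  qed
  then have "integrable (?M \<Otimes>\<^sub>M ?M) (case_prod f)" by (simp add: case_prod_unfold)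
  from PP.Fubini_integral[OF this]
  have Fub: "(LINT z|?M. LINT y|?M. f y z) = (LINT y|?M. LINT z|?M. f y z)" .
  have e1: "(LINT z|?M. f y z) = orth_proj \<mu> k q y * proj_kernel \<mu> j x y" for y
    by (simp add: f_def orth_proj_eq[OF mu])
  have e2: "(LINT y|?M. f y z) = q z * (if j = k then proj_kernel \<mu> k x z else 0)" for z
  proof -
    have "(LINT y|?M. f y z) = q z * (LINT y|?M. proj_kernel \<mu> k z y * proj_kernel \<mu> j x y)"
      by (simp add: f_def mult.assoc proj_kernel_commute[OF mu, of k _ z])
    also have "(LINT y|?M. proj_kernel \<mu> k z y * proj_kernel \<mu> j x y) = (if j = k then proj_kernel \<mu> k x z else 0)"
    proof (cases j k rule: linorder_cases)
      case less
      then show ?thesis using proj_kernel_orth[OF mu proj_kernel_poly_space[OF mu, of j x], of k z] by (simp add: mult.commute)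
    next
      case greater
      then show ?thesis using proj_kernel_orth[OF mu proj_kernel_poly_space[OF mu, of k z], of j x] by simp
    next
      case equal
      then show ?thesis using proj_kernel_reproduce[OF mu proj_kernel_orth_poly_space[OF mu, of k z], of x] by (simp add: proj_kernel_commute[OF mu, of k z])
    qed
    finally show ?thesis .
  qed
  have "orth_proj \<mu> j (orth_proj \<mu> k q) x = (LINT z|?M. LINT y|?M. f y z)"
    unfolding Fub e1 by (simp add: orth_proj_eq[OF mu, of j])
  then show ?thesis unfolding e2 by (auto simp: orth_proj_eq[OF mu])
qed

section \<open>Multiplier operators on functions with spectrum in degrees at most
  \<open>N\<close>\<close>

locale ball_mult =
  fixes \<mu> :: real and N :: nat and D :: "'d::finite itself"
  assumes mu: "\<mu> \<ge> 0"
begin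

definition lam :: real where "lam = \<mu> + (real CARD('d) - 1) / 2"

text \<open>Contains \<open>poly_space N\<close>, but is phrased by projections: closure under
  \<open>mult_op\<close> then follows from \<open>orth_proj_orth_proj\<close> alone.\<close>

definition spec :: "(real ^ 'd \<Rightarrow> real) set" where
  "spec = {q. continuous_on (cball 0 1) q \<and> (\<forall>x. (\<Sum>k\<le>N. orth_proj \<mu> k q x) = q x)}"

definition mult_op :: "(nat \<Rightarrow> real) \<Rightarrow> (real ^ 'd \<Rightarrow> real) \<Rightarrow> real ^ 'd \<Rightarrow> real" where
  "mult_op m q x = (\<Sum>k\<le>N. m k * orth_proj \<mu> k q x)"

definition mult_bound :: "(nat \<Rightarrow> real) \<Rightarrow> real \<Rightarrow> bool" where
  "mult_bound m L \<longleftrightarrow> (\<forall>q\<in>spec. \<forall>B. (\<forall>x. norm x \<le> 1 \<longrightarrow> \<bar>q x\<bar> \<le> B) \<longrightarrow> (\<forall>x. norm x \<le> 1 \<longrightarrow> \<bar>mult_op m q x\<bar> \<le> L * B))"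

lemma lam_nonneg: "lam \<ge> 0"
  unfolding lam_def by (rule zonal_param_nonneg[OF mu])

lemma poly_space_spec: "q \<in> poly_space N \<Longrightarrow> q \<in> spec"
  using proj_kernel_sum[OF mu] by (auto simp: spec_def orth_proj_eq[OF mu] intro: continuous_poly_space)

lemma orth_proj_mult_op:
  assumes q: "q \<in> spec"
  shows "orth_proj \<mu> j (mult_op m q) x = (if j \<le> N then m j * orth_proj \<mu> j q x else 0)"
proof -
  have c: "continuous_on (cball 0 1) q" using q by (simp add: spec_def)
  have "orth_proj \<mu> j (mult_op m q) x = (LINT y|ball_measure \<mu>. (\<Sum>k\<le>N. m k * (orth_proj \<mu> k q y * proj_kernel \<mu> j x y)))"
    by (simp add: orth_proj_eq[OF mu, of j] mult_op_def sum_distrib_right mult.assoc)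
  also have "\<dots> = (\<Sum>k\<le>N. m k * (LINT y|ball_measure \<mu>. orth_proj \<mu> k q y * proj_kernel \<mu> j x y))"
    using integrable_times_proj_kernel[OF mu continuous_orth_proj[OF mu c]]
    by (subst Bochner_Integration.integral_sum) auto
  also have "\<dots> = (\<Sum>k\<le>N. m k * (if j = k then orth_proj \<mu> k q x else 0))"
    unfolding orth_proj_eq[OF mu, of j, symmetric] orth_proj_orth_proj[OF mu c] ..
  also have "\<dots> = (\<Sum>k\<le>N. if j = k then m k * orth_proj \<mu> k q x else 0)"
    by (intro sum.cong) auto
  finally show ?thesis by simp
qed

lemma mult_op_one: "q \<in> spec \<Longrightarrow> mult_op (\<lambda>_. 1) q = q"
  by (auto simp: spec_def mult_op_def)

lemma orth_proj_high: "q \<in> spec \<Longrightarrow> j > N \<Longrightarrow> orth_proj \<mu> j q x = 0"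
  using orth_proj_mult_op[of q j "\<lambda>_. 1" x] by (simp add: mult_op_one)

lemma mult_op_spec: 
  assumes q: "q \<in> spec"
  shows "mult_op m q \<in> spec"
proof -
  have "continuous_on (cball 0 1) (mult_op m q)"
    unfolding mult_op_def using q by (intro continuous_intros continuous_orth_proj mu) (simp add: spec_def)
  moreover have "(\<Sum>k\<le>N. orth_proj \<mu> k (mult_op m q) x) = mult_op m q x" for x
    unfolding orth_proj_mult_op[OF q] by (simp add: mult_op_def)
  ultimately show ?thesis by (simp add: spec_def)
qed

lemma mult_op_mult: "q \<in> spec \<Longrightarrow> mult_op m (mult_op m' q) = mult_op (\<lambda>k. m k * m' k) q"
  by (rule ext, subst mult_op_def) (simp add: orth_proj_mult_op, simp add: mult_op_def mult.assoc)

lemma mult_bound_mono: "mult_bound m L \<Longrightarrow> L \<le> L' \<Longrightarrow> mult_bound m L'"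
  unfolding mult_bound_def
proof (intro ballI allI impI)
  fix q :: "real ^ 'd \<Rightarrow> real" and B :: real and x :: "real ^ 'd"
  assume m: "\<forall>q\<in>spec. \<forall>B. (\<forall>x. norm x \<le> 1 \<longrightarrow> \<bar>q x\<bar> \<le> B) \<longrightarrow> (\<forall>x. norm x \<le> 1 \<longrightarrow> \<bar>mult_op m q x\<bar> \<le> L * B)"
    and L: "L \<le> L'" and q: "q \<in> spec" "\<forall>x. norm x \<le> 1 \<longrightarrow> \<bar>q x\<bar> \<le> B" and x: "norm x \<le> 1"
  have "0 \<le> B" using q(2) abs_ge_zero[of "q x"] x order_trans by blast
  then have "L * B \<le> L' * B" using L by (rule mult_right_mono[rotated])
  then show "\<bar>mult_op m q x\<bar> \<le> L' * B" using m q x by (blast intro: order_trans)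
qed

lemma mult_bound_cong: "mult_bound m L \<Longrightarrow> (\<And>k. k \<le> N \<Longrightarrow> m k = m' k) \<Longrightarrow> mult_bound m' L"
proof -
  assume m: "mult_bound m L" and "\<And>k. k \<le> N \<Longrightarrow> m k = m' k"
  then have "mult_op m = mult_op m'" by (intro ext) (auto simp: mult_op_def intro!: sum.cong)
  with m show ?thesis by (simp add: mult_bound_def)
qed

lemma mult_bound_1: "mult_bound (\<lambda>_. 1) 1"
  by (simp add: mult_bound_def mult_op_one)

lemma mult_bound_add:
  assumes "mult_bound m L" "mult_bound m' L'"
  shows "mult_bound (\<lambda>k. m k + m' k) (L + L')"
  unfolding mult_bound_def
proof (intro ballI allI impI)
  fix q :: "real ^ 'd \<Rightarrow> real" and B :: real and x :: "real ^ 'd"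
  assume q: "q \<in> spec" "\<forall>x. norm x \<le> 1 \<longrightarrow> \<bar>q x\<bar> \<le> B" and x: "norm x \<le> 1"
  have "\<bar>mult_op m q x\<bar> \<le> L * B" "\<bar>mult_op m' q x\<bar> \<le> L' * B" using assms q x unfolding mult_bound_def by blast+
  moreover have "mult_op (\<lambda>k. m k + m' k) q x = mult_op m q x + mult_op m' q x"
    by (simp add: mult_op_def distrib_right sum.distrib)
  ultimately show "\<bar>mult_op (\<lambda>k. m k + m' k) q x\<bar> \<le> (L + L') * B" by (simp add: distrib_right)
qed

lemma mult_bound_cmult:
  assumes "mult_bound m L"
  shows "mult_bound (\<lambda>k. c * m k) (\<bar>c\<bar> * L)"
  unfolding mult_bound_def
proof (intro ballI allI impI)
  fix q :: "real ^ 'd \<Rightarrow> real" and B :: real and x :: "real ^ 'd"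
  assume q: "q \<in> spec" "\<forall>x. norm x \<le> 1 \<longrightarrow> \<bar>q x\<bar> \<le> B" and x: "norm x \<le> 1"
  have "\<bar>mult_op m q x\<bar> \<le> L * B" using assms q x unfolding mult_bound_def by blast
  then have "\<bar>c\<bar> * \<bar>mult_op m q x\<bar> \<le> \<bar>c\<bar> * (L * B)" by (intro mult_left_mono) auto
  moreover have "mult_op (\<lambda>k. c * m k) q x = c * mult_op m q x"
    by (simp add: mult_op_def sum_distrib_left mult.assoc)
  ultimately show "\<bar>mult_op (\<lambda>k. c * m k) q x\<bar> \<le> \<bar>c\<bar> * L * B" by (simp add: abs_mult mult.assoc)
qed

lemma mult_bound_mult:
  assumes "mult_bound m L" "mult_bound m' L'"
  shows "mult_bound (\<lambda>k. m k * m' k) (L * L')"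
  unfolding mult_bound_def
proof (intro ballI allI impI)
  fix q :: "real ^ 'd \<Rightarrow> real" and B :: real and x :: "real ^ 'd"
  assume q: "q \<in> spec" "\<forall>x. norm x \<le> 1 \<longrightarrow> \<bar>q x\<bar> \<le> B" and x: "norm x \<le> 1"
  have "\<forall>x. norm x \<le> 1 \<longrightarrow> \<bar>mult_op m' q x\<bar> \<le> L' * B" using assms(2) q unfolding mult_bound_def by blast
  then have "\<bar>mult_op m (mult_op m' q) x\<bar> \<le> L * (L' * B)" 
    using assms(1) mult_op_spec[OF q(1)] x unfolding mult_bound_def by blast
  then show "\<bar>mult_op (\<lambda>k. m k * m' k) q x\<bar> \<le> L * L' * B" by (simp add: mult_op_mult[OF q(1)] mult.assoc)
qed

lemma mult_bound_power: "mult_bound m L \<Longrightarrow> mult_bound (\<lambda>k. m k ^ j) (L ^ j)"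
  by (induction j) (auto simp: mult_bound_1 intro: mult_bound_mult)

lemma mult_bound_integral:
  fixes m :: "real \<Rightarrow> nat \<Rightarrow> real"
  assumes m: "\<And>t. mult_bound (m t) (L t)" and iL: "integrable lborel L" and im: "\<And>k. k \<le> N \<Longrightarrow> integrable lborel (\<lambda>t. m t k)"
  shows "mult_bound (\<lambda>k. LINT t|lborel. m t k) (LINT t|lborel. L t)"
  unfolding mult_bound_def
proof (intro ballI allI impI)
  fix q :: "real ^ 'd \<Rightarrow> real" and B :: real and x :: "real ^ 'd"
  assume q: "q \<in> spec" "\<forall>x. norm x \<le> 1 \<longrightarrow> \<bar>q x\<bar> \<le> B" and x: "norm x \<le> 1"
  have i: "integrable lborel (\<lambda>t. mult_op (m t) q x)" unfolding mult_op_def using im by auto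
  have "mult_op (\<lambda>k. LINT t|lborel. m t k) q x = (\<Sum>k\<le>N. LINT t|lborel. m t k * orth_proj \<mu> k q x)"
    by (simp add: mult_op_def)
  also have "\<dots> = (LINT t|lborel. mult_op (m t) q x)"
    unfolding mult_op_def using im by (subst Bochner_Integration.integral_sum) auto
  also have "\<bar>\<dots>\<bar> \<le> (LINT t|lborel. \<bar>mult_op (m t) q x\<bar>)" by (rule integral_abs_bound)
  also have "\<dots> \<le> (LINT t|lborel. L t * B)"
    using m q x i iL unfolding mult_bound_def by (intro integral_mono) auto
  finally show "\<bar>mult_op (\<lambda>k. LINT t|lborel. m t k) q x\<bar> \<le> (LINT t|lborel. L t) * B" by simp
qed

text \<open>The multiplier is the Poisson semigroup; its value at \<open>x\<close> is the Abel sum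
  for the single node \<open>x\<close> with weight 1.\<close>

lemma mult_bound_exp:
  assumes t: "t \<ge> 0"
  shows "mult_bound (\<lambda>k. exp (- t * real k)) 1"
proof (cases "t = 0")
  case True
  then show ?thesis using mult_bound_1 by simp
next
  case False
  show ?thesis unfolding mult_bound_def
  proof (intro ballI allI impI)
    fix q :: "real ^ 'd \<Rightarrow> real" and B :: real and x :: "real ^ 'd"
    assume q: "q \<in> spec" "\<forall>x. norm x \<le> 1 \<longrightarrow> \<bar>q x\<bar> \<le> B" and x: "norm x \<le> 1"
    interpret B: ball_nodes \<mu> "\<lambda>_. 1" "{0}" "\<lambda>_. x" by unfold_locales (use mu x in auto)
    have qi: "integrable (ball_measure \<mu>) q" using q(1) by (intro integrable_ball_continuous mu) (simp add: spec_def)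
    have e: "B.node_coeff q n = orth_proj \<mu> n q x" for n by (simp add: B.node_coeff_proj[OF qi])
    have "\<bar>\<Sum>n. B.node_coeff q n * exp (- t) ^ n\<bar> \<le> B"
      using q(2) t False by (intro B.abs_node_coeff_sum_le qi) auto
    also have "(\<Sum>n. B.node_coeff q n * exp (- t) ^ n) = (\<Sum>n\<le>N. B.node_coeff q n * exp (- t) ^ n)"
      using orth_proj_high[OF q(1)] by (intro suminf_finite) (auto simp: e)
    also have "\<dots> = mult_op (\<lambda>k. exp (- t * real k)) q x"
      by (simp add: mult_op_def e exp_of_nat_mult[symmetric] mult.commute)
    finally show "\<bar>mult_op (\<lambda>k. exp (- t * real k)) q x\<bar> \<le> 1 * B" by simp
  qed
qed

text \<open>The kernel is the lift of a nonnegative Cesaro polynomial, so the norm is at most the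
  integral of the kernel, which is the multiplier at \<open>k = 0\<close>. For
  \<open>M \<ge> N\<close> the degrees between \<open>N\<close> and \<open>M\<close> contribute
  nothing on \<open>spec\<close>.\<close>

lemma mult_bound_cesaro:
  assumes c: "c \<ge> 2 * lam + 4" and M: "M \<ge> N"
  shows "mult_bound (\<lambda>k. rising_binom c (M - k)) (rising_binom c M)"
  unfolding mult_bound_def
proof (intro ballI allI impI)
  fix q :: "real ^ 'd \<Rightarrow> real" and B :: real and x :: "real ^ 'd"
  assume q: "q \<in> spec" "\<forall>x. norm x \<le> 1 \<longrightarrow> \<bar>q x\<bar> \<le> B" and x: "norm x \<le> 1"
  have qc: "continuous_on (cball 0 1) q" using q by (simp add: spec_def)
  define K where "K y = lift (\<mu> + 1/2) (cesaro lam c M) x y" for y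
  have K: "K y = (\<Sum>k\<le>M. rising_binom c (M - k) * proj_kernel \<mu> k x y)" for y
    by (simp add: K_def cesaro_def lift_sum lift_smult proj_kernel_lift[OF mu] lam_def)
  have K0: "K y \<ge> 0" if "norm y \<le> 1" for y
    unfolding K_def using mu x that c by (intro lift_nonneg cesaro_nonneg lam_nonneg) auto
  have Kc: "continuous_on (cball 0 1) K"
    unfolding K by (intro continuous_intros continuous_proj_kernel mu)
  have IK: "(LINT y|ball_measure \<mu>. h y * K y) = (\<Sum>k\<le>M. rising_binom c (M - k) * orth_proj \<mu> k h x)"
    if h: "continuous_on (cball 0 1) h" for h
  proof -
    have "(LINT y|ball_measure \<mu>. h y * K y) = (LINT y|ball_measure \<mu>. (\<Sum>k\<le>M. rising_binom c (M - k) * (h y * proj_kernel \<mu> k x y)))"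
      by (simp add: K sum_distrib_left mult_ac)
    also have "\<dots> = (\<Sum>k\<le>M. rising_binom c (M - k) * orth_proj \<mu> k h x)"
      using integrable_times_proj_kernel[OF mu h] by (subst Bochner_Integration.integral_sum) (auto simp: orth_proj_eq[OF mu])
    finally show ?thesis .
  qed
  have one: "orth_proj \<mu> k (\<lambda>_. 1) x = (if k = 0 then 1 else 0)" for k
    using proj_kernel_orth[OF mu poly_space_const[of 1 0], of k x] by (auto simp: orth_proj_eq[OF mu] proj_kernel_0[OF mu] mu)
  have "(LINT y|ball_measure \<mu>. K y) = (\<Sum>k\<le>M. if k = 0 then rising_binom c (M - k) else 0)"
    using IK[of "\<lambda>_. 1"] by (simp add: one if_distrib cong: if_cong)
  then have IK1: "(LINT y|ball_measure \<mu>. K y) = rising_binom c M" by simp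
  have "mult_op (\<lambda>k. rising_binom c (M - k)) q x = (\<Sum>k\<le>M. rising_binom c (M - k) * orth_proj \<mu> k q x)"
    unfolding mult_op_def using M orth_proj_high[OF q(1)] by (intro sum.mono_neutral_left) auto
  also have "\<dots> = (LINT y|ball_measure \<mu>. q y * K y)" by (rule IK[OF qc, symmetric])
  also have "\<bar>\<dots>\<bar> \<le> (LINT y|ball_measure \<mu>. \<bar>q y * K y\<bar>)" by (rule integral_abs_bound)
  also have "\<dots> \<le> (LINT y|ball_measure \<mu>. B * K y)"
  proof (rule integral_mono)
    show "integrable (ball_measure \<mu>) (\<lambda>y. \<bar>q y * K y\<bar>)" "integrable (ball_measure \<mu>) (\<lambda>y. B * K y)"
      by (intro integrable_ball_continuous mu continuous_intros qc Kc)+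
    fix y :: "real ^ 'd" assume "y \<in> space (ball_measure \<mu>)"
    then have y: "norm y \<le> 1" using mu by simp
    show "\<bar>q y * K y\<bar> \<le> B * K y" using q(2) y K0[OF y] by (auto simp: abs_mult intro!: mult_right_mono)
  qed
  finally show "\<bar>mult_op (\<lambda>k. rising_binom c (M - k)) q x\<bar> \<le> rising_binom c M * B" by (simp add: IK1 mult.commute)
qed

end

section \<open>Cesaro numbers, their differences and block sums\<close>

lemma rising_binom_diff: "rising_binom c (Suc n) - rising_binom c n = rising_binom (c - 1) (Suc n)"
proof -
  have p: "pochhammer (c - 1) (Suc n) = (c - 1) * pochhammer c n" using pochhammer_rec[of "c - 1" n] by simp
  have f: "fact (Suc n) = (real n + 1) * fact n" by simp
  have "rising_binom c n = (real n + 1) * pochhammer c n / fact (Suc n)" unfolding rising_binom_def f by simp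
  then have "rising_binom c (Suc n) - rising_binom c n = ((c + real n) * pochhammer c n - (real n + 1) * pochhammer c n) / fact (Suc n)"
    by (simp add: rising_binom_def pochhammer_Suc diff_divide_distrib mult.commute)
  also have "(c + real n) * pochhammer c n - (real n + 1) * pochhammer c n = pochhammer (c - 1) (Suc n)"
    unfolding p by (simp add: algebra_simps)
  finally show ?thesis by (simp add: rising_binom_def)
qed

lemma rising_binom_mono: "c \<ge> 1 \<Longrightarrow> m \<le> n \<Longrightarrow> rising_binom c m \<le> rising_binom c n"
proof (rule lift_Suc_mono_le[of "rising_binom c"])
  fix n assume "c \<ge> 1"
  then have "rising_binom (c - 1) (Suc n) \<ge> 0" by (intro rising_binom_nonneg) simp
  then show "rising_binom c n \<le> rising_binom c (Suc n)" using rising_binom_diff[of c n] by simp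
qed auto

lemma rising_binom_1: "rising_binom 1 n = 1"
  by (simp add: rising_binom_def pochhammer_fact[symmetric])

lemma rising_binom_2: "rising_binom 2 n = real n + 1"
  by (induction n) (use rising_binom_diff[of 2] rising_binom_1 in \<open>auto simp: algebra_simps\<close>)

lemma rising_binom_le: "rising_binom (real m + 1) n \<le> (real n + 1) ^ m"
proof (induction m arbitrary: n)
  case 0
  then show ?case by (simp add: rising_binom_1)
next
  case (Suc m)
  note IH = Suc
  show ?case
  proof (induction n)
    case 0
    show ?case by simp
  next
    case (Suc n)
    have "rising_binom (real (Suc m) + 1) (Suc n) = rising_binom (real (Suc m) + 1) n + rising_binom (real m + 1) (Suc n)"
    proof -
      have e: "real (Suc m) + 1 - 1 = real m + 1" by simp
      show ?thesis using rising_binom_diff[of "real (Suc m) + 1" n] unfolding e by linarith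
    qed
    also have "\<dots> \<le> (real n + 1) ^ Suc m + (real (Suc n) + 1) ^ m" using Suc IH[of "Suc n"] by (rule add_mono)
    also have "(real n + 1) ^ Suc m \<le> (real n + 1) * (real (Suc n) + 1) ^ m"
      by (simp only: power_Suc, intro mult_left_mono power_mono) auto
    also have "(real n + 1) * (real (Suc n) + 1) ^ m + (real (Suc n) + 1) ^ m = (real (Suc n) + 1) ^ Suc m"
      by (simp add: algebra_simps)
    finally show ?case by simp
  qed
qed

lemma rising_binom_block: "n \<ge> N \<Longrightarrow> rising_binom c n - rising_binom c (n - N) = (\<Sum>i<N. rising_binom (c - 1) (n - i))"
proof (induction N)
  case (Suc N)
  then have e: "n - N = Suc (n - Suc N)" by simp
  have "rising_binom c n - rising_binom c (n - Suc N) = (rising_binom c n - rising_binom c (n - N)) + (rising_binom c (n - N) - rising_binom c (n - Suc N))" by simp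
  also have "rising_binom c (n - N) - rising_binom c (n - Suc N) = rising_binom (c - 1) (n - N)" unfolding e by (rule rising_binom_diff)
  finally show ?case using Suc by simp
qed simp

text \<open>The generating function is \<open>((1 - X ^ N) / (1 - X)) ^ j / (1 - X) powr c\<close>: up to the order of the factors, \<open>j\<close>
  differences with step \<open>N\<close> of \<open>rising_binom (c + j)\<close>, which become linear for \<open>c = 2\<close>.\<close>

primrec block_binom :: "nat \<Rightarrow> real \<Rightarrow> nat \<Rightarrow> nat \<Rightarrow> real" where
  "block_binom N c 0 n = rising_binom c n"
| "block_binom N c (Suc j) n = (\<Sum>i<N. block_binom N c j (n - i))"

text \<open>In generating functions, one block \<open>(1 - X ^ N) / (1 - X)\<close> trades a factor
  \<open>1 / (1 - X)\<close> for a difference with step \<open>N\<close>. The assumption on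
  \<open>n\<close> keeps every natural subtraction exact.\<close>

lemma block_binom_diff: "n \<ge> Suc j * N \<Longrightarrow> block_binom N (c - 1) (Suc j) n = block_binom N c j n - block_binom N c j (n - N)"
proof (induction j arbitrary: n)
  case 0
  then show ?case using rising_binom_block[of N n c] by simp
next
  case (Suc j)
  have "block_binom N (c - 1) (Suc (Suc j)) n = (\<Sum>i<N. block_binom N (c - 1) (Suc j) (n - i))" by simp
  also have "\<dots> = (\<Sum>i<N. block_binom N c j (n - i) - block_binom N c j (n - N - i))"
  proof (intro sum.cong refl)
    fix i assume "i \<in> {..<N}"
    then have "n - i \<ge> Suc j * N" using Suc.prems by simp
    from Suc.IH[OF this] show "block_binom N (c - 1) (Suc j) (n - i) = block_binom N c j (n - i) - block_binom N c j (n - N - i)"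
      by (simp add: add.commute)
  qed
  finally show ?case by (simp add: sum_subtractf)
qed

text \<open>The coefficients \<open>n + 1\<close> of \<open>(1 - X) powr (- 2)\<close> are linear,
  and summing over a block keeps them linear: each block multiplies by \<open>N\<close> and lowers
  the argument by its mean \<open>(N - 1) / 2\<close>.\<close>

lemma block_binom_2: "n \<ge> j * N \<Longrightarrow> block_binom N 2 j n = real N ^ j * (real n + 1 - real j * (real N - 1) / 2)"
proof (induction j arbitrary: n)
  case 0
  then show ?case by (simp add: rising_binom_2)
next
  case (Suc j)
  have s: "(\<Sum>i<N. real i) = real N * (real N - 1) / 2" by (induction N) (auto simp: field_simps)
  have "block_binom N 2 (Suc j) n = (\<Sum>i<N. block_binom N 2 j (n - i))" by simp
  also have "\<dots> = (\<Sum>i<N. real N ^ j * (real n + 1 - real j * (real N - 1) / 2) - real N ^ j * real i)"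
  proof (intro sum.cong refl)
    fix i assume i: "i \<in> {..<N}"
    then have "n - i \<ge> j * N" "real (n - i) = real n - real i" using Suc.prems by auto
    then show "block_binom N 2 j (n - i) = real N ^ j * (real n + 1 - real j * (real N - 1) / 2) - real N ^ j * real i"
      using Suc.IH[of "n - i"] by (simp add: algebra_simps)
  qed
  also have "\<dots> = real N * (real N ^ j * (real n + 1 - real j * (real N - 1) / 2)) - real N ^ j * (real N * (real N - 1) / 2)"
    by (simp add: sum_subtractf sum_distrib_left[symmetric] s)
  also have "\<dots> = real N ^ Suc j * (real n + 1 - real (Suc j) * (real N - 1) / 2)" by (simp add: field_simps)
  finally show ?case .
qed

text \<open>Substitution gives \<open>frac_int s (\<lambda>t. \<phi> (\<kappa> * t)) = \<kappa> powr s * frac_int s \<phi>\<close>, which represents fractional powers through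
  \<open>\<phi> t = 1 - exp (- t)\<close>.\<close>

definition frac_int :: "real \<Rightarrow> (real \<Rightarrow> real) \<Rightarrow> real" where
  "frac_int s \<phi> = (LINT t|lborel. indicator {0<..} t * t powr (- s - 1) * \<phi> t)"

lemma integrable_indicator_HK:
  fixes f :: "real \<Rightarrow> real"
  assumes "f integrable_on S" "\<And>x. x \<in> S \<Longrightarrow> f x \<ge> 0" "S \<in> sets borel" "f \<in> borel_measurable borel"
  shows "integrable lborel (\<lambda>x. indicator S x * f x)"
proof -
  have "f absolutely_integrable_on S" using assms by (intro nonnegative_absolutely_integrable_1)
  then have "integrable lebesgue (\<lambda>x. indicator S x * f x)" by (simp add: set_integrable_def)
  then show ?thesis using assms by (subst (asm) integrable_completion) auto
qed

lemma frac_int_integrable: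
  fixes s :: real and \<phi> :: "real \<Rightarrow> real"
  assumes s: "0 < s" "s < 1" and \<phi>: "\<phi> \<in> borel_measurable borel" "\<And>t. t > 0 \<Longrightarrow> 0 \<le> \<phi> t" "\<And>t. t > 0 \<Longrightarrow> \<phi> t \<le> min 2 t"
  shows "integrable lborel (\<lambda>t. indicator {0<..} t * t powr (- s - 1) * \<phi> t)"
proof (rule Bochner_Integration.integrable_bound[of _ "\<lambda>t. indicator {0..1} t * t powr (- s) + 2 * (indicator {1..} t * t powr (- s - 1))"])
  have "(\<lambda>t. t powr (- s - 1)) integrable_on {1..}"
    using has_integral_powr_to_inf[of "- s - 1" 1] s by (auto simp: integrable_on_def)
  then have "integrable lborel (\<lambda>t. indicator {1..} t * t powr (- s - 1))" by (intro integrable_indicator_HK) auto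
  moreover have "integrable lborel (\<lambda>t. indicator {0..1} t * t powr (- s))"
    using integrable_on_powr_from_0[of "- s" 1] s by (intro integrable_indicator_HK) auto
  ultimately show "integrable lborel (\<lambda>t. indicator {0..1} t * t powr (- s) + 2 * (indicator {1..} t * t powr (- s - 1)))" by simp
  show "(\<lambda>t. indicator {0<..} t * t powr (- s - 1) * \<phi> t) \<in> borel_measurable lborel" using \<phi> by simp
  show "AE t in lborel. norm (indicator {0<..} t * t powr (- s - 1) * \<phi> t) \<le> norm (indicator {0..1} t * t powr (- s) + 2 * (indicator {1..} t * t powr (- s - 1)))"
  proof (rule AE_I2)
    fix t :: real
    consider "t \<le> 0" | "0 < t" "t \<le> 1" | "t > 1" by linarith
    then show "norm (indicator {0<..} t * t powr (- s - 1) * \<phi> t) \<le> norm (indicator {0..1} t * t powr (- s) + 2 * (indicator {1..} t * t powr (- s - 1)))"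
    proof cases
      case 2
      have "t powr (- s - 1) * \<phi> t \<le> t powr (- s - 1) * t powr 1" using \<phi>(3)[OF 2(1)] 2 by (intro mult_left_mono) auto
      also have "\<dots> = t powr (- s)" by (simp only: powr_add[symmetric]) simp
      also have "\<dots> \<le> t powr (- s) + 2 * (indicator {1..} t * t powr (- s - 1))" by simp
      finally show ?thesis using 2 \<phi>(2)[OF 2(1)] by (simp add: abs_mult)
    next
      case 3
      have "t powr (- s - 1) * \<phi> t \<le> t powr (- s - 1) * 2" using \<phi>(3)[of t] 3 by (intro mult_left_mono) auto
      then show ?thesis using 3 \<phi>(2)[of t] by (simp add: abs_mult)
    qed simp
  qed
qed

lemma frac_int_scale:
  fixes s :: real and \<phi> :: "real \<Rightarrow> real"
  assumes s: "0 < s" "s < 1" and \<phi>: "\<phi> \<in> borel_measurable borel" "\<And>t. t > 0 \<Longrightarrow> 0 \<le> \<phi> t" "\<And>t. t > 0 \<Longrightarrow> \<phi> t \<le> min 2 t"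
    and k: "k > 0"
  shows "integrable lborel (\<lambda>t. indicator {0<..} t * t powr (- s - 1) * \<phi> (k * t))"
    and "(LINT t|lborel. indicator {0<..} t * t powr (- s - 1) * \<phi> (k * t)) = k powr s * frac_int s \<phi>"
proof -
  define f where "f t = indicator {0<..} t * t powr (- s - 1) * \<phi> t" for t
  have i: "integrable lborel f" unfolding f_def by (rule frac_int_integrable[OF s \<phi>])
  have e: "indicator {0<..} t * t powr (- s - 1) * \<phi> (k * t) = k powr (s + 1) * f (0 + k * t)" for t
  proof (cases "t > 0")
    case True
    then have "(k * t) powr (- s - 1) = k powr (- s - 1) * t powr (- s - 1)" using k by (simp add: powr_mult)
    moreover have "k powr (s + 1) * k powr (- s - 1) = 1" using k by (simp flip: powr_add)
    ultimately have "k powr (s + 1) * (k * t) powr (- s - 1) = t powr (- s - 1)" by (simp add: mult.assoc[symmetric])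
    then show ?thesis using True k by (simp add: f_def mult.assoc[symmetric])
  next
    case False
    then have "\<not> 0 < k * t" using k by (simp add: zero_less_mult_iff)
    then show ?thesis using False by (simp add: f_def)
  qed
  show "integrable lborel (\<lambda>t. indicator {0<..} t * t powr (- s - 1) * \<phi> (k * t))"
    unfolding e using lborel_integrable_real_affine[OF i, of k 0] k by simp
  have "frac_int s \<phi> = k * (LINT t|lborel. f (0 + k * t))"
    using lborel_integral_real_affine[of k f 0] k by (simp add: frac_int_def f_def)
  moreover have "k powr (s + 1) = k powr s * k" using k by (simp add: powr_add)
  ultimately show "(LINT t|lborel. indicator {0<..} t * t powr (- s - 1) * \<phi> (k * t)) = k powr s * frac_int s \<phi>"
    unfolding e by simp
qed

lemma exp_phi: "t > 0 \<Longrightarrow> 0 \<le> 1 - exp (- t)" "t > 0 \<Longrightarrow> 1 - exp (- t) \<le> min 2 (t :: real)"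
proof -
  assume t: "t > 0"
  have e: "exp (- t) > 0" "1 - t \<le> exp (- t)" using exp_ge_add_one_self[of "- t"] by auto
  show "0 \<le> 1 - exp (- t)" using t by simp
  show "1 - exp (- t) \<le> min 2 t" by (rule min.boundedI) (use e in linarith)+
qed

lemma frac_int_exp_pos:
  assumes s: "0 < s" "s < 1"
  shows "frac_int s (\<lambda>t. 1 - exp (- t)) > 0"
proof -
  define c where "c = 2 powr (- s - 1) * (1 - exp (- 1 :: real))"
  have c: "c > 0" unfolding c_def by (intro mult_pos_pos) auto
  have "(LINT t|lborel. c * indicator {1..2::real} t) \<le> frac_int s (\<lambda>t. 1 - exp (- t))"
    unfolding frac_int_def
  proof (rule integral_mono)
    show "integrable lborel (\<lambda>t. indicator {0<..} t * t powr (- s - 1) * (1 - exp (- t)))"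
      by (rule frac_int_integrable[OF s _ exp_phi]) auto
    show "c * indicator {1..2} t \<le> indicator {0<..} t * t powr (- s - 1) * (1 - exp (- t))" for t :: real
    proof (cases "t \<in> {1..2}")
      case True
      then have "2 powr (- s - 1) \<le> t powr (- s - 1)" using s by (intro powr_mono2') auto
      then have "c \<le> t powr (- s - 1) * (1 - exp (- t))" unfolding c_def using True by (intro mult_mono) auto
      then show ?thesis using True by simp
    next
      case False
      then show ?thesis using exp_phi(1)[of t] by (cases "t > 0") auto
    qed
  qed simp
  moreover have "(LINT t|lborel. c * indicator {1..2::real} t) = c" by simp
  ultimately show ?thesis using c by linarith
qed

definition frac_const :: "real \<Rightarrow> real" where
  "frac_const a = (if frac a = 0 then 1 else frac_int (frac a) (min 2) / frac_int (frac a) (\<lambda>t. 1 - exp (- t)))"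

text \<open>For \<open>l \<ge> 0\<close>, \<open>j\<close> is the least number of differences with
  \<open>j + 2 \<ge> 2 * l + 4\<close>, the order from which Cesaro sums are positive. The summand
  \<open>j + 2\<close> bounds the constant part and the product the block part in
  \<open>mult_bound_id\<close>.\<close>

definition bern_const :: "real \<Rightarrow> real" where
  "bern_const l = (let j = nat \<lceil>2 * l + 2\<rceil> in real j + 2 + 2 ^ j * (real j + 2) ^ Suc j)"

lemma bern_const_pos: "bern_const l > 0"
proof -
  have "real j + 2 + 2 ^ j * (real j + 2) ^ Suc j > 0" for j :: nat by (rule add_pos_nonneg) auto
  then show ?thesis by (simp only: bern_const_def Let_def)
qed

context ball_mult
begin

text \<open>Each difference with step \<open>N\<close> of a bounded multiplier at most doubles the
  bound, since the Cesaro numbers increase.\<close>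

lemma mult_bound_block_binom:
  assumes c: "c \<ge> 2 * lam + 4"
  shows "M \<ge> Suc j * N \<Longrightarrow> mult_bound (\<lambda>k. block_binom N (c - real j) j (M - k)) (2 ^ j * rising_binom c M)"
proof (induction j arbitrary: M)
  case 0
  then show ?case using mult_bound_cesaro[OF c, of M] by simp
next
  case (Suc j)
  have M: "M - N \<ge> Suc j * N" "M \<ge> Suc j * N" using Suc.prems by auto
  have "mult_bound (\<lambda>k. block_binom N (c - real j) j (M - k) + (- 1) * block_binom N (c - real j) j (M - N - k)) (2 ^ j * rising_binom c M + \<bar>- 1\<bar> * (2 ^ j * rising_binom c (M - N)))"
    using Suc.IH[OF M(2)] Suc.IH[OF M(1)] by (intro mult_bound_add mult_bound_cmult)
  then have "mult_bound (\<lambda>k. block_binom N (c - real (Suc j)) (Suc j) (M - k)) (2 ^ j * rising_binom c M + \<bar>- 1\<bar> * (2 ^ j * rising_binom c (M - N)))"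
  proof (rule mult_bound_cong)
    fix k assume "k \<le> N"
    then have "M - k \<ge> Suc j * N" using Suc.prems by simp
    from block_binom_diff[OF this, of "c - real j"]
    have "block_binom N (c - real (Suc j)) (Suc j) (M - k) = block_binom N (c - real j) j (M - k) - block_binom N (c - real j) j (M - k - N)" by (simp add: algebra_simps)
    then show "block_binom N (c - real j) j (M - k) + (- 1) * block_binom N (c - real j) j (M - N - k) = block_binom N (c - real (Suc j)) (Suc j) (M - k)"
      by (simp add: add.commute)
  qed
  moreover have "2 ^ j * rising_binom c M + \<bar>- 1\<bar> * (2 ^ j * rising_binom c (M - N)) \<le> 2 ^ Suc j * rising_binom c M"
    using rising_binom_mono[of c "M - N" M] c lam_nonneg by simp
  ultimately show ?case by (rule mult_bound_mono)
qed

text \<open>The Bernstein inequality of order one. Starting from the positive Cesaro multiplier of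
  parameter \<open>j + 2\<close>, \<open>j\<close> differences lead to parameter 2, where the
  multiplier is \<open>N ^ j * (A - k)\<close> for \<open>k \<le> N\<close>. Hence \<open>k\<close>
  is a constant of size \<open>O(N)\<close> minus a multiplier of norm
  \<open>O(M ^ (j + 1) / N ^ j) = O(N)\<close>.\<close>

lemma mult_bound_id:
  assumes N: "N \<ge> 1"
  shows "mult_bound real (bern_const lam * real N)"
proof -
  define j where "j = nat \<lceil>2 * lam + 2\<rceil>"
  have j: "real j \<ge> 2 * lam + 2" unfolding j_def by linarith
  \<comment> \<open>Large enough for \<open>M - k \<ge> j * N\<close> whenever
    \<open>k \<le> N\<close>, the range in which \<open>block_binom_2\<close> is linear.\<close>
  define M where "M = Suc j * N"
  define A where "A = real M + 1 - real j * (real N - 1) / 2"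
  have "real j * (real N - 1) \<ge> 0" "real j * (real N - 1) \<le> real j * real N" using N by (auto intro!: mult_nonneg_nonneg mult_left_mono)
  moreover have "real j * real N \<ge> 0" "real M = real j * real N + real N" by (auto simp: M_def)
  ultimately have A: "A \<ge> 0" "A \<le> real M + 1" unfolding A_def by linarith+
  have M1: "real M + 1 \<le> (real j + 2) * real N" using N by (simp add: M_def algebra_simps)
  have b: "mult_bound (\<lambda>k. block_binom N 2 j (M - k)) (2 ^ j * rising_binom (real j + 2) M)"
    using mult_bound_block_binom[of "real j + 2" j M] j by (simp add: M_def)
  have Np: "real N ^ j > 0" using N by simp
  have "mult_bound (\<lambda>k. A * 1 + (- 1 / real N ^ j) * block_binom N 2 j (M - k)) (\<bar>A\<bar> * 1 + \<bar>- 1 / real N ^ j\<bar> * (2 ^ j * rising_binom (real j + 2) M))"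
    by (intro mult_bound_add mult_bound_cmult mult_bound_1 b)
  then have "mult_bound real (\<bar>A\<bar> * 1 + \<bar>- 1 / real N ^ j\<bar> * (2 ^ j * rising_binom (real j + 2) M))"
  proof (rule mult_bound_cong)
    fix k assume k: "k \<le> N"
    then have "M - k \<ge> j * N" "real (M - k) = real M - real k" by (auto simp: M_def)
    then have "block_binom N 2 j (M - k) = real N ^ j * (A - real k)" by (simp add: block_binom_2 A_def)
    then show "A * 1 + (- 1 / real N ^ j) * block_binom N 2 j (M - k) = real k" using Np by simp
  qed
  moreover have "\<bar>A\<bar> * 1 + \<bar>- 1 / real N ^ j\<bar> * (2 ^ j * rising_binom (real j + 2) M) \<le> bern_const lam * real N"
  proof -
    have "rising_binom (real j + 2) M \<le> (real M + 1) ^ Suc j" using rising_binom_le[of "Suc j" M] by (simp add: add.commute)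
    also have "\<dots> \<le> ((real j + 2) * real N) ^ Suc j" using M1 by (intro power_mono) auto
    also have "\<dots> = real N ^ j * ((real j + 2) ^ Suc j * real N)" by (simp add: power_mult_distrib mult_ac)
    finally have "rising_binom (real j + 2) M / real N ^ j \<le> (real j + 2) ^ Suc j * real N" using Np by (simp add: divide_le_eq mult.commute)
    then have "2 ^ j * (rising_binom (real j + 2) M / real N ^ j) \<le> 2 ^ j * ((real j + 2) ^ Suc j * real N)" by (intro mult_left_mono) auto
    moreover have "\<bar>- 1 / real N ^ j\<bar> * (2 ^ j * rising_binom (real j + 2) M) = 2 ^ j * (rising_binom (real j + 2) M / real N ^ j)"
      using Np by (simp add: abs_divide)
    ultimately show ?thesis using A M1 unfolding bern_const_def Let_def j_def[symmetric] by (simp add: algebra_simps)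
  qed
  ultimately show ?thesis by (rule mult_bound_mono)
qed

text \<open>The bound 2 is the triangle inequality; the bound \<open>\<Lambda> * t\<close> comes
  from writing the multiplier as the integral of \<open>\<kappa> k * exp (- s * \<kappa> k)\<close>
  over \<open>s\<close> from 0 to \<open>t\<close>.\<close>

lemma mult_bound_one_minus_exp:
  assumes \<kappa>: "mult_bound \<kappa> \<Lambda>" and e: "\<And>t. t \<ge> 0 \<Longrightarrow> mult_bound (\<lambda>k. exp (- t * \<kappa> k)) 1" and t: "t \<ge> 0" and L: "\<Lambda> > 0"
  shows "mult_bound (\<lambda>k. 1 - exp (- (\<kappa> k * t))) (min 2 (\<Lambda> * t))"
proof -
  have "mult_bound (\<lambda>k. 1 + (- 1) * exp (- t * \<kappa> k)) (1 + \<bar>- 1\<bar> * 1)"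
    by (intro mult_bound_add mult_bound_cmult mult_bound_1 e t)
  then have two: "mult_bound (\<lambda>k. 1 - exp (- (\<kappa> k * t))) 2" by (simp add: mult.commute)
  have 1: "mult_bound (\<lambda>k. indicator {0..t} s * (\<kappa> k * exp (- s * \<kappa> k))) (indicator {0..t} s * \<Lambda>)" for s
  proof (cases "s \<in> {0..t}")
    case True
    have "mult_bound (\<lambda>k. \<kappa> k * exp (- s * \<kappa> k)) (\<Lambda> * 1)" using True by (intro mult_bound_mult \<kappa> e) auto
    then show ?thesis using True by simp
  next
    case False
    then show ?thesis using mult_bound_cmult[OF mult_bound_1, of 0] by simp
  qed
  have 2: "has_bochner_integral lborel (\<lambda>s. (\<kappa> k * exp (- s * \<kappa> k)) * indicator {0..t} s) (- exp (- t * \<kappa> k) - (- exp (- 0 * \<kappa> k)))" for k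
    using t by (intro has_bochner_integral_FTC_Icc_real) (auto intro!: derivative_eq_intros continuous_intros)
  have i: "integrable lborel (\<lambda>s. indicator {0..t} s * (\<kappa> k * exp (- s * \<kappa> k)))"
    and v: "(LINT s|lborel. indicator {0..t} s * (\<kappa> k * exp (- s * \<kappa> k))) = 1 - exp (- (\<kappa> k * t))" for k
    using 2[of k] unfolding has_bochner_integral_iff by (auto simp: mult.commute)
  have "mult_bound (\<lambda>k. LINT s|lborel. indicator {0..t} s * (\<kappa> k * exp (- s * \<kappa> k))) (LINT s|lborel. indicator {0..t} s * \<Lambda>)"
    using t by (intro mult_bound_integral 1 i integrable_mult_left integrable_real_indicator) auto
  moreover have "(LINT s|lborel. indicator {0..t} s * \<Lambda>) = \<Lambda> * t" using t by simp
  ultimately have "mult_bound (\<lambda>k. 1 - exp (- (\<kappa> k * t))) (\<Lambda> * t)" by (simp only: v)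
  then show ?thesis using two by (simp add: min_def)
qed

text \<open>\<open>\<kappa> powr s\<close> is a positive superposition of the multipliers
  \<open>1 - exp (- \<kappa> * t)\<close>. Their norms \<open>min 2 (\<Lambda> * t)\<close> scale in
  the same way, so integrating them against the same density gives a multiple of
  \<open>\<Lambda> powr s\<close>.\<close>

lemma mult_bound_frac:
  assumes \<kappa>: "mult_bound \<kappa> \<Lambda>" and e: "\<And>t. t \<ge> 0 \<Longrightarrow> mult_bound (\<lambda>k. exp (- t * \<kappa> k)) 1" and L: "\<Lambda> > 0"
    and \<kappa>0: "\<And>k. \<kappa> k \<ge> 0" and s: "0 < s" "s < 1"
  shows "mult_bound (\<lambda>k. \<kappa> k powr s) (frac_int s (min 2) / frac_int s (\<lambda>t. 1 - exp (- t)) * \<Lambda> powr s)"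
proof -
  define c where "c = frac_int s (\<lambda>t. 1 - exp (- t))"
  have c: "c > 0" unfolding c_def by (rule frac_int_exp_pos[OF s])
  define m where "m t k = (indicator {0<..} t * t powr (- s - 1)) * (1 - exp (- (\<kappa> k * t)))" for t k
  define L where "L t = (indicator {0<..} t * t powr (- s - 1)) * min 2 (\<Lambda> * t)" for t
  have 1: "mult_bound (m t) (L t)" for t
  proof (cases "t > 0")
    case True
    then have "mult_bound (\<lambda>k. t powr (- s - 1) * (1 - exp (- (\<kappa> k * t)))) (\<bar>t powr (- s - 1)\<bar> * min 2 (\<Lambda> * t))"
      by (intro mult_bound_cmult mult_bound_one_minus_exp \<kappa> e assms) auto
    then show ?thesis using True by (simp add: m_def[abs_def] L_def)
  next
    case False
    then show ?thesis using mult_bound_cmult[OF mult_bound_1, of 0] by (simp add: m_def[abs_def] L_def)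
  qed
  have mm: "(min 2 :: real \<Rightarrow> real) \<in> borel_measurable borel" by simp
  note sL = frac_int_scale[OF s mm _ _ L]
  have iL: "integrable lborel L" and vL: "(LINT t|lborel. L t) = \<Lambda> powr s * frac_int s (min 2)"
    unfolding L_def by (rule sL; simp)+
  have im: "integrable lborel (\<lambda>t. m t k)" and vm: "(LINT t|lborel. m t k) = \<kappa> k powr s * c" for k
  proof -
    have "integrable lborel (\<lambda>t. m t k) \<and> (LINT t|lborel. m t k) = \<kappa> k powr s * c"
    proof (cases "\<kappa> k = 0")
      case True
      then show ?thesis by (simp add: m_def)
    next
      case False
      then have k: "\<kappa> k > 0" using \<kappa>0[of k] by simp
      show ?thesis unfolding m_def c_def using frac_int_scale[OF s _ exp_phi k] by simp
    qed
    then show "integrable lborel (\<lambda>t. m t k)" "(LINT t|lborel. m t k) = \<kappa> k powr s * c" by auto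
  qed
  have "mult_bound (\<lambda>k. (1 / c) * (LINT t|lborel. m t k)) (\<bar>1 / c\<bar> * (LINT t|lborel. L t))"
    by (intro mult_bound_cmult mult_bound_integral 1 iL im)
  then show ?thesis using c by (simp add: vm vL c_def[symmetric] mult.commute)
qed

lemma mult_bound_powr:
  assumes \<kappa>: "mult_bound \<kappa> \<Lambda>" and e: "\<And>t. t \<ge> 0 \<Longrightarrow> mult_bound (\<lambda>k. exp (- t * \<kappa> k)) 1" and L: "\<Lambda> > 0"
    and \<kappa>0: "\<And>k. \<kappa> k \<ge> 0" and a: "a > 0"
  shows "mult_bound (\<lambda>k. \<kappa> k powr a) (frac_const a * \<Lambda> powr a)"
proof -
  define j where "j = nat \<lfloor>a\<rfloor>"
  define s where "s = frac a"
  have as: "a = real j + s" using a by (simp add: j_def s_def frac_def)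
  have pa: "x powr a = x ^ j * (if s = 0 then 1 else x powr s)" if "x \<ge> 0" for x
  proof (cases "x = 0")
    case True
    then show ?thesis using a as by (cases "j = 0") (auto simp: power_0_left)
  next
    case False
    then show ?thesis using that by (simp add: as powr_add powr_realpow)
  qed
  show ?thesis
  proof (cases "s = 0")
    case True
    then have "frac_const a = 1" by (simp add: frac_const_def s_def)
    then show ?thesis using mult_bound_power[OF \<kappa>, of j] True L by (simp add: pa \<kappa>0)
  next
    case False
    then have s: "0 < s" "s < 1" using frac_ge_0[of a] frac_lt_1[of a] unfolding s_def by linarith+
    have "mult_bound (\<lambda>k. \<kappa> k ^ j * \<kappa> k powr s) (\<Lambda> ^ j * (frac_int s (min 2) / frac_int s (\<lambda>t. 1 - exp (- t)) * \<Lambda> powr s))"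
      by (intro mult_bound_mult mult_bound_power mult_bound_frac \<kappa> e L \<kappa>0 s)
    moreover have "frac_const a = frac_int s (min 2) / frac_int s (\<lambda>t. 1 - exp (- t))"
      using False by (simp add: frac_const_def s_def)
    ultimately show ?thesis using False L by (simp add: pa \<kappa>0 mult_ac)
  qed
qed

text \<open>The eigenvalue is the product of \<open>k\<close> and \<open>k + 2 * lam\<close>. Both
  factors have norm at most \<open>\<Lambda> = O(N)\<close> and generate contraction semigroups, so
  the power \<open>r / 2\<close> can be taken of each separately.\<close>

lemma mult_bound_eigenvalue:
  assumes N: "N \<ge> 1" and r: "r > 0"
  shows "mult_bound (\<lambda>k. (real k * (real k + 2 * lam)) powr (r / 2)) ((frac_const (r / 2) * (bern_const lam + 2 * lam) powr (r / 2))\<^sup>2 * real N powr r)"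
proof -
  define \<Lambda> where "\<Lambda> = (bern_const lam + 2 * lam) * real N"
  have L: "\<Lambda> > 0" unfolding \<Lambda>_def using N bern_const_pos[of lam] lam_nonneg by (intro mult_pos_pos add_pos_nonneg) auto
  have b: "mult_bound real (bern_const lam * real N)" by (rule mult_bound_id[OF N])
  have b1: "mult_bound real \<Lambda>"
    by (rule mult_bound_mono[OF b]) (use lam_nonneg in \<open>simp add: \<Lambda>_def distrib_right\<close>)
  have "mult_bound (\<lambda>k. real k + 2 * lam * 1) (bern_const lam * real N + \<bar>2 * lam\<bar> * 1)"
    by (intro mult_bound_add mult_bound_cmult mult_bound_1 b)
  then have "mult_bound (\<lambda>k. real k + 2 * lam) (bern_const lam * real N + 2 * lam)" using lam_nonneg by simp
  then have b2: "mult_bound (\<lambda>k. real k + 2 * lam) \<Lambda>"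
  proof (rule mult_bound_mono)
    have "2 * lam * 1 \<le> 2 * lam * real N" using N lam_nonneg by (intro mult_left_mono) auto
    then show "bern_const lam * real N + 2 * lam \<le> \<Lambda>" by (simp add: \<Lambda>_def distrib_right)
  qed
  have e2: "mult_bound (\<lambda>k. exp (- t * (real k + 2 * lam))) 1" if t: "t \<ge> 0" for t
  proof -
    have "mult_bound (\<lambda>k. exp (- t * (2 * lam)) * exp (- t * real k)) (\<bar>exp (- t * (2 * lam))\<bar> * 1)"
      by (intro mult_bound_cmult mult_bound_exp t)
    moreover have "\<bar>exp (- t * (2 * lam))\<bar> * 1 \<le> 1" using t lam_nonneg by simp
    ultimately have "mult_bound (\<lambda>k. exp (- t * (2 * lam)) * exp (- t * real k)) 1" by (rule mult_bound_mono)
    then show ?thesis by (rule mult_bound_cong) (simp add: exp_add[symmetric] algebra_simps)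
  qed
  have "mult_bound (\<lambda>k. real k powr (r / 2) * (real k + 2 * lam) powr (r / 2)) ((frac_const (r / 2) * \<Lambda> powr (r / 2)) * (frac_const (r / 2) * \<Lambda> powr (r / 2)))"
    using r lam_nonneg by (intro mult_bound_mult mult_bound_powr b1 b2 mult_bound_exp e2 L) auto
  moreover have "(frac_const (r / 2) * \<Lambda> powr (r / 2)) * (frac_const (r / 2) * \<Lambda> powr (r / 2)) = (frac_const (r / 2) * (bern_const lam + 2 * lam) powr (r / 2))\<^sup>2 * real N powr r"
  proof -
    have "\<Lambda> powr (r / 2) = (bern_const lam + 2 * lam) powr (r / 2) * real N powr (r / 2)" unfolding \<Lambda>_def by (rule powr_mult)
    moreover have "real N powr r = real N powr (r / 2) * real N powr (r / 2)" by (simp flip: powr_add)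
    ultimately show ?thesis by (simp add: power2_eq_square)
  qed
  ultimately have "mult_bound (\<lambda>k. real k powr (r / 2) * (real k + 2 * lam) powr (r / 2)) ((frac_const (r / 2) * (bern_const lam + 2 * lam) powr (r / 2))\<^sup>2 * real N powr r)"
    by (simp only:)
  then show ?thesis by (rule mult_bound_cong) (simp only: powr_mult)
qed

end

lemma bernstein:
  assumes mu: "\<mu> \<ge> 0" and r: "r > 0"
  obtains C where "C > 0" "\<And>N q B. N \<ge> 1 \<Longrightarrow> q \<in> poly_space N \<Longrightarrow> (\<And>x. norm x \<le> 1 \<Longrightarrow> \<bar>q x\<bar> \<le> B) \<Longrightarrow>
    \<exists>g. continuous_on (cball 0 1) g \<and> is_frac_power \<mu> r q (g :: real ^ 'd::finite \<Rightarrow> real) \<and> (\<forall>x. norm x \<le> 1 \<longrightarrow> \<bar>g x\<bar> \<le> C * real N powr r * B)"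
proof -
  define l where "l = \<mu> + (real CARD('d) - 1) / 2"
  define C where "C = (frac_const (r / 2) * (bern_const l + 2 * l) powr (r / 2))\<^sup>2 + 1"
  have "C > 0" unfolding C_def by (rule add_nonneg_pos) auto
  moreover have "\<exists>g. continuous_on (cball 0 1) g \<and> is_frac_power \<mu> r q (g :: real ^ 'd \<Rightarrow> real) \<and> (\<forall>x. norm x \<le> 1 \<longrightarrow> \<bar>g x\<bar> \<le> C * real N powr r * B)"
    if N: "N \<ge> 1" and q: "q \<in> poly_space N" and B: "\<And>x. norm x \<le> 1 \<Longrightarrow> \<bar>q x\<bar> \<le> B" for N q B
  proof -
    interpret ball_mult \<mu> N "TYPE('d)" by unfold_locales (rule mu)
    define m where "m k = (real k * (real k + 2 * lam)) powr (r / 2)" for k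
    have ll: "lam = l" by (simp add: lam_def l_def)
    have qs: "q \<in> spec" by (rule poly_space_spec[OF q])
    have "mult_bound m ((frac_const (r / 2) * (bern_const lam + 2 * lam) powr (r / 2))\<^sup>2 * real N powr r)"
      unfolding m_def by (rule mult_bound_eigenvalue[OF N r])
    then have "mult_bound m (C * real N powr r)"
      by (rule mult_bound_mono) (simp add: C_def ll distrib_right)
    then have b: "\<forall>x. norm x \<le> 1 \<longrightarrow> \<bar>mult_op m q x\<bar> \<le> C * real N powr r * B"
      using qs B unfolding mult_bound_def by blast
    have c: "continuous_on (cball 0 1) (mult_op m q)" using mult_op_spec[OF qs] by (simp add: spec_def)
    have m: "m k = (real k * (real k + 2 * \<mu> + real CARD('d) - 1)) powr (r / 2)" for k
    proof -
      have "real k + 2 * lam = real k + 2 * \<mu> + real CARD('d) - 1" by (simp add: lam_def field_simps)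
      then show ?thesis by (simp only: m_def)
    qed
    have "is_frac_power \<mu> r q (mult_op m q)"
      unfolding is_frac_power_def m[symmetric] orth_proj_mult_op[OF qs] using orth_proj_high[OF qs] by auto
    with b c show ?thesis by blast
  qed
  ultimately show ?thesis by (rule that)
qed

section \<open>Fooling polynomials and the lower bound\<close>

text \<open>\<open>lborel\<close> is the image of a product measure indexed by the basis vectors;
  the bijection \<open>e\<close> from coordinates to basis vectors turns this into Fubini for
  products over coordinates.\<close>

lemma lborel_prod_coords:
  fixes h :: "'d::finite \<Rightarrow> real \<Rightarrow> real"
  assumes h: "\<And>i. integrable lborel (h i)"
  shows "integrable lborel (\<lambda>y :: real ^ 'd. \<Prod>i\<in>UNIV. h i (y $ i))"
    and "(LINT y|(lborel :: (real ^ 'd) measure). (\<Prod>i\<in>UNIV. h i (y $ i))) = (\<Prod>i\<in>UNIV. (LINT t|lborel. h i t))"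
proof -
  define e where "e = (\<lambda>i. axis i (1::real) :: real ^ 'd)"
  have inj: "inj e" by (auto simp: e_def inj_on_def axis_eq_axis)
  have B: "Basis = range e" by (auto simp: Basis_vec_def e_def)
  define f where "f b = h (inv e b)" for b
  have fe: "f (e i) = h i" for i by (simp add: f_def inv_f_f[OF inj])
  interpret product_sigma_finite "\<lambda>_ :: real ^ 'd. lborel :: real measure" by standard
  define G where "G = (\<lambda>x. \<Sum>b\<in>Basis. x b *\<^sub>R (b :: real ^ 'd))"
  have Gm: "G \<in> measurable (\<Pi>\<^sub>M b\<in>Basis. lborel) borel" unfolding G_def by measurable
  have eq: "(lborel :: (real ^ 'd) measure) = distr (\<Pi>\<^sub>M b\<in>Basis. lborel) borel G" unfolding G_def by (rule lborel_eq)
  have hm: "h i \<in> borel_measurable borel" for i using borel_measurable_integrable[OF h[of i]] by simp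
  have Fm: "(\<lambda>y :: real ^ 'd. \<Prod>i\<in>UNIV. h i (y $ i)) \<in> borel_measurable borel"
    by (intro borel_measurable_prod measurable_compose[OF _ hm] borel_measurable_continuous_onI continuous_intros)
  have FG: "(\<Prod>i\<in>UNIV. h i (G x $ i)) = (\<Prod>b\<in>Basis. f b (x b))" for x
  proof -
    have "h i (G x $ i) = f (e i) (x (e i))" for i
    proof -
      have "G x $ i = G x \<bullet> e i" by (simp add: e_def inner_axis)
      also have "\<dots> = x (e i)" unfolding G_def by (rule inner_sum_left_Basis) (simp add: B)
      finally show ?thesis by (simp add: fe)
    qed
    then show ?thesis unfolding B prod.reindex[OF inj] by simp
  qed
  have fi: "integrable lborel (f b)" for b by (simp add: f_def h)
  show "integrable lborel (\<lambda>y :: real ^ 'd. \<Prod>i\<in>UNIV. h i (y $ i))"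
    unfolding eq integrable_distr_eq[OF Gm Fm] FG by (intro product_integrable_prod fi) auto
  have "(LINT y|(lborel :: (real ^ 'd) measure). (\<Prod>i\<in>UNIV. h i (y $ i))) = (LINT x|(\<Pi>\<^sub>M b\<in>Basis. lborel). (\<Prod>b\<in>Basis. f b (x b)))"
    unfolding eq integral_distr[OF Gm Fm] FG ..
  also have "\<dots> = (\<Prod>b\<in>Basis. (LINT t|lborel. f b t))" by (intro product_integral_prod fi) auto
  also have "\<dots> = (\<Prod>i\<in>UNIV. (LINT t|lborel. h i t))" unfolding B prod.reindex[OF inj] by (simp add: fe)
  finally show "(LINT y|(lborel :: (real ^ 'd) measure). (\<Prod>i\<in>UNIV. h i (y $ i))) = (\<Prod>i\<in>UNIV. (LINT t|lborel. h i t))" .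
qed

section \<open>Finite orthonormal systems and tensor Chebyshev polynomials\<close>

definition orthonormal_on :: "'a set \<Rightarrow> nat \<Rightarrow> (nat \<Rightarrow> 'a \<Rightarrow> real) \<Rightarrow> bool" where
  "orthonormal_on I m u \<longleftrightarrow> (\<forall>j<m. \<forall>k<m. (\<Sum>a\<in>I. u j a * u k a) = (if j = k then 1 else 0))"

lemma bessel_identity:
  assumes u: "orthonormal_on I m u"
  shows "(\<Sum>a\<in>I. (v a - (\<Sum>j<m. (\<Sum>b\<in>I. v b * u j b) * u j a))\<^sup>2) = (\<Sum>a\<in>I. (v a)\<^sup>2) - (\<Sum>j<m. (\<Sum>b\<in>I. v b * u j b)\<^sup>2)"
proof -
  define c where "c j = (\<Sum>b\<in>I. v b * u j b)" for j
  have 1: "(\<Sum>a\<in>I. v a * (\<Sum>j<m. c j * u j a)) = (\<Sum>j<m. (c j)\<^sup>2)"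
  proof -
    have "(\<Sum>a\<in>I. v a * (\<Sum>j<m. c j * u j a)) = (\<Sum>j<m. \<Sum>a\<in>I. c j * (v a * u j a))"
      unfolding sum_distrib_left by (subst sum.swap) (simp add: mult_ac)
    also have "\<dots> = (\<Sum>j<m. (c j)\<^sup>2)" by (simp add: sum_distrib_left[symmetric] c_def[symmetric] power2_eq_square)
    finally show ?thesis .
  qed
  have 2: "(\<Sum>a\<in>I. (\<Sum>j<m. c j * u j a)\<^sup>2) = (\<Sum>j<m. (c j)\<^sup>2)"
  proof -
    have "(\<Sum>a\<in>I. (\<Sum>j<m. c j * u j a)\<^sup>2) = (\<Sum>a\<in>I. \<Sum>j<m. \<Sum>k<m. c j * c k * (u j a * u k a))"
      by (simp add: power2_eq_square sum_product mult_ac)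
    also have "\<dots> = (\<Sum>j<m. \<Sum>k<m. \<Sum>a\<in>I. c j * c k * (u j a * u k a))"
      by (subst sum.swap, intro sum.cong refl, subst sum.swap) simp
    also have "\<dots> = (\<Sum>j<m. \<Sum>k<m. c j * c k * (if j = k then 1 else 0))"
      using u by (auto simp: orthonormal_on_def sum_distrib_left[symmetric] intro!: sum.cong)
    also have "\<dots> = (\<Sum>j<m. (c j)\<^sup>2)"
      by (intro sum.cong refl) (simp add: if_distrib power2_eq_square cong: if_cong)
    finally show ?thesis .
  qed
  have "(\<Sum>a\<in>I. (v a - (\<Sum>j<m. c j * u j a))\<^sup>2) = (\<Sum>a\<in>I. (v a)\<^sup>2) - 2 * (\<Sum>a\<in>I. v a * (\<Sum>j<m. c j * u j a)) + (\<Sum>a\<in>I. (\<Sum>j<m. c j * u j a)\<^sup>2)"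
    by (simp add: power2_diff sum.distrib sum_subtractf sum_distrib_left mult.assoc)
  then show ?thesis unfolding 1 2 by (simp add: c_def)
qed

lemma gram_schmidt:
  assumes I: "finite I"
  shows "\<exists>m u. m \<le> n \<and> orthonormal_on I m u \<and> (\<forall>i<n. \<forall>a\<in>I. v i a = (\<Sum>j<m. (\<Sum>b\<in>I. v i b * u j b) * u j a))"
proof (induction n)
  case 0
  show ?case by (intro exI[of _ 0]) (simp add: orthonormal_on_def)
next
  case (Suc n)
  then obtain m u where m: "m \<le> n" and u: "orthonormal_on I m u"
    and v: "\<And>i a. i < n \<Longrightarrow> a \<in> I \<Longrightarrow> v i a = (\<Sum>j<m. (\<Sum>b\<in>I. v i b * u j b) * u j a)" by blast
  define c where "c j = (\<Sum>b\<in>I. v n b * u j b)" for j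
  define w where "w a = v n a - (\<Sum>j<m. c j * u j a)" for a
  have wu: "(\<Sum>a\<in>I. w a * u k a) = 0" if k: "k < m" for k
  proof -
    have "(\<Sum>a\<in>I. w a * u k a) = c k - (\<Sum>a\<in>I. \<Sum>j<m. c j * (u j a * u k a))"
      by (simp add: w_def left_diff_distrib sum_subtractf sum_distrib_right mult.assoc c_def)
    also have "(\<Sum>a\<in>I. \<Sum>j<m. c j * (u j a * u k a)) = (\<Sum>j<m. c j * (\<Sum>a\<in>I. u j a * u k a))"
      by (subst sum.swap) (simp add: sum_distrib_left)
    also have "\<dots> = (\<Sum>j<m. if j = k then c j else 0)"
      using u k by (intro sum.cong) (auto simp: orthonormal_on_def)
    also have "\<dots> = c k" using k by simp
    finally show ?thesis by simp
  qed
  \<comment> \<open>If the residual \<open>w\<close> vanishes, the new vector already lies in the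
    span and the system is not enlarged; this is why \<open>m\<close> may stay below
    \<open>n\<close>.\<close>
  define s where "s = (\<Sum>a\<in>I. (w a)\<^sup>2)"
  show ?case
  proof (cases "s = 0")
    case True
    then have "w a = 0" if "a \<in> I" for a using that I by (simp add: s_def sum_nonneg_eq_0_iff)
    then have "v n a = (\<Sum>j<m. (\<Sum>b\<in>I. v n b * u j b) * u j a)" if "a \<in> I" for a
      using that by (simp add: w_def c_def)
    then show ?thesis using m u v by (intro exI[of _ m] exI[of _ u]) (auto simp: less_Suc_eq)
  next
    case False
    moreover have "s \<ge> 0" unfolding s_def by (intro sum_nonneg) auto
    ultimately have s: "s > 0" by simp
    define u' where "u' j = (if j = m then (\<lambda>a. w a / sqrt s) else u j)" for j
    have u'k: "u' k = u k" if "k < m" for k using that by (simp add: u'_def)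
    have n1: "(\<Sum>a\<in>I. u' m a * u' m a) = 1"
    proof -
      have "(\<Sum>a\<in>I. u' m a * u' m a) = (\<Sum>a\<in>I. (w a)\<^sup>2 / s)" using s by (simp add: u'_def power2_eq_square)
      also have "\<dots> = s / s" unfolding sum_divide_distrib[symmetric] by (simp only: s_def)
      finally show ?thesis using s by simp
    qed
    have n0: "(\<Sum>a\<in>I. u' m a * u' k a) = 0" "(\<Sum>a\<in>I. u' k a * u' m a) = 0" if "k < m" for k
    proof -
      have "(\<Sum>a\<in>I. u' m a * u' k a) = (\<Sum>a\<in>I. w a * u k a) / sqrt s"
        using that by (simp add: u'_def sum_divide_distrib)
      then show "(\<Sum>a\<in>I. u' m a * u' k a) = 0" using wu[OF that] by simp
      then show "(\<Sum>a\<in>I. u' k a * u' m a) = 0" by (simp add: mult.commute)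
    qed
    have o: "orthonormal_on I (Suc m) u'"
      using u n1 n0 by (auto simp: orthonormal_on_def less_Suc_eq u'k)
    have A: "v i a = (\<Sum>j<Suc m. (\<Sum>b\<in>I. v i b * u' j b) * u' j a)" if i: "i < n" and a: "a \<in> I" for i a
    proof -
      define e where "e j = (\<Sum>b\<in>I. v i b * u j b)" for j
      have "(\<Sum>b\<in>I. v i b * u' m b) = (\<Sum>b\<in>I. (\<Sum>j<m. e j * u j b) * u' m b)"
        using v[OF i] unfolding e_def by (intro sum.cong refl) simp
      also have "\<dots> = (\<Sum>j<m. e j * (\<Sum>b\<in>I. u' j b * u' m b))"
        unfolding sum_distrib_right sum_distrib_left[of _ _ I] by (subst sum.swap) (simp add: u'k mult.assoc)
      also have "\<dots> = 0" by (simp add: n0)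
      finally show ?thesis using v[OF i a] by (simp add: u'k)
    qed
    have B: "v n a = (\<Sum>j<Suc m. (\<Sum>b\<in>I. v n b * u' j b) * u' j a)" if a: "a \<in> I" for a
    proof -
      have "(\<Sum>b\<in>I. v n b * u' m b) = (\<Sum>b\<in>I. w b * u' m b) + (\<Sum>b\<in>I. (\<Sum>j<m. c j * u j b) * u' m b)"
        by (simp add: w_def left_diff_distrib sum_subtractf)
      also have "(\<Sum>b\<in>I. (\<Sum>j<m. c j * u j b) * u' m b) = (\<Sum>j<m. c j * (\<Sum>b\<in>I. u' j b * u' m b))"
        unfolding sum_distrib_right sum_distrib_left[of _ _ I] by (subst sum.swap) (simp add: u'k mult.assoc)
      also have "\<dots> = 0" by (simp add: n0)
      also have "(\<Sum>b\<in>I. w b * u' m b) = s / sqrt s" by (simp add: u'_def s_def sum_divide_distrib power2_eq_square)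
      finally have "(\<Sum>b\<in>I. v n b * u' m b) * u' m a = w a" using s by (simp add: u'_def)
      then show ?thesis by (simp add: u'k w_def c_def)
    qed
    show ?thesis
    proof (rule exI[of _ "Suc m"], rule exI[of _ u'], intro conjI allI impI ballI o)
      show "Suc m \<le> Suc n" using m by simp
      fix i a assume "i < Suc n" and a: "a \<in> I"
      then consider "i = n" | "i < n" by linarith
      then show "v i a = (\<Sum>j<Suc m. (\<Sum>b\<in>I. v i b * u' j b) * u' j a)" using A[OF _ a] B[OF a] by cases blast+
    qed
  qed
qed

text \<open>For \<open>l = 0\<close> the recurrence is that of the cosines. The missing factor 2 at
  \<open>k = 0\<close> is made up for by \<open>zonal_down 0 0 = 2\<close>.\<close>

lemma poly_zonal_0_cos: "poly (zonal 0 k) (cos \<theta>) = (if k = 0 then 1 else 2 * cos (real k * \<theta>))"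
proof (induction k rule: less_induct)
  case (less k)
  have rec: "2 * z * poly (zonal 0 n) z = poly (zonal 0 (Suc n)) z + (if n = 0 then 0 else zonal_down 0 (n - 1) * poly (zonal 0 (n - 1)) z)" for n z
    using arg_cong[OF zonal_rec[of 0 n], of "\<lambda>F. poly F z"] by (simp add: zonal_up_def split: if_splits)
  consider "k = 0" | "k = 1" | n where "k = Suc (Suc n)" by (metis One_nat_def not0_implies_Suc)
  then show ?case
  proof cases
    case 1
    then show ?thesis by (simp add: zonal_def)
  next
    case 2
    then show ?thesis using rec[of "cos \<theta>" 0] by (simp add: zonal_def)
  next
    case 3
    have "poly (zonal 0 k) (cos \<theta>) = 2 * cos \<theta> * poly (zonal 0 (Suc n)) (cos \<theta>) - zonal_down 0 n * poly (zonal 0 n) (cos \<theta>)"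
      using rec[of "cos \<theta>" "Suc n"] by (simp add: 3)
    also have "zonal_down 0 n * poly (zonal 0 n) (cos \<theta>) = 2 * cos (real n * \<theta>)"
      using less.IH[of n] by (cases "n = 0") (simp_all add: zonal_down_def 3)
    also have "poly (zonal 0 (Suc n)) (cos \<theta>) = 2 * cos (real (Suc n) * \<theta>)"
      using less.IH[of "Suc n"] by (simp add: 3)
    finally show ?thesis unfolding 3 cos_rec by simp
  qed
qed

text \<open>For \<open>k > 0\<close> the polynomial \<open>zonal 0 k\<close> is twice the Chebyshev
  polynomial and has squared norm 2, so these factors normalise it.\<close>

definition cheb :: "nat \<Rightarrow> real poly" where
  "cheb k = smult (if k = 0 then 1 else 1 / sqrt 2) (zonal 0 k)"

lemma degree_cheb: "degree (cheb k) \<le> k"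
  unfolding cheb_def using degree_zonal[of 0 k] order_trans[OF degree_smult_le] by blast

lemma cheb_orthonormal: "umbral (arc_mom 1) (cheb j * cheb k) = (if j = k then 1 else 0)"
proof -
  have z: "umbral (arc_mom 1) (zonal 0 j * zonal 0 k) = 0" if "j < k" for j k
    using zonal_orth[of 0 "zonal 0 j" k] degree_zonal[of 0 j] that by simp
  have n: "umbral (arc_mom 1) (zonal 0 k * zonal 0 k) = poly (zonal 0 k) 1"
  proof -
    have "umbral (arc_mom 1) (zonal 0 k * zonal 0 n) = 0" if "n < k" for n using z[OF that] by (simp add: mult.commute)
    then have "(\<Sum>n\<le>k. umbral (arc_mom 1) (zonal 0 k * zonal 0 n)) = umbral (arc_mom 1) (zonal 0 k * zonal 0 k)"
      by (simp add: lessThan_Suc_atMost[symmetric])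
    then show ?thesis using zonal_reproduce[of 0 "zonal 0 k" k] degree_zonal[of 0 k] by simp
  qed
  have p: "poly (zonal 0 k) 1 = (if k = 0 then 1 else 2)" using poly_zonal_0_cos[of k 0] by simp
  consider "j < k" | "k < j" | "j = k" by linarith
  then show ?thesis
  proof cases
    case 1
    then show ?thesis using z[OF 1] by (simp add: cheb_def umbral_smult)
  next
    case 2
    then show ?thesis using z[OF 2] by (simp add: cheb_def umbral_smult mult.commute[of "zonal 0 j"])
  next
    case 3
    then show ?thesis using n p by (simp add: cheb_def umbral_smult)
  qed
qed

lemma cheb_sq_le: "\<bar>z\<bar> \<le> 1 \<Longrightarrow> (poly (cheb k) z)\<^sup>2 \<le> 2"
proof -
  assume "\<bar>z\<bar> \<le> 1"
  then obtain \<theta> where z: "z = cos \<theta>" using arccos_repr by blast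
  have "(cos (real k * \<theta>))\<^sup>2 \<le> 1" by (simp add: abs_square_le_1)
  then show ?thesis by (auto simp: z cheb_def poly_zonal_0_cos power_mult_distrib power_divide)
qed

text \<open>Two neighbouring Chebyshev polynomials are not both small: the sum of squares of
  \<open>cos a\<close> and \<open>cos b\<close> is \<open>1 + cos (a + b) * cos (a - b)\<close>, and
  here \<open>a - b = \<theta>\<close> with
  \<open>\<bar>cos \<theta>\<bar> \<le> 1/2\<close>.\<close>

lemma cheb_sq_pair: "\<bar>z\<bar> \<le> 1/2 \<Longrightarrow> (poly (cheb k) z)\<^sup>2 + (poly (cheb (Suc k)) z)\<^sup>2 \<ge> 1/2"
proof -
  assume h: "\<bar>z\<bar> \<le> 1/2"
  then obtain \<theta> where z: "z = cos \<theta>" using arccos_repr[of z] by auto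
  have c: "(poly (cheb k) z)\<^sup>2 \<ge> (cos (real k * \<theta>))\<^sup>2" for k
    by (auto simp: z cheb_def poly_zonal_0_cos power_mult_distrib power_divide)
  define a b where "a = real (Suc k) * \<theta>" and "b = real k * \<theta>"
  have t: "a - b = \<theta>" by (simp add: a_def b_def algebra_simps)
  have i: "(cos a)\<^sup>2 + (cos b)\<^sup>2 = 1 + cos (a + b) * cos (a - b)"
  proof -
    have "cos (a + b) * cos (a - b) = (cos a)\<^sup>2 * (cos b)\<^sup>2 - (sin a)\<^sup>2 * (sin b)\<^sup>2"
      by (simp add: cos_add cos_diff power2_eq_square algebra_simps)
    then show ?thesis by (simp add: sin_squared_eq algebra_simps)
  qed
  have "\<bar>cos (a + b) * cos (a - b)\<bar> \<le> 1 * (1/2)"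
    unfolding abs_mult t using h z by (intro mult_mono) auto
  then have "(cos a)\<^sup>2 + (cos b)\<^sup>2 \<ge> 1/2" unfolding i by linarith
  then show ?thesis using c[of k] c[of "Suc k"] by (simp add: a_def b_def)
qed

lemma cheb_sq_sum: "\<bar>z\<bar> \<le> 1/2 \<Longrightarrow> (\<Sum>k<2 * L. (poly (cheb k) z)\<^sup>2) \<ge> real L / 2"
proof (induction L)
  case (Suc L)
  then show ?case using cheb_sq_pair[of z "2 * L"] by simp
qed simp

text \<open>The arcsine density, for which the polynomials \<open>cheb\<close> are
  orthonormal.\<close>

definition cheb_wt :: "real \<Rightarrow> real" where
  "cheb_wt z = ball_wt (1/2) 1 z / ball_mass TYPE(real) (1/2)"

lemma cheb_wt_nonneg: "cheb_wt z \<ge> 0"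
  using ball_mass_pos[of "1/2", where 'a = real] by (simp add: cheb_wt_def)

lemma cheb_wt_ge: "\<bar>z\<bar> < 1 \<Longrightarrow> cheb_wt z \<ge> 1 / ball_mass TYPE(real) (1/2)"
proof -
  assume z: "\<bar>z\<bar> < 1"
  then have "z\<^sup>2 < 1" by (simp add: abs_square_less_1)
  moreover have "(1 - z\<^sup>2) powr (1/2 - 1) \<ge> 1 powr (1/2 - 1)" using \<open>z\<^sup>2 < 1\<close> by (intro powr_mono2') auto
  ultimately have "ball_wt (1/2) 1 z \<ge> 1" by (simp add: ball_wt_def)
  then show ?thesis using ball_mass_pos[of "1/2", where 'a = real] by (simp add: cheb_wt_def divide_right_mono)
qed

lemma cheb_wt_integral:
  shows "integrable lborel (\<lambda>z. cheb_wt z * (poly (cheb j) z * poly (cheb k) z))"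
    and "(LINT z|lborel. cheb_wt z * (poly (cheb j) z * poly (cheb k) z)) = (if j = k then 1 else 0)"
proof -
  let ?h = "\<lambda>z :: real. poly (cheb j * cheb k) z"
  have hc: "continuous_on UNIV ?h" by (intro continuous_intros)
  have hm: "?h \<in> borel_measurable borel" by (intro borel_measurable_continuous_onI continuous_intros)
  have wm: "(\<lambda>z :: real. ball_wt (1/2) 1 z) \<in> borel_measurable borel" unfolding ball_wt_def by measurable
  have g: "ball_prob (1/2) = density lborel (\<lambda>z :: real. ennreal (cheb_wt z))" by (simp add: ball_prob_def cheb_wt_def)
  have cm: "cheb_wt \<in> borel_measurable lborel" unfolding cheb_wt_def[abs_def] using wm by simp
  have "integrable (ball_prob (1/2)) ?h" by (rule AE_ball_prob_integrable[OF _ hc]) simp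
  then have "integrable lborel (\<lambda>z. cheb_wt z *\<^sub>R ?h z)"
    unfolding g using cm hm cheb_wt_nonneg by (subst (asm) integrable_density) (simp_all del: poly_mult)
  then show "integrable lborel (\<lambda>z. cheb_wt z * (poly (cheb j) z * poly (cheb k) z))" by simp
  have "(LINT z|ball_prob (1/2). ?h z) = (LINT z|lborel. cheb_wt z *\<^sub>R ?h z)"
    unfolding g using cm hm cheb_wt_nonneg by (subst integral_density) (simp_all del: poly_mult)
  then show "(LINT z|lborel. cheb_wt z * (poly (cheb j) z * poly (cheb k) z)) = (if j = k then 1 else 0)"
    using integral_ball_prob_real_poly[of "1/2" "cheb j * cheb k"] by (simp add: cheb_orthonormal)
qed

definition cheb_tensor :: "('d::finite \<Rightarrow> nat) \<Rightarrow> real ^ 'd \<Rightarrow> real" where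
  "cheb_tensor \<alpha> y = (\<Prod>i\<in>UNIV. poly (cheb (\<alpha> i)) (y $ i))"

definition cheb_tensor_wt :: "real ^ 'd::finite \<Rightarrow> real" where
  "cheb_tensor_wt y = (\<Prod>i\<in>UNIV. cheb_wt (y $ i))"

definition multi_degrees :: "nat \<Rightarrow> ('d::finite \<Rightarrow> nat) set" where
  "multi_degrees K = PiE UNIV (\<lambda>_. {..<K})"

lemma finite_multi_degrees: "finite (multi_degrees K)" unfolding multi_degrees_def by (intro finite_PiE) auto

lemma card_multi_degrees: "card (multi_degrees K :: ('d::finite \<Rightarrow> nat) set) = K ^ CARD('d)"
  unfolding multi_degrees_def by (simp add: card_PiE)

lemma cheb_tensor_sq_sum: "(\<Sum>\<alpha>\<in>multi_degrees K. (cheb_tensor \<alpha> y)\<^sup>2) = (\<Prod>i\<in>UNIV. \<Sum>k<K. (poly (cheb k) (y $ i))\<^sup>2)"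
  unfolding multi_degrees_def cheb_tensor_def prod_power_distrib
  by (subst prod_sum_PiE) auto

lemma cheb_tensor_poly_space:
  fixes \<alpha> :: "'d::finite \<Rightarrow> nat"
  assumes "\<alpha> \<in> multi_degrees K"
  shows "cheb_tensor \<alpha> \<in> poly_space (CARD('d) * K)"
proof -
  have p: "(\<lambda>y :: real ^ 'd. poly F (y $ i)) \<in> poly_space (degree F)" for F i
  proof -
    have "(\<lambda>y :: real ^ 'd. coeff F n * (y $ i) ^ n) \<in> poly_space (degree F)" if "n \<le> degree F" for n
      using poly_space_le[OF poly_space_power[OF poly_space_coord[of i], of n]] that by (intro poly_space_cmult) simp
    then show ?thesis unfolding poly_altdef by (intro poly_space_sum) simp
  qed
  have "(\<lambda>y. \<Prod>i\<in>A. poly (cheb (\<alpha> i)) (y $ i)) \<in> poly_space (card A * K)" if "finite A" for A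
    using that
  proof (induction A)
    case (insert i A)
    have "degree (cheb (\<alpha> i)) \<le> K" using degree_cheb[of "\<alpha> i"] assms by (auto simp: multi_degrees_def PiE_def Pi_def intro: order_trans less_imp_le)
    then have "(\<lambda>y :: real ^ 'd. poly (cheb (\<alpha> i)) (y $ i)) \<in> poly_space K" using p poly_space_le by blast
    from poly_space_mult[OF this insert.IH] show ?case using insert by simp
  qed (simp add: poly_space_const)
  from this[of UNIV] show ?thesis by (simp add: cheb_tensor_def[abs_def])
qed

lemma cheb_tensor_integral:
  fixes \<alpha> \<beta> :: "'d::finite \<Rightarrow> nat"
  shows "integrable lborel (\<lambda>y. cheb_tensor_wt y * (cheb_tensor \<alpha> y * cheb_tensor \<beta> y))"
    and "(LINT y|lborel. cheb_tensor_wt y * (cheb_tensor \<alpha> y * cheb_tensor \<beta> y)) = (if \<alpha> = \<beta> then 1 else 0)"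
proof -
  have e: "cheb_tensor_wt y * (cheb_tensor \<alpha> y * cheb_tensor \<beta> y) = (\<Prod>i\<in>UNIV. cheb_wt (y $ i) * (poly (cheb (\<alpha> i)) (y $ i) * poly (cheb (\<beta> i)) (y $ i)))" for y
    by (simp add: cheb_tensor_wt_def cheb_tensor_def prod.distrib)
  note L = lborel_prod_coords[where h = "\<lambda>i z. cheb_wt z * (poly (cheb (\<alpha> i)) z * poly (cheb (\<beta> i)) z)", OF cheb_wt_integral(1)]
  show "integrable lborel (\<lambda>y. cheb_tensor_wt y * (cheb_tensor \<alpha> y * cheb_tensor \<beta> y))" unfolding e by (rule L(1))
  have "(LINT y|lborel. cheb_tensor_wt y * (cheb_tensor \<alpha> y * cheb_tensor \<beta> y)) = (\<Prod>i\<in>UNIV. if \<alpha> i = \<beta> i then 1 else 0)"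
    unfolding e L(2) cheb_wt_integral(2) ..
  also have "\<dots> = (if \<alpha> = \<beta> then 1 else 0)" by (auto simp: fun_eq_iff)
  finally show "(LINT y|lborel. cheb_tensor_wt y * (cheb_tensor \<alpha> y * cheb_tensor \<beta> y)) = (if \<alpha> = \<beta> then 1 else 0)" .
qed

lemma cheb_tensor_wt_nonneg: "cheb_tensor_wt y \<ge> 0"
  unfolding cheb_tensor_wt_def by (intro prod_nonneg cheb_wt_nonneg)

lemma cheb_tensor_sum_integral:
  fixes u :: "('d::finite \<Rightarrow> nat) \<Rightarrow> real"
  assumes I: "finite I"
  shows "integrable lborel (\<lambda>y. cheb_tensor_wt y * (\<Sum>\<alpha>\<in>I. cheb_tensor \<alpha> y * u \<alpha>)\<^sup>2)"
    and "(LINT y|lborel. cheb_tensor_wt y * (\<Sum>\<alpha>\<in>I. cheb_tensor \<alpha> y * u \<alpha>)\<^sup>2) = (\<Sum>\<alpha>\<in>I. (u \<alpha>)\<^sup>2)"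
proof -
  have e: "cheb_tensor_wt y * (\<Sum>\<alpha>\<in>I. cheb_tensor \<alpha> y * u \<alpha>)\<^sup>2 = (\<Sum>\<alpha>\<in>I. \<Sum>\<beta>\<in>I. u \<alpha> * u \<beta> * (cheb_tensor_wt y * (cheb_tensor \<alpha> y * cheb_tensor \<beta> y)))" for y
    unfolding power2_eq_square sum_product by (simp add: sum_distrib_left mult_ac)
  show "integrable lborel (\<lambda>y. cheb_tensor_wt y * (\<Sum>\<alpha>\<in>I. cheb_tensor \<alpha> y * u \<alpha>)\<^sup>2)"
    unfolding e by (intro Bochner_Integration.integrable_sum integrable_mult_right cheb_tensor_integral(1))
  have "(LINT y|lborel. cheb_tensor_wt y * (\<Sum>\<alpha>\<in>I. cheb_tensor \<alpha> y * u \<alpha>)\<^sup>2) = (\<Sum>\<alpha>\<in>I. \<Sum>\<beta>\<in>I. u \<alpha> * u \<beta> * (if \<alpha> = \<beta> then 1 else 0))"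
    unfolding e
    by (subst Bochner_Integration.integral_sum, intro Bochner_Integration.integrable_sum integrable_mult_right cheb_tensor_integral(1),
        intro sum.cong refl, subst Bochner_Integration.integral_sum, intro integrable_mult_right cheb_tensor_integral(1))
       (simp add: cheb_tensor_integral)
  also have "\<dots> = (\<Sum>\<alpha>\<in>I. (u \<alpha>)\<^sup>2)"
    using I by (intro sum.cong refl) (simp add: if_distrib power2_eq_square cong: if_cong)
  finally show "(LINT y|lborel. cheb_tensor_wt y * (\<Sum>\<alpha>\<in>I. cheb_tensor \<alpha> y * u \<alpha>)\<^sup>2) = (\<Sum>\<alpha>\<in>I. (u \<alpha>)\<^sup>2)" .
qed

text \<open>Let \<open>A\<close> be the squared length of the Chebyshev vector and \<open>Q\<close>
  that of its projection to the span at the samples. On the ball \<open>S\<close> of radius 1/2 the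
  value of \<open>A\<close> is at least of order \<open>K ^ d\<close>, whereas the integral of
  \<open>Q\<close> for the Chebyshev weight of the cube is exactly the dimension
  \<open>m \<le> n\<close>. The weights of ball and cube are compared only on \<open>S\<close>,
  where both are harmless; elsewhere \<open>f \<ge> 0\<close> suffices.\<close>

lemma fooling_polynomial:
  assumes mu: "\<mu> \<ge> 0"
  obtains \<kappa> c where "\<kappa> > 0" "c > 0"
    "\<And>n L x. real n \<le> \<kappa> * real (2 * L) ^ CARD('d::finite) \<Longrightarrow> L \<ge> 1 \<Longrightarrow>
      \<exists>f\<in>poly_space (2 * (CARD('d) * (2 * L))). (\<forall>i<n. f (x i :: real ^ 'd) = 0) \<and> (\<forall>y. norm y \<le> 1 \<longrightarrow> \<bar>f y\<bar> \<le> 2 ^ CARD('d)) \<and> c \<le> INT_ball \<mu> f"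
proof -
  define d where "d = CARD('d)"
  define mass where "mass = ball_mass TYPE(real ^ 'd) (\<mu> + 1/2)"
  define M where "M = ball_mass TYPE(real) (1/2)"
  define W where "W = (\<lambda>y :: real ^ 'd. ball_wt (\<mu> + 1/2) 1 y)"
  define e where "e = \<mu> - 1/2"
  \<comment> \<open>On \<open>S\<close> the base \<open>1 - (norm y)^2\<close> lies between 3/4 and
    1; the absolute value gives bounds that hold for either sign of \<open>e\<close>.\<close>
  define cw where "cw = (3/4) powr \<bar>e\<bar>"
  define Cw where "Cw = (3/4) powr (- \<bar>e\<bar>)"
  define S where "S = cball (0 :: real ^ 'd) (1/2)"
  define vol where "vol = measure lborel S"
  \<comment> \<open>Chosen so that the projection part \<open>Z * m\<close> consumes at most half of
    the lower bound for the integral of \<open>A\<close>.\<close>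
  define \<kappa> where "\<kappa> = cw * vol / 4 ^ d / 2 / (Cw * M ^ d)"
  define c where "c = cw * vol / 4 ^ d / 2 / mass"
  have b: "\<mu> + 1/2 > 0" using mu by simp
  have mass: "mass > 0" unfolding mass_def using b by (rule ball_mass_pos)
  have M: "M > 0" unfolding M_def by (rule ball_mass_pos) simp
  have cw: "cw > 0" "Cw > 0" by (auto simp: cw_def Cw_def)
  have vol: "vol > 0" unfolding vol_def S_def by (rule content_cball_pos) simp
  have pos: "\<kappa> > 0" "c > 0" unfolding \<kappa>_def c_def using cw vol M mass by simp_all
  have W0: "W y \<ge> 0" for y by (simp add: W_def)
  have WS: "cw \<le> W y" "W y \<le> Cw" if "y \<in> S" for y
  proof -
    have "norm y \<le> 1/2" using that by (simp add: S_def)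
    then have "(norm y)\<^sup>2 \<le> (1/2)\<^sup>2" by (intro power_mono) auto
    then have t: "3/4 \<le> 1 - (norm y)\<^sup>2" "1 - (norm y)\<^sup>2 \<le> 1" by (auto simp: power2_eq_square)
    have Wy: "W y = (1 - (norm y)\<^sup>2) powr e" using t by (simp add: W_def ball_wt_def e_def)
    have "cw \<le> (1 - (norm y)\<^sup>2) powr \<bar>e\<bar>" unfolding cw_def using t by (intro powr_mono2) auto
    also have "\<dots> \<le> W y" unfolding Wy using t by (intro powr_mono') auto
    finally show "cw \<le> W y" .
    have "W y \<le> (1 - (norm y)\<^sup>2) powr (- \<bar>e\<bar>)" unfolding Wy using t by (intro powr_mono') auto
    also have "\<dots> \<le> Cw" unfolding Cw_def using t by (intro powr_mono2') auto
    finally show "W y \<le> Cw" .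
  qed
  have coord: "\<bar>y $ i\<bar> \<le> norm y" for y :: "real ^ 'd" and i using component_le_norm_cart[of y i] by simp
  have tS: "1 \<le> M ^ d * cheb_tensor_wt y" if "y \<in> S" for y
  proof -
    have "(\<Prod>i\<in>(UNIV :: 'd set). 1 / M) \<le> cheb_tensor_wt y"
      unfolding cheb_tensor_wt_def M_def
    proof (intro prod_mono conjI)
      fix i
      have "\<bar>y $ i\<bar> < 1" using coord[of y i] that by (simp add: S_def)
      then show "1 / ball_mass TYPE(real) (1/2) \<le> cheb_wt (y $ i)" by (rule cheb_wt_ge)
    qed (use M in \<open>simp add: M_def\<close>)
    then have "M ^ d * (1 / M) ^ d \<le> M ^ d * cheb_tensor_wt y" using M by (intro mult_left_mono) (auto simp: d_def)
    then show ?thesis using M by (simp add: power_one_over)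
  qed
  have main: "\<exists>f\<in>poly_space (2 * (CARD('d) * (2 * L))). (\<forall>i<n. f (x i :: real ^ 'd) = 0) \<and> (\<forall>y. norm y \<le> 1 \<longrightarrow> \<bar>f y\<bar> \<le> 2 ^ CARD('d)) \<and> c \<le> INT_ball \<mu> f"
    if nL: "real n \<le> \<kappa> * real (2 * L) ^ CARD('d)" and L: "L \<ge> 1" for n L x
  proof -
    \<comment> \<open>Even, so that the degrees below \<open>K\<close> fall into neighbouring
      pairs.\<close>
    define K where "K = 2 * L"
    define I where "I = (multi_degrees K :: ('d \<Rightarrow> nat) set)"
    have I: "finite I" "card I = K ^ d" unfolding I_def d_def by (rule finite_multi_degrees, rule card_multi_degrees)
    have K: "real K > 0" using L by (simp add: K_def)
    obtain m u where m: "m \<le> n" and u: "orthonormal_on I m u"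
      and g: "\<And>i a. i < n \<Longrightarrow> a \<in> I \<Longrightarrow> cheb_tensor a (x i) = (\<Sum>j<m. (\<Sum>b\<in>I. cheb_tensor b (x i) * u j b) * u j a)"
      using gram_schmidt[OF I(1), of n "\<lambda>i a. cheb_tensor a (x i)"] by blast
    define A where "A y = (\<Sum>a\<in>I. (cheb_tensor a y)\<^sup>2)" for y
    define Q where "Q y = (\<Sum>j<m. (\<Sum>b\<in>I. cheb_tensor b y * u j b)\<^sup>2)" for y
    define f where "f y = (1 / real K ^ d) * (A y + (- 1) * Q y)" for y
    have AQ: "A y - Q y = (\<Sum>a\<in>I. (cheb_tensor a y - (\<Sum>j<m. (\<Sum>b\<in>I. cheb_tensor b y * u j b) * u j a))\<^sup>2)" for y
      unfolding A_def Q_def by (rule bessel_identity[OF u, symmetric])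
    have AQ0: "A y - Q y \<ge> 0" for y unfolding AQ by (intro sum_nonneg) auto
    have Q0: "Q y \<ge> 0" for y unfolding Q_def by (intro sum_nonneg) auto
    have f0: "f y \<ge> 0" for y unfolding f_def using AQ0[of y] K by simp
    have zero: "f (x i) = 0" if "i < n" for i
    proof -
      have "A (x i) - Q (x i) = 0" unfolding AQ using g[OF that] by simp
      then show ?thesis by (simp add: f_def)
    qed
    have Aeq: "A y = (\<Prod>i\<in>UNIV. \<Sum>k<K. (poly (cheb k) (y $ i))\<^sup>2)" for y
      unfolding A_def I_def by (rule cheb_tensor_sq_sum)
    have bound: "\<bar>f y\<bar> \<le> 2 ^ d" if "norm y \<le> 1" for y
    proof -
      have "A y \<le> (\<Prod>i\<in>(UNIV :: 'd set). 2 * real K)"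
        unfolding Aeq
      proof (intro prod_mono conjI sum_nonneg)
        fix i
        have "\<bar>y $ i\<bar> \<le> 1" using coord[of y i] that by simp
        then have "(\<Sum>k<K. (poly (cheb k) (y $ i))\<^sup>2) \<le> (\<Sum>k<K. 2)" by (intro sum_mono cheb_sq_le)
        then show "(\<Sum>k<K. (poly (cheb k) (y $ i))\<^sup>2) \<le> 2 * real K" by simp
      qed simp
      then have "A y \<le> 2 ^ d * real K ^ d" by (simp add: d_def power_mult_distrib)
      then have "A y + (- 1) * Q y \<le> 2 ^ d * real K ^ d" using Q0[of y] by simp
      then have "(1 / real K ^ d) * (A y + (- 1) * Q y) \<le> (1 / real K ^ d) * (2 ^ d * real K ^ d)"
        by (rule mult_left_mono) simp
      also have "\<dots> = 2 ^ d" using K by simp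
      finally show ?thesis using f0[of y] by (simp only: f_def abs_of_nonneg)
    qed
    have tp: "cheb_tensor a \<in> poly_space (d * K)" if "a \<in> I" for a
      using that cheb_tensor_poly_space[of a K] by (simp add: I_def d_def)
    have sqp: "(\<lambda>y. (h y)\<^sup>2) \<in> poly_space (2 * (d * K))" if "h \<in> poly_space (d * K)" for h :: "real ^ 'd \<Rightarrow> real"
      using poly_space_power[OF that, of 2] by (simp add: mult.commute)
    have ps: "f \<in> poly_space (2 * (d * K))"
    proof -
      have "(\<lambda>y. \<Sum>b\<in>I. u j b * cheb_tensor b y) \<in> poly_space (d * K)" for j
        by (intro poly_space_sum poly_space_cmult tp)
      then have lin: "(\<lambda>y. \<Sum>b\<in>I. cheb_tensor b y * u j b) \<in> poly_space (d * K)" for j by (simp only: mult.commute)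
      show ?thesis unfolding f_def[abs_def] A_def Q_def
        by (intro poly_space_cmult poly_space_add poly_space_sum sqp[OF lin] sqp[OF tp])
    qed
    have fc: "continuous_on UNIV f" by (rule continuous_poly_space[OF ps])
    then have fm: "f \<in> borel_measurable borel" by (rule borel_measurable_continuous_onI)
    have Wm: "W \<in> borel_measurable borel" unfolding W_def ball_wt_def by measurable
    have Wf: "integrable lborel (\<lambda>y. W y * f y)"
    proof -
      have "integrable (ball_prob (\<mu> + 1/2)) f" by (rule AE_ball_prob_integrable[OF b fc])
      moreover have "ball_prob (\<mu> + 1/2) = density lborel (\<lambda>y. ennreal (W y / mass))" by (simp add: ball_prob_def W_def mass_def)
      ultimately have "integrable lborel (\<lambda>y. (W y / mass) *\<^sub>R f y)"
        using Wm fm W0 mass by (simp add: integrable_density)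
      then have "integrable lborel (\<lambda>y. mass * ((W y / mass) *\<^sub>R f y))" by (rule integrable_mult_right)
      then show ?thesis using mass by simp
    qed
    define Z where "Z = Cw * M ^ d"
    define a0 where "a0 = cw * (real L / 2) ^ d"
    have Z: "Z > 0" unfolding Z_def using cw M by simp
    have tQ: "integrable lborel (\<lambda>y. cheb_tensor_wt y * Q y)" "(LINT y|lborel. cheb_tensor_wt y * Q y) = real m"
    proof -
      have tq: "cheb_tensor_wt y * Q y = (\<Sum>j<m. cheb_tensor_wt y * (\<Sum>b\<in>I. cheb_tensor b y * u j b)\<^sup>2)" for y
        by (simp add: Q_def sum_distrib_left)
      show "integrable lborel (\<lambda>y. cheb_tensor_wt y * Q y)" unfolding tq
        by (intro Bochner_Integration.integrable_sum cheb_tensor_sum_integral(1) I)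
      have "(LINT y|lborel. cheb_tensor_wt y * Q y) = (\<Sum>j<m. \<Sum>a\<in>I. (u j a)\<^sup>2)"
        unfolding tq using I(1) by (subst Bochner_Integration.integral_sum) (auto intro: cheb_tensor_sum_integral(1) simp: cheb_tensor_sum_integral(2))
      also have "\<dots> = (\<Sum>j<m. 1)" using u by (intro sum.cong refl) (simp add: orthonormal_on_def power2_eq_square)
      finally show "(LINT y|lborel. cheb_tensor_wt y * Q y) = real m" by simp
    qed
    have pw: "(1 / real K ^ d) * (a0 * indicator S y - Z * (cheb_tensor_wt y * Q y)) \<le> W y * f y" for y
    proof (cases "y \<in> S")
      case True
      have "(\<Prod>i\<in>(UNIV :: 'd set). real L / 2) \<le> A y"
        unfolding Aeq
      proof (intro prod_mono conjI)
        fix i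
        have "\<bar>y $ i\<bar> \<le> 1/2" using coord[of y i] True by (simp add: S_def)
        then show "real L / 2 \<le> (\<Sum>k<K. (poly (cheb k) (y $ i))\<^sup>2)" unfolding K_def by (rule cheb_sq_sum)
      qed simp
      then have "(real L / 2) ^ d \<le> A y" by (simp add: d_def)
      then have 1: "a0 \<le> W y * A y" unfolding a0_def using WS(1)[OF True] W0 cw by (intro mult_mono) auto
      have "W y * Q y \<le> Cw * Q y" using WS(2)[OF True] Q0 by (rule mult_right_mono)
      also have "\<dots> \<le> Cw * ((M ^ d * cheb_tensor_wt y) * Q y)"
        using mult_right_mono[OF tS[OF True] Q0[of y]] cw by (intro mult_left_mono) auto
      finally have 2: "W y * Q y \<le> Z * (cheb_tensor_wt y * Q y)" by (simp add: Z_def mult_ac)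
      have "a0 * indicator S y - Z * (cheb_tensor_wt y * Q y) \<le> W y * A y - W y * Q y" using 1 2 True by simp
      also have "\<dots> = W y * (A y - Q y)" by (simp add: right_diff_distrib)
      finally have "(1 / real K ^ d) * (a0 * indicator S y - Z * (cheb_tensor_wt y * Q y)) \<le> (1 / real K ^ d) * (W y * (A y - Q y))"
        by (rule mult_left_mono) simp
      also have "\<dots> = W y * f y" by (simp add: f_def)
      finally show ?thesis .
    next
      case False
      have "a0 * indicator S y - Z * (cheb_tensor_wt y * Q y) \<le> 0"
        using False Z Q0[of y] cheb_tensor_wt_nonneg[of y] by simp
      then have "(1 / real K ^ d) * (a0 * indicator S y - Z * (cheb_tensor_wt y * Q y)) \<le> 0"
        by (rule mult_nonneg_nonpos[rotated]) simp
      also have "0 \<le> W y * f y" using W0 f0 by simp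
      finally show ?thesis .
    qed
    have iS: "integrable lborel (indicator S :: real ^ 'd \<Rightarrow> real)"
      unfolding S_def using emeasure_lborel_cball_finite[of 0 "1/2"] by (intro integrable_real_indicator) (auto simp: less_top[symmetric])
    have "(LINT y|lborel. (1 / real K ^ d) * (a0 * indicator S y - Z * (cheb_tensor_wt y * Q y))) \<le> (LINT y|lborel. W y * f y)"
      using iS tQ(1) by (intro integral_mono Wf pw) auto
    also have "(LINT y|lborel. (1 / real K ^ d) * (a0 * indicator S y - Z * (cheb_tensor_wt y * Q y))) = (1 / real K ^ d) * (a0 * vol - Z * real m)"
    proof -
      have "(LINT y|lborel. a0 * indicator S y - Z * (cheb_tensor_wt y * Q y)) = (LINT y|lborel. a0 * indicator S y) - (LINT y|lborel. Z * (cheb_tensor_wt y * Q y))"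
        using iS tQ(1) by (intro Bochner_Integration.integral_diff) auto
      also have "(LINT y|lborel. a0 * indicator S y) = a0 * vol" using iS by (simp add: vol_def)
      also have "(LINT y|lborel. Z * (cheb_tensor_wt y * Q y)) = Z * real m" using tQ by simp
      finally show ?thesis by simp
    qed
    also have "(1 / real K ^ d) * (a0 * vol - Z * real m) \<ge> cw * vol / 4 ^ d / 2"
    proof -
      have "real m \<le> \<kappa> * real K ^ d" using m nL by (simp add: K_def d_def)
      then have "Z * real m \<le> Z * (\<kappa> * real K ^ d)" using Z by (intro mult_left_mono) auto
      also have "\<dots> = cw * vol / 4 ^ d / 2 * real K ^ d" using Z by (simp add: \<kappa>_def Z_def[symmetric])
      finally have 1: "Z * real m \<le> cw * vol / 4 ^ d / 2 * real K ^ d" .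
      have "real L / 2 = real K / 4" by (simp add: K_def)
      then have "a0 * vol = cw * vol / 4 ^ d * real K ^ d" unfolding a0_def by (simp only:) (simp add: power_divide)
      then have "cw * vol / 4 ^ d / 2 * real K ^ d \<le> a0 * vol - Z * real m" using 1 by simp
      then have "(1 / real K ^ d) * (cw * vol / 4 ^ d / 2 * real K ^ d) \<le> (1 / real K ^ d) * (a0 * vol - Z * real m)"
        by (rule mult_left_mono) simp
      then show ?thesis using K by simp
    qed
    finally have "cw * vol / 4 ^ d / 2 \<le> (LINT y|lborel. W y * f y)" by simp
    then have "c \<le> (LINT y|lborel. W y * f y) / mass" unfolding c_def using mass by (intro divide_right_mono) auto
    also have "\<dots> = INT_ball \<mu> f"
      unfolding INT_ball_def LINT_ball_ball_prob[OF mu fm] ball_prob_integral[OF b fm] by (simp add: W_def mass_def)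
    finally have "c \<le> INT_ball \<mu> f" .
    then show ?thesis using ps zero bound by (intro bexI[of _ f]) (auto simp: d_def K_def)
  qed
  show ?thesis by (rule that[OF pos main])
qed

section \<open>Scaling into the class and the argument against adaptive algorithms\<close>

lemma Lp_bounded:
  fixes f :: "real ^ 'd::finite \<Rightarrow> real"
  assumes mu: "\<mu> \<ge> 0" and p: "1 \<le> p" and f: "continuous_on (cball 0 1) f" and B: "\<And>x. norm x \<le> 1 \<Longrightarrow> \<bar>f x\<bar> \<le> B"
  shows "f \<in> Lp_space \<mu> p" and "Lp_norm \<mu> p f \<le> B"
proof -
  have fm: "f \<in> borel_measurable (ball_measure \<mu>)" by (rule measurable_ball_continuous[OF mu f])
  have B0: "B \<ge> 0" using B[of 0] by simp
  have "f \<in> Lp_space \<mu> p \<and> Lp_norm \<mu> p f \<le> B"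
  proof (cases "p = \<infinity>")
    case True
    have "(SUP x\<in>cball 0 1. \<bar>f x\<bar>) \<le> B" using B by (intro cSUP_least) auto
    then show ?thesis using True f by (simp add: Lp_space_def Lp_norm_def)
  next
    case False
    define q where "q = enn2real p"
    have "p = ennreal q" using False by (simp add: q_def less_top)
    then have q: "q \<ge> 1" using p by (simp add: ennreal_le_iff2 flip: ennreal_1)
    have bd: "\<bar>f x\<bar> powr q \<le> B powr q" if "norm x \<le> 1" for x
      using B[OF that] q by (intro powr_mono2) auto
    have i: "integrable (ball_measure \<mu>) (\<lambda>x. \<bar>f x\<bar> powr q)"
      using bd by (intro integrable_ball_bounded[OF mu, of _ "B powr q"]) (use fm in auto)
    have "(LINT x|ball_measure \<mu>. \<bar>f x\<bar> powr q) \<le> (LINT x|(ball_measure \<mu> :: (real ^ 'd) measure). B powr q)"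
    proof (rule integral_mono[OF i])
      show "integrable (ball_measure \<mu>) (\<lambda>x :: real ^ 'd. B powr q)" by (intro integrable_ball_continuous mu continuous_intros)
      fix x :: "real ^ 'd" assume "x \<in> space (ball_measure \<mu>)"
      then show "\<bar>f x\<bar> powr q \<le> B powr q" using bd mu by simp
    qed
    then have "(LINT x|ball_measure \<mu>. \<bar>f x\<bar> powr q) \<le> B powr q" using mu by simp
    then have "(LINT x|ball_measure \<mu>. \<bar>f x\<bar> powr q) powr (1 / q) \<le> (B powr q) powr (1 / q)"
      using q by (intro powr_mono2) (auto intro!: integral_nonneg_AE)
    also have "\<dots> = B" using q B0 by (simp add: powr_powr)
    finally show ?thesis using i fm False by (simp add: Lp_space_def Lp_norm_def q_def)
  qed
  then show "f \<in> Lp_space \<mu> p" "Lp_norm \<mu> p f \<le> B" by auto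
qed

text \<open>As long as every answer is 0, the adaptive choice of points is the fixed sequence
  \<open>X (replicate j 0)\<close>; a function vanishing on it cannot be told from the zero
  function.\<close>

lemma observed_values_zero:
  assumes "\<And>j. j < n \<Longrightarrow> f (X (replicate j 0)) = 0"
  shows "observed_values X f n = replicate n 0"
proof -
  have "j \<le> n \<Longrightarrow> observed_values X f j = replicate j 0" for j
  proof (induction j)
    case (Suc j)
    then show ?case using assms[of j] by (simp add: replicate_append_same)
  qed simp
  then show ?thesis by simp
qed

lemma lower_bound:
  fixes \<mu> r :: real and p :: ennreal
  assumes mu: "\<mu> \<ge> 0" and p: "1 \<le> p" and r: "r > 0"
  shows "\<exists>c>0. \<forall>n\<ge>1. ennreal (c * real n powr (- r / real CARD('d)))
     \<le> det_error \<mu> n (sobolev_ball \<mu> p r :: (real ^ 'd::finite \<Rightarrow> real) set)"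
proof -
  define d where "d = CARD('d)"
  have d: "d \<ge> 1" unfolding d_def using zero_less_card_finite[where 'a = 'd] by linarith
  obtain \<kappa> c0 where \<kappa>: "\<kappa> > 0" and c0: "c0 > 0"
    and fool: "\<And>n L x. real n \<le> \<kappa> * real (2 * L) ^ CARD('d) \<Longrightarrow> L \<ge> 1 \<Longrightarrow>
      \<exists>f\<in>poly_space (2 * (CARD('d) * (2 * L))). (\<forall>i<n. f (x i :: real ^ 'd) = 0) \<and> (\<forall>y. norm y \<le> 1 \<longrightarrow> \<bar>f y\<bar> \<le> 2 ^ CARD('d)) \<and> c0 \<le> INT_ball \<mu> f"
    by (rule fooling_polynomial[OF mu, where 'd = 'd]) blast
  obtain C where C: "C > 0" and bern: "\<And>N q B. N \<ge> 1 \<Longrightarrow> q \<in> poly_space N \<Longrightarrow> (\<And>x. norm x \<le> 1 \<Longrightarrow> \<bar>q x\<bar> \<le> B) \<Longrightarrow>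
    \<exists>g. continuous_on (cball 0 1) g \<and> is_frac_power \<mu> r q (g :: real ^ 'd \<Rightarrow> real) \<and> (\<forall>x. norm x \<le> 1 \<longrightarrow> \<bar>g x\<bar> \<le> C * real N powr r * B)"
  proof (rule bernstein[OF mu r, where 'd = 'd])
    fix C :: real
    assume "C > 0" "\<And>N q B. N \<ge> 1 \<Longrightarrow> q \<in> poly_space N \<Longrightarrow> (\<And>x. norm x \<le> 1 \<Longrightarrow> \<bar>q x\<bar> \<le> B) \<Longrightarrow>
      \<exists>g. continuous_on (cball 0 1) g \<and> is_frac_power \<mu> r q (g :: real ^ 'd \<Rightarrow> real) \<and> (\<forall>x. norm x \<le> 1 \<longrightarrow> \<bar>g x\<bar> \<le> C * real N powr r * B)"
    then show thesis by (rule that)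
  qed
  define B :: real where "B = 2 ^ d"
  have B: "B > 0" by (simp add: B_def)
  \<comment> \<open>The degree used below is \<open>N = 4 * d * L\<close> with
    \<open>L \<le> R + 1\<close>, hence \<open>N \<le> E * n powr (1 / d)\<close>.\<close>
  define E where "E = 4 * real d * ((1 / \<kappa>) powr (1 / real d) + 1)"
  have E: "E > 0" unfolding E_def using d by (intro mult_pos_pos add_nonneg_pos) auto
  define c where "c = c0 / (B + C * E powr r * B)"
  have c: "c > 0" unfolding c_def using c0 B C E by (intro divide_pos_pos add_pos_pos mult_pos_pos) auto
  have "ennreal (c * real n powr (- r / real CARD('d))) \<le> det_error \<mu> n (sobolev_ball \<mu> p r :: (real ^ 'd \<Rightarrow> real) set)"
    if n: "n \<ge> 1" for n
    unfolding det_error_def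
  proof (rule INF_greatest)
    fix Al :: "(real ^ 'd \<Rightarrow> real) \<Rightarrow> real" assume "Al \<in> det_algorithms n"
    then obtain \<phi> X where X: "\<And>v. X v \<in> cball 0 1" and Al: "Al = (\<lambda>f. \<phi> (observed_values X f n))"
      unfolding det_algorithms_def by blast
    define R where "R = (real n / \<kappa>) powr (1 / real d)"
    have R: "R > 0" unfolding R_def using n \<kappa> by simp
    define L where "L = nat \<lceil>R\<rceil>"
    have L: "L \<ge> 1" "real L \<ge> R" "real L \<le> R + 1" unfolding L_def using R by linarith+
    have "R ^ d = real n / \<kappa>" unfolding R_def using n \<kappa> d by (simp add: powr_power)
    moreover have "R ^ d \<le> real (2 * L) ^ d" using L R by (intro power_mono) auto
    ultimately have "real n \<le> \<kappa> * real (2 * L) ^ CARD('d)" using \<kappa> by (simp add: d_def divide_le_eq mult.commute)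
    from fool[OF this L(1), of "\<lambda>j. X (replicate j 0)"] obtain f where
      f: "f \<in> poly_space (2 * (d * (2 * L)))" "\<And>j. j < n \<Longrightarrow> f (X (replicate j 0)) = 0" "\<And>y. norm y \<le> 1 \<Longrightarrow> \<bar>f y\<bar> \<le> B" "c0 \<le> INT_ball \<mu> f"
      unfolding d_def B_def by blast
    define N where "N = 2 * (d * (2 * L))"
    have N: "N \<ge> 1" unfolding N_def using d L by simp
    obtain g where g: "continuous_on (cball 0 1) g" "is_frac_power \<mu> r f g" "\<And>x. norm x \<le> 1 \<Longrightarrow> \<bar>g x\<bar> \<le> C * real N powr r * B"
      using bern[OF N f(1)[folded N_def] f(3)] by blast
    have fc: "continuous_on (cball 0 1) f" by (rule continuous_poly_space[OF f(1)])
    \<comment> \<open>The sum of the bounds for \<open>f\<close> and for its fractional power, so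
      that \<open>f / T\<close> and \<open>- f / T\<close> have Sobolev norm at most 1.\<close>
    define T where "T = B + C * real N powr r * B"
    have T: "T > 0" unfolding T_def using B C by (intro add_pos_nonneg) auto
    have mem: "(\<lambda>x. s * f x) \<in> sobolev_ball \<mu> p r" if s: "\<bar>s\<bar> = 1 / T" for s
    proof -
      have bf: "\<bar>s * f x\<bar> \<le> B / T" if "norm x \<le> 1" for x
        using f(3)[OF that] T by (simp add: abs_mult s divide_right_mono)
      have bg: "\<bar>s * g x\<bar> \<le> C * real N powr r * B / T" if "norm x \<le> 1" for x
        using g(3)[OF that] T by (simp add: abs_mult s divide_right_mono)
      have cf: "continuous_on (cball 0 1) (\<lambda>x. s * f x)" and cg: "continuous_on (cball 0 1) (\<lambda>x. s * g x)"
        by (intro continuous_intros fc g)+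
      have "orth_proj \<mu> k (\<lambda>x. s * h x) y = s * orth_proj \<mu> k h y" for k y and h :: "real ^ 'd \<Rightarrow> real"
        by (simp add: orth_proj_def mult.assoc)
      then have "is_frac_power \<mu> r (\<lambda>x. s * f x) (\<lambda>x. s * g x)" using g(2) by (simp add: is_frac_power_def)
      moreover have "Lp_norm \<mu> p (\<lambda>x. s * f x) + Lp_norm \<mu> p (\<lambda>x. s * g x) \<le> B / T + C * real N powr r * B / T"
        by (intro add_mono Lp_bounded(2)[OF mu p cf bf] Lp_bounded(2)[OF mu p cg bg])
      moreover have "B / T + C * real N powr r * B / T = 1" using T by (simp add: add_divide_distrib[symmetric] T_def[symmetric])
      ultimately show ?thesis unfolding sobolev_ball_def using cf Lp_bounded(1)[OF mu p cf bf] Lp_bounded(1)[OF mu p cg bg] by auto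
    qed
    have obs: "observed_values X (\<lambda>x. s * f x) n = replicate n 0" for s
      by (rule observed_values_zero) (simp add: f(2))
    have INTs: "INT_ball \<mu> (\<lambda>x. s * f x) = s * INT_ball \<mu> f" for s by (simp add: INT_ball_def)
    define a where "a = \<phi> (replicate n 0)"
    define v where "v = 1 / T * INT_ball \<mu> f"
    have sup: "ennreal \<bar>s * INT_ball \<mu> f - a\<bar> \<le> (SUP f\<in>sobolev_ball \<mu> p r. ennreal \<bar>INT_ball \<mu> f - Al f\<bar>)" if "\<bar>s\<bar> = 1 / T" for s
      by (rule SUP_upper2[OF mem[OF that]]) (simp add: INTs Al obs a_def)
    have "c * real n powr (- r / real CARD('d)) \<le> v"
    proof -
      define nd where "nd = real n powr (1 / real d)"
      have nd: "nd \<ge> 1" unfolding nd_def using n d by (intro ge_one_powr_ge_zero) auto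
      have "R = (1 / \<kappa>) powr (1 / real d) * nd" unfolding R_def nd_def using n \<kappa> by (simp add: powr_mult[symmetric])
      then have "real L \<le> ((1 / \<kappa>) powr (1 / real d) + 1) * nd" using L(3) nd by (simp add: distrib_right)
      then have "real N \<le> 4 * real d * (((1 / \<kappa>) powr (1 / real d) + 1) * nd)"
        unfolding N_def using mult_left_mono[of "real L" _ "4 * real d"] by simp
      then have "real N \<le> E * nd" by (simp add: E_def mult.assoc)
      then have "real N powr r \<le> (E * nd) powr r" using r by (intro powr_mono2) auto
      also have "\<dots> = E powr r * nd powr r" by (rule powr_mult)
      finally have Nr: "real N powr r \<le> E powr r * nd powr r" .
      have nr: "nd powr r \<ge> 1" using nd r by (intro ge_one_powr_ge_zero) auto
      have "T \<le> B * nd powr r + C * (E powr r * nd powr r) * B"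
        unfolding T_def using Nr nr B C by (intro add_mono mult_right_mono mult_left_mono) auto
      also have "\<dots> = (B + C * E powr r * B) * nd powr r" by (simp add: algebra_simps)
      finally have T1: "T \<le> (B + C * E powr r * B) * nd powr r" .
      have "real n powr (- r / real CARD('d)) = 1 / nd powr r"
        by (simp add: nd_def powr_powr d_def powr_minus_divide)
      then have "c * real n powr (- r / real CARD('d)) = c0 / ((B + C * E powr r * B) * nd powr r)"
        by (simp add: c_def)
      also have "\<dots> \<le> c0 / T" using T1 T c0 by (intro divide_left_mono) (auto intro!: mult_pos_pos)
      also have "\<dots> \<le> v" unfolding v_def using f(4) T by (simp add: divide_right_mono)
      finally show ?thesis .
    qed
    \<comment> \<open>The algorithm answers \<open>a\<close> for both \<open>f / T\<close> and
      \<open>- f / T\<close>, whose integrals are \<open>v\<close> and \<open>- v\<close>; one of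
      the two errors is at least \<open>v\<close>.\<close>
    also have "v \<le> max \<bar>v - a\<bar> \<bar>- v - a\<bar>" by linarith
    finally have "ennreal (c * real n powr (- r / real CARD('d))) \<le> ennreal (max \<bar>v - a\<bar> \<bar>- v - a\<bar>)"
      by (rule ennreal_leI)
    also have "\<dots> \<le> (SUP f\<in>sobolev_ball \<mu> p r. ennreal \<bar>INT_ball \<mu> f - Al f\<bar>)"
      using sup[of "1 / T"] sup[of "- 1 / T"] T by (auto simp: max_def v_def)
    finally show "ennreal (c * real n powr (- r / real CARD('d))) \<le> (SUP f\<in>sobolev_ball \<mu> p r. ennreal \<bar>INT_ball \<mu> f - Al f\<bar>)" .
  qed
  with c show ?thesis by blast
qed

theorem theorem1p1:
  fixes \<mu> r :: real and p :: ennreal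
  assumes "\<mu> \<ge> 0" and "1 \<le> p"
    and "ennreal (real CARD('d::finite) + 2 * \<mu>) / p < ennreal r"
  shows "\<exists>c\<^sub>1>0. \<exists>c\<^sub>2>0. \<forall>n\<ge>1.
      ennreal (c\<^sub>1 * real n powr (- r / real CARD('d)))
        \<le> det_error \<mu> n (sobolev_ball \<mu> p r :: (real ^ 'd \<Rightarrow> real) set) \<and>
      det_error \<mu> n (sobolev_ball \<mu> p r :: (real ^ 'd \<Rightarrow> real) set)
        \<le> ennreal (c\<^sub>2 * real n powr (- r / real CARD('d)))"
proof -
  have "r > 0"
  proof (rule ccontr)
    assume "\<not> r > 0"
    then have "ennreal r = 0" by (simp add: ennreal_neg)
    then show False using assms(3) by simp
  qed
  then show ?thesis using lower_bound[OF assms(1,2), of r] upper_bound[OF assms] by blast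
qed

end
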